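(* Let $0<p<\infty$ and $\alpha>1$, and let $\mu$ be a positive Borel measure on $[0,1)$ such that $\mu$ is a $1/p$-Carleson measure if $0<p\le1$, and $\mu$ is a $1$-Carleson measure if $1<p<\infty$. (i) If $q>1$ and $q\ge\alpha p$, then $\mathcal{H}_{\mu,\alpha}$ is a compact operator from $H^p$ into $A^q_{\alpha-2}$ if and only if $\mu$ is a vanishing $(1/p+\alpha/q')$-Carleson measure, where $1/q+1/q'=1$. (ii) If $q=1$ and $q\ge p$, then $\mathcal{H}_{\mu,\alpha}$ is a compact operator from $H^p$ into $A^1_{\alpha-2}$ if and only if $\mu$ is a vanishing $1$-logarithmic $1/p$-Carleson measure. (iii) $\mathcal{H}_{\mu,\alpha}$ is a compact operator from $H^p$ into $\mathcal{B}$ if and only if $\mu$ is a vanishing $(1/p+\alpha)$-Carleson measure.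
   Context: $\mathbb{D}=\{z\in\mathbb{C}:|z|<1\}$ and $H(\mathbb{D})$ is the class of analytic functions on $\mathbb{D}$. For $0<p<\infty$, the Hardy space $H^p$ is the set of $f\in H(\mathbb{D})$ with $\|f\|_{H^p}=\sup_{0<r<1}\left(\frac{1}{2\pi}\int_0^{2\pi}|f(re^{i\theta})|^p\,\mathrm{d}\theta\right)^{1/p}<\infty$. For $0<q<\infty$ and $\beta>-1$, the weighted Bergman space $A^q_\beta$ is the set of $f\in H(\mathbb{D})$ with $\|f\|_{A^q_\beta}=\left((\beta+1)\int_{\mathbb{D}}|f(z)|^q(1-|z|^2)^\beta\,\mathrm{d}A(z)\right)^{1/q}<\infty$, where $\mathrm{d}A=\frac1\pi\,\mathrm{d}x\,\mathrm{d}y$. The Bloch space $\mathcal{B}$ is the set of $f\in H(\mathbb{D})$ with $\|f\|_{\mathcal{B}}=|f(0)|+\sup_{z\in\mathbb{D}}(1-|z|^2)|f'(z)|<\infty$. For $a\ge0$ and $s>0$, a positive Borel measure $\mu$ on $[0,1)$ is an $a$-logarithmic $s$-Carleson measure if there is a constant $C>0$ with $\left(\log\frac{2}{1-t}\right)^a\mu([t,1))\le C(1-t)^s$ for all $0\le t<1$, and it is a vanishing $a$-logarithmic $s$-Carleson measure if $\left(\log\frac{2}{1-t}\right)^a\mu([t,1))=o((1-t)^s)$ as $t\to1^-$. When $a=0$ these are called $s$-Carleson and vanishing $s$-Carleson measures respectively. For $\alpha>0$ and $f(z)=\sum_{k\ge0}a_kz^k\in H(\mathbb{D})$, the generalized Hilbert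 operator is $$\mathcal{H}_{\mu,\alpha}(f)(z)=\sum_{n=0}^\infty\left(\sum_{k=0}^\infty\mu_{n,k,\alpha}a_k\right)z^n,\qquad \mu_{n,k,\alpha}=\int_{[0,1)}\frac{\Gamma(n+\alpha)}{n!\,\Gamma(\alpha)}t^{n+k}\,\mathrm{d}\mu(t),$$ whenever the right-hand side makes sense and defines an analytic function in $\mathbb{D}$. A linear operator from $X$ into $Y$ is compact if it maps bounded subsets of $X$ to relatively compact subsets of $Y$. *)

theory Defs
  imports "HOL-Analysis.Analysis"
begin

(* A function on the open unit disc is represented by its extension by 0 to all of \<complex>, so that
   equality of functions on the disc is HOL equality and norms separate points. *)
definition disc_holomorphic :: "(complex \<Rightarrow> complex) set" where
  "disc_holomorphic = {f. f holomorphic_on ball 0 1 \<and> (\<forall>z. z \<notin> ball 0 1 \<longrightarrow> f z = 0)}"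

definition hardy_mean :: "real \<Rightarrow> real \<Rightarrow> (complex \<Rightarrow> complex) \<Rightarrow> real" where
  "hardy_mean p r f =
     (1 / (2 * pi) * (LINT \<theta>:{0..2*pi}|lborel. norm (f (of_real r * cis \<theta>)) powr p)) powr (1 / p)"

(* A real supremum is meaningful only for bounded sets; finiteness of the norm is therefore part
   of the carrier sets. The same applies to the integral in the Bergman norm. *)
definition hardy_norm :: "real \<Rightarrow> (complex \<Rightarrow> complex) \<Rightarrow> real" where
  "hardy_norm p f = (SUP r\<in>{0<..<1}. hardy_mean p r f)"

definition hardy_space :: "real \<Rightarrow> (complex \<Rightarrow> complex) set" where
  "hardy_space p = {f \<in> disc_holomorphic. bdd_above ((\<lambda>r. hardy_mean p r f) ` {0<..<1})}"

(* lborel on complex is dx dy, hence the factor 1 / pi for the normalised area measure. *)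
definition bergman_norm :: "real \<Rightarrow> real \<Rightarrow> (complex \<Rightarrow> complex) \<Rightarrow> real" where
  "bergman_norm q \<beta> f =
     ((\<beta> + 1) * (1 / pi * (LINT z:ball 0 1|lborel. norm (f z) powr q * (1 - (norm z)\<^sup>2) powr \<beta>)))
       powr (1 / q)"

definition bergman_space :: "real \<Rightarrow> real \<Rightarrow> (complex \<Rightarrow> complex) set" where
  "bergman_space q \<beta> = {f \<in> disc_holomorphic.
     set_integrable lborel (ball 0 1) (\<lambda>z. norm (f z) powr q * (1 - (norm z)\<^sup>2) powr \<beta>)}"

definition bloch_norm :: "(complex \<Rightarrow> complex) \<Rightarrow> real" where
  "bloch_norm f = norm (f 0) + (SUP z\<in>ball 0 1. (1 - (norm z)\<^sup>2) * norm (deriv f z))"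

definition bloch_space :: "(complex \<Rightarrow> complex) set" where
  "bloch_space = {f \<in> disc_holomorphic.
     bdd_above ((\<lambda>z. (1 - (norm z)\<^sup>2) * norm (deriv f z)) ` ball 0 1)}"

definition borel_measure_01 :: "real measure \<Rightarrow> bool" where
  "borel_measure_01 \<mu> \<longleftrightarrow> sets \<mu> = sets (restrict_space borel {0..<1})"

definition log_carleson :: "real \<Rightarrow> real \<Rightarrow> real measure \<Rightarrow> bool" where
  "log_carleson a s \<mu> \<longleftrightarrow> (\<exists>C>0. \<forall>t. 0 \<le> t \<and> t < 1 \<longrightarrow>
     ennreal (ln (2 / (1 - t)) powr a) * emeasure \<mu> {t..<1} \<le> ennreal (C * (1 - t) powr s))"

definition vanishing_log_carleson :: "real \<Rightarrow> real \<Rightarrow> real measure \<Rightarrow> bool" where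
  "vanishing_log_carleson a s \<mu> \<longleftrightarrow>
     ((\<lambda>t. ennreal (ln (2 / (1 - t)) powr a) * emeasure \<mu> {t..<1} / ennreal ((1 - t) powr s))
        \<longlongrightarrow> 0) (at_left 1)"

abbreviation carleson :: "real \<Rightarrow> real measure \<Rightarrow> bool" where
  "carleson \<equiv> log_carleson 0"

abbreviation vanishing_carleson :: "real \<Rightarrow> real measure \<Rightarrow> bool" where
  "vanishing_carleson \<equiv> vanishing_log_carleson 0"

definition taylor_coeff :: "(complex \<Rightarrow> complex) \<Rightarrow> nat \<Rightarrow> complex" where
  "taylor_coeff f k = (deriv ^^ k) f 0 / fact k"

definition hilbert_entry :: "real measure \<Rightarrow> real \<Rightarrow> nat \<Rightarrow> nat \<Rightarrow> real" where
  "hilbert_entry \<mu> \<alpha> n k = (LINT t|\<mu>. Gamma (real n + \<alpha>) / (fact n * Gamma \<alpha>) * t ^ (n + k))"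

definition hilbert_coeff :: "real measure \<Rightarrow> real \<Rightarrow> (complex \<Rightarrow> complex) \<Rightarrow> nat \<Rightarrow> complex" where
  "hilbert_coeff \<mu> \<alpha> f n = (\<Sum>k. of_real (hilbert_entry \<mu> \<alpha> n k) * taylor_coeff f k)"

definition hilbert_op ::
    "real measure \<Rightarrow> real \<Rightarrow> (complex \<Rightarrow> complex) \<Rightarrow> (complex \<Rightarrow> complex)" where
  "hilbert_op \<mu> \<alpha> f = (\<lambda>z. if z \<in> ball 0 1 then (\<Sum>n. hilbert_coeff \<mu> \<alpha> f n * z ^ n) else 0)"

(* The defining formula of hilbert_op makes sense at f and yields an analytic function. *)
definition hilbert_defined :: "real measure \<Rightarrow> real \<Rightarrow> (complex \<Rightarrow> complex) \<Rightarrow> bool" where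
  "hilbert_defined \<mu> \<alpha> f \<longleftrightarrow>
     (\<forall>n k. integrable \<mu> (\<lambda>t. Gamma (real n + \<alpha>) / (fact n * Gamma \<alpha>) * t ^ (n + k))) \<and>
     (\<forall>n. summable (\<lambda>k. of_real (hilbert_entry \<mu> \<alpha> n k) * taylor_coeff f k)) \<and>
     (\<forall>z\<in>ball 0 1. summable (\<lambda>n. hilbert_coeff \<mu> \<alpha> f n * z ^ n)) \<and>
     hilbert_op \<mu> \<alpha> f holomorphic_on ball 0 1"

(* Metric_space requires symmetry and nonnegativity of the distance on the whole type, hence the
   value 0 off the carrier, where the norm is meaningless; mtopology only looks at the carrier. *)
definition norm_topology ::
    "(complex \<Rightarrow> complex) set \<Rightarrow> ((complex \<Rightarrow> complex) \<Rightarrow> real) \<Rightarrow> (complex \<Rightarrow> complex) topology" where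
  "norm_topology Y N =
     Metric_space.mtopology Y (\<lambda>f g. if f \<in> Y \<and> g \<in> Y then N (\<lambda>z. f z - g z) else 0)"

definition linear_operator_on ::
    "(complex \<Rightarrow> complex) set \<Rightarrow> (complex \<Rightarrow> complex) set \<Rightarrow>
     ((complex \<Rightarrow> complex) \<Rightarrow> (complex \<Rightarrow> complex)) \<Rightarrow> bool" where
  "linear_operator_on X Y T \<longleftrightarrow> T \<in> X \<rightarrow> Y \<and>
     (\<forall>f\<in>X. \<forall>g\<in>X. T (\<lambda>z. f z + g z) = (\<lambda>z. T f z + T g z)) \<and>
     (\<forall>c. \<forall>f\<in>X. T (\<lambda>z. c * f z) = (\<lambda>z. c * T f z))"

definition compact_operator ::
    "(complex \<Rightarrow> complex) set \<Rightarrow> ((complex \<Rightarrow> complex) \<Rightarrow> real) \<Rightarrow>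
     (complex \<Rightarrow> complex) set \<Rightarrow> ((complex \<Rightarrow> complex) \<Rightarrow> real) \<Rightarrow>
     ((complex \<Rightarrow> complex) \<Rightarrow> (complex \<Rightarrow> complex)) \<Rightarrow> bool" where
  "compact_operator X NX Y NY T \<longleftrightarrow> linear_operator_on X Y T \<and>
     (\<forall>S. S \<subseteq> X \<and> (\<exists>B. \<forall>f\<in>S. NX f \<le> B) \<longrightarrow>
        compactin (norm_topology Y NY) (norm_topology Y NY closure_of (T ` S)))"

definition hilbert_compact ::
    "real measure \<Rightarrow> real \<Rightarrow>
     (complex \<Rightarrow> complex) set \<Rightarrow> ((complex \<Rightarrow> complex) \<Rightarrow> real) \<Rightarrow>
     (complex \<Rightarrow> complex) set \<Rightarrow> ((complex \<Rightarrow> complex) \<Rightarrow> real) \<Rightarrow> bool" where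
  "hilbert_compact \<mu> \<alpha> X NX Y NY \<longleftrightarrow>
     (\<forall>f\<in>X. hilbert_defined \<mu> \<alpha> f) \<and> compact_operator X NX Y NY (hilbert_op \<mu> \<alpha>)"

end

theory Submission
 imports Defs "HOL-Complex_Analysis.Complex_Analysis"
begin

text \<open>
Why the theorem holds. On functions f of H^p the operator is an integral operator: H f(z) is the
integral over \<mu> of f(t) (1 - t z)^(-\<alpha>). Expanding f in its Taylor series and summing over n
gives this formally; the sum over k inside a coefficient need not converge absolutely, and is
treated by the theorem of Tauber. Its terms are moments of \<mu> times Taylor coefficients of f.
With p1 = min p 1 the coefficients are O(k^(1/p1 - 1)), and the moments are o(k^(-1/p1)) as soon as
\<mu> is a vanishing 1/p1-Carleson measure, which each of the three conditions implies; the Abel means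
converge because the dilations of f tend to f in L^1(\<mu>). This is lemma moment_represented_hardy.

Sufficiency. The tool is a Carleson embedding into L^q of a measure on the radius [0, 1)
(carleson_embedding): a measure with \<nu>([t, 1)) \<le> e (1 - t)^(q/p) embeds H^p into L^q(\<nu>) with
q-th power constant O(e). On a circle that avoids the zeros of f, dividing by Blaschke factors and
taking the power p/2 replaces |f|^p by |h|^2 with h holomorphic and zero-free, and the power series
of h with absolute values as coefficients is an increasing function on the radius which dominates f.
For it, embedding into L^q(\<nu>) reduces to Lebesgue measure (nn_integral_le_of_tail_bound), where a
Cauchy-Schwarz argument gives a Hilbert inequality. Then:
\<^item> for q > 1, Jensen's inequality with an auxiliary power weight and Fubini's theorem bound the
 Bergman norm of H f by the L^q norm of f for the measure (1 - t)^((q-1)(s-\<alpha>)) d\<mu> with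
 s = 1/p + \<alpha>/q' (bergman_estimate); this measure is a vanishing q/p-Carleson measure if \<mu> is a
 vanishing s-Carleson measure, and q \<ge> \<alpha> p is exactly the condition s \<ge> \<alpha>;
\<^item> for q = 1 the integral of the kernel over the disc is a logarithm, and the measure becomes
 log(2/(1 - t)) d\<mu> (bergman_estimate_1, tail_bound_log_weight);
\<^item> for the Bloch space the growth estimate of H^p and the tail of \<mu> are enough (bloch_estimate).
In all cases the contribution of t near 1 is uniformly small, so H maps bounded sequences that tend
to 0 locally uniformly to norm-null sequences. By Montel's theorem this is compactness
(compact_operatorI).

Necessity. The functions f_b(z) = (1 - b)^(1/p) (1 - b z)^(-2/p), 0 < b < 1, are bounded in H^p. All
integrands in H f_b at points of [0, 1) are positive, so restricting the integral to t \<ge> b bounds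
the norm of H f_b below by a multiple of (1 - b)^(-s) \<mu>([b, 1)), with a logarithm in addition if
q = 1. Compactness makes the norm of H f_b tend to 0 as b tends to 1 (vanishing_of_compact).
\<close>

section \<open>Power kernels on the unit interval\<close>

lemma nn_integral_powr_from_0:
 fixes \<sigma> c :: real
 assumes "0 < \<sigma>" "0 \<le> c"
 shows "(\<integral>\<^sup>+u\<in>{0..c}. ennreal (u powr (\<sigma> - 1)) \<partial>lborel) = ennreal (c powr \<sigma> / \<sigma>)"
proof -
 have "((\<lambda>x. x powr (\<sigma> - 1)) has_integral (c powr (\<sigma> - 1 + 1) / (\<sigma> - 1 + 1))) {0..c}"
  by (rule has_integral_powr_from_0) (use assms in auto)
 from nn_integral_has_integral_lebesgue[OF _ this] show ?thesis
  by (subst nn_integral_set_ennreal) (simp add: mult.commute)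
qed

lemma nn_integral_powr_to_1:
 fixes \<tau> \<delta> :: real
 assumes "0 < \<tau>" "0 < \<delta>" "\<delta> \<le> 1"
 shows "(\<integral>\<^sup>+u\<in>{\<delta>..1}. ennreal (u powr (-\<tau> - 1)) \<partial>lborel) \<le> ennreal (\<delta> powr (-\<tau>) / \<tau>)"
proof -
 have "((\<lambda>x. x powr (-\<tau> - 1)) has_integral (- (1 powr (-\<tau>)) / \<tau> - (- (\<delta> powr (-\<tau>)) / \<tau>))) {\<delta>..1}"
  by (rule fundamental_theorem_of_calculus)
    (use assms in \<open>auto intro!: derivative_eq_intros simp flip: has_real_derivative_iff_has_vector_derivative\<close>)
 from nn_integral_has_integral_lebesgue[OF _ this]
 have "(\<integral>\<^sup>+u\<in>{\<delta>..1}. ennreal (u powr (-\<tau> - 1)) \<partial>lborel) = ennreal (\<delta> powr (-\<tau>) / \<tau> - 1 / \<tau>)"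
  by (subst nn_integral_set_ennreal) (simp add: mult.commute)
 also have "\<dots> \<le> ennreal (\<delta> powr (-\<tau>) / \<tau>)"
  using assms by (intro ennreal_leI) auto
 finally show ?thesis .
qed

lemma nn_integral_inverse_to_1:
 fixes \<delta> :: real
 assumes "0 < \<delta>" "\<delta> \<le> 1"
 shows "(\<integral>\<^sup>+u\<in>{\<delta>..1}. ennreal (1 / u) \<partial>lborel) = ennreal (ln (1 / \<delta>))"
proof -
 have "((\<lambda>x. 1 / x) has_integral (ln 1 - ln \<delta>)) {\<delta>..1}"
  by (rule fundamental_theorem_of_calculus)
    (use assms in \<open>auto intro!: derivative_eq_intros simp: divide_inverse simp flip: has_real_derivative_iff_has_vector_derivative\<close>)
 from nn_integral_has_integral_lebesgue[OF _ this] show ?thesis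
  using assms by (simp add: nn_integral_set_ennreal mult.commute ln_div)
qed

text \<open>A smooth kernel (1 - t r)^(-y) is comparable to max (1 - r) (1 - t) to the power -y. Splitting at
u = \<delta> leaves two power integrals, and the logarithm of the critical case y = \<sigma> is
the source of the logarithmic condition for q = 1.\<close>

lemma nn_integral_max_kernel:
 fixes \<sigma> y \<delta> :: real
 assumes "0 < \<sigma>" "\<sigma> \<le> y" "0 < \<delta>" "\<delta> \<le> 1"
 shows "(\<integral>\<^sup>+u\<in>{0..1}. ennreal (u powr (\<sigma> - 1) * max \<delta> u powr (-y)) \<partial>lborel)
  \<le> ennreal (if \<sigma> = y then 1 / \<sigma> + ln (1 / \<delta>) else (1 / \<sigma> + 1 / (y - \<sigma>)) * \<delta> powr (\<sigma> - y))"
proof -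
 have "(\<integral>\<^sup>+u\<in>{0..1}. ennreal (u powr (\<sigma> - 1) * max \<delta> u powr (-y)) \<partial>lborel)
  \<le> (\<integral>\<^sup>+u. ennreal (\<delta> powr (-y)) * (ennreal (u powr (\<sigma> - 1)) * indicator {0..\<delta>} u)
     + ennreal (u powr (-(y - \<sigma>) - 1)) * indicator {\<delta>..1} u \<partial>lborel)"
  using assms
  by (intro nn_integral_mono)
    (auto simp: indicator_def max_def ennreal_mult[symmetric] mult.commute powr_add[symmetric] algebra_simps)
 also have "\<dots> = ennreal (\<delta> powr (-y)) * (\<integral>\<^sup>+u\<in>{0..\<delta>}. ennreal (u powr (\<sigma> - 1)) \<partial>lborel)
   + (\<integral>\<^sup>+u\<in>{\<delta>..1}. ennreal (u powr (-(y - \<sigma>) - 1)) \<partial>lborel)"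
  by (subst nn_integral_add) (auto simp: nn_integral_cmult)
 also have "ennreal (\<delta> powr (-y)) * (\<integral>\<^sup>+u\<in>{0..\<delta>}. ennreal (u powr (\<sigma> - 1)) \<partial>lborel) =
   ennreal (\<delta> powr (\<sigma> - y) / \<sigma>)"
  using assms by (subst nn_integral_powr_from_0) (auto simp: ennreal_mult[symmetric] powr_diff powr_minus field_simps)
 also have "(\<integral>\<^sup>+u\<in>{\<delta>..1}. ennreal (u powr (-(y - \<sigma>) - 1)) \<partial>lborel) \<le>
   ennreal (if \<sigma> = y then ln (1 / \<delta>) else \<delta> powr (-(y - \<sigma>)) / (y - \<sigma>))"
 proof (cases "\<sigma> = y")
  case True
  have "(\<integral>\<^sup>+u\<in>{\<delta>..1}. ennreal (u powr (-(y - \<sigma>) - 1)) \<partial>lborel) =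
    (\<integral>\<^sup>+u\<in>{\<delta>..1}. ennreal (1 / u) \<partial>lborel)"
   using assms True by (intro nn_integral_cong) (auto simp: indicator_def powr_minus divide_inverse)
  then show ?thesis using nn_integral_inverse_to_1[of \<delta>] assms True by simp
 next
  case False
  then show ?thesis using nn_integral_powr_to_1[of "y - \<sigma>" \<delta>] assms by simp
 qed
 finally have "(\<integral>\<^sup>+u\<in>{0..1}. ennreal (u powr (\<sigma> - 1) * max \<delta> u powr (-y)) \<partial>lborel) \<le>
   ennreal (\<delta> powr (\<sigma> - y) / \<sigma>) + ennreal (if \<sigma> = y then ln (1 / \<delta>) else \<delta> powr (-(y - \<sigma>)) / (y - \<sigma>))"
  by (simp add: add_left_mono)
 also have "\<dots> = ennreal (if \<sigma> = y then 1 / \<sigma> + ln (1 / \<delta>) else (1 / \<sigma> + 1 / (y - \<sigma>)) * \<delta> powr (\<sigma> - y))"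
  using assms by (auto simp: ennreal_plus[symmetric] algebra_simps simp del: ennreal_plus)
 finally show ?thesis .
qed

lemma nn_integral_reflect_unit:
 fixes f :: "real \<Rightarrow> ennreal"
 assumes [measurable]: "f \<in> borel_measurable borel"
 shows "(\<integral>\<^sup>+t\<in>{0..1}. f (1 - t) \<partial>lborel) = (\<integral>\<^sup>+u\<in>{0..1}. f u \<partial>lborel)"
 by (subst (2) nn_integral_real_affine[where c = "-1" and t = 1])
   (auto intro!: nn_integral_cong simp: indicator_def)

lemma nn_integral_disc_kernel:
 fixes \<sigma> y r :: real
 assumes "0 < \<sigma>" "\<sigma> \<le> y" "0 \<le> r" "r < 1"
 shows "(\<integral>\<^sup>+t\<in>{0..1}. ennreal ((1 - t) powr (\<sigma> - 1) * (1 - t * r) powr (-y)) \<partial>lborel)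
  \<le> ennreal (if \<sigma> = y then 1 / \<sigma> + ln (1 / (1 - r)) else (1 / \<sigma> + 1 / (y - \<sigma>)) * (1 - r) powr (\<sigma> - y))"
proof -
 have "(\<integral>\<^sup>+t\<in>{0..1}. ennreal ((1 - t) powr (\<sigma> - 1) * (1 - t * r) powr (-y)) \<partial>lborel)
  \<le> (\<integral>\<^sup>+t\<in>{0..1}. ennreal ((1 - t) powr (\<sigma> - 1) * max (1 - r) (1 - t) powr (-y)) \<partial>lborel)"
 proof (intro nn_integral_mono)
  fix t :: real
  show "ennreal ((1 - t) powr (\<sigma> - 1) * (1 - t * r) powr (-y)) * indicator {0..1} t \<le>
    ennreal ((1 - t) powr (\<sigma> - 1) * max (1 - r) (1 - t) powr (-y)) * indicator {0..1} t"
  proof (cases "t \<in> {0..1}")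
   case True
   then have "t * r \<le> 1 * r" "t * r \<le> t * 1"
    using assms by (intro mult_right_mono mult_left_mono; simp)+
   then have "(1 - t * r) powr (-y) \<le> max (1 - r) (1 - t) powr (-y)"
    using assms by (intro powr_mono2') auto
   then show ?thesis by (intro mult_right_mono ennreal_leI mult_left_mono) auto
  qed auto
 qed
 also have "\<dots> = (\<integral>\<^sup>+u\<in>{0..1}. ennreal (u powr (\<sigma> - 1) * max (1 - r) u powr (-y)) \<partial>lborel)"
  by (rule nn_integral_reflect_unit) measurable
 finally show ?thesis
  using nn_integral_max_kernel[of \<sigma> y "1 - r"] assms by (auto split: if_splits intro: order_trans)
qed

section \<open>Measures with a power tail bound\<close>

text \<open>The set is written with 0 \<le> l so that the outer integral may run over all reals.\<close>

lemma nn_integral_layer_cake: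
 fixes \<phi> :: "real \<Rightarrow> real"
 assumes "finite_measure N" and sN[measurable_cong]: "sets N = sets borel"
  and [measurable]: "\<phi> \<in> borel_measurable borel" and "\<And>t. 0 \<le> \<phi> t"
 shows "(\<integral>\<^sup>+t. ennreal (\<phi> t) \<partial>N) = (\<integral>\<^sup>+l. emeasure N {t. 0 \<le> l \<and> l < \<phi> t} \<partial>lborel)"
proof -
 interpret finite_measure N by fact
 interpret P: pair_sigma_finite N lborel ..
 have [measurable]: "\<phi> \<in> borel_measurable N" using sN by (simp cong: measurable_cong_sets)
 have "(\<integral>\<^sup>+t. ennreal (\<phi> t) \<partial>N) = (\<integral>\<^sup>+t. \<integral>\<^sup>+l. indicator {0..<\<phi> t} l \<partial>lborel \<partial>N)"
  using assms(4) by simp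
 also have "\<dots> = (\<integral>\<^sup>+t. \<integral>\<^sup>+l. (if 0 \<le> l \<and> l < \<phi> t then 1 else 0) \<partial>lborel \<partial>N)"
  by (intro nn_integral_cong) (auto simp: indicator_def)
 also have "\<dots> = (\<integral>\<^sup>+l. \<integral>\<^sup>+t. (if 0 \<le> l \<and> l < \<phi> t then 1 else 0) \<partial>N \<partial>lborel)"
  by (rule P.Fubini'[symmetric]) measurable
 also have "\<dots> = (\<integral>\<^sup>+l. emeasure N {t. 0 \<le> l \<and> l < \<phi> t} \<partial>lborel)"
 proof (rule nn_integral_cong)
  fix l :: real
  have "{t \<in> space N. 0 \<le> l \<and> l < \<phi> t} \<in> sets N" by measurable
  then have "{t. 0 \<le> l \<and> l < \<phi> t} \<in> sets N" using sets_eq_imp_space_eq[OF sN] by simp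
  from nn_integral_indicator[OF this]
  show "(\<integral>\<^sup>+t. (if 0 \<le> l \<and> l < \<phi> t then 1 else 0) \<partial>N) = emeasure N {t. 0 \<le> l \<and> l < \<phi> t}"
   by (simp add: indicator_def of_bool_def)
 qed
 finally show ?thesis .
qed

lemma nn_integral_powr_tail:
 fixes s c :: real
 assumes "0 < s" "c < 1"
 shows "(\<integral>\<^sup>+t\<in>{c<..<1}. ennreal ((1 - t) powr (s - 1)) \<partial>lborel) = ennreal ((1 - c) powr s / s)"
proof -
 have "(\<integral>\<^sup>+t\<in>{c<..<1}. ennreal ((1 - t) powr (s - 1)) \<partial>lborel)
  = (\<integral>\<^sup>+u\<in>{0<..<1-c}. ennreal (u powr (s - 1)) \<partial>lborel)"
  by (subst nn_integral_real_affine[where c = "-1" and t = 1])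
    (auto intro!: nn_integral_cong simp: indicator_def)
 also have "\<dots> = (\<integral>\<^sup>+u\<in>{0..1-c}. ennreal (u powr (s - 1)) \<partial>lborel)"
  by (rule nn_integral_cong_AE, rule AE_mp[OF AE_lborel_singleton[of 0]],
    rule AE_mp[OF AE_lborel_singleton[of "1-c"]], rule AE_I2) (auto simp: indicator_def)
 finally show ?thesis using assms by (simp add: nn_integral_powr_from_0)
qed

lemma borel_measure_01D:
 assumes "borel_measure_01 \<mu>"
 shows "sets \<mu> = sets (restrict_space borel {0..<1})" "space \<mu> = {0..<1}"
  "A \<in> sets borel \<Longrightarrow> A \<inter> {0..<1} \<in> sets \<mu>" "f \<in> borel_measurable borel \<Longrightarrow> f \<in> borel_measurable \<mu>"
proof -
 show *: "sets \<mu> = sets (restrict_space borel {0..<1})" using assms by (simp add: borel_measure_01_def)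
 show "space \<mu> = {0..<1}" using sets_eq_imp_space_eq[OF *] by (simp add: space_restrict_space)
 show "A \<in> sets borel \<Longrightarrow> A \<inter> {0..<1} \<in> sets \<mu>" by (auto simp: * sets_restrict_space)
 show "f \<in> borel_measurable borel \<Longrightarrow> f \<in> borel_measurable \<mu>"
  by (simp add: measurable_restrict_space1 cong: measurable_cong_sets[OF * refl])
qed

definition tail_bound :: "real measure \<Rightarrow> real \<Rightarrow> real \<Rightarrow> real \<Rightarrow> bool" where
 "tail_bound \<mu> a s \<epsilon> \<longleftrightarrow> (\<forall>t. a \<le> t \<and> t < 1 \<longrightarrow> emeasure \<mu> {t..<1} \<le> ennreal (\<epsilon> * (1 - t) powr s))"

text \<open>The superlevel sets of an increasing function are tails, up to their left end point. On tails
\<mu> is dominated by the measure with density \<epsilon> s (1 - t)^(s - 1), whose mass on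
{t..<1} is \<epsilon> (1 - t)^s; the layer cake formula transports this to integrals.
Monotonicity is essential, as the hypothesis says nothing about the distribution of \<mu> within
a tail.\<close>

lemma nn_integral_le_of_tail_bound:
 fixes \<mu> :: "real measure" and \<phi> :: "real \<Rightarrow> real"
 assumes \<mu>: "borel_measure_01 \<mu>" and a: "0 \<le> a" "a < 1" and s: "0 < s" and \<epsilon>: "0 \<le> \<epsilon>"
  and tail: "tail_bound \<mu> a s \<epsilon>"
  and [measurable]: "\<phi> \<in> borel_measurable borel"
  and nonneg: "\<And>t. a \<le> t \<Longrightarrow> t < 1 \<Longrightarrow> 0 \<le> \<phi> t"
  and mono: "\<And>t t'. a \<le> t \<Longrightarrow> t \<le> t' \<Longrightarrow> t' < 1 \<Longrightarrow> \<phi> t \<le> \<phi> t'"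
 shows "(\<integral>\<^sup>+t\<in>{a..<1}. ennreal (\<phi> t) \<partial>\<mu>)
  \<le> ennreal (\<epsilon> * s) * (\<integral>\<^sup>+t\<in>{a..<1}. ennreal (\<phi> t * (1 - t) powr (s - 1)) \<partial>lborel)"
proof -
 note D = borel_measure_01D[OF \<mu>]
 define N where "N = distr (density \<mu> (indicator {a..<1})) borel (\<lambda>t. t)"
 define \<nu> where "\<nu> = density lborel (\<lambda>t. ennreal (\<epsilon> * s * (1 - t) powr (s - 1)) * indicator {a..<1} t)"
 define \<psi> where "\<psi> = (\<lambda>t. \<phi> t * indicator {a..<1} t)"
 have [measurable]: "\<psi> \<in> borel_measurable borel" unfolding \<psi>_def by measurable
 have \<psi>0: "0 \<le> \<psi> t" for t using nonneg by (auto simp: \<psi>_def indicator_def)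
 have int_N: "(\<integral>\<^sup>+t. g t \<partial>N) = (\<integral>\<^sup>+t\<in>{a..<1}. g t \<partial>\<mu>)" if g: "g \<in> borel_measurable borel" for g
 proof -
  have id: "(\<lambda>t. t) \<in> measurable (density \<mu> (indicator {a..<1})) borel" using D(4)[of "\<lambda>t. t"] by simp
  have "(\<integral>\<^sup>+t. g t \<partial>N) = (\<integral>\<^sup>+t. g t \<partial>density \<mu> (indicator {a..<1}))"
   unfolding N_def by (rule nn_integral_distr[OF id]) (use g in simp)
  also have "\<dots> = (\<integral>\<^sup>+t. indicator {a..<1} t * g t \<partial>\<mu>)"
   by (rule nn_integral_density) (auto intro!: D(4) g)
  finally show ?thesis by (simp add: mult.commute)
 qed
 have em_N: "emeasure N A = emeasure \<mu> (A \<inter> {a..<1})" if [measurable]: "A \<in> sets borel" for A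
 proof -
  have "emeasure N A = (\<integral>\<^sup>+t\<in>{a..<1}. indicator A t \<partial>\<mu>)"
   using int_N[of "indicator A"] that by (simp add: N_def)
  also have "\<dots> = (\<integral>\<^sup>+t. indicator (A \<inter> {a..<1}) t \<partial>\<mu>)"
   by (intro nn_integral_cong) (auto simp: indicator_def)
  also have "\<dots> = emeasure \<mu> (A \<inter> {a..<1})"
  proof (rule nn_integral_indicator)
   have "A \<inter> {a..<1} \<inter> {0..<1} \<in> sets \<mu>" by (rule D(3)) simp
   then show "A \<inter> {a..<1} \<in> sets \<mu>" using a by (simp add: Int_assoc)
  qed
  finally show ?thesis .
 qed
 have em_\<nu>: "emeasure \<nu> {c<..<1} = ennreal (\<epsilon> * (1 - c) powr s)" if "a \<le> c" "c < 1" for c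
 proof -
  have "emeasure \<nu> {c<..<1} = (\<integral>\<^sup>+t. ennreal (\<epsilon> * s) * (ennreal ((1 - t) powr (s - 1)) * indicator {c<..<1} t) \<partial>lborel)"
   unfolding \<nu>_def using that \<epsilon> s
   by (subst emeasure_density) (auto intro!: nn_integral_cong simp: indicator_def ennreal_mult[symmetric])
  also have "\<dots> = ennreal (\<epsilon> * s) * ennreal ((1 - c) powr s / s)"
   using that s by (subst nn_integral_cmult) (auto simp: nn_integral_powr_tail)
  also have "\<dots> = ennreal (\<epsilon> * (1 - c) powr s)"
   using s \<epsilon> by (simp add: ennreal_mult[symmetric])
  finally show ?thesis .
 qed
 have fN: "finite_measure N"
 proof (rule finite_measureI)
  have "emeasure N (space N) = emeasure \<mu> {a..<1}" using em_N[of UNIV] by (simp add: N_def)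
  also have "\<dots> \<le> ennreal (\<epsilon> * (1 - a) powr s)" using tail a unfolding tail_bound_def by auto
  finally show "emeasure N (space N) \<noteq> \<infinity>" by (auto simp: top_unique)
 qed
 have f\<nu>: "finite_measure \<nu>"
 proof (rule finite_measureI)
  let ?w = "\<lambda>t. ennreal (\<epsilon> * s * (1 - t) powr (s - 1)) * indicator {a..<1} t"
  have [measurable]: "?w \<in> borel_measurable lborel" by measurable
  have "emeasure \<nu> (space \<nu>) = (\<integral>\<^sup>+t\<in>(space \<nu>). ?w t \<partial>lborel)"
   unfolding \<nu>_def by (rule emeasure_density) auto
  also have "\<dots> = (\<integral>\<^sup>+t\<in>{a<..<1}. ?w t \<partial>lborel)"
   by (rule nn_integral_cong_AE, rule AE_mp[OF AE_lborel_singleton[of a]], rule AE_I2) (auto simp: indicator_def \<nu>_def)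
  also have "\<dots> = emeasure \<nu> {a<..<1}"
   unfolding \<nu>_def by (rule emeasure_density[symmetric]) auto
  finally show "emeasure \<nu> (space \<nu>) \<noteq> \<infinity>" using em_\<nu>[of a] a by simp
 qed
 have comp: "emeasure N {t. 0 \<le> l \<and> l < \<psi> t} \<le> emeasure \<nu> {t. 0 \<le> l \<and> l < \<psi> t}" for l
 proof (cases "{t. 0 \<le> l \<and> l < \<psi> t} = {}")
  case False
  define A where "A = {t. 0 \<le> l \<and> l < \<psi> t}"
  have l0: "0 \<le> l" using False by auto
  have Asub: "A \<subseteq> {a..<1}" by (auto simp: A_def \<psi>_def indicator_def split: if_splits)
  have Ane: "A \<noteq> {}" using False by (simp add: A_def)
  have A[measurable]: "A \<in> sets borel" unfolding A_def by measurable
  define c where "c = Inf A"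
  have bdd: "bdd_below A" using Asub by (intro bdd_belowI[of _ a]) auto
  have ca: "a \<le> c" unfolding c_def using Asub by (intro cInf_greatest[OF Ane]) auto
  obtain t1 where t1: "t1 \<in> A" using Ane by auto
  have c1: "c < 1" using cInf_lower[OF t1 bdd] Asub t1 unfolding c_def by force
  have up: "{c<..<1} \<subseteq> A"
  proof
   fix t assume t: "t \<in> {c<..<1}"
   then obtain t' where t': "t' \<in> A" "t' < t" using cInf_lessD[OF Ane] unfolding c_def by auto
   then have "\<phi> t' \<le> \<phi> t" using mono[of t' t] Asub t by auto
   moreover have "a \<le> t'" "0 \<le> l \<and> l < \<phi> t'" using t' Asub by (auto simp: A_def \<psi>_def indicator_def split: if_splits)
   ultimately show "t \<in> A" using t' t ca by (auto simp: A_def \<psi>_def indicator_def)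
  qed
  have "emeasure N A = emeasure \<mu> (A \<inter> {a..<1})" by (rule em_N) simp
  also have "\<dots> \<le> emeasure \<mu> {c..<1}"
  proof (rule emeasure_mono)
   show "A \<inter> {a..<1} \<subseteq> {c..<1}" using cInf_lower[OF _ bdd] by (auto simp: c_def)
   have "{c..<1} \<inter> {0..<1} \<in> sets \<mu>" by (rule D(3)) simp
   then show "{c..<1} \<in> sets \<mu>" using ca a by (simp add: Int_absorb2)
  qed
  also have "\<dots> \<le> ennreal (\<epsilon> * (1 - c) powr s)" using tail ca c1 unfolding tail_bound_def by auto
  also have "\<dots> = emeasure \<nu> {c<..<1}" using em_\<nu> ca c1 by simp
  also have "\<dots> \<le> emeasure \<nu> A" by (rule emeasure_mono[OF up]) (simp add: \<nu>_def)
  finally show ?thesis by (simp add: A_def)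
 qed auto
 have "(\<integral>\<^sup>+t\<in>{a..<1}. ennreal (\<phi> t) \<partial>\<mu>) = (\<integral>\<^sup>+t. ennreal (\<psi> t) \<partial>N)"
  by (subst int_N) (auto intro!: nn_integral_cong simp: \<psi>_def indicator_def)
 also have "\<dots> = (\<integral>\<^sup>+l. emeasure N {t. 0 \<le> l \<and> l < \<psi> t} \<partial>lborel)"
  by (rule nn_integral_layer_cake[OF fN]) (auto simp: \<psi>0 N_def)
 also have "\<dots> \<le> (\<integral>\<^sup>+l. emeasure \<nu> {t. 0 \<le> l \<and> l < \<psi> t} \<partial>lborel)"
  by (intro nn_integral_mono comp)
 also have "\<dots> = (\<integral>\<^sup>+t. ennreal (\<psi> t) \<partial>\<nu>)"
  by (rule nn_integral_layer_cake[OF f\<nu>, symmetric]) (auto simp: \<psi>0 \<nu>_def)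
 also have "\<dots> = (\<integral>\<^sup>+t. ennreal (\<epsilon> * s) * (ennreal (\<phi> t * (1 - t) powr (s - 1)) * indicator {a..<1} t) \<partial>lborel)"
  unfolding \<nu>_def using \<epsilon> s nonneg
  by (subst nn_integral_density) (auto intro!: nn_integral_cong simp: \<psi>_def indicator_def ennreal_mult[symmetric] mult_ac)
 also have "\<dots> = ennreal (\<epsilon> * s) * (\<integral>\<^sup>+t\<in>{a..<1}. ennreal (\<phi> t * (1 - t) powr (s - 1)) \<partial>lborel)"
  by (rule nn_integral_cmult) measurable
 finally show ?thesis .
qed

text \<open>The constant in the bound of the kernel integral in the noncritical case \<sigma> < y.\<close>

definition kernel_const :: "real \<Rightarrow> real \<Rightarrow> real" where
 "kernel_const \<sigma> y = 1 / \<sigma> + 1 / (y - \<sigma>)"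

lemma kernel_const_pos: "0 < \<sigma> \<Longrightarrow> \<sigma> < y \<Longrightarrow> 0 < kernel_const \<sigma> y"
 by (simp add: kernel_const_def add_pos_pos)

text \<open>The basic estimate for power kernels against \<mu>: the integrand increases in t, so it may be
integrated against (1 - t)^(s - 1) dt instead.\<close>

lemma nn_integral_tail_kernel:
 assumes \<mu>: "borel_measure_01 \<mu>" and a: "0 \<le> a" "a < 1" and \<epsilon>: "0 \<le> \<epsilon>"
  and tail: "tail_bound \<mu> a s \<epsilon>"
  and x: "0 \<le> x" "x < s" "s - x < y" and r: "0 \<le> r" "r < 1"
 shows "(\<integral>\<^sup>+t\<in>{a..<1}. ennreal ((1 - t) powr (-x) * (1 - t * r) powr (-y)) \<partial>\<mu>)
  \<le> ennreal (\<epsilon> * (s * kernel_const (s - x) y) * (1 - r) powr (s - x - y))"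
proof -
 have 1: "(\<integral>\<^sup>+t\<in>{a..<1}. ennreal ((1 - t) powr (-x) * (1 - t * r) powr (-y)) \<partial>\<mu>)
  \<le> ennreal (\<epsilon> * s) * (\<integral>\<^sup>+t\<in>{a..<1}. ennreal ((1 - t) powr (-x) * (1 - t * r) powr (-y) * (1 - t) powr (s - 1)) \<partial>lborel)"
 proof (rule nn_integral_le_of_tail_bound[OF \<mu> a _ \<epsilon> tail])
  fix t t' assume t: "a \<le> t" "t \<le> t'" "t' < 1"
  have "t' * r \<le> 1 * r" using t r by (intro mult_right_mono) auto
  then have "0 < 1 - t' * r" using r by simp
  moreover have "t * r \<le> t' * r" using t r by (intro mult_right_mono) auto
  ultimately show "(1 - t) powr - x * (1 - t * r) powr - y \<le> (1 - t') powr - x * (1 - t' * r) powr - y"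
   using t x by (intro mult_mono powr_mono2') auto
 qed (use x in auto)
 have "(\<integral>\<^sup>+t\<in>{a..<1}. ennreal ((1 - t) powr (-x) * (1 - t * r) powr (-y) * (1 - t) powr (s - 1)) \<partial>lborel)
  \<le> (\<integral>\<^sup>+t\<in>{0..1}. ennreal ((1 - t) powr (s - x - 1) * (1 - t * r) powr (-y)) \<partial>lborel)"
 proof (intro nn_integral_mono)
  fix t :: real
  have eq: "(1 - t) powr (-x) * (1 - t * r) powr (-y) * (1 - t) powr (s - 1) = (1 - t) powr (s - x - 1) * (1 - t * r) powr (-y)"
  proof -
   have "(1 - t) powr (-x) * (1 - t * r) powr (-y) * (1 - t) powr (s - 1) =
    ((1 - t) powr (-x) * (1 - t) powr (s - 1)) * (1 - t * r) powr (-y)" by simp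
   also have "\<dots> = (1 - t) powr (s - x - 1) * (1 - t * r) powr (-y)"
    by (subst powr_add[symmetric]) (simp add: algebra_simps)
   finally show ?thesis .
  qed
  show "ennreal ((1 - t) powr (-x) * (1 - t * r) powr (-y) * (1 - t) powr (s - 1)) * indicator {a..<1} t
    \<le> ennreal ((1 - t) powr (s - x - 1) * (1 - t * r) powr (-y)) * indicator {0..1} t"
   using a by (subst eq) (simp add: indicator_def)
 qed
 also have "\<dots> \<le> ennreal (kernel_const (s - x) y * (1 - r) powr (s - x - y))"
  using nn_integral_disc_kernel[of "s - x" y r] x r by (simp add: kernel_const_def)
 finally have 2: "ennreal (\<epsilon> * s) * (\<integral>\<^sup>+t\<in>{a..<1}. ennreal ((1 - t) powr (-x) * (1 - t * r) powr (-y) * (1 - t) powr (s - 1)) \<partial>lborel)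
   \<le> ennreal (\<epsilon> * s) * ennreal (kernel_const (s - x) y * (1 - r) powr (s - x - y))"
  by (rule mult_left_mono) simp
 show ?thesis
  using order_trans[OF 1 2] \<epsilon> x kernel_const_pos[of "s-x" y] by (simp add: ennreal_mult[symmetric] mult_ac)
qed

section \<open>Power kernels on circles\<close>

lemma sin_ge_half_self:
 fixes x :: real
 assumes "0 \<le> x" "x \<le> pi / 2"
 shows "x / 2 \<le> sin x"
proof -
 have *: "y * cos y \<le> sin y" if "0 \<le> y" "y \<le> pi" for y :: real
 proof -
  have "sin 0 - 0 * cos 0 \<le> sin y - y * cos y"
  proof (rule DERIV_nonneg_imp_nondecreasing[OF that(1)])
   fix u assume u: "0 \<le> u" "u \<le> y"
   then have "0 \<le> u * sin u" using that by (intro mult_nonneg_nonneg sin_ge_zero) auto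
   moreover have "((\<lambda>x. sin x - x * cos x) has_real_derivative u * sin u) (at u)"
    by (auto intro!: derivative_eq_intros)
   ultimately show "\<exists>d. ((\<lambda>x. sin x - x * cos x) has_real_derivative d) (at u) \<and> 0 \<le> d" by blast
  qed
  then show ?thesis by simp
 qed
 have c: "cos (pi / 4) \<le> cos (x / 2)" using assms by (intro cos_monotone_0_pi_le) auto
 have "(sqrt 2 / 2) * (sqrt 2 / 2) \<le> cos (x / 2) * cos (x / 2)"
  using c cos_ge_zero[of "x/2"] assms by (intro mult_mono) (auto simp: cos_45)
 then have "1 / 2 \<le> cos (x/2) * cos (x/2)" by simp
 then have "x * (1 / 2) \<le> x * (cos (x/2) * cos (x/2))" using assms by (intro mult_left_mono) auto
 also have "\<dots> = 2 * (x / 2 * cos (x/2)) * cos (x/2)" by simp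
 also have "\<dots> \<le> 2 * sin (x/2) * cos (x/2)"
  using *[of "x/2"] assms by (intro mult_right_mono mult_left_mono cos_ge_zero) auto
 also have "\<dots> = sin x" using sin_double[of "x/2"] by simp
 finally show ?thesis by simp
qed

text \<open>Half of the chord |1 - cis \<theta>| is sin (\<theta>/2), and moving to radius \<rho> changes the
distance by at most 1 - \<rho>. The maximum with \<theta>/pi puts the angular integral into the
form of the kernel integrals on the unit interval.\<close>

lemma norm_one_minus_cis_ge:
 assumes "0 \<le> \<rho>" "\<rho> < 1" "0 \<le> \<theta>" "\<theta> \<le> pi"
 shows "max (1 - \<rho>) (\<theta> / pi) / 4 \<le> norm (1 - of_real \<rho> * cis \<theta>)"
proof -
 have s0: "0 \<le> sin (\<theta> / 2)" using assms by (intro sin_ge_zero) auto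
 have eq: "(norm (1 - cis \<theta>))\<^sup>2 = (2 * sin (\<theta> / 2))\<^sup>2"
 proof -
  have "(norm (1 - cis \<theta>))\<^sup>2 = 2 - 2 * cos \<theta>"
   unfolding cmod_power2 using sin_cos_squared_add[of \<theta>] by (simp add: power2_eq_square algebra_simps)
  also have "\<dots> = (2 * sin (\<theta> / 2))\<^sup>2"
   using cos_double_sin[of "\<theta>/2"] by (simp add: power2_eq_square)
  finally show ?thesis .
 qed
 have "norm (1 - cis \<theta>) = 2 * sin (\<theta> / 2)"
  by (rule power2_eq_imp_eq[OF eq]) (use s0 in simp_all)
 with sin_ge_half_self[of "\<theta>/2"] assms have 1: "\<theta> / 2 \<le> norm (1 - cis \<theta>)" by linarith
 have "norm (1 - cis \<theta>) \<le> norm (1 - of_real \<rho> * cis \<theta>) + norm (of_real (1 - \<rho>) * cis \<theta>)"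
  using norm_triangle_ineq4[of "1 - of_real \<rho> * cis \<theta>" "of_real (1 - \<rho>) * cis \<theta>"] by (simp add: algebra_simps)
 also have "norm (of_real (1 - \<rho>) * cis \<theta>) = 1 - \<rho>" using assms by (simp add: norm_mult del: of_real_diff)
 finally have 2: "norm (1 - cis \<theta>) \<le> norm (1 - of_real \<rho> * cis \<theta>) + (1 - \<rho>)" .
 have 3: "1 - \<rho> \<le> norm (1 - of_real \<rho> * cis \<theta>)"
  using norm_triangle_ineq2[of 1 "of_real \<rho> * cis \<theta>"] assms by (simp add: norm_mult)
 have "\<theta> / pi \<le> \<theta> / 1" using assms pi_ge_two by (intro divide_left_mono) auto
 then show ?thesis using 1 2 3 assms by auto
qed

lemma nn_integral_reflect_angle:
 assumes "F \<in> borel_measurable (borel :: complex measure)"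
 shows "(\<integral>\<^sup>+\<theta>\<in>{pi..2*pi}. F (cis \<theta>) \<partial>lborel) = (\<integral>\<^sup>+\<theta>\<in>{0..pi}. F (cis (-\<theta>)) \<partial>lborel)"
proof -
 have [measurable]: "(\<lambda>\<theta>. F (cis \<theta>)) \<in> borel_measurable borel"
  by (rule measurable_compose[OF _ assms]) (intro borel_measurable_continuous_onI continuous_intros)
 have cis2: "cis (2 * pi - \<theta>) = cis (-\<theta>)" for \<theta> by (simp add: cis.code cos_diff sin_diff)
 show ?thesis
  by (subst nn_integral_real_affine[where c = "-1" and t = "2*pi"])
    (auto intro!: nn_integral_cong simp: indicator_def cis2)
qed

text \<open>Two half circles of length pi, the factor 4 of the preceding lower bound, and the kernel
constant.\<close>

definition angular_const :: "real \<Rightarrow> real" where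
 "angular_const A = 2 * pi * 4 powr A * kernel_const 1 A"

lemma angular_const_pos: "1 < A \<Longrightarrow> 0 < angular_const A"
 by (simp add: angular_const_def kernel_const_pos)

lemma nn_integral_angular_half:
 assumes A: "1 < A" and \<rho>: "0 \<le> \<rho>" "\<rho> < 1" and [measurable]: "f \<in> borel_measurable borel"
  and f: "\<And>\<theta>. 0 \<le> \<theta> \<Longrightarrow> \<theta> \<le> pi \<Longrightarrow> max (1 - \<rho>) (\<theta> / pi) / 4 \<le> f \<theta>"
 shows "(\<integral>\<^sup>+\<theta>\<in>{0..pi}. ennreal (f \<theta> powr (-A)) \<partial>lborel) \<le> ennreal (angular_const A / 2 * (1 - \<rho>) powr (1 - A))"
proof -
 have [simp]: "\<not> pi \<le> 0" using pi_gt_zero by linarith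
 have "(\<integral>\<^sup>+\<theta>\<in>{0..pi}. ennreal (f \<theta> powr (-A)) \<partial>lborel) =
   ennreal pi * (\<integral>\<^sup>+u\<in>{0..1}. ennreal (f (pi * u) powr (-A)) \<partial>lborel)"
  by (subst nn_integral_real_affine[where c = pi and t = 0])
    (auto intro!: nn_integral_cong simp: indicator_def zero_le_mult_iff)
 also have "(\<integral>\<^sup>+u\<in>{0..1}. ennreal (f (pi * u) powr (-A)) \<partial>lborel) \<le>
   (\<integral>\<^sup>+u. ennreal (4 powr A) * (ennreal (u powr (1 - 1) * max (1 - \<rho>) u powr (-A)) * indicator {0..1} u) \<partial>lborel)"
 proof (rule nn_integral_mono_AE, rule AE_mp[OF AE_lborel_singleton[of 0]], rule AE_I2, rule impI)
  fix u :: real assume "u \<noteq> 0"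
  show "ennreal (f (pi * u) powr (-A)) * indicator {0..1} u \<le>
   ennreal (4 powr A) * (ennreal (u powr (1 - 1) * max (1 - \<rho>) u powr (-A)) * indicator {0..1} u)"
  proof (cases "u \<in> {0..1}")
   case True
   have "f (pi * u) powr (-A) \<le> (max (1 - \<rho>) u / 4) powr (-A)"
    using f[of "pi * u"] True \<rho> A by (intro powr_mono2') auto
   also have "\<dots> = 4 powr A * max (1 - \<rho>) u powr (-A)"
    using True \<rho> by (subst powr_divide) (auto simp: powr_minus field_simps)
   finally show ?thesis using \<open>u \<noteq> 0\<close> True by (simp add: ennreal_mult[symmetric] del: powr_zero_eq_one) (simp add: ennreal_leI)
  qed auto
 qed
 also have "\<dots> = ennreal (4 powr A) * (\<integral>\<^sup>+u\<in>{0..1}. ennreal (u powr (1 - 1) * max (1 - \<rho>) u powr (-A)) \<partial>lborel)"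
  by (rule nn_integral_cmult) measurable
 also have "\<dots> \<le> ennreal (4 powr A) * ennreal (kernel_const 1 A * (1 - \<rho>) powr (1 - A))"
  using nn_integral_max_kernel[of 1 A "1 - \<rho>"] A \<rho> by (intro mult_left_mono) (auto simp: kernel_const_def)
 also have "ennreal pi * (ennreal (4 powr A) * ennreal (kernel_const 1 A * (1 - \<rho>) powr (1 - A))) =
    ennreal (angular_const A / 2 * (1 - \<rho>) powr (1 - A))"
  using kernel_const_pos[of 1 A] A by (simp add: ennreal_mult[symmetric] angular_const_def mult_ac)
 finally show ?thesis by (simp add: mult_left_mono)
qed

lemma nn_integral_angular_kernel:
 assumes A: "1 < A" and \<rho>: "0 \<le> \<rho>" "\<rho> < 1"
 shows "(\<integral>\<^sup>+\<theta>\<in>{0..2*pi}. ennreal (norm (1 - of_real \<rho> * cis \<theta>) powr (-A)) \<partial>lborel)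
  \<le> ennreal (angular_const A * (1 - \<rho>) powr (1 - A))"
proof -
 have cont: "(\<lambda>\<theta>. norm (1 - of_real \<rho> * cis \<theta>)) \<in> borel_measurable borel"
  "(\<lambda>\<theta>. norm (1 - of_real \<rho> * cis (-\<theta>))) \<in> borel_measurable borel"
  by (intro borel_measurable_continuous_onI continuous_intros)+
 note [measurable] = cont
 have sym: "norm (1 - of_real \<rho> * cis (-\<theta>)) = norm (1 - of_real \<rho> * cis \<theta>)" for \<theta>
  by (metis cis_cnj complex_cnj_complex_of_real complex_cnj_diff complex_cnj_mult complex_cnj_one complex_mod_cnj)
 have "(\<integral>\<^sup>+\<theta>\<in>{0..2*pi}. ennreal (norm (1 - of_real \<rho> * cis \<theta>) powr (-A)) \<partial>lborel)
   \<le> (\<integral>\<^sup>+\<theta>. ennreal (norm (1 - of_real \<rho> * cis \<theta>) powr (-A)) * indicator {0..pi} \<theta>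
    + ennreal (norm (1 - of_real \<rho> * cis \<theta>) powr (-A)) * indicator {pi..2*pi} \<theta> \<partial>lborel)"
  by (intro nn_integral_mono) (auto simp: indicator_def)
 also have "\<dots> = (\<integral>\<^sup>+\<theta>\<in>{0..pi}. ennreal (norm (1 - of_real \<rho> * cis \<theta>) powr (-A)) \<partial>lborel)
   + (\<integral>\<^sup>+\<theta>\<in>{pi..2*pi}. ennreal (norm (1 - of_real \<rho> * cis \<theta>) powr (-A)) \<partial>lborel)"
  by (rule nn_integral_add) measurable
 also have "(\<integral>\<^sup>+\<theta>\<in>{pi..2*pi}. ennreal (norm (1 - of_real \<rho> * cis \<theta>) powr (-A)) \<partial>lborel)
  = (\<integral>\<^sup>+\<theta>\<in>{0..pi}. ennreal (norm (1 - of_real \<rho> * cis \<theta>) powr (-A)) \<partial>lborel)"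
  by (subst nn_integral_reflect_angle[where F = "\<lambda>w. ennreal (norm (1 - of_real \<rho> * w) powr (-A))"])
    (auto simp: sym)
 finally have 1: "(\<integral>\<^sup>+\<theta>\<in>{0..2*pi}. ennreal (norm (1 - of_real \<rho> * cis \<theta>) powr (-A)) \<partial>lborel)
  \<le> (\<integral>\<^sup>+\<theta>\<in>{0..pi}. ennreal (norm (1 - of_real \<rho> * cis \<theta>) powr (-A)) \<partial>lborel) +
   (\<integral>\<^sup>+\<theta>\<in>{0..pi}. ennreal (norm (1 - of_real \<rho> * cis \<theta>) powr (-A)) \<partial>lborel)" .
 have 2: "(\<integral>\<^sup>+\<theta>\<in>{0..pi}. ennreal (norm (1 - of_real \<rho> * cis \<theta>) powr (-A)) \<partial>lborel) \<le>
   ennreal (angular_const A / 2 * (1 - \<rho>) powr (1 - A))"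
  by (rule nn_integral_angular_half[OF A \<rho> cont(1)]) (rule norm_one_minus_cis_ge[OF \<rho>])
 define X where "X = angular_const A / 2 * (1 - \<rho>) powr (1 - A)"
 have "0 \<le> X" using angular_const_pos[OF A] by (simp add: X_def)
 then have "ennreal X + ennreal X = ennreal (X + X)" by (intro ennreal_plus[symmetric])
 also have "X + X = angular_const A * (1 - \<rho>) powr (1 - A)" by (simp add: X_def)
 finally show ?thesis using order_trans[OF 1 add_mono[OF 2 2]] unfolding X_def by (simp only:)
qed

section \<open>Polar coordinates\<close>

lemma lborel_complex_eq_distr: "(lborel :: complex measure) = distr (lborel \<Otimes>\<^sub>M lborel) borel (\<lambda>(x, y). Complex x y)"
proof (rule lborel_eqI)
 fix l u :: complex assume le: "\<And>b. b \<in> Basis \<Longrightarrow> l \<bullet> b \<le> u \<bullet> b"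
 then have le': "Re l \<le> Re u" "Im l \<le> Im u" using le[of 1] le[of "\<i>"] by (simp_all add: Basis_complex_def inner_complex_def)
 have m: "(\<lambda>(x, y). Complex x y) \<in> (lborel \<Otimes>\<^sub>M lborel) \<rightarrow>\<^sub>M (borel :: complex measure)"
  unfolding Complex_eq by measurable
 have "(\<lambda>(x, y). Complex x y) -` box l u \<inter> space (lborel \<Otimes>\<^sub>M lborel) = {Re l<..<Re u} \<times> {Im l<..<Im u}"
  by (auto simp: box_complex_eq space_pair_measure in_box_complex_iff)
 then show "emeasure (distr (lborel \<Otimes>\<^sub>M lborel) borel (\<lambda>(x, y). Complex x y)) (box l u) = (\<Prod>b\<in>Basis. (u - l) \<bullet> b)"
  using le' m by (subst emeasure_distr) (auto simp: lborel.emeasure_pair_measure_Times ennreal_mult Basis_complex_def)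
qed simp

lemma nn_integral_complex_iterated:
 assumes [measurable]: "F \<in> borel_measurable borel"
 shows "(\<integral>\<^sup>+z. F z \<partial>lborel) = (\<integral>\<^sup>+x. \<integral>\<^sup>+y. F (Complex x y) \<partial>lborel \<partial>lborel)"
  and "(\<integral>\<^sup>+z. F z \<partial>lborel) = (\<integral>\<^sup>+y. \<integral>\<^sup>+x. F (Complex x y) \<partial>lborel \<partial>lborel)"
proof -
 have m[measurable]: "(\<lambda>(x, y). Complex x y) \<in> (lborel \<Otimes>\<^sub>M lborel) \<rightarrow>\<^sub>M (borel :: complex measure)"
  unfolding Complex_eq by measurable
 have [measurable]: "(\<lambda>(x, y). F (Complex x y)) \<in> borel_measurable (lborel \<Otimes>\<^sub>M lborel)"
  using measurable_compose[OF m assms] by (simp add: case_prod_beta')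
 have "(\<integral>\<^sup>+z. F z \<partial>lborel) = (\<integral>\<^sup>+z. (\<lambda>(x, y). F (Complex x y)) z \<partial>(lborel \<Otimes>\<^sub>M lborel))"
  by (subst lborel_complex_eq_distr, subst nn_integral_distr[OF m]) (auto simp: case_prod_beta')
 also have "\<dots> = (\<integral>\<^sup>+x. \<integral>\<^sup>+y. F (Complex x y) \<partial>lborel \<partial>lborel)"
  by (subst lborel.nn_integral_fst[symmetric]) auto
 finally show 1: "(\<integral>\<^sup>+z. F z \<partial>lborel) = (\<integral>\<^sup>+x. \<integral>\<^sup>+y. F (Complex x y) \<partial>lborel \<partial>lborel)" .
 then show "(\<integral>\<^sup>+z. F z \<partial>lborel) = (\<integral>\<^sup>+y. \<integral>\<^sup>+x. F (Complex x y) \<partial>lborel \<partial>lborel)"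
  by (subst lborel_pair.Fubini') auto
qed

lemma nn_integral_lborel_shift: "f \<in> borel_measurable borel \<Longrightarrow> (\<integral>\<^sup>+x. f (c + x) \<partial>lborel) = (\<integral>\<^sup>+x. f (x::real) \<partial>lborel)"
 by (subst (2) nn_integral_real_affine[where c = 1 and t = c]) auto

text \<open>By Tonelli a shear is a translation in each fibre.\<close>

lemma nn_integral_shear:
 assumes F[measurable]: "F \<in> borel_measurable borel"
 shows "(\<integral>\<^sup>+z. F (z + of_real (s * Im z)) \<partial>lborel) = (\<integral>\<^sup>+z. F z \<partial>lborel)"
  and "(\<integral>\<^sup>+z. F (z + \<i> * of_real (s * Re z)) \<partial>lborel) = (\<integral>\<^sup>+z. F z \<partial>lborel)"
proof -
 have m: "(\<lambda>x. F (Complex x y)) \<in> borel_measurable borel" "(\<lambda>x. F (Complex y x)) \<in> borel_measurable borel" for y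
  unfolding Complex_eq by measurable
 have "(\<integral>\<^sup>+z. F (z + of_real (s * Im z)) \<partial>lborel) = (\<integral>\<^sup>+y. \<integral>\<^sup>+x. F (Complex (s * y + x) y) \<partial>lborel \<partial>lborel)"
  by (subst nn_integral_complex_iterated(2)) (auto simp: Complex_eq algebra_simps)
 also have "\<dots> = (\<integral>\<^sup>+z. F z \<partial>lborel)"
  by (subst nn_integral_complex_iterated(2)) (auto simp: nn_integral_lborel_shift[OF m(1)])
 finally show "(\<integral>\<^sup>+z. F (z + of_real (s * Im z)) \<partial>lborel) = (\<integral>\<^sup>+z. F z \<partial>lborel)" .
 have "(\<integral>\<^sup>+z. F (z + \<i> * of_real (s * Re z)) \<partial>lborel) = (\<integral>\<^sup>+x. \<integral>\<^sup>+y. F (Complex x (s * x + y)) \<partial>lborel \<partial>lborel)"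
  by (subst nn_integral_complex_iterated(1)) (auto simp: Complex_eq algebra_simps)
 also have "\<dots> = (\<integral>\<^sup>+z. F z \<partial>lborel)"
  by (subst nn_integral_complex_iterated(1)) (auto simp: nn_integral_lborel_shift[OF m(2)])
 finally show "(\<integral>\<^sup>+z. F (z + \<i> * of_real (s * Re z)) \<partial>lborel) = (\<integral>\<^sup>+z. F z \<partial>lborel)" .
qed

text \<open>Rotation invariance of planar Lebesgue measure by elementary means: a rotation by \<theta> is a
product of three shears, provided tan (\<theta>/2) is finite.\<close>

lemma nn_integral_rotate:
 assumes F[measurable]: "F \<in> borel_measurable borel" and c: "cos (\<theta> / 2) \<noteq> 0"
 shows "(\<integral>\<^sup>+z. F (cis \<theta> * z) \<partial>lborel) = (\<integral>\<^sup>+z. F z \<partial>lborel)"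
proof -
 define t where "t = - tan (\<theta> / 2)"
 define S where "S = (\<lambda>z. z + of_real (t * Im z))"
 define U where "U = (\<lambda>z. z + \<i> * of_real (sin \<theta> * Re z))"
 have [measurable]: "S \<in> borel_measurable borel" "U \<in> borel_measurable borel" unfolding S_def U_def by measurable
 have h: "sin \<theta> = 2 * sin (\<theta>/2) * cos (\<theta>/2)" "cos \<theta> = 1 - 2 * (sin (\<theta>/2))\<^sup>2"
  using sin_double[of "\<theta>/2"] cos_double_sin[of "\<theta>/2"] by auto
 have a: "1 + t * sin \<theta> = cos \<theta>" using c by (simp add: h t_def tan_def power2_eq_square)
 have b: "t + (1 + t * sin \<theta>) * t = - sin \<theta>"
 proof -
  have "t + (1 + t * sin \<theta>) * t = - (sin (\<theta>/2) / cos (\<theta>/2)) * (2 - 2 * (sin (\<theta>/2))\<^sup>2)"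
   unfolding a by (simp add: h t_def tan_def algebra_simps)
  also have "2 - 2 * (sin (\<theta>/2))\<^sup>2 = 2 * (cos (\<theta>/2))\<^sup>2" by (simp add: sin_squared_eq)
  finally show ?thesis using c by (simp add: h power2_eq_square)
 qed
 have rot: "cis \<theta> * z = S (U (S z))" for z
 proof (rule complex_eqI)
  have "Re (S (U (S z))) = (1 + t * sin \<theta>) * Re z + (t + (1 + t * sin \<theta>) * t) * Im z"
   by (simp add: S_def U_def algebra_simps)
  then show "Re (cis \<theta> * z) = Re (S (U (S z)))" unfolding b unfolding a by simp
  have "Im (S (U (S z))) = sin \<theta> * Re z + (1 + t * sin \<theta>) * Im z"
   by (simp add: S_def U_def algebra_simps)
  then show "Im (cis \<theta> * z) = Im (S (U (S z)))" unfolding a by simp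
 qed
 have m: "(\<lambda>w. F (S (U w))) \<in> borel_measurable borel" "(\<lambda>w. F (S w)) \<in> borel_measurable borel"
  by measurable
 have "(\<integral>\<^sup>+z. F (cis \<theta> * z) \<partial>lborel) = (\<integral>\<^sup>+z. F (S (U (S z))) \<partial>lborel)" by (simp only: rot)
 also have "\<dots> = (\<integral>\<^sup>+z. F (S (U z)) \<partial>lborel)"
  using nn_integral_shear(1)[OF m(1), of t] by (simp only: S_def)
 also have "\<dots> = (\<integral>\<^sup>+z. F (S z) \<partial>lborel)"
  using nn_integral_shear(2)[OF m(2), of "sin \<theta>"] by (simp only: U_def)
 also have "\<dots> = (\<integral>\<^sup>+z. F z \<partial>lborel)" using nn_integral_shear(1)[OF F, of t] by (simp only: S_def)
 finally show ?thesis .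
qed

lemma nn_integral_cis_shift:
 assumes F[measurable]: "F \<in> borel_measurable (borel :: complex measure)" and \<phi>: "0 \<le> \<phi>" "\<phi> \<le> 2 * pi"
 shows "(\<integral>\<^sup>+\<theta>\<in>{0..<2*pi}. F (cis (\<phi> + \<theta>)) \<partial>lborel) = (\<integral>\<^sup>+\<theta>\<in>{0..<2*pi}. F (cis \<theta>) \<partial>lborel)"
proof -
 have cm: "cis \<in> borel_measurable borel" by (intro borel_measurable_continuous_onI continuous_intros)
 have [measurable]: "(\<lambda>\<theta>. F (cis \<theta>)) \<in> borel_measurable borel" by (rule measurable_compose[OF cm F])
 have per: "cis (2 * pi + \<theta>) = cis \<theta>" for \<theta> by (simp add: cis.code cos_add sin_add)
 let ?I = "\<lambda>S. \<integral>\<^sup>+\<theta>. F (cis \<theta>) * indicator S \<theta> \<partial>lborel"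
 have split: "?I {x..<z} = ?I {x..<y} + ?I {y..<z}" if "x \<le> y" "y \<le> z" for x y z
 proof -
  have "?I {x..<z} = (\<integral>\<^sup>+\<theta>. F (cis \<theta>) * indicator {x..<y} \<theta> + F (cis \<theta>) * indicator {y..<z} \<theta> \<partial>lborel)"
   using that by (intro nn_integral_cong) (auto simp: indicator_def)
  also have "\<dots> = ?I {x..<y} + ?I {y..<z}" by (rule nn_integral_add) measurable
  finally show ?thesis .
 qed
 have "(\<integral>\<^sup>+\<theta>\<in>{0..<2*pi}. F (cis (\<phi> + \<theta>)) \<partial>lborel) = ?I {\<phi>..<2*pi+\<phi>}"
  by (subst nn_integral_lborel_shift[where c = \<phi>, symmetric]) (auto intro!: nn_integral_cong simp: indicator_def)
 also have "\<dots> = ?I {\<phi>..<2*pi} + ?I {2*pi..<2*pi+\<phi>}" using \<phi> by (intro split) auto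
 also have "?I {2*pi..<2*pi+\<phi>} = ?I {0..<\<phi>}"
  by (subst nn_integral_lborel_shift[where c = "2*pi", symmetric]) (auto intro!: nn_integral_cong simp: indicator_def per)
 also have "?I {\<phi>..<2*pi} + ?I {0..<\<phi>} = ?I {0..<2*pi}" using split[of 0 \<phi> "2*pi"] \<phi> by (simp add: add.commute)
 finally show ?thesis .
qed

lemma borel_measurable_cis[measurable]: "cis \<in> borel_measurable borel"
 by (intro borel_measurable_continuous_onI continuous_intros)

lemma emeasure_disc: "0 \<le> r \<Longrightarrow> emeasure lborel (ball (0::complex) r) = ennreal (pi * r\<^sup>2)"
 "0 \<le> r \<Longrightarrow> emeasure lborel (cball (0::complex) r) = ennreal (pi * r\<^sup>2)"
 by (simp_all add: emeasure_ball emeasure_cball unit_ball_vol_2)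

lemma borel_disc[measurable]: "ball (0::complex) r \<in> sets borel" "ball (0::complex) r \<in> sets lborel"
 by simp_all

text \<open>Two measures on [0, 1) agree because the disc of radius r has area pi r^2: the image of area
under |z|^2 is pi times Lebesgue measure.\<close>

lemma nn_integral_disc_radial:
 assumes k[measurable]: "k \<in> borel_measurable borel"
 shows "(\<integral>\<^sup>+z. k ((norm z)\<^sup>2) * indicator (ball (0::complex) 1) z \<partial>lborel) = ennreal pi * (\<integral>\<^sup>+u\<in>{0..<1}. k u \<partial>lborel)"
proof -
 define M where "M = distr (density lborel (indicator (ball (0::complex) 1))) borel (\<lambda>z. (norm z)\<^sup>2)"
 define N where "N = density lborel (\<lambda>u::real. ennreal pi * indicator {0..<1} u)"
 have emM: "emeasure M {x<..} = emeasure lborel (ball (0::complex) 1 \<inter> {z. x < (norm z)\<^sup>2})" for x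
 proof -
  have "emeasure M {x<..} = (\<integral>\<^sup>+z. indicator (ball 0 1) z * indicator {z. x < (norm z)\<^sup>2} z \<partial>(lborel :: complex measure))"
   unfolding M_def by (subst emeasure_distr, measurable, subst emeasure_density) (auto simp: vimage_def)
  also have "\<dots> = (\<integral>\<^sup>+z. indicator (ball (0::complex) 1 \<inter> {z. x < (norm z)\<^sup>2}) z \<partial>lborel)"
   by (intro nn_integral_cong) (auto simp: indicator_def)
  also have "\<dots> = emeasure lborel (ball (0::complex) 1 \<inter> {z. x < (norm z)\<^sup>2})"
   by (rule nn_integral_indicator) measurable
  finally show ?thesis .
 qed
 have emN: "emeasure N {x<..} = ennreal pi * emeasure lborel ({0..<1} \<inter> {x<..})" for x
 proof -
  have "emeasure N {x<..} = (\<integral>\<^sup>+u\<in>({0..<1} \<inter> {x<..}). ennreal pi \<partial>lborel)"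
   unfolding N_def by (subst emeasure_density) (auto intro!: nn_integral_cong simp: indicator_def)
  also have "\<dots> = ennreal pi * emeasure lborel ({0..<1} \<inter> {x<..})"
   by (rule nn_integral_cmult_indicator) simp
  finally show ?thesis .
 qed
 have "M = N"
 proof (rule measure_eqI_lessThan)
  fix x :: real
  show "emeasure M {x <..} < \<infinity>"
  proof -
   have "emeasure M {x <..} \<le> emeasure lborel (ball (0::complex) 1)"
    unfolding emM by (rule emeasure_mono) auto
   then show ?thesis by (auto simp: emeasure_disc(1) intro: le_less_trans)
  qed
  consider "x < 0" | "0 \<le> x" "x < 1" | "1 \<le> x" by linarith
  then show "emeasure M {x <..} = emeasure N {x <..}"
  proof cases
   case 1
   then have "x < (norm z)\<^sup>2" for z :: complex using zero_le_power2[of "norm z"] by linarith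
   then have "ball (0::complex) 1 \<inter> {z. x < (norm z)\<^sup>2} = ball 0 1" by auto
   moreover have "{0..<1} \<inter> {x<..} = {0..<1::real}" using 1 by auto
   ultimately
   show ?thesis unfolding emM emN by (simp add: emeasure_disc)
  next
   case 2
   have sq: "x < (norm z)\<^sup>2 \<longleftrightarrow> sqrt x < norm z" for z :: complex
    by (metis real_sqrt_less_iff real_sqrt_abs abs_norm_cancel)
   have "ball (0::complex) 1 \<inter> {z. x < (norm z)\<^sup>2} = ball 0 1 - cball 0 (sqrt x)"
    unfolding sq by (rule set_eqI) (simp only: Int_iff Diff_iff mem_ball mem_cball dist_0_norm mem_Collect_eq not_le)
   moreover have "emeasure lborel (ball (0::complex) 1 - cball 0 (sqrt x)) = ennreal (pi * 1\<^sup>2) - ennreal (pi * (sqrt x)\<^sup>2)"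
   proof (subst emeasure_Diff)
    have "sqrt x < 1" using 2 by simp
    then show "cball 0 (sqrt x) \<subseteq> ball (0::complex) 1" by (simp add: cball_subset_ball_iff)
   qed (use 2 in \<open>auto simp: emeasure_disc\<close>)
   moreover have "{0..<1} \<inter> {x<..} = {x<..<1}" using 2 by auto
   ultimately show ?thesis unfolding emM emN using 2
    by (simp add: ennreal_minus ennreal_mult[symmetric] algebra_simps)
  next
   case 3
   then have "ball (0::complex) 1 \<inter> {z. x < (norm z)\<^sup>2} = {}" "{0..<1} \<inter> {x<..} = {}"
    using power_le_one[of "norm z" 2 for z :: complex] by (auto simp: not_less) (smt (verit) norm_ge_zero power_le_one)
   then show ?thesis unfolding emM emN by (simp only: emeasure_empty mult_zero_right)
  qed
 qed (auto simp: M_def N_def)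
 have "(\<integral>\<^sup>+z. k ((norm z)\<^sup>2) * indicator (ball (0::complex) 1) z \<partial>lborel) = (\<integral>\<^sup>+u. k u \<partial>M)"
  unfolding M_def by (subst nn_integral_distr, measurable, subst nn_integral_density) (auto simp: mult.commute)
 also have "\<dots> = (\<integral>\<^sup>+u. ennreal pi * (k u * indicator {0..<1} u) \<partial>lborel)"
  unfolding \<open>M = N\<close> N_def by (subst nn_integral_density) (auto intro!: nn_integral_cong simp: mult_ac)
 also have "\<dots> = ennreal pi * (\<integral>\<^sup>+u\<in>{0..<1}. k u \<partial>lborel)"
  by (rule nn_integral_cmult) measurable
 finally show ?thesis .
qed

text \<open>Averaging F over rotations does not change its integral and produces a radial function, to which
the area formula for discs applies. The variable u stands for the square of the radius, which
removes the Jacobian and matches the weight (1 - |z|^2)^\<beta>.\<close>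

lemma nn_integral_disc_polar:
 fixes F :: "complex \<Rightarrow> ennreal"
 assumes F[measurable]: "F \<in> borel_measurable borel"
 shows "(\<integral>\<^sup>+z\<in>(ball 0 1). F z \<partial>lborel) =
  ennreal (1/2) * (\<integral>\<^sup>+u\<in>{0..<1}. \<integral>\<^sup>+\<theta>\<in>{0..<2*pi}. F (of_real (sqrt u) * cis \<theta>) \<partial>lborel \<partial>lborel)"
proof -
 define G where "G = (\<lambda>z. F z * indicator (ball 0 1) z)"
 have [measurable]: "G \<in> borel_measurable borel" unfolding G_def by measurable
 define k where "k = (\<lambda>u. \<integral>\<^sup>+\<theta>. F (of_real (sqrt u) * cis \<theta>) * indicator {0..<2*pi} \<theta> \<partial>lborel)"
 have [measurable]: "k \<in> borel_measurable borel" unfolding k_def by measurable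
 have radial: "(\<integral>\<^sup>+\<theta>\<in>{0..<2*pi}. G (cis \<theta> * z) \<partial>lborel) = k ((norm z)\<^sup>2) * indicator (ball 0 1) z" for z
 proof -
  define \<phi> where "\<phi> = Arg2pi z"
  have \<phi>: "0 \<le> \<phi>" "\<phi> \<le> 2 * pi" "z = of_real (norm z) * cis \<phi>"
   using Arg2pi[of z] by (auto simp: is_Arg_def cis_conv_exp \<phi>_def)
  have eq: "cis \<theta> * z = of_real (norm z) * cis (\<phi> + \<theta>)" for \<theta>
  proof -
   have "cis \<theta> * z = cis \<theta> * (of_real (norm z) * cis \<phi>)" using \<phi>(3) by (rule arg_cong)
   also have "\<dots> = of_real (norm z) * (cis \<phi> * cis \<theta>)" by (simp only: mult_ac)
   finally show ?thesis by (simp only: cis_mult)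
  qed
  have "(\<integral>\<^sup>+\<theta>\<in>{0..<2*pi}. G (cis \<theta> * z) \<partial>lborel) =
    (\<integral>\<^sup>+\<theta>\<in>{0..<2*pi}. (\<lambda>w. G (of_real (norm z) * w)) (cis (\<phi> + \<theta>)) \<partial>lborel)"
   by (simp only: eq)
  also have "\<dots> = (\<integral>\<^sup>+\<theta>\<in>{0..<2*pi}. G (of_real (norm z) * cis \<theta>) \<partial>lborel)"
   by (rule nn_integral_cis_shift[OF _ \<phi>(1,2)]) measurable
  also have "\<dots> = k ((norm z)\<^sup>2) * indicator (ball 0 1) z"
   by (auto simp: G_def k_def indicator_def norm_mult)
  finally show ?thesis .
 qed
 have const: "ennreal (2 * pi) * X = (\<integral>\<^sup>+\<theta>\<in>{0..<2*pi}. X \<partial>lborel)" for X :: ennreal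
  by (subst nn_integral_cmult_indicator) (simp_all add: mult.commute)
 have "ennreal (2 * pi) * (\<integral>\<^sup>+z. G z \<partial>lborel) = (\<integral>\<^sup>+\<theta>\<in>{0..<2*pi}. \<integral>\<^sup>+z. G z \<partial>lborel \<partial>lborel)"
  by (rule const)
 also have "\<dots> = (\<integral>\<^sup>+\<theta>. \<integral>\<^sup>+z. G (cis \<theta> * z) * indicator {0..<2*pi} \<theta> \<partial>lborel \<partial>lborel)"
 proof (rule nn_integral_cong_AE, rule AE_mp[OF AE_lborel_singleton[of pi]], rule AE_I2, rule impI)
  \<comment> \<open>Rotation by pi, where the shears degenerate, is a null set of angles.\<close>
  fix \<theta> :: real assume "\<theta> \<noteq> pi"
  show "(\<integral>\<^sup>+z. G z \<partial>lborel) * indicator {0..<2*pi} \<theta> = (\<integral>\<^sup>+z. G (cis \<theta> * z) * indicator {0..<2*pi} \<theta> \<partial>lborel)"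
  proof (cases "\<theta> \<in> {0..<2*pi}")
   case True
   have "cos (\<theta> / 2) \<noteq> 0"
   proof
    assume "cos (\<theta> / 2) = 0"
    then have "\<theta> / 2 = pi / 2" using True by (rule_tac cos_inj_pi) auto
    with \<open>\<theta> \<noteq> pi\<close> show False by simp
   qed
   then show ?thesis using nn_integral_rotate[of G \<theta>] True by simp
  qed simp
 qed
 also have "\<dots> = (\<integral>\<^sup>+z. \<integral>\<^sup>+\<theta>. G (cis \<theta> * z) * indicator {0..<2*pi} \<theta> \<partial>lborel \<partial>lborel)"
  by (rule lborel_pair.Fubini') measurable
 also have "\<dots> = ennreal pi * (\<integral>\<^sup>+u\<in>{0..<1}. k u \<partial>lborel)"
  unfolding radial by (rule nn_integral_disc_radial) measurable
 also have "ennreal pi = ennreal (2 * pi) * ennreal (1/2)" by (subst ennreal_mult[symmetric]) simp_all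
 finally have "ennreal (2 * pi) * (\<integral>\<^sup>+z. G z \<partial>lborel) = ennreal (2 * pi) * (ennreal (1/2) * (\<integral>\<^sup>+u\<in>{0..<1}. k u \<partial>lborel))"
  by (simp add: mult.assoc)
 then show ?thesis
  by (subst (asm) ennreal_mult_cancel_left) (auto simp: G_def k_def)
qed

section \<open>A Jensen inequality and a Tauberian theorem\<close>

lemma powr_tangent_le:
 fixes q c x :: real
 assumes "1 < q" "0 < c" "0 \<le> x"
 shows "q * c powr (q - 1) * x \<le> x powr q + (q - 1) * c powr q"
proof -
 define q' where "q' = q / (q - 1)"
 have q': "1 < q'" "1 / q + 1 / q' = 1" "(q - 1) * q' = q" using assms by (auto simp: q'_def field_simps)
 have "x * c powr (q - 1) \<le> x powr q / q + (c powr (q - 1)) powr q' / q'"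
  by (rule Youngs_inequality) (use assms q' in auto)
 also have "(c powr (q - 1)) powr q' = c powr q" by (simp add: powr_powr q')
 finally have "q * (x * c powr (q - 1)) \<le> q * (x powr q / q + c powr q / q')"
  using assms by (intro mult_left_mono) auto
 also have "\<dots> = x powr q + (q - 1) * c powr q" using assms by (simp add: q'_def field_simps)
 finally show ?thesis by (simp add: mult_ac)
qed

text \<open>The tangent inequality at c = I / J is integrated against w. The total mass of w enters through
J, and the right-hand side may be infinite.\<close>

lemma jensen_powr_nn_integral:
 fixes F w :: "'a \<Rightarrow> real"
 assumes q: "1 < q" and J: "0 < J" and I: "0 \<le> I"
  and [measurable]: "F \<in> borel_measurable M" "w \<in> borel_measurable M"
  and nn: "\<And>x. x \<in> space M \<Longrightarrow> 0 \<le> F x" "\<And>x. x \<in> space M \<Longrightarrow> 0 \<le> w x"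
  and wJ: "(\<integral>\<^sup>+x. ennreal (w x) \<partial>M) \<le> ennreal J"
  and FI: "(\<integral>\<^sup>+x. ennreal (F x * w x) \<partial>M) = ennreal I"
 shows "ennreal (I powr q) \<le> ennreal (J powr (q - 1)) * (\<integral>\<^sup>+x. ennreal (F x powr q * w x) \<partial>M)"
proof (cases "I = 0")
 case False
 with I have I: "0 < I" by simp
 define c where "c = I / J"
 have c: "0 < c" using I J by (simp add: c_def)
 define A where "A = (\<integral>\<^sup>+x. ennreal (F x powr q * w x) \<partial>M)"
 have "ennreal (q * c powr (q - 1)) * ennreal I = (\<integral>\<^sup>+x. ennreal (q * c powr (q - 1)) * ennreal (F x * w x) \<partial>M)"
  unfolding FI[symmetric] by (rule nn_integral_cmult[symmetric]) measurable
 also have "\<dots> \<le> (\<integral>\<^sup>+x. ennreal (F x powr q * w x) + ennreal ((q - 1) * c powr q) * ennreal (w x) \<partial>M)"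
 proof (rule nn_integral_mono)
  fix x assume x: "x \<in> space M"
  have "q * c powr (q - 1) * F x * w x \<le> (F x powr q + (q - 1) * c powr q) * w x"
   using powr_tangent_le[OF q c nn(1)[OF x]] nn(2)[OF x] by (rule mult_right_mono)
  then have "ennreal (q * c powr (q - 1) * (F x * w x)) \<le> ennreal (F x powr q * w x + (q - 1) * c powr q * w x)"
   by (intro ennreal_leI) (simp add: algebra_simps)
  then show "ennreal (q * c powr (q - 1)) * ennreal (F x * w x) \<le> ennreal (F x powr q * w x) + ennreal ((q - 1) * c powr q) * ennreal (w x)"
   using nn[OF x] q by (simp add: ennreal_mult ennreal_plus)
 qed
 also have "\<dots> = A + ennreal ((q - 1) * c powr q) * (\<integral>\<^sup>+x. ennreal (w x) \<partial>M)"
  unfolding A_def by (subst nn_integral_add) (auto simp: nn_integral_cmult)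
 also have "\<dots> \<le> A + ennreal ((q - 1) * c powr q) * ennreal J"
  by (intro add_left_mono mult_left_mono wJ) simp
 finally have *: "ennreal (q * c powr (q - 1)) * ennreal I \<le> A + ennreal ((q - 1) * c powr q) * ennreal J" .
 show ?thesis
 proof (cases "A = top")
  case True
  then show ?thesis using J by (simp add: A_def[symmetric] ennreal_mult_top)
 next
  case False
  then obtain B where B: "A = ennreal B" "0 \<le> B" by (cases A) auto
  have "ennreal (q * c powr (q - 1) * I) \<le> ennreal (B + (q - 1) * c powr q * J)"
   using * B q I J by (simp add: ennreal_mult ennreal_plus)
  then have 1: "q * c powr (q - 1) * I \<le> B + (q - 1) * c powr q * J"
   using B q J by (subst (asm) ennreal_le_iff) auto
  have 2: "c powr q * J = c powr (q - 1) * I"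
  proof -
   have "c powr q = c powr (q - 1) * c" using c by (simp add: powr_mult_base[symmetric] mult.commute powr_diff)
   then show ?thesis using J by (simp add: c_def)
  qed
  have "q * (c powr (q - 1) * I) \<le> B + (q - 1) * (c powr (q - 1) * I)" using 1 2 by (simp add: mult.assoc)
  then have 3: "c powr (q - 1) * I \<le> B" by (simp add: algebra_simps)
  have "I powr q = J powr (q - 1) * (c powr (q - 1) * I)"
   using I J by (simp add: c_def powr_divide powr_diff)
  also have "\<dots> \<le> J powr (q - 1) * B" using 3 by (intro mult_left_mono) auto
  finally show ?thesis using B by (simp add: A_def[symmetric] ennreal_mult[symmetric] ennreal_leI)
 qed
qed (use q in auto)

text \<open>The classical comparison of the N-th partial sum with the Abel mean at r = 1 - 1/(N + 1): the
difference of the initial parts is bounded by a Cesaro mean of k |u_k|, and the remainder is at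
most sup k |u_k| over k > N.\<close>

lemma tauber:
 fixes u :: "nat \<Rightarrow> complex"
 assumes small: "(\<lambda>k. real k * norm (u k)) \<longlonglongrightarrow> 0"
  and lim: "((\<lambda>r. \<Sum>k. u k * of_real (r ^ k)) \<longlongrightarrow> L) (at_left 1)"
 shows "u sums L"
proof -
 define v where "v = (\<lambda>k. real k * norm (u k))"
 have v0: "0 \<le> v k" for k by (simp add: v_def)
 obtain B where B: "\<And>k. v k \<le> B"
  using convergent_imp_Bseq[of v] small unfolding v_def[symmetric]
  by (metis Bseq_def convergentI norm_conv_dist abs_le_D1 real_norm_def)
 define N' where "N' = (\<lambda>N. 1 - 1 / real (Suc N))"
 have N'1: "0 \<le> N' N" "N' N < 1" for N by (auto simp: N'_def field_simps)
 have N'lim: "filterlim N' (at_left 1) sequentially"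
 proof -
  have "N' \<longlonglongrightarrow> 1 - 0" unfolding N'_def by (intro tendsto_intros LIMSEQ_Suc lim_1_over_n)
  then have "N' \<longlonglongrightarrow> 1" by (simp only: diff_zero)
  then show ?thesis by (rule tendsto_imp_filterlim_at_left) (simp only: N'1 eventually_True)
 qed
 have summ: "summable (\<lambda>k. norm (u k) * r ^ k)" if "0 \<le> r" "r < 1" for r
 proof (rule summable_comparison_test'[where N = 1 and g = "\<lambda>k. B * r ^ k"])
  show "summable (\<lambda>k. B * r ^ k)" using that by (intro summable_mult summable_geometric) auto
  fix n :: nat assume "1 \<le> n"
  then have "norm (u n) * 1 \<le> norm (u n) * real n" by (intro mult_left_mono) auto
  also have "\<dots> \<le> B" using B[of n] by (simp add: v_def mult.commute)
  finally show "norm (norm (u n) * r ^ n) \<le> B * r ^ n" using that by (simp add: mult_right_mono)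
 qed
 have "(\<lambda>N. (\<Sum>k<Suc N. u k) - (\<Sum>k. u k * of_real (N' N ^ k))) \<longlonglongrightarrow> 0"
 proof (rule LIMSEQ_I)
  fix e :: real assume e: "0 < e"
  obtain K where K: "\<And>k. K \<le> k \<Longrightarrow> v k < e / 4"
   using LIMSEQ_D[OF small, of "e/4"] e by (auto simp: v_def)
  define S where "S = (\<Sum>k<K. v k)"
  have S0: "0 \<le> S" unfolding S_def using v0 by (intro sum_nonneg) auto
  obtain M where M: "S / (e / 4) < real M" using reals_Archimedean2 by blast
  show "\<exists>no. \<forall>N\<ge>no. norm ((\<Sum>k<Suc N. u k) - (\<Sum>k. u k * of_real (N' N ^ k)) - 0) < e"
  proof (intro exI[of _ "max K M"] allI impI)
   fix N assume N: "max K M \<le> N"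
   let ?r = "N' N" let ?n = "real (Suc N)"
   have sm: "summable (\<lambda>k. u k * of_real (?r ^ k))"
    using summ[OF N'1, of N] N'1[of N] by (intro summable_norm_cancel[of "\<lambda>k. u k * of_real (?r ^ k)"]) (simp add: norm_mult norm_power)
   have "(\<Sum>k<Suc N. u k) - (\<Sum>k. u k * of_real (?r ^ k)) = (\<Sum>k<Suc N. u k * of_real (1 - ?r ^ k)) - (\<Sum>k. u (k + Suc N) * of_real (?r ^ (k + Suc N)))"
    by (subst suminf_split_initial_segment[OF sm, of "Suc N"]) (simp add: sum_subtractf algebra_simps)
   also have "norm \<dots> \<le> norm (\<Sum>k<Suc N. u k * of_real (1 - ?r ^ k)) + norm (\<Sum>k. u (k + Suc N) * of_real (?r ^ (k + Suc N)))"
    by (rule norm_triangle_ineq4)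
   also have "norm (\<Sum>k<Suc N. u k * of_real (1 - ?r ^ k)) \<le> (S + e / 4 * ?n) / ?n"
   proof -
    have "norm (\<Sum>k<Suc N. u k * of_real (1 - ?r ^ k)) \<le> (\<Sum>k<Suc N. v k / ?n)"
    proof (rule sum_norm_le)
     fix k
     have "1 + real k * (?r - 1) \<le> (1 + (?r - 1)) ^ k" by (rule Bernoulli_inequality) (use N'1[of N] in auto)
     then have "1 - ?r ^ k \<le> real k / ?n" by (simp add: N'_def)
     moreover have "?r ^ k \<le> 1" using N'1[of N] by (intro power_le_one) auto
     ultimately have "norm (u k) * \<bar>1 - ?r ^ k\<bar> \<le> norm (u k) * (real k / ?n)" by (intro mult_left_mono) auto
     then show "norm (u k * of_real (1 - ?r ^ k)) \<le> v k / ?n"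
      by (simp add: norm_mult v_def mult.commute del: of_real_diff of_real_power)
    qed
    also have "\<dots> = (\<Sum>k<Suc N. v k) / ?n" by (simp only: sum_divide_distrib)
    also have "(\<Sum>k<Suc N. v k) \<le> S + e / 4 * ?n"
    proof -
     have "(\<Sum>k<Suc N. v k) \<le> (\<Sum>k<Suc N. (if k < K then v k else 0) + e / 4)"
      using K v0 e by (intro sum_mono) (auto simp: not_less less_imp_le)
     also have "\<dots> = (\<Sum>k<Suc N. if k < K then v k else 0) + e / 4 * ?n"
      by (simp add: sum.distrib del: sum.lessThan_Suc)
     also have "(\<Sum>k<Suc N. if k < K then v k else 0) = S"
      unfolding S_def using N by (intro sum.mono_neutral_cong_right) auto
     finally show ?thesis by simp
    qed
    finally show ?thesis by (simp add: divide_right_mono)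
   qed
   also have "norm (\<Sum>k. u (k + Suc N) * of_real (?r ^ (k + Suc N))) \<le> e / 4"
   proof -
    have g: "(\<lambda>k. e / 4 / ?n * ?r ^ k) sums (e / 4 / ?n * (1 / (1 - ?r)))"
     using N'1[of N] by (intro sums_mult geometric_sums) auto
    have "norm (\<Sum>k. u (k + Suc N) * of_real (?r ^ (k + Suc N))) \<le> (\<Sum>k. e / 4 / ?n * ?r ^ k)"
    proof (rule norm_suminf_le)
     fix k
     have "norm (u (k + Suc N)) * ?n \<le> norm (u (k + Suc N)) * real (k + Suc N)" by (intro mult_left_mono) auto
     also have "\<dots> \<le> e / 4" using K[of "k + Suc N"] N by (simp add: v_def mult.commute)
     finally have 1: "norm (u (k + Suc N)) \<le> e / 4 / ?n" by (simp add: field_simps)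
     have "?r ^ (k + Suc N) \<le> ?r ^ k" using N'1[of N] by (intro power_decreasing) auto
     moreover have "norm (u (k + Suc N) * of_real (?r ^ (k + Suc N))) = norm (u (k + Suc N)) * ?r ^ (k + Suc N)"
      using N'1[of N] by (simp only: norm_mult norm_of_real abs_of_nonneg zero_le_power)
     moreover have "norm (u (k + Suc N)) * ?r ^ (k + Suc N) \<le> e / 4 / ?n * ?r ^ k" if "?r ^ (k + Suc N) \<le> ?r ^ k"
      using 1 that by (rule mult_mono) (use e N'1[of N] in \<open>simp_all del: power_Suc\<close>)
     ultimately show "norm (u (k + Suc N) * of_real (?r ^ (k + Suc N))) \<le> e / 4 / ?n * ?r ^ k"
      by (simp only:)
    qed (use g in \<open>simp add: sums_iff\<close>)
    also have "\<dots> = e / 4 / ?n * (1 / (1 - ?r))" using g by (simp add: sums_iff)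
    also have "1 / (1 - ?r) = ?n" by (simp add: N'_def)
    also have "e / 4 / ?n * ?n = e / 4" by (rule nonzero_eq_divide_eq[THEN iffD1, OF _ refl]) simp
    finally show ?thesis .
   qed
   also have "(S + e / 4 * ?n) / ?n + e / 4 < e"
   proof -
    have "S < e / 4 * real M" using M e by (simp add: field_simps)
    also have "\<dots> \<le> e / 4 * ?n" using N e by (intro mult_left_mono) auto
    finally have "S + e / 4 * ?n < e / 2 * ?n" by (simp add: field_simps)
    then have "(S + e / 4 * ?n) / ?n < e / 2" by (subst pos_divide_less_eq) auto
    then show ?thesis using e by linarith
   qed
   finally show "norm ((\<Sum>k<Suc N. u k) - (\<Sum>k. u k * of_real (?r ^ k)) - 0) < e" by simp
  qed
 qed
 moreover have "(\<lambda>N. \<Sum>k. u k * of_real (N' N ^ k)) \<longlonglongrightarrow> L"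
  by (rule filterlim_compose[OF lim N'lim])
 ultimately have "(\<lambda>N. \<Sum>k<Suc N. u k) \<longlonglongrightarrow> 0 + L"
  by (drule_tac tendsto_add) auto
 then show ?thesis unfolding sums_def by (intro LIMSEQ_imp_Suc[of "\<lambda>N. sum u {..<N}"]) simp
qed

section \<open>Parseval's identity on a circle\<close>

lemma has_integral_cis:
 "((\<lambda>\<theta>. cis (of_int m * \<theta>)) has_integral (if m = 0 then 2 * of_real pi else 0)) {0..2*pi}"
proof (cases "m = 0")
 case True
 have "((\<lambda>\<theta>::real. 1::complex) has_integral (measure lborel {0..2*pi} *\<^sub>R 1)) {0..2*pi}"
  by (rule has_integral_const_real)
 then show ?thesis using True by (simp add: scaleR_conv_of_real)
next
 case False
 have "((\<lambda>\<theta>. cis (of_int m * \<theta>)) has_integral (cis (of_int m * (2*pi)) / (\<i> * of_int m) - cis (of_int m * 0) / (\<i> * of_int m))) {0..2*pi}"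
 proof (rule fundamental_theorem_of_calculus)
  fix x :: real
  have "((\<lambda>\<theta>. exp (\<i> * of_int m * of_real \<theta>) / (\<i> * of_int m)) has_vector_derivative exp (\<i> * of_int m * of_real x)) (at x within {0..2*pi})"
   using False by (auto intro!: derivative_eq_intros has_vector_derivative_real_field)
  then show "((\<lambda>\<theta>. cis (of_int m * \<theta>) / (\<i> * of_int m)) has_vector_derivative cis (of_int m * x)) (at x within {0..2*pi})"
   by (simp add: cis_conv_exp mult_ac)
 qed auto
 moreover have "cis (of_int m * (2*pi)) = 1"
  using cis_multiple_2pi[of "of_int m"] by (simp add: mult_ac)
 ultimately show ?thesis using False by simp
qed

text \<open>Only absolutely convergent series are needed, so the partial sums converge uniformly and the
identity follows from orthogonality.\<close>

lemma parseval_circle: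
 fixes d :: "nat \<Rightarrow> complex"
 assumes "summable (\<lambda>k. norm (d k))"
 shows "(\<lambda>k. (norm (d k))\<^sup>2) sums (1 / (2 * pi) * integral {0..2*pi} (\<lambda>\<theta>. (norm (\<Sum>k. d k * cis (real k * \<theta>)))\<^sup>2))"
proof -
 define S where "S = (\<lambda>N \<theta>. \<Sum>k<N. d k * cis (real k * \<theta>))"
 define h where "h = (\<lambda>\<theta>. \<Sum>k. d k * cis (real k * \<theta>))"
 have cont: "continuous_on A (S N)" for N A unfolding S_def by (intro continuous_intros)
 have lim: "uniform_limit (cbox 0 (2*pi)) S h sequentially"
  unfolding S_def h_def by (rule Weierstrass_m_test[OF _ assms]) (simp add: norm_mult)
 have ch: "continuous_on (cbox 0 (2*pi)) h"
  by (rule uniform_limit_theorem[OF _ lim]) (auto intro!: always_eventually cont)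
 have lim2: "uniform_limit (cbox 0 (2*pi)) (\<lambda>N \<theta>. (norm (S N \<theta>))\<^sup>2) (\<lambda>\<theta>. (norm (h \<theta>))\<^sup>2) sequentially"
 proof -
  have b: "bounded (h ` cbox 0 (2*pi))" by (intro compact_imp_bounded compact_continuous_image ch compact_cbox)
  have "uniform_limit (cbox 0 (2*pi)) (\<lambda>N \<theta>. norm (S N \<theta>) * norm (S N \<theta>)) (\<lambda>\<theta>. norm (h \<theta>) * norm (h \<theta>)) sequentially"
   using b by (intro uniform_lim_mult uniform_limit_intros lim) (auto simp: bounded_iff)
  then show ?thesis by (simp add: power2_eq_square)
 qed
 have "(\<lambda>N. integral {0..2*pi} (\<lambda>\<theta>. (norm (S N \<theta>))\<^sup>2)) \<longlonglongrightarrow> integral {0..2*pi} (\<lambda>\<theta>. (norm (h \<theta>))\<^sup>2)"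
 proof -
  obtain I J where IJ: "\<And>N. ((\<lambda>\<theta>. (norm (S N \<theta>))\<^sup>2) has_integral I N) (cbox 0 (2*pi))"
   "((\<lambda>\<theta>. (norm (h \<theta>))\<^sup>2) has_integral J) (cbox 0 (2*pi))" "I \<longlonglongrightarrow> J"
   by (rule uniform_limit_integral_cbox[OF lim2]) (auto intro!: continuous_intros cont)
  show ?thesis using IJ(3) unfolding integral_unique[OF IJ(1), unfolded cbox_interval] integral_unique[OF IJ(2), unfolded cbox_interval] .
 qed
 moreover have "integral {0..2*pi} (\<lambda>\<theta>. (norm (S N \<theta>))\<^sup>2) = 2 * pi * (\<Sum>k<N. (norm (d k))\<^sup>2)" for N
 proof -
  have "((\<lambda>\<theta>. \<Sum>k<N. \<Sum>j<N. d k * cnj (d j) * cis (of_int (int k - int j) * \<theta>)) has_integral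
   (\<Sum>k<N. \<Sum>j<N. d k * cnj (d j) * (if int k - int j = 0 then 2 * of_real pi else 0))) {0..2*pi}"
   by (intro has_integral_sum has_integral_mult_right has_integral_cis) auto
  also have "(\<lambda>\<theta>. \<Sum>k<N. \<Sum>j<N. d k * cnj (d j) * cis (of_int (int k - int j) * \<theta>)) = (\<lambda>\<theta>. of_real ((norm (S N \<theta>))\<^sup>2))"
  proof
   fix \<theta>
   have "complex_of_real ((norm (S N \<theta>))\<^sup>2) = S N \<theta> * cnj (S N \<theta>)" by (simp only: complex_norm_square)
   also have "\<dots> = (\<Sum>k<N. \<Sum>j<N. d k * cis (real k * \<theta>) * (cnj (d j) * cis (- (real j * \<theta>))))"
    by (simp add: S_def cnj_sum sum_product cis_cnj)
   also have "\<dots> = (\<Sum>k<N. \<Sum>j<N. d k * cnj (d j) * cis (of_int (int k - int j) * \<theta>))"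
    by (intro sum.cong refl) (simp add: cis_mult left_diff_distrib right_diff_distrib mult_ac)
   finally show "(\<Sum>k<N. \<Sum>j<N. d k * cnj (d j) * cis (of_int (int k - int j) * \<theta>)) = complex_of_real ((norm (S N \<theta>))\<^sup>2)" by simp
  qed
  also have "(\<Sum>k<N. \<Sum>j<N. d k * cnj (d j) * (if int k - int j = 0 then 2 * of_real pi else 0)) = complex_of_real (2 * pi * (\<Sum>k<N. (norm (d k))\<^sup>2))"
  proof -
   have "(\<Sum>j<N. d k * cnj (d j) * (if int k - int j = 0 then 2 * of_real pi else 0)) = complex_of_real (2 * pi * (norm (d k))\<^sup>2)" if "k < N" for k
   proof -
    have "(\<Sum>j<N. d k * cnj (d j) * (if int k - int j = 0 then 2 * of_real pi else 0)) = (\<Sum>j<N. if j = k then d k * cnj (d k) * (2 * of_real pi) else 0)"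
     by (intro sum.cong) auto
    also have "\<dots> = d k * cnj (d k) * (2 * of_real pi)" using that by simp
    also have "d k * cnj (d k) = of_real ((norm (d k))\<^sup>2)" by (simp only: complex_norm_square)
    finally show ?thesis by simp
   qed
   then show ?thesis by (simp add: sum_distrib_left)
  qed
  finally have "((\<lambda>\<theta>. complex_of_real ((norm (S N \<theta>))\<^sup>2)) has_integral complex_of_real (2 * pi * (\<Sum>k<N. (norm (d k))\<^sup>2))) {0..2*pi}" .
  from has_integral_linear[OF this bounded_linear_Re]
  have "((\<lambda>\<theta>. (norm (S N \<theta>))\<^sup>2) has_integral (2 * pi * (\<Sum>k<N. (norm (d k))\<^sup>2))) {0..2*pi}"
   by (simp only: o_def Re_complex_of_real)
  then show ?thesis by (simp add: integral_unique)
 qed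
 ultimately have "(\<lambda>N. 1 / (2 * pi) * (2 * pi * (\<Sum>k<N. (norm (d k))\<^sup>2))) \<longlonglongrightarrow> 1 / (2 * pi) * integral {0..2*pi} (\<lambda>\<theta>. (norm (h \<theta>))\<^sup>2)"
  by (intro tendsto_mult_left) simp
 then show ?thesis unfolding sums_def h_def by simp
qed

section \<open>Removing zeros by Blaschke factors\<close>

lemma blaschke_factor_bounds:
 fixes a z :: complex
 assumes "0 < R" "norm a < R"
 shows "norm z = R \<Longrightarrow> norm (of_real R * (z - a)) = norm (of_real (R\<^sup>2) - cnj a * z)"
  and "norm z \<le> R \<Longrightarrow> norm (of_real R * (z - a)) \<le> norm (of_real (R\<^sup>2) - cnj a * z)"
  and "norm z \<le> R \<Longrightarrow> of_real (R\<^sup>2) - cnj a * z \<noteq> 0"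
proof -
 have key: "(norm (of_real (R\<^sup>2) - cnj a * z))\<^sup>2 - (norm (of_real R * (z - a)))\<^sup>2 = (R\<^sup>2 - (norm z)\<^sup>2) * (R\<^sup>2 - (norm a)\<^sup>2)"
  unfolding cmod_power2 by (simp add: power2_eq_square algebra_simps)
 show "norm (of_real R * (z - a)) = norm (of_real (R\<^sup>2) - cnj a * z)" if "norm z = R"
  by (rule power2_eq_imp_eq) (use key that in simp_all)
 show "norm (of_real R * (z - a)) \<le> norm (of_real (R\<^sup>2) - cnj a * z)" if "norm z \<le> R"
 proof (rule power2_le_imp_le)
  have "norm a ^ 2 \<le> R ^ 2" using assms by (intro power_mono) auto
  moreover have "norm z ^ 2 \<le> R ^ 2" using that by (intro power_mono) auto
  ultimately have "0 \<le> (R\<^sup>2 - (norm z)\<^sup>2) * (R\<^sup>2 - (norm a)\<^sup>2)" by (intro mult_nonneg_nonneg) auto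
  then show "(norm (of_real R * (z - a)))\<^sup>2 \<le> (norm (of_real (R\<^sup>2) - cnj a * z))\<^sup>2" using key by linarith
 qed simp
 show "of_real (R\<^sup>2) - cnj a * z \<noteq> 0" if "norm z \<le> R"
 proof
  assume "of_real (R\<^sup>2) - cnj a * z = 0"
  then have "norm (cnj a * z) = R\<^sup>2" by (metis eq_iff_diff_eq_0 norm_of_real abs_power2)
  moreover have "norm a * norm z < R * R"
   by (rule le_less_trans[OF mult_left_mono[OF that] mult_strict_right_mono]) (use assms in auto)
  ultimately show False by (simp add: norm_mult power2_eq_square)
 qed
qed

text \<open>Dividing by the Blaschke factor R (z - a) / (R^2 - cnj a z) keeps the modulus on the circle and
increases it inside.\<close>

lemma divide_out_zero:
 assumes f: "f holomorphic_on ball 0 \<rho>" and R: "0 < R" "R < \<rho>" and a: "norm a < R" "f a = 0"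
  and nz: "\<And>z. norm z = R \<Longrightarrow> f z \<noteq> 0"
 obtains F where "F holomorphic_on ball 0 \<rho>" "\<And>z. norm z = R \<Longrightarrow> norm (F z) = norm (f z)"
  "\<And>z. norm z \<le> R \<Longrightarrow> norm (f z) \<le> norm (F z)" "\<And>z. norm z \<le> R \<Longrightarrow> F z = 0 \<longleftrightarrow> f z = 0 \<and> z \<noteq> a"
proof -
 have nc: "\<not> f constant_on ball 0 \<rho>"
 proof
  assume "f constant_on ball 0 \<rho>"
  moreover have "a \<in> ball 0 \<rho>" "of_real R \<in> ball (0::complex) \<rho>" using a R by auto
  ultimately have "f a = f (of_real R)" unfolding constant_on_def by metis
  then show False using a(2) nz[of "of_real R"] R by simp
 qed
 have a\<rho>: "a \<in> ball 0 \<rho>" using a R by simp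
 obtain g r n where g: "0 < n" "0 < r" "ball a r \<subseteq> ball 0 \<rho>" "g holomorphic_on ball a r"
   "\<And>w. w \<in> ball a r \<Longrightarrow> f w = (w - a) ^ n * g w" "\<And>w. w \<in> ball a r \<Longrightarrow> g w \<noteq> 0"
  by (rule holomorphic_factor_zero_nonconstant[OF f open_ball connected_ball a\<rho> a(2) nc]) (rule that)
 define q where "q = (\<lambda>z. (of_real (R\<^sup>2) - cnj a * z) / of_real R)"
 have qhol: "q holomorphic_on A" for A unfolding q_def using R by (intro holomorphic_intros) auto
 \<comment> \<open>All n zeros at a are divided out at once.\<close>
 define F where "F = (\<lambda>z. if z = a then g a * q a ^ n else f z * (q z / (z - a)) ^ n)"
 have Fr: "F z = g z * q z ^ n" if "z \<in> ball a r" for z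
  using g(5)[OF that] by (auto simp: F_def power_divide)
 have "F holomorphic_on (ball 0 \<rho> - {a}) \<union> ball a r"
 proof (rule holomorphic_on_Un)
  have "(\<lambda>z. f z * (q z / (z - a)) ^ n) holomorphic_on ball 0 \<rho> - {a}"
   by (intro holomorphic_intros qhol holomorphic_on_subset[OF f]) auto
  then show "F holomorphic_on ball 0 \<rho> - {a}" by (rule holomorphic_transform) (auto simp: F_def)
  have "(\<lambda>z. g z * q z ^ n) holomorphic_on ball a r" by (intro holomorphic_intros qhol g)
  then show "F holomorphic_on ball a r" by (rule holomorphic_transform) (simp add: Fr)
 qed auto
 moreover have "(ball 0 \<rho> - {a}) \<union> ball a r = ball 0 \<rho>" using g(2,3) by auto
 ultimately have Fhol: "F holomorphic_on ball 0 \<rho>" by simp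
 have qn: "norm (q z / (z - a)) = norm (of_real (R\<^sup>2) - cnj a * z) / norm (of_real R * (z - a))" for z
  by (simp add: q_def norm_divide norm_mult mult.commute)
 show ?thesis
 proof
  show "F holomorphic_on ball 0 \<rho>" by fact
  show "norm (F z) = norm (f z)" if z: "norm z = R" for z
  proof -
   have "z \<noteq> a" using a z by auto
   then have "0 < norm (of_real R * (z - a))" using R by (simp add: norm_mult)
   then have "norm (q z / (z - a)) = 1" unfolding qn blaschke_factor_bounds(1)[OF R(1) a(1) z, symmetric] by (rule divide_self[OF less_imp_neq[symmetric]])
   then show ?thesis using \<open>z \<noteq> a\<close> by (simp add: F_def norm_mult norm_power)
  qed
  show "norm (f z) \<le> norm (F z)" if z: "norm z \<le> R" for z
  proof (cases "z = a")
   case False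
   then have "0 < norm (of_real R * (z - a))" using R by (simp add: norm_mult)
   then have "1 \<le> norm (q z / (z - a))"
    unfolding qn using blaschke_factor_bounds(2)[OF R(1) a(1) z] by (simp only: le_divide_eq_1_pos)
   then have "norm (f z) * 1 \<le> norm (f z) * norm (q z / (z - a)) ^ n" by (intro mult_left_mono one_le_power) auto
   then show ?thesis using False by (simp add: F_def norm_mult norm_power)
  qed (use a in simp)
  show "F z = 0 \<longleftrightarrow> f z = 0 \<and> z \<noteq> a" if z: "norm z \<le> R" for z
  proof -
   have "q z \<noteq> 0" using blaschke_factor_bounds(3)[OF R(1) a(1) z] R by (simp add: q_def)
   then show ?thesis using g(2) g(6)[of a] by (auto simp: F_def)
  qed
 qed
qed

lemma divide_out_all_zeros:
 assumes "finite Z" "f holomorphic_on ball 0 \<rho>" "0 < R" "R < \<rho>" "{z \<in> cball 0 R. f z = 0} = Z"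
  "\<And>z. norm z = R \<Longrightarrow> f z \<noteq> 0"
 shows "\<exists>F. F holomorphic_on ball 0 \<rho> \<and> (\<forall>z. norm z = R \<longrightarrow> norm (F z) = norm (f z)) \<and>
  (\<forall>z. norm z \<le> R \<longrightarrow> norm (f z) \<le> norm (F z) \<and> F z \<noteq> 0)"
 using assms
proof (induction Z arbitrary: f rule: Finite_Set.finite_induct)
 case empty
 then show ?case by (intro exI[of _ f]) auto
next
 case (insert a Z)
 note P = insert.prems
 have "a \<in> {z \<in> cball 0 R. f z = 0}" using insert.prems(4) by auto
 then have a: "norm a < R" "f a = 0" using insert.prems(5)[of a] by (auto simp: less_le)
 obtain F where F: "F holomorphic_on ball 0 \<rho>" "\<And>z. norm z = R \<Longrightarrow> norm (F z) = norm (f z)"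
  "\<And>z. norm z \<le> R \<Longrightarrow> norm (f z) \<le> norm (F z)" "\<And>z. norm z \<le> R \<Longrightarrow> F z = 0 \<longleftrightarrow> f z = 0 \<and> z \<noteq> a"
  using divide_out_zero[OF insert.prems(1-3) a insert.prems(5)] by metis
 have "{z \<in> cball 0 R. F z = 0} = {z \<in> cball 0 R. f z = 0} - {a}" using F(4) by auto
 also have "\<dots> = Z" using insert.prems(4) insert.hyps by auto
 finally have Z: "{z \<in> cball 0 R. F z = 0} = Z" .
 have nz: "F z \<noteq> 0" if "norm z = R" for z using F(4)[of z] insert.prems(5)[OF that] that by auto
 obtain G where "G holomorphic_on ball 0 \<rho>" "\<And>z. norm z = R \<Longrightarrow> norm (G z) = norm (F z)"
   "\<And>z. norm z \<le> R \<Longrightarrow> norm (F z) \<le> norm (G z) \<and> G z \<noteq> 0"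
  using insert.IH[OF F(1) insert.prems(2,3) Z nz] by blast
 then show ?case using F(2,3) by (intro exI[of _ G]) (metis order_trans)
qed

text \<open>After removing the zeros, F = exp G near the closed disc and h = exp (p G / 2) is a holomorphic
function with |h|^2 = |F|^p. The numbers a k are the moduli of its coefficients, scaled to the
circle of radius R: the sum of their squares is the mean of |f|^p there by Parseval, and the
triangle inequality gives the majorant.\<close>

lemma power_series_majorant:
 fixes f :: "complex \<Rightarrow> complex"
 assumes f: "f holomorphic_on ball 0 1" and R: "0 < R" "R < 1" and p: "0 < p"
  and nz: "\<And>z. norm z = R \<Longrightarrow> f z \<noteq> 0"
 obtains a :: "nat \<Rightarrow> real" where "\<And>k. 0 \<le> a k" "summable a" "summable (\<lambda>k. (a k)\<^sup>2)"
  "(\<Sum>k. (a k)\<^sup>2) = 1 / (2 * pi) * integral {0..2*pi} (\<lambda>\<theta>. norm (f (of_real R * cis \<theta>)) powr p)"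
  "\<And>z. norm z \<le> R \<Longrightarrow> norm (f z) powr p \<le> (\<Sum>k. a k * (norm z / R) ^ k)\<^sup>2"
proof -
 have "finite {z \<in> cball 0 R. f z = 0}"
 proof (cases "f constant_on ball 0 1")
  case True
  then obtain c where c: "\<And>z. z \<in> ball 0 1 \<Longrightarrow> f z = c" unfolding constant_on_def by auto
  have "c \<noteq> 0" using nz[of "of_real R"] c[of "of_real R"] R by auto
  then have "{z \<in> cball 0 R. f z = 0} = {}" using c R by auto
  then show ?thesis by (simp only: finite.emptyI)
 next
  case False
  show ?thesis by (rule holomorphic_compact_finite_zeros[OF f _ _ _ _ False]) (use R in auto)
 qed
 then obtain F where F: "F holomorphic_on ball 0 1" "\<And>z. norm z = R \<Longrightarrow> norm (F z) = norm (f z)"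
  "\<And>z. norm z \<le> R \<Longrightarrow> norm (f z) \<le> norm (F z)" "\<And>z. norm z \<le> R \<Longrightarrow> F z \<noteq> 0"
  using divide_out_all_zeros[OF _ f R refl nz] by blast
 obtain \<rho> where \<rho>: "R < \<rho>" "\<rho> < 1" "\<And>z. z \<in> ball 0 \<rho> \<Longrightarrow> F z \<noteq> 0"
 proof -
  have "open {z \<in> ball 0 1. F z \<in> - {0}}"
   by (intro continuous_open_preimage[unfolded vimage_def Int_def mem_Collect_eq] holomorphic_on_imp_continuous_on F) auto
  moreover have "cball 0 R \<subseteq> {z \<in> ball 0 1. F z \<in> - {0}}" using F(4) R by auto
  ultimately obtain e where e: "0 < e" "(\<Union>y\<in>cball 0 R. ball y e) \<subseteq> {z \<in> ball 0 1. F z \<in> - {0}}"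
   using compact_subset_open_imp_ball_epsilon_subset[OF compact_cball] by metis
  define \<rho> where "\<rho> = R + min e (1 - R) / 2"
  show ?thesis
  proof
   show "R < \<rho>" "\<rho> < 1" using e R by (auto simp: \<rho>_def min_def field_simps)
   fix z :: complex assume z: "z \<in> ball 0 \<rho>"
   show "F z \<noteq> 0"
   proof (cases "norm z \<le> R")
    case False
    then have z0: "z \<noteq> 0" "norm z > R" using R by auto
    define y where "y = of_real (R / norm z) * z"
    have y: "norm y = R" using z0 R by (simp add: y_def norm_mult norm_divide)
    have "z - y = of_real (1 - R / norm z) * z" by (simp add: y_def algebra_simps)
    then have "norm (z - y) = \<bar>1 - R / norm z\<bar> * norm z" by (simp only: norm_mult norm_of_real)
    then have d: "norm (z - y) = norm z - R" using z0 R by (simp add: abs_of_nonneg left_diff_distrib)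
    have "norm z < R + min e (1 - R) / 2" using z by (simp add: \<rho>_def)
    moreover have "min e (1 - R) / 2 \<le> e / 2" by simp
    ultimately have "dist y z < e" unfolding dist_norm norm_minus_commute[of y z] d using e(1) by linarith
    then have "y \<in> cball 0 R" "z \<in> ball y e" using y by auto
    then have "z \<in> (\<Union>y\<in>cball 0 R. ball y e)" by blast
    from subsetD[OF e(2) this] show ?thesis by simp
   qed (use F(4) in auto)
  qed
 qed
 have Fhol: "F holomorphic_on ball 0 \<rho>" using F(1) \<rho> by (rule_tac holomorphic_on_subset) auto
 obtain G where G: "G holomorphic_on ball 0 \<rho>" "\<And>z. z \<in> ball 0 \<rho> \<Longrightarrow> exp (G z) = F z"
  by (rule holomorphic_logarithm_exists[OF convex_ball open_ball Fhol \<rho>(3), of 0]) (use \<rho> R in auto)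
 define h where "h = (\<lambda>z. exp (of_real (p/2) * G z))"
 have h: "h holomorphic_on ball 0 \<rho>" unfolding h_def by (intro holomorphic_intros G)
 have nh: "(norm (h z))\<^sup>2 = norm (F z) powr p" if "z \<in> ball 0 \<rho>" for z
 proof -
  have "norm (F z) = exp (Re (G z))" using G(2)[OF that] by (metis norm_exp_eq_Re)
  then show ?thesis by (simp add: h_def powr_def power2_eq_square exp_add[symmetric])
 qed
 define c where "c = (\<lambda>k. (deriv ^^ k) h 0 / fact k)"
 have hs: "(\<lambda>k. c k * z ^ k) sums h z" if "z \<in> ball 0 \<rho>" for z
  using holomorphic_power_series[OF h that] by (simp add: c_def)
 define a where "a = (\<lambda>k. norm (c k) * R ^ k)"
 have sa: "summable a"
 proof -
  have "summable (\<lambda>k. c k * of_real ((R + \<rho>)/2) ^ k)"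
   using hs[of "of_real ((R + \<rho>)/2)"] \<rho> R by (auto simp: sums_iff simp del: of_real_add of_real_divide)
  then have "summable (\<lambda>k. norm (c k * of_real R ^ k))"
   by (rule powser_insidea) (use \<rho> R in \<open>auto simp del: of_real_add of_real_divide\<close>)
  then show ?thesis using R by (simp add: a_def norm_mult norm_power)
 qed
 have a0: "0 \<le> a k" for k using R by (simp add: a_def)
 have cis_h: "(\<Sum>k. c k * of_real R ^ k * cis (real k * \<theta>)) = h (of_real R * cis \<theta>)" for \<theta>
 proof -
  have "(\<lambda>k. c k * (of_real R * cis \<theta>) ^ k) sums h (of_real R * cis \<theta>)"
   using \<rho> R by (intro hs) (simp add: norm_mult)
  moreover have "c k * of_real R ^ k * cis (real k * \<theta>) = c k * (of_real R * cis \<theta>) ^ k" for k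
   by (simp only: power_mult_distrib Complex.DeMoivre mult.assoc)
  ultimately show ?thesis by (simp only: sums_unique[symmetric])
 qed
 have "(\<lambda>k. (norm (c k * of_real R ^ k))\<^sup>2) sums (1 / (2 * pi) * integral {0..2*pi} (\<lambda>\<theta>. (norm (\<Sum>k. c k * of_real R ^ k * cis (real k * \<theta>)))\<^sup>2))"
  by (rule parseval_circle) (use sa R in \<open>simp add: a_def norm_mult norm_power\<close>)
 also have "(\<lambda>\<theta>. (norm (\<Sum>k. c k * of_real R ^ k * cis (real k * \<theta>)))\<^sup>2) = (\<lambda>\<theta>. norm (f (of_real R * cis \<theta>)) powr p)"
  unfolding cis_h using \<rho> R F(2) by (auto simp: nh norm_mult)
 finally have s2: "(\<lambda>k. (a k)\<^sup>2) sums (1 / (2 * pi) * integral {0..2*pi} (\<lambda>\<theta>. norm (f (of_real R * cis \<theta>)) powr p))"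
  using R by (simp add: a_def norm_mult norm_power)
 show ?thesis
 proof
  fix z :: complex assume z: "norm z \<le> R"
  then have zb: "z \<in> ball 0 \<rho>" using \<rho> by auto
  have eq: "norm (c k * z ^ k) = a k * (norm z / R) ^ k" for k
   using R by (simp add: a_def norm_mult norm_power power_divide)
  have "summable (\<lambda>k. a k * (norm z / R) ^ k)"
  proof (rule summable_comparison_test'[OF sa, where N = 0])
   fix n :: nat
   have "(norm z / R) ^ n \<le> 1" using z R by (intro power_le_one) auto
   then show "norm (a n * (norm z / R) ^ n) \<le> a n" using a0[of n] R by (simp add: abs_mult mult_left_le)
  qed
  then have "summable (\<lambda>k. norm (c k * z ^ k))" by (simp only: eq)
  then have "norm (\<Sum>k. c k * z ^ k) \<le> (\<Sum>k. norm (c k * z ^ k))" by (rule summable_norm)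
  then have "norm (h z) \<le> (\<Sum>k. a k * (norm z / R) ^ k)" using hs[OF zb] by (simp only: eq) (simp add: sums_iff)
  then have "(norm (h z))\<^sup>2 \<le> (\<Sum>k. a k * (norm z / R) ^ k)\<^sup>2" by (intro power_mono) auto
  moreover have "norm (f z) powr p \<le> norm (F z) powr p" using F(3)[OF z] p by (intro powr_mono2) auto
  ultimately show "norm (f z) powr p \<le> (\<Sum>k. a k * (norm z / R) ^ k)\<^sup>2" using nh[OF zb] by simp
 qed (use s2 sa a0 in \<open>auto simp: sums_iff\<close>)
qed

section \<open>Circle means and the radial majorant\<close>

lemma suminf_cauchy_schwarz:
 fixes x y :: "nat \<Rightarrow> real"
 assumes "summable (\<lambda>k. (x k)\<^sup>2)" "summable (\<lambda>k. (y k)\<^sup>2)" "summable (\<lambda>k. x k * y k)"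
 shows "(\<Sum>k. x k * y k)\<^sup>2 \<le> (\<Sum>k. (x k)\<^sup>2) * (\<Sum>k. (y k)\<^sup>2)"
proof (rule LIMSEQ_le)
 show "(\<lambda>n. (\<Sum>k<n. x k * y k)\<^sup>2) \<longlonglongrightarrow> (\<Sum>k. x k * y k)\<^sup>2"
  by (intro tendsto_power summable_LIMSEQ assms)
 show "(\<lambda>n. (\<Sum>k<n. (x k)\<^sup>2) * (\<Sum>k<n. (y k)\<^sup>2)) \<longlonglongrightarrow> (\<Sum>k. (x k)\<^sup>2) * (\<Sum>k. (y k)\<^sup>2)"
  by (intro tendsto_mult summable_LIMSEQ assms)
 show "\<exists>N. \<forall>n\<ge>N. (\<Sum>k<n. x k * y k)\<^sup>2 \<le> (\<Sum>k<n. (x k)\<^sup>2) * (\<Sum>k<n. (y k)\<^sup>2)"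
  using Cauchy_Schwarz_ineq_sum by blast
qed

lemma power_series_square_le:
 fixes a :: "nat \<Rightarrow> real"
 assumes a: "\<And>k. 0 \<le> a k" "summable a" "summable (\<lambda>k. (a k)\<^sup>2)" and t: "0 \<le> t" "t < 1"
 shows "(\<Sum>k. a k * t ^ k)\<^sup>2 * (1 - t) \<le> (\<Sum>k. (a k)\<^sup>2)"
proof -
 have t2: "t\<^sup>2 < 1" using t by (simp add: power_less_one_iff abs_square_less_1)
 have g: "(\<lambda>k. (t ^ k)\<^sup>2) sums (1 / (1 - t\<^sup>2))"
  using geometric_sums[of "t\<^sup>2"] t2 by (simp add: power_mult[symmetric] mult.commute)
 have s: "summable (\<lambda>k. a k * t ^ k)"
  by (rule summable_comparison_test'[OF a(2), where N = 0]) (use a t in \<open>auto simp: abs_mult mult_left_le power_le_one\<close>)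
 have "(\<Sum>k. a k * t ^ k)\<^sup>2 \<le> (\<Sum>k. (a k)\<^sup>2) * (\<Sum>k. (t ^ k)\<^sup>2)"
  by (rule suminf_cauchy_schwarz[OF a(3) _ s]) (use g in \<open>simp add: sums_iff\<close>)
 also have "(\<Sum>k. (t ^ k)\<^sup>2) = 1 / (1 - t\<^sup>2)" using g by (simp add: sums_iff)
 finally have "(\<Sum>k. a k * t ^ k)\<^sup>2 * (1 - t\<^sup>2) \<le> (\<Sum>k. (a k)\<^sup>2)" using t2 by (simp add: field_simps)
 moreover have "(\<Sum>k. a k * t ^ k)\<^sup>2 * (1 - t) \<le> (\<Sum>k. a k * t ^ k)\<^sup>2 * (1 - t\<^sup>2)"
  using t by (intro mult_left_mono) (auto simp: power2_eq_square mult_left_le)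
 ultimately show ?thesis by linarith
qed

text \<open>The k-th moment of (1 - t)^(-1/2) dt, used as a weight in a Cauchy-Schwarz (Schur test) argument.\<close>

definition half_moment :: "nat \<Rightarrow> real" where "half_moment k = Beta (real k + 1) (1/2)"

lemma half_moment_pos: "0 < half_moment k"
 by (simp add: half_moment_def Beta_def Gamma_real_pos)

lemma nn_integral_half_moment:
 "(\<integral>\<^sup>+t\<in>{0..1}. ennreal (t ^ k * (1 - t) powr (-(1/2))) \<partial>lborel) = ennreal (half_moment k)"
proof -
 have "((\<lambda>t. t powr (real k + 1 - 1) * (1 - t) powr (1/2 - 1)) has_integral half_moment k) {0..1}"
  unfolding half_moment_def by (rule has_integral_Beta_real) auto
 from nn_integral_has_integral_lebesgue[OF _ this]
 have "(\<integral>\<^sup>+t\<in>{0..1}. ennreal (t powr (real k + 1 - 1) * (1 - t) powr (1/2 - 1)) \<partial>lborel) = ennreal (half_moment k)"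
  by (subst nn_integral_set_ennreal) (simp add: mult.commute)
 moreover have "(\<integral>\<^sup>+t\<in>{0..1}. ennreal (t powr (real k + 1 - 1) * (1 - t) powr (1/2 - 1)) \<partial>lborel)
  = (\<integral>\<^sup>+t\<in>{0..1}. ennreal (t ^ k * (1 - t) powr (-(1/2))) \<partial>lborel)"
  by (rule nn_integral_cong_AE, rule AE_mp[OF AE_lborel_singleton[of 0]], rule AE_I2)
    (auto simp: indicator_def powr_realpow)
 ultimately show ?thesis by simp
qed

text \<open>Summing the geometric series under the integral gives the integral of (1 - u)^(-1/2) / (1 - u t).\<close>

lemma suminf_half_moment_le:
 assumes t: "0 \<le> t" "t < 1"
 shows "summable (\<lambda>k. half_moment k * t ^ k)" "(\<Sum>k. half_moment k * t ^ k) \<le> 4 * (1 - t) powr (-(1/2))"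
proof -
 have geo: "(\<Sum>k. ennreal (t ^ k * u ^ k)) = ennreal (1 / (1 - u * t))" if "0 \<le> u" "u \<le> 1" for u
 proof -
  have "u * t \<le> 1 * t" using that t by (intro mult_right_mono) auto
  then have "(\<lambda>k. (u * t) ^ k) sums (1 / (1 - u * t))" using t that by (intro geometric_sums) simp
  then have "(\<lambda>k. t ^ k * u ^ k) sums (1 / (1 - u * t))" by (simp add: power_mult_distrib mult.commute)
  then show ?thesis using t that by (intro suminf_ennreal_eq) auto
 qed
 have "(\<Sum>k. ennreal (half_moment k * t ^ k)) = (\<Sum>k. \<integral>\<^sup>+u. ennreal (t ^ k * u ^ k) * (ennreal ((1 - u) powr (-(1/2))) * indicator {0..1} u) \<partial>lborel)"
 proof (rule suminf_cong)
  fix k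
  have "ennreal (half_moment k * t ^ k) = ennreal (t ^ k) * (\<integral>\<^sup>+u\<in>{0..1}. ennreal (u ^ k * (1 - u) powr (-(1/2))) \<partial>lborel)"
   unfolding nn_integral_half_moment using half_moment_pos[of k] t by (simp add: ennreal_mult[symmetric] mult.commute)
  also have "\<dots> = (\<integral>\<^sup>+u. ennreal (t ^ k) * (ennreal (u ^ k * (1 - u) powr (-(1/2))) * indicator {0..1} u) \<partial>lborel)"
   by (rule nn_integral_cmult[symmetric]) measurable
  also have "\<dots> = (\<integral>\<^sup>+u. ennreal (t ^ k * u ^ k) * (ennreal ((1 - u) powr (-(1/2))) * indicator {0..1} u) \<partial>lborel)"
   using t by (intro nn_integral_cong) (auto simp: indicator_def ennreal_mult[symmetric] mult_ac)
  finally show "ennreal (half_moment k * t ^ k) = (\<integral>\<^sup>+u. ennreal (t ^ k * u ^ k) * (ennreal ((1 - u) powr (-(1/2))) * indicator {0..1} u) \<partial>lborel)" .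
 qed
 also have "\<dots> = (\<integral>\<^sup>+u. (\<Sum>k. ennreal (t ^ k * u ^ k) * (ennreal ((1 - u) powr (-(1/2))) * indicator {0..1} u)) \<partial>lborel)"
  by (rule nn_integral_suminf[symmetric]) measurable
 also have "\<dots> = (\<integral>\<^sup>+u\<in>{0..1}. ennreal ((1 - u) powr (1/2 - 1) * (1 - u * t) powr (-1)) \<partial>lborel)"
 proof (rule nn_integral_cong)
  fix u :: real
  show "(\<Sum>k. ennreal (t ^ k * u ^ k) * (ennreal ((1 - u) powr (-(1/2))) * indicator {0..1} u)) =
    ennreal ((1 - u) powr (1/2 - 1) * (1 - u * t) powr (-1)) * indicator {0..1} u"
  proof (cases "u \<in> {0..1}")
   case True
   have "u * t \<le> 1 * t" using True t by (intro mult_right_mono) auto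
   then have pos: "0 < 1 - u * t" using t by simp
   have "(\<Sum>k. ennreal (t ^ k * u ^ k) * (ennreal ((1 - u) powr (-(1/2))) * indicator {0..1} u)) =
     (\<Sum>k. ennreal (t ^ k * u ^ k)) * ennreal ((1 - u) powr (-(1/2)))"
    using True by (simp add: ennreal_suminf_multc)
   also have "\<dots> = ennreal ((1 - u) powr (1/2 - 1) * (1 - u * t) powr (-1))"
    using True pos by (subst geo) (auto simp: ennreal_mult[symmetric] powr_minus_divide mult.commute)
   finally show ?thesis using True by simp
  qed simp
 qed
 also have "\<dots> \<le> ennreal (4 * (1 - t) powr (-(1/2)))"
  using nn_integral_disc_kernel[of "1/2" 1 t] t by simp
 finally have le: "(\<Sum>k. ennreal (half_moment k * t ^ k)) \<le> ennreal (4 * (1 - t) powr (-(1/2)))" .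
 show s: "summable (\<lambda>k. half_moment k * t ^ k)"
 proof (rule summable_suminf_not_top)
  show "0 \<le> half_moment k * t ^ k" for k using half_moment_pos[of k] t by simp
  show "(\<Sum>k. ennreal (half_moment k * t ^ k)) \<noteq> top" using le by (auto simp: top_unique)
 qed
 have "ennreal (\<Sum>k. half_moment k * t ^ k) = (\<Sum>k. ennreal (half_moment k * t ^ k))"
  using less_imp_le[OF half_moment_pos] t by (intro suminf_ennreal2[symmetric] s mult_nonneg_nonneg zero_le_power)
 with le have "ennreal (\<Sum>k. half_moment k * t ^ k) \<le> ennreal (4 * (1 - t) powr (-(1/2)))" by simp
 then show "(\<Sum>k. half_moment k * t ^ k) \<le> 4 * (1 - t) powr (-(1/2))"
  by (subst (asm) ennreal_le_iff) auto
qed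

text \<open>Equivalent to Hilbert's inequality with constant 4 in place of pi. Cauchy-Schwarz with the
weights b k = half_moment k bounds the square of the series by 4 (1 - t)^(-1/2) times the sum of
a_k^2 t^k / b_k, and integrating this against dt turns each t^k (1 - t)^(-1/2) into b_k.\<close>

lemma nn_integral_power_series_square_le:
 fixes a :: "nat \<Rightarrow> real"
 assumes a: "\<And>k. 0 \<le> a k" "summable a" "summable (\<lambda>k. (a k)\<^sup>2)"
 shows "(\<integral>\<^sup>+t\<in>{0..<1}. ennreal ((\<Sum>k. a k * t ^ k)\<^sup>2) \<partial>lborel) \<le> ennreal (4 * (\<Sum>k. (a k)\<^sup>2))"
proof -
 note b = half_moment_pos
 have "(\<integral>\<^sup>+t\<in>{0..<1}. ennreal ((\<Sum>k. a k * t ^ k)\<^sup>2) \<partial>lborel) \<le>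
   (\<integral>\<^sup>+t. (\<Sum>k. ennreal (4 * (a k)\<^sup>2 / half_moment k) * (ennreal (t ^ k * (1 - t) powr (-(1/2))) * indicator {0..1} t)) \<partial>lborel)"
 proof (rule nn_integral_mono)
  fix t :: real
  show "ennreal ((\<Sum>k. a k * t ^ k)\<^sup>2) * indicator {0..<1} t \<le>
    (\<Sum>k. ennreal (4 * (a k)\<^sup>2 / half_moment k) * (ennreal (t ^ k * (1 - t) powr (-(1/2))) * indicator {0..1} t))"
  proof (cases "t \<in> {0..<1}")
   case True
   then have t: "0 \<le> t" "t < 1" by auto
   let ?x = "\<lambda>k. a k * sqrt (t ^ k / half_moment k)" and ?y = "\<lambda>k. sqrt (half_moment k * t ^ k)"
   have x2: "(?x k)\<^sup>2 = (a k)\<^sup>2 * t ^ k / half_moment k" for k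
    using t b[of k] by (simp add: power_mult_distrib less_imp_le)
   have y2: "(?y k)\<^sup>2 = half_moment k * t ^ k" for k
    using t b[of k] by (simp add: less_imp_le)
   have xy: "?x k * ?y k = a k * t ^ k" for k
   proof -
    have "sqrt (t ^ k / half_moment k) * sqrt (half_moment k * t ^ k) = sqrt ((t ^ k)\<^sup>2)"
     using b[of k] by (simp add: real_sqrt_mult[symmetric] power2_eq_square)
    also have "\<dots> = t ^ k" using t by simp
    finally show ?thesis by simp
   qed
   have s: "summable (\<lambda>k. a k * t ^ k)"
    by (rule summable_comparison_test'[OF a(2), where N = 0]) (use a t in \<open>auto simp: abs_mult mult_left_le power_le_one\<close>)
   have z: "0 \<le> (a k)\<^sup>2 * t ^ k / half_moment k" for k using t b[of k] by simp
   have eq: "(\<Sum>k. ennreal (4 * (a k)\<^sup>2 / half_moment k) * (ennreal (t ^ k * (1 - t) powr (-(1/2))) * indicator {0..1} t))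
     = ennreal (4 * (1 - t) powr (-(1/2))) * (\<Sum>k. ennreal ((a k)\<^sup>2 * t ^ k / half_moment k))"
    unfolding ennreal_suminf_cmult[symmetric]
    using t b by (intro suminf_cong) (simp add: ennreal_mult[symmetric] less_imp_le mult_ac)
   show ?thesis
   proof (cases "(\<Sum>k. ennreal ((a k)\<^sup>2 * t ^ k / half_moment k)) = top")
    case True
    then show ?thesis unfolding eq using t by (simp add: ennreal_mult_top)
   next
    case False
    then have sx: "summable (\<lambda>k. (a k)\<^sup>2 * t ^ k / half_moment k)" by (intro summable_suminf_not_top z)
    have "(\<Sum>k. ?x k * ?y k)\<^sup>2 \<le> (\<Sum>k. (?x k)\<^sup>2) * (\<Sum>k. (?y k)\<^sup>2)"
     by (rule suminf_cauchy_schwarz) (simp_all only: x2 y2 xy sx s suminf_half_moment_le(1)[OF t])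
    then have "(\<Sum>k. a k * t ^ k)\<^sup>2 \<le> (\<Sum>k. (a k)\<^sup>2 * t ^ k / half_moment k) * (\<Sum>k. half_moment k * t ^ k)"
     by (simp only: x2 y2 xy)
    also have "\<dots> \<le> (\<Sum>k. (a k)\<^sup>2 * t ^ k / half_moment k) * (4 * (1 - t) powr (-(1/2)))"
     by (intro mult_left_mono suminf_half_moment_le(2)[OF t] suminf_nonneg sx z)
    also have "\<dots> = (4 * (1 - t) powr (-(1/2))) * (\<Sum>k. (a k)\<^sup>2 * t ^ k / half_moment k)" by (rule mult.commute)
    finally have "ennreal ((\<Sum>k. a k * t ^ k)\<^sup>2) \<le> ennreal ((4 * (1 - t) powr (-(1/2))) * (\<Sum>k. (a k)\<^sup>2 * t ^ k / half_moment k))"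
     by (rule ennreal_leI)
    also have "\<dots> = ennreal (4 * (1 - t) powr (-(1/2))) * ennreal (\<Sum>k. (a k)\<^sup>2 * t ^ k / half_moment k)"
     by (rule ennreal_mult) (simp, intro suminf_nonneg sx z)
    also have "ennreal (\<Sum>k. (a k)\<^sup>2 * t ^ k / half_moment k) = (\<Sum>k. ennreal ((a k)\<^sup>2 * t ^ k / half_moment k))"
     by (intro suminf_ennreal2[symmetric] z sx)
    finally show ?thesis unfolding eq using t by simp
   qed
  qed simp
 qed
 also have "\<dots> = (\<Sum>k. \<integral>\<^sup>+t. ennreal (4 * (a k)\<^sup>2 / half_moment k) * (ennreal (t ^ k * (1 - t) powr (-(1/2))) * indicator {0..1} t) \<partial>lborel)"
  by (rule nn_integral_suminf) measurable
 also have "\<dots> = (\<Sum>k. ennreal (4 * (a k)\<^sup>2))"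
 proof (rule suminf_cong)
  fix k
  have "(\<integral>\<^sup>+t. ennreal (4 * (a k)\<^sup>2 / half_moment k) * (ennreal (t ^ k * (1 - t) powr (-(1/2))) * indicator {0..1} t) \<partial>lborel)
    = ennreal (4 * (a k)\<^sup>2 / half_moment k) * (\<integral>\<^sup>+t\<in>{0..1}. ennreal (t ^ k * (1 - t) powr (-(1/2))) \<partial>lborel)"
   by (rule nn_integral_cmult) measurable
  also have "\<dots> = ennreal (4 * (a k)\<^sup>2)"
   unfolding nn_integral_half_moment using b[of k] by (subst ennreal_mult[symmetric]) auto
  finally show "(\<integral>\<^sup>+t. ennreal (4 * (a k)\<^sup>2 / half_moment k) * (ennreal (t ^ k * (1 - t) powr (-(1/2))) * indicator {0..1} t) \<partial>lborel) = ennreal (4 * (a k)\<^sup>2)" .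
 qed
 also have "\<dots> = ennreal (\<Sum>k. 4 * (a k)\<^sup>2)"
  by (intro suminf_ennreal2 summable_mult a) simp
 also have "(\<Sum>k. 4 * (a k)\<^sup>2) = 4 * (\<Sum>k. (a k)\<^sup>2)" by (rule suminf_mult[OF a(3)])
 finally show ?thesis .
qed

definition circle_mean :: "real \<Rightarrow> real \<Rightarrow> (complex \<Rightarrow> complex) \<Rightarrow> real" where
 "circle_mean p r f = 1 / (2 * pi) * integral {0..2*pi} (\<lambda>\<theta>. norm (f (of_real r * cis \<theta>)) powr p)"

lemma circle_mean_integrand:
 assumes f: "f holomorphic_on ball 0 1" and r: "0 \<le> r" "r < 1"
 shows "continuous_on A (\<lambda>\<theta>. f (of_real r * cis \<theta>))"
  and "0 < p \<Longrightarrow> continuous_on A (\<lambda>\<theta>. norm (f (of_real r * cis \<theta>)) powr p)"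
proof -
 have *: "continuous_on A (\<lambda>\<theta>. f (of_real r * cis \<theta>))"
  by (rule continuous_on_compose2[OF holomorphic_on_imp_continuous_on[OF f]])
    (use r in \<open>auto intro!: continuous_intros simp: norm_mult\<close>)
 then show "continuous_on A (\<lambda>\<theta>. f (of_real r * cis \<theta>))" .
 show "0 < p \<Longrightarrow> continuous_on A (\<lambda>\<theta>. norm (f (of_real r * cis \<theta>)) powr p)"
  by (intro continuous_on_powr' continuous_on_norm * continuous_on_const) auto
qed

lemma
 assumes f: "f holomorphic_on ball 0 1" and r: "0 \<le> r" "r < 1" and p: "0 < p"
 shows circle_mean_nonneg: "0 \<le> circle_mean p r f"
  and hardy_mean_eq_circle_mean: "hardy_mean p r f = circle_mean p r f powr (1 / p)"
  and nn_integral_circle_mean: "(\<integral>\<^sup>+\<theta>\<in>{0..<2*pi}. ennreal (norm (f (of_real r * cis \<theta>)) powr p) \<partial>lborel)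
   = ennreal (2 * pi * circle_mean p r f)"
proof -
 note c = circle_mean_integrand(2)[OF f r p]
 have int: "(\<lambda>\<theta>. norm (f (of_real r * cis \<theta>)) powr p) integrable_on {0..2*pi}"
  by (rule integrable_continuous_real[OF c])
 show "0 \<le> circle_mean p r f"
  unfolding circle_mean_def by (intro mult_nonneg_nonneg integral_nonneg int) auto
 have "set_integrable lborel {0..2*pi} (\<lambda>\<theta>. norm (f (of_real r * cis \<theta>)) powr p)"
  by (rule borel_integrable_atLeastAtMost'[OF c])
 from set_borel_integral_eq_integral(2)[OF this]
 show "hardy_mean p r f = circle_mean p r f powr (1 / p)"
  unfolding hardy_mean_def circle_mean_def by simp
 have "(\<integral>\<^sup>+\<theta>\<in>{0..<2*pi}. ennreal (norm (f (of_real r * cis \<theta>)) powr p) \<partial>lborel)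
  = (\<integral>\<^sup>+\<theta>\<in>{0..2*pi}. ennreal (norm (f (of_real r * cis \<theta>)) powr p) \<partial>lborel)"
  by (rule nn_integral_cong_AE, rule AE_mp[OF AE_lborel_singleton[of "2*pi"]], rule AE_I2) (auto simp: indicator_def)
 also have "\<dots> = ennreal (integral {0..2*pi} (\<lambda>\<theta>. norm (f (of_real r * cis \<theta>)) powr p))"
  using nn_integral_has_integral_lebesgue[OF _ integrable_integral[OF int]]
  by (subst nn_integral_set_ennreal) (simp add: mult.commute)
 finally show "(\<integral>\<^sup>+\<theta>\<in>{0..<2*pi}. ennreal (norm (f (of_real r * cis \<theta>)) powr p) \<partial>lborel)
   = ennreal (2 * pi * circle_mean p r f)"
  by (simp add: circle_mean_def)
qed

text \<open>An increasing function on the radius dominating |f|^p, whose pointwise growth and whose integral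
are controlled by the mean of |f|^p over one circle. It plays the role of a maximal function.\<close>

definition radial_majorant :: "real \<Rightarrow> real \<Rightarrow> (complex \<Rightarrow> complex) \<Rightarrow> (real \<Rightarrow> real) \<Rightarrow> bool" where
 "radial_majorant p R f A \<longleftrightarrow> A \<in> borel_measurable borel \<and> (\<forall>t. 0 \<le> A t) \<and>
   (\<forall>t t'. 0 \<le> t \<and> t \<le> t' \<and> t' < 1 \<longrightarrow> A t \<le> A t') \<and>
   (\<forall>z. norm z < R \<longrightarrow> norm (f z) powr p \<le> A (norm z / R)) \<and>
   (\<forall>t. 0 \<le> t \<and> t < 1 \<longrightarrow> A t * (1 - t) \<le> circle_mean p R f) \<and>
   (\<integral>\<^sup>+t\<in>{0..<1}. ennreal (A t) \<partial>lborel) \<le> ennreal (4 * circle_mean p R f)"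

lemma radial_majorant_exists_nonzero:
 assumes f: "f holomorphic_on ball 0 1" and R: "0 < R" "R < 1" and p: "0 < p"
  and nz: "\<And>z. norm z = R \<Longrightarrow> f z \<noteq> 0"
 shows "\<exists>A. radial_majorant p R f A"
proof -
 obtain a where a': "\<And>k. 0 \<le> a k" "summable a" "summable (\<lambda>k. (a k)\<^sup>2)"
  "(\<Sum>k. (a k)\<^sup>2) = 1 / (2 * pi) * integral {0..2*pi} (\<lambda>\<theta>. norm (f (of_real R * cis \<theta>)) powr p)"
  "\<And>z. norm z \<le> R \<Longrightarrow> norm (f z) powr p \<le> (\<Sum>k. a k * (norm z / R) ^ k)\<^sup>2"
  by (rule power_series_majorant[OF f R p]) (erule nz, rule that)
 note a = a'(1-3) a'(4)[folded circle_mean_def] a'(5)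
 have s: "summable (\<lambda>k. a k * t ^ k)" if "0 \<le> t" "t < 1" for t
  by (rule summable_comparison_test'[OF a(2), where N = 0]) (use a that in \<open>auto simp: abs_mult mult_left_le power_le_one\<close>)
 define A where "A = (\<lambda>t. (\<Sum>k. a k * t ^ k)\<^sup>2)"
 have "A \<in> borel_measurable borel" unfolding A_def by measurable
 moreover have "A t \<le> A t'" if "0 \<le> t" "t \<le> t'" "t' < 1" for t t'
  unfolding A_def using that a(1)
  by (intro power_mono suminf_le suminf_nonneg s mult_left_mono mult_nonneg_nonneg) auto
 moreover have "norm (f z) powr p \<le> A (norm z / R)" if "norm z < R" for z
  using a(5)[of z] that by (simp add: A_def)
 moreover have "A t * (1 - t) \<le> circle_mean p R f" if "0 \<le> t" "t < 1" for t
  using power_series_square_le[OF a(1-3) that] by (simp add: A_def a(4))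
 moreover have "(\<integral>\<^sup>+t\<in>{0..<1}. ennreal (A t) \<partial>lborel) \<le> ennreal (4 * circle_mean p R f)"
  using nn_integral_power_series_square_le[OF a(1-3)] by (simp add: A_def a(4))
 ultimately have "radial_majorant p R f A" unfolding radial_majorant_def by (auto simp: A_def)
 then show ?thesis by blast
qed

text \<open>Circles through zeros of f are exceptional; there are only countably many of them, and all later
limits can avoid them.\<close>

lemma radial_majorant_exists:
 assumes f: "f holomorphic_on ball 0 1" and p: "0 < p"
 obtains E where "countable E" "\<And>R. 0 < R \<Longrightarrow> R < 1 \<Longrightarrow> R \<notin> E \<Longrightarrow> \<exists>A. radial_majorant p R f A"
proof (cases "\<forall>z\<in>ball 0 1. f z = 0")
 case True
 have "radial_majorant p R f (\<lambda>t. 0)" if R: "0 < R" "R < 1" for R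
 proof -
  have "f (of_real R * cis \<theta>) = 0" for \<theta> using True R by (simp add: norm_mult)
  then have "circle_mean p R f = 0" using p by (simp add: circle_mean_def)
  then show ?thesis using True R by (auto simp: radial_majorant_def)
 qed
 then show ?thesis by (intro that[of "{}"]) auto
next
 case False
 then obtain z0 where z0: "z0 \<in> ball 0 1" "f z0 \<noteq> 0" by blast
 have "countable {z\<in>ball 0 1. f z = 0}"
 proof (cases "f constant_on ball 0 1")
  case True
  then obtain c where c: "\<And>z. z \<in> ball 0 1 \<Longrightarrow> f z = c" unfolding constant_on_def by auto
  then have "{z\<in>ball 0 1. f z = 0} = {}" using z0 by auto
  then show ?thesis by (simp only: countable_empty)
 next
  case False
  have "ball (0::complex) 1 = (\<Union>n::nat. cball 0 (1 - 1 / real (Suc n)))"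
  proof (rule set_eqI, rule iffI)
   fix z :: complex assume "z \<in> ball 0 1"
   then obtain n where "inverse (real (Suc n)) < 1 - norm z" using reals_Archimedean[of "1 - norm z"] by auto
   then have "z \<in> cball 0 (1 - 1 / real (Suc n))" by (simp add: inverse_eq_divide)
   then show "z \<in> (\<Union>n::nat. cball 0 (1 - 1 / real (Suc n)))" by blast
  next
   fix z :: complex assume "z \<in> (\<Union>n::nat. cball 0 (1 - 1 / real (Suc n)))"
   then obtain n where "norm z \<le> 1 - 1 / real (Suc n)" by auto
   then have "norm z < 1" by (rule le_less_trans) simp
   then show "z \<in> ball 0 1" by simp
  qed
  then have "fsigma (ball (0::complex) 1)" by (simp only: fsigma.intros[OF closed_cball])
  then show ?thesis by (intro holomorphic_countable_zeros[OF f _ _ _ False]) auto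
 qed
 then have "countable (norm ` {z\<in>ball 0 1. f z = 0})" by (rule countable_image)
 then show ?thesis
 proof (rule that)
  fix R :: real assume R: "0 < R" "R < 1" "R \<notin> norm ` {z\<in>ball 0 1. f z = 0}"
  show "\<exists>A. radial_majorant p R f A"
   by (rule radial_majorant_exists_nonzero[OF f R(1,2) p]) (use R in auto)
 qed
qed

section \<open>Bounded sets in Hardy spaces\<close>

text \<open>Working with the means of |f|^p instead of the norm avoids p-th roots and treats p < 1 and p
\<ge> 1 alike.\<close>

definition hardy_ball :: "real \<Rightarrow> real \<Rightarrow> (complex \<Rightarrow> complex) set" where
 "hardy_ball p B = {f \<in> disc_holomorphic. \<forall>r. 0 < r \<and> r < 1 \<longrightarrow> circle_mean p r f \<le> B}"

lemma disc_holomorphicD: "f \<in> disc_holomorphic \<Longrightarrow> f holomorphic_on ball 0 1"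
 "f \<in> disc_holomorphic \<Longrightarrow> z \<notin> ball 0 1 \<Longrightarrow> f z = 0"
 by (auto simp: disc_holomorphic_def)

lemma hardy_ballD:
 assumes "f \<in> hardy_ball p B"
 shows "f \<in> disc_holomorphic" "f holomorphic_on ball 0 1" "\<And>r. 0 < r \<Longrightarrow> r < 1 \<Longrightarrow> circle_mean p r f \<le> B"
 using assms by (auto simp: hardy_ball_def disc_holomorphic_def)

lemma hardy_ball_nonneg: "f \<in> hardy_ball p B \<Longrightarrow> 0 < p \<Longrightarrow> 0 \<le> B"
 using circle_mean_nonneg[of f "1/2" p] hardy_ballD(2)[of f p B] hardy_ballD(3)[of f p B "1/2"] by force

lemma hardy_ball_of_norm_le:
 assumes p: "0 < p" and f: "f \<in> hardy_space p" and B: "hardy_norm p f \<le> B"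
 shows "f \<in> hardy_ball p (B powr p)"
proof -
 have fd: "f \<in> disc_holomorphic" and bdd: "bdd_above ((\<lambda>r. hardy_mean p r f) ` {0<..<1})"
  using f by (auto simp: hardy_space_def)
 note fh = disc_holomorphicD(1)[OF fd]
 have "circle_mean p r f \<le> B powr p" if r: "0 < r" "r < 1" for r
 proof -
  have "hardy_mean p r f \<le> hardy_norm p f"
   unfolding hardy_norm_def by (rule cSUP_upper[OF _ bdd]) (use r in auto)
  then have le: "circle_mean p r f powr (1/p) \<le> B"
   using B hardy_mean_eq_circle_mean[OF fh _ r(2) p] r by simp
  have c0: "0 \<le> circle_mean p r f" using circle_mean_nonneg[OF fh _ r(2) p] r by simp
  have "circle_mean p r f = (circle_mean p r f powr (1/p)) powr p" using p c0 by (simp add: powr_powr)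
  also have "\<dots> \<le> B powr p" using le p by (intro powr_mono2) auto
  finally show ?thesis .
 qed
 then show ?thesis using fd by (simp add: hardy_ball_def)
qed

lemma hardy_ball_imp_norm_le:
 assumes p: "0 < p" and f: "f \<in> hardy_ball p B"
 shows "f \<in> hardy_space p" "hardy_norm p f \<le> B powr (1/p)"
proof -
 have le: "hardy_mean p r f \<le> B powr (1/p)" if "r \<in> {0<..<1}" for r
 proof -
  have "hardy_mean p r f = circle_mean p r f powr (1/p)"
   using hardy_mean_eq_circle_mean[OF hardy_ballD(2)[OF f] _ _ p] that by simp
  also have "\<dots> \<le> B powr (1/p)"
   using hardy_ballD(3)[OF f] circle_mean_nonneg[OF hardy_ballD(2)[OF f] _ _ p] that p by (intro powr_mono2) auto
  finally show ?thesis .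
 qed
 show "f \<in> hardy_space p"
  unfolding hardy_space_def using hardy_ballD(1)[OF f] le by (auto intro!: bdd_aboveI2[where M = "B powr (1/p)"])
 show "hardy_norm p f \<le> B powr (1/p)"
  unfolding hardy_norm_def by (rule cSUP_least) (use le in auto)
qed

lemma disc_holomorphic_measurable[measurable_dest]:
 assumes "f \<in> disc_holomorphic"
 shows "f \<in> borel_measurable borel"
proof -
 have "(\<lambda>z. indicator (ball 0 1) z *\<^sub>R f z) \<in> borel_measurable borel"
  by (rule borel_measurable_continuous_on_indicator)
    (use disc_holomorphicD(1)[OF assms] in \<open>auto intro: holomorphic_on_imp_continuous_on\<close>)
 also have "(\<lambda>z. indicator (ball 0 1) z *\<^sub>R f z) = f"
  using disc_holomorphicD(2)[OF assms] by (intro ext) (auto simp: indicator_def)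
 finally show ?thesis .
qed

lemma radii_avoiding_countable:
 assumes "countable E"
 obtains R :: "nat \<Rightarrow> real" where "\<And>n. 0 < R n" "\<And>n. R n < 1" "\<And>n. R n \<notin> E" "R \<longlonglongrightarrow> 1"
proof -
 have "\<exists>x. x \<in> {1 - 1 / real (n + 2)<..<1} - E" for n
 proof -
  have "uncountable {1 - 1 / real (n + 2)<..<1}" by (rule uncountable_open_interval[THEN iffD2]) simp
  then have "uncountable ({1 - 1 / real (n + 2)<..<1} - E)" using assms by (rule uncountable_minus_countable)
  then show ?thesis by (metis countable_empty ex_in_conv)
 qed
 then obtain R where R: "\<And>n. R n \<in> {1 - 1 / real (n + 2)<..<1} - E" by metis
 have pos: "0 < R n" for n
 proof -
  have "1 - 1 / real (n + 2) < R n" using R[of n] by (simp only: Diff_iff greaterThanLessThan_iff)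
  moreover have "0 \<le> 1 - 1 / real (n + 2)" by simp
  ultimately show ?thesis by linarith
 qed
 have "R \<longlonglongrightarrow> 1"
 proof (rule tendsto_sandwich)
  show "(\<lambda>n. 1 - 1 / real (n + 2)) \<longlonglongrightarrow> 1" by real_asymp
  show "(\<lambda>n. 1) \<longlonglongrightarrow> (1::real)" by simp
  show "\<forall>\<^sub>F n in sequentially. 1 - 1 / real (n + 2) \<le> R n" using R by (intro always_eventually) (auto intro: less_imp_le)
  show "\<forall>\<^sub>F n in sequentially. R n \<le> 1" using R by (intro always_eventually) (auto intro: less_imp_le)
 qed
 then show ?thesis using R pos by (intro that) auto
qed

text \<open>The growth of the majorant at radius R, as R tends to 1 outside the exceptional set.\<close>

lemma hardy_growth:
 assumes p: "0 < p" and f: "f \<in> hardy_ball p B" and z: "norm z < 1"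
 shows "norm (f z) powr p * (1 - norm z) \<le> B" "norm (f z) \<le> (B / (1 - norm z)) powr (1/p)"
proof -
 obtain E where E: "countable E" "\<And>R. 0 < R \<Longrightarrow> R < 1 \<Longrightarrow> R \<notin> E \<Longrightarrow> \<exists>A. radial_majorant p R f A"
  by (rule radial_majorant_exists[OF hardy_ballD(2)[OF f] p]) (rule that)
 obtain R where R: "\<And>n. 0 < R n" "\<And>n. R n < 1" "\<And>n. R n \<notin> E" "R \<longlonglongrightarrow> 1"
  by (rule radii_avoiding_countable[OF E(1)]) (rule that)
 have lim: "(\<lambda>n. norm (f z) powr p * (1 - norm z / R n)) \<longlonglongrightarrow> norm (f z) powr p * (1 - norm z / 1)"
  by (intro tendsto_intros R(4)) simp
 have "\<forall>\<^sub>F n in sequentially. norm z < R n" using order_tendstoD(1)[OF R(4) z] .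
 then have ev: "\<forall>\<^sub>F n in sequentially. norm (f z) powr p * (1 - norm z / R n) \<le> B"
 proof eventually_elim
  case (elim n)
  obtain A where A: "radial_majorant p (R n) f A" using E(2) R by metis
  have t: "0 \<le> norm z / R n" "norm z / R n < 1" using elim R(1)[of n] by auto
  have "norm (f z) powr p * (1 - norm z / R n) \<le> A (norm z / R n) * (1 - norm z / R n)"
   using A elim t unfolding radial_majorant_def by (intro mult_right_mono) auto
  also have "\<dots> \<le> circle_mean p (R n) f" using A t unfolding radial_majorant_def by blast
  also have "\<dots> \<le> B" using hardy_ballD(3)[OF f] R by blast
  finally show ?case .
 qed
 from tendsto_upperbound[OF lim ev] show *: "norm (f z) powr p * (1 - norm z) \<le> B" by simp
 have "norm (f z) = (norm (f z) powr p) powr (1/p)" using p by (simp add: powr_powr)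
 also have "\<dots> \<le> (B / (1 - norm z)) powr (1/p)"
  using * z p by (intro powr_mono2) (auto simp: pos_le_divide_eq)
 finally show "norm (f z) \<le> (B / (1 - norm z)) powr (1/p)" .
qed

lemma nn_integral_fatou_le:
 assumes "\<And>n. u n \<in> borel_measurable M" "\<And>x. x \<in> space M \<Longrightarrow> (\<lambda>n. u n x) \<longlonglongrightarrow> v x" "\<And>n. (\<integral>\<^sup>+x. u n x \<partial>M) \<le> c"
 shows "(\<integral>\<^sup>+x. v x \<partial>M) \<le> c"
proof -
 have "(\<integral>\<^sup>+x. v x \<partial>M) = (\<integral>\<^sup>+x. liminf (\<lambda>n. u n x) \<partial>M)"
  by (intro nn_integral_cong) (simp add: lim_imp_Liminf[OF _ assms(2)])
 also have "\<dots> \<le> liminf (\<lambda>n. \<integral>\<^sup>+x. u n x \<partial>M)" by (rule nn_integral_liminf[OF assms(1)])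
 also have "\<dots> \<le> liminf (\<lambda>n. c)" by (rule Liminf_mono) (use assms(3) in auto)
 finally show ?thesis by (simp add: Liminf_const)
qed

lemma isCont_disc_radial:
 assumes "f holomorphic_on ball 0 1" "norm z < 1" "R \<longlonglongrightarrow> 1"
 shows "(\<lambda>n. f (of_real (R n) * z)) \<longlonglongrightarrow> f z"
proof -
 have "isCont f z" using assms by (intro continuous_on_interior[OF holomorphic_on_imp_continuous_on]) auto
 moreover have "(\<lambda>n. of_real (R n) * z) \<longlonglongrightarrow> of_real 1 * z" by (intro tendsto_intros assms)
 then have "(\<lambda>n. of_real (R n) * z) \<longlonglongrightarrow> z" by simp
 ultimately show ?thesis by (rule isCont_tendsto_compose)
qed

text \<open>Since A (1 - t) \<le> B, the power A^(q/p) (1 - t)^(q/p - 1) of the majorant is at most B^(q/p -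
1) A, so only the L^1 norm of A against Lebesgue measure is needed. The dilations of f are
handled first; Fatou's lemma removes them.\<close>

lemma carleson_embedding:
 assumes p: "0 < p" "p \<le> q" and f: "f \<in> hardy_ball p B"
  and \<nu>: "borel_measure_01 \<nu>" and a: "0 \<le> a" "a < 1" and e: "0 \<le> e" and tail: "tail_bound \<nu> a (q / p) e"
 shows "(\<integral>\<^sup>+t\<in>{a..<1}. ennreal (norm (f (of_real t)) powr q) \<partial>\<nu>) \<le> ennreal (4 * (q / p) * e * B powr (q / p))"
proof -
 have B: "0 \<le> B" using hardy_ball_nonneg[OF f p(1)] .
 have [measurable]: "f \<in> borel_measurable borel" using disc_holomorphic_measurable[OF hardy_ballD(1)[OF f]] .
 obtain E where E: "countable E" "\<And>R. 0 < R \<Longrightarrow> R < 1 \<Longrightarrow> R \<notin> E \<Longrightarrow> \<exists>A. radial_majorant p R f A"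
  by (rule radial_majorant_exists[OF hardy_ballD(2)[OF f] p(1)]) (rule that)
 obtain R where R: "\<And>n. 0 < R n" "\<And>n. R n < 1" "\<And>n. R n \<notin> E" "R \<longlonglongrightarrow> 1"
  by (rule radii_avoiding_countable[OF E(1)]) (rule that)
 have qp: "1 \<le> q / p" using p by simp
 have m: "(\<lambda>t. ennreal (norm (f (of_real (c * t))) powr q) * indicator {a..<1} t) \<in> borel_measurable \<nu>" for c :: real
  by (rule borel_measure_01D(4)[OF \<nu>]) measurable
 show ?thesis
 proof (rule nn_integral_fatou_le)
  show "(\<lambda>t. ennreal (norm (f (of_real (R n * t))) powr q) * indicator {a..<1} t) \<in> borel_measurable \<nu>" for n
   by (rule m)
  fix t assume "t \<in> space \<nu>"
  then have t: "0 \<le> t" "t < 1" using borel_measure_01D(2)[OF \<nu>] by auto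
  then have "(\<lambda>n. f (of_real (R n) * of_real t)) \<longlonglongrightarrow> f (of_real t)"
   by (intro isCont_disc_radial hardy_ballD(2)[OF f] R(4)) simp
  then have "(\<lambda>n. f (of_real (R n * t))) \<longlonglongrightarrow> f (of_real t)" by simp
  then have "(\<lambda>n. norm (f (of_real (R n * t))) powr q) \<longlonglongrightarrow> norm (f (of_real t)) powr q"
   using p by (intro tendsto_powr' tendsto_norm tendsto_const) auto
  then show "(\<lambda>n. ennreal (norm (f (of_real (R n * t))) powr q) * indicator {a..<1} t) \<longlonglongrightarrow> ennreal (norm (f (of_real t)) powr q) * indicator {a..<1} t"
   by (cases "t \<in> {a..<1}") (auto intro!: tendsto_ennrealI)
 next
  fix n
  obtain A where A: "radial_majorant p (R n) f A" using E(2) R by metis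
  note A = A[unfolded radial_majorant_def]
  have [measurable]: "A \<in> borel_measurable borel" using A by blast
  have A0: "0 \<le> A t" for t using A by blast
  have cm: "circle_mean p (R n) f \<le> B" using hardy_ballD(3)[OF f] R by blast
  have "(\<integral>\<^sup>+t\<in>{a..<1}. ennreal (norm (f (of_real (R n * t))) powr q) \<partial>\<nu>)
   \<le> (\<integral>\<^sup>+t\<in>{a..<1}. ennreal (A t powr (q / p)) \<partial>\<nu>)"
  proof (rule nn_integral_mono)
   fix t
   show "ennreal (norm (f (of_real (R n * t))) powr q) * indicator {a..<1} t \<le> ennreal (A t powr (q / p)) * indicator {a..<1} t"
   proof (cases "t \<in> {a..<1}")
    case True
    then have t: "0 \<le> t" "t < 1" using a by auto
    have n: "norm (of_real (R n * t) :: complex) = R n * t" using t R(1)[of n] by (simp add: norm_mult)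
    have lt: "R n * t < R n" using t R(1)[of n] by simp
    have "norm (f (of_real (R n * t))) powr p \<le> A (norm (of_real (R n * t) :: complex) / R n)"
     using A n lt by (metis (no_types))
    then have le: "norm (f (of_real (R n * t))) powr p \<le> A t" unfolding n using R(1)[of n] by simp
    have "norm (f (of_real (R n * t))) powr q = (norm (f (of_real (R n * t))) powr p) powr (q / p)"
     using p by (simp add: powr_powr)
    also have "\<dots> \<le> A t powr (q / p)" using le qp by (intro powr_mono2) auto
    finally show ?thesis using True by (simp add: ennreal_leI)
   qed simp
  qed
  also have "\<dots> \<le> ennreal (e * (q / p)) * (\<integral>\<^sup>+t\<in>{a..<1}. ennreal (A t powr (q / p) * (1 - t) powr (q / p - 1)) \<partial>lborel)"
  proof (rule nn_integral_le_of_tail_bound[OF \<nu> a _ e tail])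
   fix t t' assume "a \<le> t" "t \<le> t'" "t' < 1"
   then have "A t \<le> A t'" using A a by (meson order_trans)
   then show "A t powr (q / p) \<le> A t' powr (q / p)" using A0 qp by (intro powr_mono2) auto
  qed (use qp in auto)
  also have "\<dots> \<le> ennreal (e * (q / p)) * (\<integral>\<^sup>+t. ennreal (B powr (q / p - 1)) * (ennreal (A t) * indicator {0..<1} t) \<partial>lborel)"
  proof (intro mult_left_mono nn_integral_mono)
   fix t
   show "ennreal (A t powr (q / p) * (1 - t) powr (q / p - 1)) * indicator {a..<1} t \<le> ennreal (B powr (q / p - 1)) * (ennreal (A t) * indicator {0..<1} t)"
   proof (cases "t \<in> {a..<1}")
    case True
    then have t: "0 \<le> t" "t < 1" using a by auto
    have "A t powr (q / p) * (1 - t) powr (q / p - 1) \<le> B powr (q / p - 1) * A t"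
    proof (cases "A t = 0")
     case False
     then have At: "0 < A t" using A0[of t] by simp
     have le: "A t * (1 - t) \<le> B" using A t cm by (meson order_trans)
     have "A t powr (q / p) = A t powr (q / p - 1) * A t" using At by (simp add: powr_diff)
     then have "A t powr (q / p) * (1 - t) powr (q / p - 1) = (A t powr (q / p - 1) * (1 - t) powr (q / p - 1)) * A t" by simp
     also have "A t powr (q / p - 1) * (1 - t) powr (q / p - 1) = (A t * (1 - t)) powr (q / p - 1)"
      using At t by (simp add: powr_mult)
     also have "(A t * (1 - t)) powr (q / p - 1) * A t \<le> B powr (q / p - 1) * A t"
      using le At t qp by (intro mult_right_mono powr_mono2) auto
     finally show ?thesis .
    qed simp
    then show ?thesis using True a A0[of t] by (simp add: ennreal_mult[symmetric] ennreal_leI)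
   qed simp
  qed simp
  also have "\<dots> = ennreal (e * (q / p)) * (ennreal (B powr (q / p - 1)) * (\<integral>\<^sup>+t\<in>{0..<1}. ennreal (A t) \<partial>lborel))"
   by (subst nn_integral_cmult) auto
  also have "\<dots> \<le> ennreal (e * (q / p)) * (ennreal (B powr (q / p - 1)) * ennreal (4 * B))"
  proof (intro mult_left_mono)
   have "(\<integral>\<^sup>+t\<in>{0..<1}. ennreal (A t) \<partial>lborel) \<le> ennreal (4 * circle_mean p (R n) f)" using A by blast
   also have "\<dots> \<le> ennreal (4 * B)" using cm by (intro ennreal_leI) simp
   finally show "(\<integral>\<^sup>+t\<in>{0..<1}. ennreal (A t) \<partial>lborel) \<le> ennreal (4 * B)" .
  qed auto
  also have "\<dots> = ennreal (4 * (q / p) * e * (B powr (q / p - 1) * B))"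
  proof -
   have "ennreal (e * (q / p)) * (ennreal (B powr (q / p - 1)) * ennreal (4 * B)) = ennreal (e * (q / p) * (B powr (q / p - 1) * (4 * B)))"
    by (subst ennreal_mult[symmetric], simp, use B in simp, rule ennreal_mult[symmetric]) (use mult_nonneg_nonneg[of e "q / p"] e qp B in auto)
   also have "e * (q / p) * (B powr (q / p - 1) * (4 * B)) = 4 * (q / p) * e * (B powr (q / p - 1) * B)"
    by (simp only: mult_ac)
   finally show ?thesis .
  qed
  also have "B powr (q / p - 1) * B = B powr (q / p)"
   using B by (cases "B = 0") (auto simp: powr_diff)
  finally show "(\<integral>\<^sup>+t\<in>{a..<1}. ennreal (norm (f (of_real (R n * t))) powr q) \<partial>\<nu>) \<le> ennreal (4 * (q / p) * e * B powr (q / p))" .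
 qed
qed

lemma hardy_ball_closed:
 assumes p: "0 < p" and F: "\<And>n. F n \<in> hardy_ball p B" and g: "g \<in> disc_holomorphic"
  and lim: "\<And>z. norm z < 1 \<Longrightarrow> (\<lambda>n. F n z) \<longlonglongrightarrow> g z"
 shows "g \<in> hardy_ball p B"
proof -
 have "circle_mean p r g \<le> B" if r: "0 < r" "r < 1" for r
 proof -
  have m: "(\<lambda>\<theta>. ennreal (norm (F n (of_real r * cis \<theta>)) powr p) * indicator {0..<2*pi} \<theta>) \<in> borel_measurable lborel" for n
  proof -
   have [measurable]: "F n \<in> borel_measurable borel" using disc_holomorphic_measurable[OF hardy_ballD(1)[OF F]] .
   show ?thesis by measurable
  qed
  have "(\<integral>\<^sup>+\<theta>\<in>{0..<2*pi}. ennreal (norm (g (of_real r * cis \<theta>)) powr p) \<partial>lborel) \<le> ennreal (2 * pi * B)"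
  proof (rule nn_integral_fatou_le[OF m])
   fix \<theta>
   have "(\<lambda>n. F n (of_real r * cis \<theta>)) \<longlonglongrightarrow> g (of_real r * cis \<theta>)" using r by (intro lim) (simp add: norm_mult)
   then have "(\<lambda>n. norm (F n (of_real r * cis \<theta>)) powr p) \<longlonglongrightarrow> norm (g (of_real r * cis \<theta>)) powr p"
    using p by (intro tendsto_powr' tendsto_norm tendsto_const) auto
   then show "(\<lambda>n. ennreal (norm (F n (of_real r * cis \<theta>)) powr p) * indicator {0..<2*pi} \<theta>) \<longlonglongrightarrow> ennreal (norm (g (of_real r * cis \<theta>)) powr p) * indicator {0..<2*pi} \<theta>"
    by (cases "\<theta> \<in> {0..<2*pi}") (auto intro!: tendsto_ennrealI)
  next
   fix n
   have "(\<integral>\<^sup>+\<theta>\<in>{0..<2*pi}. ennreal (norm (F n (of_real r * cis \<theta>)) powr p) \<partial>lborel) = ennreal (2 * pi * circle_mean p r (F n))"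
    using nn_integral_circle_mean[OF hardy_ballD(2)[OF F] _ r(2) p] r by simp
   also have "\<dots> \<le> ennreal (2 * pi * B)" using hardy_ballD(3)[OF F r] by (intro ennreal_leI mult_left_mono) auto
   finally show "(\<integral>\<^sup>+\<theta>\<in>{0..<2*pi}. ennreal (norm (F n (of_real r * cis \<theta>)) powr p) \<partial>lborel) \<le> ennreal (2 * pi * B)" .
  qed
  then have "ennreal (2 * pi * circle_mean p r g) \<le> ennreal (2 * pi * B)"
   using nn_integral_circle_mean[OF disc_holomorphicD(1)[OF g] _ r(2) p] r by simp
  then show ?thesis using hardy_ball_nonneg[OF F p] by (subst (asm) ennreal_le_iff) auto
 qed
 then show ?thesis using g by (simp add: hardy_ball_def)
qed

lemma powr_add_le: "0 \<le> x \<Longrightarrow> 0 \<le> y \<Longrightarrow> 0 < p \<Longrightarrow> (x + y) powr p \<le> 2 powr p * (x powr p + y powr (p::real))"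
proof -
 assume *: "0 \<le> x" "0 \<le> y" "0 < p"
 have "(x + y) powr p \<le> (2 * max x y) powr p" using * by (intro powr_mono2) auto
 also have "\<dots> = 2 powr p * max x y powr p" using * by (simp add: powr_mult)
 also have "\<dots> \<le> 2 powr p * (x powr p + y powr p)" by (intro mult_left_mono) (auto simp: max_def)
 finally show ?thesis .
qed

lemma circle_mean_mono:
 assumes "f holomorphic_on ball 0 1" "0 < r" "r < 1" "0 < p"
  and "continuous_on {0..2*pi} h" "\<And>\<theta>. norm (f (of_real r * cis \<theta>)) powr p \<le> h \<theta>"
 shows "circle_mean p r f \<le> 1 / (2 * pi) * integral {0..2*pi} h"
 unfolding circle_mean_def
 using assms by (intro mult_left_mono integral_le integrable_continuous_real circle_mean_integrand(2)) auto

lemma hardy_ball_add: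
 assumes p: "0 < p" and f: "f \<in> hardy_ball p B" and g: "g \<in> hardy_ball p C"
 shows "(\<lambda>z. f z + g z) \<in> hardy_ball p (2 powr p * (B + C))"
proof -
 have "circle_mean p r (\<lambda>z. f z + g z) \<le> 2 powr p * (B + C)" if r: "0 < r" "r < 1" for r
 proof -
  let ?F = "\<lambda>\<theta>. norm (f (of_real r * cis \<theta>)) powr p" and ?G = "\<lambda>\<theta>. norm (g (of_real r * cis \<theta>)) powr p"
  have c: "continuous_on {0..2*pi} ?F" "continuous_on {0..2*pi} ?G"
   using r p by (auto intro!: circle_mean_integrand(2) hardy_ballD(2)[OF f] hardy_ballD(2)[OF g])
  have "circle_mean p r (\<lambda>z. f z + g z) \<le> 1 / (2 * pi) * integral {0..2*pi} (\<lambda>\<theta>. 2 powr p * (?F \<theta> + ?G \<theta>))"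
  proof (rule circle_mean_mono[OF _ r p])
   show "(\<lambda>z. f z + g z) holomorphic_on ball 0 1" by (intro holomorphic_intros hardy_ballD(2)[OF f] hardy_ballD(2)[OF g])
   show "continuous_on {0..2*pi} (\<lambda>\<theta>. 2 powr p * (?F \<theta> + ?G \<theta>))" by (intro continuous_on_mult continuous_on_add c continuous_on_const)
   fix \<theta>
   have "norm (f (of_real r * cis \<theta>) + g (of_real r * cis \<theta>)) powr p \<le> (norm (f (of_real r * cis \<theta>)) + norm (g (of_real r * cis \<theta>))) powr p"
    using p by (intro powr_mono2 norm_triangle_ineq) auto
   also have "\<dots> \<le> 2 powr p * (?F \<theta> + ?G \<theta>)" using p by (intro powr_add_le) auto
   finally show "norm (f (of_real r * cis \<theta>) + g (of_real r * cis \<theta>)) powr p \<le> 2 powr p * (?F \<theta> + ?G \<theta>)" .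
  qed
  also have "integral {0..2*pi} (\<lambda>\<theta>. 2 powr p * (?F \<theta> + ?G \<theta>)) = 2 powr p * (integral {0..2*pi} ?F + integral {0..2*pi} ?G)"
   by (simp add: integral_add integrable_continuous_real c)
  also have "1 / (2 * pi) * (2 powr p * (integral {0..2*pi} ?F + integral {0..2*pi} ?G)) = 2 powr p * (circle_mean p r f + circle_mean p r g)"
   unfolding circle_mean_def by (simp add: field_simps)
  also have "\<dots> \<le> 2 powr p * (B + C)" using hardy_ballD(3)[OF f r] hardy_ballD(3)[OF g r] by (intro mult_left_mono) auto
  finally show ?thesis .
 qed
 moreover have "(\<lambda>z. f z + g z) \<in> disc_holomorphic"
  using hardy_ballD(1)[OF f] hardy_ballD(1)[OF g] by (auto simp: disc_holomorphic_def intro!: holomorphic_intros)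
 ultimately show ?thesis by (simp add: hardy_ball_def)
qed

lemma hardy_ball_cmult:
 assumes p: "0 < p" and f: "f \<in> hardy_ball p B"
 shows "(\<lambda>z. c * f z) \<in> hardy_ball p (norm c powr p * B)"
proof -
 have "circle_mean p r (\<lambda>z. c * f z) = norm c powr p * circle_mean p r f" for r
  unfolding circle_mean_def by (simp add: norm_mult powr_mult)
 then show ?thesis using f by (auto simp: hardy_ball_def disc_holomorphic_def intro!: holomorphic_intros mult_left_mono)
qed

lemma hardy_ball_diff:
 assumes p: "0 < p" and f: "f \<in> hardy_ball p B" and g: "g \<in> hardy_ball p C"
 shows "(\<lambda>z. f z - g z) \<in> hardy_ball p (2 powr p * (B + C))"
 using hardy_ball_add[OF p f hardy_ball_cmult[OF p g, of "-1"]] by simp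

text \<open>x^p1 \<le> 1 + x^p for x \<ge> 0.\<close>

lemma hardy_ball_lower_exponent:
 assumes p: "0 < p1" "p1 \<le> p" and f: "f \<in> hardy_ball p B"
 shows "f \<in> hardy_ball p1 (1 + B)"
proof -
 have "circle_mean p1 r f \<le> 1 + B" if r: "0 < r" "r < 1" for r
 proof -
  let ?F = "\<lambda>\<theta>. norm (f (of_real r * cis \<theta>)) powr p"
  have c: "continuous_on {0..2*pi} ?F"
   using r p by (auto intro!: circle_mean_integrand(2) hardy_ballD(2)[OF f])
  have "circle_mean p1 r f \<le> 1 / (2 * pi) * integral {0..2*pi} (\<lambda>\<theta>. 1 + ?F \<theta>)"
  proof (rule circle_mean_mono[OF hardy_ballD(2)[OF f] r p(1)])
   show "continuous_on {0..2*pi} (\<lambda>\<theta>. 1 + ?F \<theta>)" by (intro continuous_on_add c continuous_on_const)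
   show "norm (f (of_real r * cis \<theta>)) powr p1 \<le> 1 + ?F \<theta>" for \<theta>
   proof (cases "1 \<le> norm (f (of_real r * cis \<theta>))")
    case True
    then have "norm (f (of_real r * cis \<theta>)) powr p1 \<le> ?F \<theta>" using p by (intro powr_mono) auto
    then show ?thesis by simp
   next
    case False
    then have "norm (f (of_real r * cis \<theta>)) powr p1 \<le> 1 powr p1" using p by (intro powr_mono2) auto
    then show ?thesis by (simp add: add_increasing2)
   qed
  qed
  also have "integral {0..2*pi} (\<lambda>\<theta>. 1 + ?F \<theta>) = 2 * pi + integral {0..2*pi} ?F"
   by (subst integral_add) (auto intro!: integrable_continuous_real c)
  also have "1 / (2 * pi) * (2 * pi + integral {0..2*pi} ?F) = 1 + circle_mean p r f"
   unfolding circle_mean_def by (simp add: field_simps)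
  also have "\<dots> \<le> 1 + B" using hardy_ballD(3)[OF f r] by simp
  finally show ?thesis .
 qed
 then show ?thesis using hardy_ballD(1)[OF f] by (simp add: hardy_ball_def)
qed

lemma compact_subset_unit_disc:
 assumes "compact K" "K \<subseteq> ball (0::complex) 1"
 obtains \<rho> where "0 \<le> \<rho>" "\<rho> < 1" "K \<subseteq> cball 0 \<rho>"
proof (cases "K = {}")
 case False
 obtain z where z: "z \<in> K" "\<And>w. w \<in> K \<Longrightarrow> norm w \<le> norm z"
  using continuous_attains_sup[OF assms(1) False, of norm] by (auto intro: continuous_intros)
 show ?thesis by (rule that[of "norm z"]) (use z assms(2) in auto)
qed (use that[of 0] in auto)

text \<open>Growth bounds give local boundedness, so Montel's theorem applies.\<close>

lemma hardy_montel:
 assumes p: "0 < p" and F: "\<And>n. F n \<in> hardy_ball p B"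
 obtains g r where "g \<in> hardy_ball p B" "strict_mono (r :: nat \<Rightarrow> nat)"
  "\<And>\<rho>. \<rho> < 1 \<Longrightarrow> uniform_limit (cball 0 \<rho>) (F \<circ> r) g sequentially"
proof -
 obtain g r where g: "g holomorphic_on ball 0 1" "strict_mono (r :: nat \<Rightarrow> nat)"
   "\<And>x. x \<in> ball 0 1 \<Longrightarrow> (\<lambda>n. F (r n) x) \<longlonglongrightarrow> g x"
   "\<And>K. compact K \<Longrightarrow> K \<subseteq> ball 0 1 \<Longrightarrow> uniform_limit K (F \<circ> r) g sequentially"
 proof (rule Montel[of "ball 0 1" "hardy_ball p B" F])
  fix K :: "complex set" assume K: "compact K" "K \<subseteq> ball 0 1"
  obtain \<rho> where \<rho>: "0 \<le> \<rho>" "\<rho> < 1" "K \<subseteq> cball 0 \<rho>" by (rule compact_subset_unit_disc[OF K]) (rule that)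
  have "norm (h z) \<le> (B / (1 - \<rho>)) powr (1/p)" if h: "h \<in> hardy_ball p B" and z: "z \<in> K" for h z
  proof -
   have nz: "norm z \<le> \<rho>" using \<rho> z by auto
   have "norm (h z) \<le> (B / (1 - norm z)) powr (1/p)" using hardy_growth(2)[OF p h] nz \<rho> by simp
   also have "\<dots> \<le> (B / (1 - \<rho>)) powr (1/p)"
    using nz \<rho> hardy_ball_nonneg[OF h p] p by (intro powr_mono2 divide_left_mono) auto
   finally show ?thesis .
  qed
  then show "\<exists>C. \<forall>h\<in>hardy_ball p B. \<forall>z\<in>K. norm (h z) \<le> C" by blast
 qed (use F in \<open>auto dest: hardy_ballD(2) intro: that\<close>)
 define g' where "g' = (\<lambda>z. if z \<in> ball 0 1 then g z else 0)"
 have g': "g' \<in> disc_holomorphic"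
  unfolding disc_holomorphic_def using g(1) by (auto simp: g'_def intro: holomorphic_transform)
 have lim: "(\<lambda>n. F (r n) z) \<longlonglongrightarrow> g' z" if "norm z < 1" for z
  using g(3)[of z] that by (simp add: g'_def)
 show ?thesis
 proof (rule that)
  show "g' \<in> hardy_ball p B" by (rule hardy_ball_closed[OF p F g' lim])
  show "strict_mono r" by fact
  fix \<rho> :: real assume \<rho>: "\<rho> < 1"
  have "uniform_limit (cball 0 \<rho>) (F \<circ> r) g sequentially" by (rule g(4)) (use \<rho> in auto)
  moreover have "uniform_limit (cball 0 \<rho>) (F \<circ> r) g' sequentially \<longleftrightarrow> uniform_limit (cball 0 \<rho>) (F \<circ> r) g sequentially"
   by (rule uniform_limit_cong') (use \<rho> in \<open>auto simp: g'_def\<close>)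
  ultimately show "uniform_limit (cball 0 \<rho>) (F \<circ> r) g' sequentially" by simp
 qed
qed

definition vanishing_tail :: "real measure \<Rightarrow> real \<Rightarrow> bool" where
 "vanishing_tail \<mu> s \<longleftrightarrow> (\<forall>e>0. \<exists>a. 0 \<le> a \<and> a < 1 \<and> tail_bound \<mu> a s e)"

lemma tendsto_zero_ennreal_le:
 fixes f :: "'a \<Rightarrow> ennreal"
 assumes "\<And>e. 0 < e \<Longrightarrow> \<forall>\<^sub>F x in F. f x \<le> ennreal e"
 shows "(f \<longlongrightarrow> 0) F"
proof (rule tendsto_zero_ennreal)
 fix e :: real assume e: "0 < e"
 have "\<forall>\<^sub>F x in F. f x \<le> ennreal (e / 2)" using assms e by simp
 then show "\<forall>\<^sub>F x in F. f x < ennreal e"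
  by eventually_elim (rule le_less_trans, assumption, use e in \<open>simp add: ennreal_lessI\<close>)
qed

text \<open>The common pattern of the limits of integrals below: uniform smallness near 1, uniform
convergence away from 1.\<close>

lemma nn_integral_to_zero_split:
 assumes \<nu>: "borel_measure_01 \<nu>" and fin: "emeasure \<nu> {0..<1} < \<infinity>"
  and [measurable]: "\<And>n. h n \<in> borel_measurable borel" and nn: "\<And>n t. 0 \<le> h n t"
  and tail: "\<And>e. 0 < e \<Longrightarrow> \<exists>a. 0 \<le> a \<and> a < 1 \<and> (\<forall>n. (\<integral>\<^sup>+t\<in>{a..<1}. ennreal (h n t) \<partial>\<nu>) \<le> ennreal e)"
  and unif: "\<And>a. a < 1 \<Longrightarrow> uniform_limit {0..a} h (\<lambda>t. 0) sequentially"
 shows "(\<lambda>n. \<integral>\<^sup>+t. ennreal (h n t) \<partial>\<nu>) \<longlonglongrightarrow> 0"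
proof (rule tendsto_zero_ennreal_le)
 fix e :: real assume e: "0 < e"
 obtain M where M: "emeasure \<nu> {0..<1} = ennreal M" "0 \<le> M" using fin by (cases "emeasure \<nu> {0..<1}") auto
 obtain a where a: "0 \<le> a" "a < 1" "\<And>n. (\<integral>\<^sup>+t\<in>{a..<1}. ennreal (h n t) \<partial>\<nu>) \<le> ennreal (e / 2)"
  using tail[of "e/2"] e by auto
 define d where "d = e / (2 * (M + 1))"
 have d: "0 < d" using e M by (simp add: d_def)
 have "\<forall>\<^sub>F n in sequentially. \<forall>t\<in>{0..a}. dist (h n t) 0 < d"
  using unif[OF a(2)] d by (simp add: uniform_limit_iff)
 then show "\<forall>\<^sub>F n in sequentially. (\<integral>\<^sup>+t. ennreal (h n t) \<partial>\<nu>) \<le> ennreal e"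
 proof eventually_elim
  case (elim n)
  have hm: "(\<lambda>t. ennreal (h n t) * indicator A t) \<in> borel_measurable \<nu>" if "A \<in> sets borel" for A
   by (rule borel_measure_01D(4)[OF \<nu>]) (use that in measurable)
  have "(\<integral>\<^sup>+t. ennreal (h n t) \<partial>\<nu>) \<le> (\<integral>\<^sup>+t. ennreal (h n t) * indicator {0..a} t + ennreal (h n t) * indicator {a..<1} t \<partial>\<nu>)"
   using borel_measure_01D(2)[OF \<nu>] by (intro nn_integral_mono) (auto simp: indicator_def)
  also have "\<dots> = (\<integral>\<^sup>+t\<in>{0..a}. ennreal (h n t) \<partial>\<nu>) + (\<integral>\<^sup>+t\<in>{a..<1}. ennreal (h n t) \<partial>\<nu>)"
   by (intro nn_integral_add hm) auto
  also have "\<dots> \<le> ennreal (e / 2) + ennreal (e / 2)"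
  proof (rule add_mono[OF _ a(3)])
   have "(\<integral>\<^sup>+t\<in>{0..a}. ennreal (h n t) \<partial>\<nu>) \<le> (\<integral>\<^sup>+t. ennreal d \<partial>\<nu>)"
    using elim nn[of n] by (intro nn_integral_mono) (auto simp: indicator_def dist_real_def less_imp_le intro!: ennreal_leI)
   also have "\<dots> = ennreal (d * M)" using borel_measure_01D(2)[OF \<nu>] M d by (simp add: ennreal_mult)
   also have "\<dots> \<le> ennreal (e / 2)"
   proof (rule ennreal_leI)
    have "d * M \<le> d * (M + 1)" using d by simp
    also have "\<dots> = e / 2" using M by (simp add: d_def field_simps)
    finally show "d * M \<le> e / 2" .
   qed
   finally show "(\<integral>\<^sup>+t\<in>{0..a}. ennreal (h n t) \<partial>\<nu>) \<le> ennreal (e / 2)" .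
  qed
  also have "\<dots> = ennreal e" using e by (subst ennreal_plus[symmetric]) auto
  finally show ?case .
 qed
qed

lemma carleson_embedding_vanishing:
 assumes p: "0 < p" "p \<le> q" and F: "\<And>n. F n \<in> hardy_ball p B"
  and \<nu>: "borel_measure_01 \<nu>" and fin: "emeasure \<nu> {0..<1} < \<infinity>" and van: "vanishing_tail \<nu> (q / p)"
  and unif: "\<And>a. a < 1 \<Longrightarrow> uniform_limit (cball 0 a) F (\<lambda>z. 0) sequentially"
 shows "(\<lambda>n. \<integral>\<^sup>+t. ennreal (norm (F n (of_real t)) powr q) \<partial>\<nu>) \<longlonglongrightarrow> 0"
proof (rule nn_integral_to_zero_split[OF \<nu> fin])
 show "(\<lambda>t. norm (F n (of_real t)) powr q) \<in> borel_measurable borel" for n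
 proof -
  have [measurable]: "F n \<in> borel_measurable borel" using disc_holomorphic_measurable[OF hardy_ballD(1)[OF F]] .
  show ?thesis by measurable
 qed
 fix e :: real assume e: "0 < e"
 define C where "C = 4 * (q / p) * B powr (q / p) + 1"
 have C: "0 < C" using p by (auto simp: C_def intro!: add_nonneg_pos)
 obtain a where a: "0 \<le> a" "a < 1" "tail_bound \<nu> a (q / p) (e / C)"
  using van e C unfolding vanishing_tail_def by (metis divide_pos_pos)
 have "(\<integral>\<^sup>+t\<in>{a..<1}. ennreal (norm (F n (of_real t)) powr q) \<partial>\<nu>) \<le> ennreal e" for n
 proof -
  have "(\<integral>\<^sup>+t\<in>{a..<1}. ennreal (norm (F n (of_real t)) powr q) \<partial>\<nu>) \<le> ennreal (4 * (q / p) * (e / C) * B powr (q / p))"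
   by (rule carleson_embedding[OF p F \<nu> a(1,2) _ a(3)]) (use e C in auto)
  also have "4 * (q / p) * (e / C) * B powr (q / p) = (C - 1) * (e / C)" by (simp add: C_def)
  also have "\<dots> \<le> C * (e / C)" using e C by (intro mult_right_mono) auto
  also have "C * (e / C) = e" using C by simp
  finally show ?thesis by (simp add: ennreal_leI)
 qed
 then show "\<exists>a. 0 \<le> a \<and> a < 1 \<and> (\<forall>n. (\<integral>\<^sup>+t\<in>{a..<1}. ennreal (norm (F n (of_real t)) powr q) \<partial>\<nu>) \<le> ennreal e)"
  using a by blast
next
 fix a :: real assume a: "a < 1"
 have q: "0 < q" using p by simp
 show "uniform_limit {0..a} (\<lambda>n t. norm (F n (of_real t)) powr q) (\<lambda>t. 0) sequentially"
  unfolding uniform_limit_iff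
 proof (intro allI impI)
  fix e :: real assume e: "0 < e"
  have "\<forall>\<^sub>F n in sequentially. \<forall>z\<in>cball 0 a. dist (F n z) 0 < e powr (1/q)"
   using unif[OF a] e unfolding uniform_limit_iff by simp
  then show "\<forall>\<^sub>F n in sequentially. \<forall>t\<in>{0..a}. dist (norm (F n (of_real t)) powr q) 0 < e"
  proof (rule eventually_mono, intro ballI)
   fix n t assume *: "\<forall>z\<in>cball 0 a. dist (F n z) 0 < e powr (1/q)" and t: "t \<in> {0..a}"
   then have "norm (F n (of_real t)) < e powr (1/q)" by auto
   then have "norm (F n (of_real t)) powr q < (e powr (1/q)) powr q" using q by (intro powr_less_mono2) auto
   also have "\<dots> = e" using e q by (simp add: powr_powr)
   finally show "dist (norm (F n (of_real t)) powr q) 0 < e" by simp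
  qed
 qed
qed simp

lemma fourier_coefficient:
 fixes d :: "nat \<Rightarrow> complex"
 assumes "summable (\<lambda>k. norm (d k))"
 shows "((\<lambda>\<theta>. (\<Sum>j. d j * cis (real j * \<theta>)) * cis (- (real k * \<theta>))) has_integral (2 * of_real pi * d k)) {0..2*pi}"
proof -
 define S where "S = (\<lambda>N \<theta>. (\<Sum>j<N. d j * cis (real j * \<theta>)) * cis (- (real k * \<theta>)))"
 define h where "h = (\<lambda>\<theta>. (\<Sum>j. d j * cis (real j * \<theta>)) * cis (- (real k * \<theta>)))"
 have lim0: "uniform_limit (cbox 0 (2*pi)) (\<lambda>N \<theta>. \<Sum>j<N. d j * cis (real j * \<theta>)) (\<lambda>\<theta>. \<Sum>j. d j * cis (real j * \<theta>)) sequentially"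
  by (rule Weierstrass_m_test[OF _ assms]) (simp add: norm_mult)
 have lim: "uniform_limit (cbox 0 (2*pi)) S h sequentially"
  unfolding uniform_limit_iff
 proof (intro allI impI)
  fix e :: real assume "0 < e"
  then have "\<forall>\<^sub>F N in sequentially. \<forall>\<theta>\<in>cbox 0 (2*pi). dist (\<Sum>j<N. d j * cis (real j * \<theta>)) (\<Sum>j. d j * cis (real j * \<theta>)) < e"
   using lim0 unfolding uniform_limit_iff by blast
  then show "\<forall>\<^sub>F N in sequentially. \<forall>\<theta>\<in>cbox 0 (2*pi). dist (S N \<theta>) (h \<theta>) < e"
   by eventually_elim (simp add: S_def h_def dist_norm left_diff_distrib[symmetric] norm_mult)
 qed
 obtain I J where IJ: "\<And>N. (S N has_integral I N) (cbox 0 (2*pi))" "(h has_integral J) (cbox 0 (2*pi))" "I \<longlonglongrightarrow> J"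
  by (rule uniform_limit_integral_cbox[OF lim]) (auto intro!: continuous_intros simp: S_def)
 have "I N = 2 * of_real pi * d k" if N: "k < N" for N
 proof -
  have "((\<lambda>\<theta>. \<Sum>j<N. d j * cis (of_int (int j - int k) * \<theta>)) has_integral (\<Sum>j<N. d j * (if int j - int k = 0 then 2 * of_real pi else 0))) {0..2*pi}"
   by (intro has_integral_sum has_integral_mult_right has_integral_cis) auto
  also have "(\<lambda>\<theta>. \<Sum>j<N. d j * cis (of_int (int j - int k) * \<theta>)) = S N"
   by (intro ext) (simp add: S_def sum_distrib_right mult.assoc cis_mult left_diff_distrib)
  also have "(\<Sum>j<N. d j * (if int j - int k = 0 then 2 * of_real pi else 0)) = (\<Sum>j<N. if j = k then d k * (2 * of_real pi) else 0)"
   by (intro sum.cong) auto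
  also have "\<dots> = 2 * of_real pi * d k" using N by simp
  finally show ?thesis using IJ(1)[of N] by (metis has_integral_unique cbox_interval)
 qed
 then have "\<forall>\<^sub>F N in sequentially. I N = 2 * of_real pi * d k" by (rule eventually_mono[OF eventually_gt_at_top[of k]])
 then have "I \<longlonglongrightarrow> 2 * of_real pi * d k" by (rule tendsto_eventually)
 then have "J = 2 * of_real pi * d k" using IJ(3) LIMSEQ_unique by blast
 then show ?thesis using IJ(2) by (simp add: h_def)
qed

lemma taylor_series:
 assumes "f \<in> disc_holomorphic" "norm z < 1"
 shows "(\<lambda>k. taylor_coeff f k * z ^ k) sums f z" "summable (\<lambda>k. norm (taylor_coeff f k * z ^ k))"
proof -
 have s: "(\<lambda>k. taylor_coeff f k * w ^ k) sums f w" if "norm w < 1" for w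
  using holomorphic_power_series[OF disc_holomorphicD(1)[OF assms(1)], of w] that by (simp add: taylor_coeff_def)
 show "(\<lambda>k. taylor_coeff f k * z ^ k) sums f z" using s assms by blast
 obtain r where r: "norm z < r" "r < 1" using dense assms(2) by blast
 have "summable (\<lambda>k. taylor_coeff f k * of_real r ^ k)"
  using s[of "of_real r"] r norm_ge_zero[of z] by (auto simp: sums_iff simp del: norm_ge_zero)
 then show "summable (\<lambda>k. norm (taylor_coeff f k * z ^ k))"
  by (rule powser_insidea) (use r norm_ge_zero[of z] in \<open>auto simp del: norm_ge_zero\<close>)
qed

text \<open>For p \<le> 1 the integrand of Cauchy's formula is at most S^(1 - p) |f|^p, where S bounds |f| on
the circle by the growth estimate.\<close>

lemma hardy_coefficient_bound:
 assumes p: "0 < p" "p \<le> 1" and f: "f \<in> hardy_ball p B"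
 shows "norm (taylor_coeff f k) \<le> 2 * B * (2 * B) powr (1/p - 1) * real (k + 1) powr (1/p - 1)"
proof -
 have B: "0 \<le> B" using hardy_ball_nonneg[OF f p(1)] .
 \<comment> \<open>At this radius 1 / (1 - R) is comparable to k and R^k stays above 1/2.\<close>
 define R where "R = 1 - 1 / (2 * real (k + 1))"
 have R: "0 < R" "R < 1" by (auto simp: R_def field_simps)
 have R1: "1 / (1 - R) = 2 * real (k + 1)" by (simp add: R_def)
 define h where "h = (\<lambda>\<theta>. f (of_real R * cis \<theta>) * cis (- (real k * \<theta>)))"
 have sum: "f (of_real R * cis \<theta>) = (\<Sum>j. taylor_coeff f j * of_real R ^ j * cis (real j * \<theta>))" for \<theta>
 proof -
  have "(\<lambda>j. taylor_coeff f j * (of_real R * cis \<theta>) ^ j) sums f (of_real R * cis \<theta>)"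
   using R by (intro taylor_series hardy_ballD(1)[OF f]) (simp add: norm_mult)
  moreover have "taylor_coeff f j * (of_real R * cis \<theta>) ^ j = taylor_coeff f j * of_real R ^ j * cis (real j * \<theta>)" for j
   by (simp only: power_mult_distrib Complex.DeMoivre mult.assoc)
  ultimately show ?thesis by (simp only: sums_unique)
 qed
 have hint: "(h has_integral (2 * of_real pi * (taylor_coeff f k * of_real R ^ k))) {0..2*pi}"
  unfolding h_def sum by (rule fourier_coefficient) (use taylor_series(2)[OF hardy_ballD(1)[OF f], of "of_real R"] R in simp)
 define S where "S = (B * (2 * real (k + 1))) powr (1/p)"
 have c: "continuous_on {0..2*pi} (\<lambda>\<theta>. norm (f (of_real R * cis \<theta>)) powr p)"
  using R p by (intro circle_mean_integrand(2) hardy_ballD(2)[OF f]) auto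
 have "norm (integral {0..2*pi} h) \<le> integral {0..2*pi} (\<lambda>\<theta>. S powr (1 - p) * norm (f (of_real R * cis \<theta>)) powr p)"
 proof (rule integral_norm_bound_integral)
  show "h integrable_on {0..2*pi}" using hint by blast
  show "(\<lambda>\<theta>. S powr (1 - p) * norm (f (of_real R * cis \<theta>)) powr p) integrable_on {0..2*pi}"
   by (intro integrable_continuous_real continuous_on_mult c continuous_on_const)
  fix \<theta>
  let ?x = "norm (f (of_real R * cis \<theta>))"
  have "?x \<le> (B / (1 - norm (of_real R * cis \<theta>))) powr (1/p)"
   using R by (intro hardy_growth(2)[OF p(1) f]) (simp add: norm_mult)
  also have "\<dots> = S" using R R1 by (simp add: norm_mult S_def divide_inverse)
  finally have x: "?x \<le> S" .
  have "?x = ?x powr (1 - p) * ?x powr p" by (simp add: powr_add[symmetric])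
  also have "\<dots> \<le> S powr (1 - p) * ?x powr p" using x p by (intro mult_right_mono powr_mono2) auto
  finally show "norm (h \<theta>) \<le> S powr (1 - p) * ?x powr p" by (simp add: h_def norm_mult)
 qed
 also have "\<dots> = S powr (1 - p) * integral {0..2*pi} (\<lambda>\<theta>. norm (f (of_real R * cis \<theta>)) powr p)"
  by simp
 also have "\<dots> = S powr (1 - p) * (2 * pi * circle_mean p R f)" by (simp add: circle_mean_def)
 also have "\<dots> \<le> S powr (1 - p) * (2 * pi * B)" using hardy_ballD(3)[OF f R] by (intro mult_left_mono) auto
 finally have "2 * pi * (norm (taylor_coeff f k) * R ^ k) \<le> 2 * pi * (S powr (1 - p) * B)"
  using R by (simp add: integral_unique[OF hint] norm_mult norm_power)
 then have 1: "norm (taylor_coeff f k) * R ^ k \<le> S powr (1 - p) * B" by simp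
 have "1 + real k * (- (1 / (2 * real (k + 1)))) \<le> (1 + (- (1 / (2 * real (k + 1))))) ^ k"
  by (rule Bernoulli_inequality) (simp add: field_simps)
 moreover have "real k * (1 / (2 * real (k + 1))) \<le> 1 / 2" by (simp add: field_simps)
 moreover have "1 + (- (1 / (2 * real (k + 1)))) = R" by (simp add: R_def)
 ultimately have Rk: "1 / 2 \<le> R ^ k" by (simp only:)
 have "norm (taylor_coeff f k) * (1/2) \<le> norm (taylor_coeff f k) * R ^ k" using Rk by (intro mult_left_mono) auto
 with 1 have "norm (taylor_coeff f k) \<le> 2 * (S powr (1 - p) * B)" by linarith
 then have "norm (taylor_coeff f k) \<le> 2 * B * S powr (1 - p)" by (simp only: mult_ac)
 also have "S powr (1 - p) = (2 * B) powr (1/p - 1) * real (k + 1) powr (1/p - 1)"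
 proof -
  have "S powr (1 - p) = (2 * B * real (k + 1)) powr (1/p - 1)"
   using p by (simp add: S_def powr_powr field_simps)
  also have "\<dots> = (2 * B) powr (1/p - 1) * real (k + 1) powr (1/p - 1)" using B by (simp add: powr_mult)
  finally show ?thesis .
 qed
 finally show ?thesis by (simp add: mult_ac)
qed

section \<open>Tail conditions and moments\<close>

lemma emeasure_divide_le_iff:
 fixes X :: ennreal
 assumes "0 < d" "0 \<le> e"
 shows "X / ennreal d \<le> ennreal e \<longleftrightarrow> X \<le> ennreal (e * d)"
proof (cases X)
 case (real x)
 then show ?thesis using assms by (simp add: divide_ennreal pos_divide_le_eq)
next
 case top
 then show ?thesis using assms by (simp add: ennreal_top_divide top_unique)
qed

lemma vanishing_log_carleson_iff:
 "vanishing_log_carleson b s \<mu> \<longleftrightarrow> (\<forall>e>0. \<exists>a. 0 \<le> a \<and> a < 1 \<and>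
   (\<forall>t. a \<le> t \<and> t < 1 \<longrightarrow> ennreal (ln (2 / (1 - t)) powr b) * emeasure \<mu> {t..<1} \<le> ennreal (e * (1 - t) powr s)))"
 (is "_ \<longleftrightarrow> (\<forall>e>0. \<exists>a. 0 \<le> a \<and> a < 1 \<and> ?P e a)")
proof -
 let ?f = "\<lambda>t. ennreal (ln (2 / (1 - t)) powr b) * emeasure \<mu> {t..<1} / ennreal ((1 - t) powr s)"
 have iff: "?f t \<le> ennreal e \<longleftrightarrow> ennreal (ln (2 / (1 - t)) powr b) * emeasure \<mu> {t..<1} \<le> ennreal (e * (1 - t) powr s)"
  if "t < 1" "0 < e" for t e using that by (intro emeasure_divide_le_iff) auto
 show ?thesis
 proof
  assume "vanishing_log_carleson b s \<mu>"
  then have lim: "(?f \<longlongrightarrow> 0) (at_left 1)" by (simp add: vanishing_log_carleson_def)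
  show "\<forall>e>0. \<exists>a. 0 \<le> a \<and> a < 1 \<and> ?P e a"
  proof (intro allI impI)
   fix e :: real assume e: "0 < e"
   have "\<forall>\<^sub>F t in at_left 1. ?f t < ennreal e" using order_tendstoD(2)[OF lim, of "ennreal e"] e by simp
   then obtain b' where b': "b' < 1" "\<And>t. b' < t \<Longrightarrow> t < 1 \<Longrightarrow> ?f t < ennreal e"
    unfolding eventually_at_left_field by blast
   define a where "a = max 0 ((b' + 1) / 2)"
   have a: "0 \<le> a" "a < 1" "b' < a" using b'(1) by (auto simp: a_def less_max_iff_disj)
   have "?P e a"
   proof (intro allI impI)
    fix t assume t: "a \<le> t \<and> t < 1"
    then have "?f t \<le> ennreal e" using b'(2)[of t] a by (simp add: less_imp_le)
    then show "ennreal (ln (2 / (1 - t)) powr b) * emeasure \<mu> {t..<1} \<le> ennreal (e * (1 - t) powr s)"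
     using iff[of t e] t e by blast
   qed
   then show "\<exists>a. 0 \<le> a \<and> a < 1 \<and> ?P e a" using a by blast
  qed
 next
  assume R: "\<forall>e>0. \<exists>a. 0 \<le> a \<and> a < 1 \<and> ?P e a"
  have "(?f \<longlongrightarrow> 0) (at_left 1)"
  proof (rule tendsto_zero_ennreal_le)
   fix e :: real assume e: "0 < e"
   obtain a where a: "0 \<le> a" "a < 1" "?P e a" using R e by blast
   have "?f t \<le> ennreal e" if "a < t" "t < 1" for t
    using iff[of t e] a(3) that e by (simp add: less_imp_le)
   then show "\<forall>\<^sub>F t in at_left 1. ?f t \<le> ennreal e"
    unfolding eventually_at_left_field using a(2) by blast
  qed
  then show "vanishing_log_carleson b s \<mu>" by (simp add: vanishing_log_carleson_def)
 qed
qed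

lemma vanishing_carleson_iff: "vanishing_carleson s \<mu> \<longleftrightarrow> vanishing_tail \<mu> s"
proof -
 have "ln (2 / (1 - t)) powr 0 = 1" if "0 \<le> t" "t < 1" for t :: real
 proof -
  have "1 < 2 / (1 - t)" using that by (simp add: field_simps)
  then have "0 < ln (2 / (1 - t))" by (rule ln_gt_zero)
  then show ?thesis by simp
 qed
 then have "(\<forall>t. a \<le> t \<and> t < 1 \<longrightarrow> ennreal (ln (2 / (1 - t)) powr 0) * emeasure \<mu> {t..<1} \<le> ennreal (e * (1 - t) powr s)) \<longleftrightarrow> tail_bound \<mu> a s e"
  if "0 \<le> a" for a e using that unfolding tail_bound_def by (simp add: order_trans)
 then show ?thesis unfolding vanishing_log_carleson_iff vanishing_tail_def by (simp cong: conj_cong)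
qed

lemma carleson_tail_bound:
 assumes "carleson s \<mu>"
 obtains C where "0 < C" "tail_bound \<mu> 0 s C"
proof -
 obtain C where C: "0 < C" "\<And>t. 0 \<le> t \<Longrightarrow> t < 1 \<Longrightarrow> ennreal (ln (2 / (1 - t)) powr 0) * emeasure \<mu> {t..<1} \<le> ennreal (C * (1 - t) powr s)"
  using assms unfolding log_carleson_def by blast
 have "emeasure \<mu> {t..<1} \<le> ennreal (C * (1 - t) powr s)" if t: "0 \<le> t" "t < 1" for t
 proof -
  have "1 < 2 / (1 - t)" using t by (simp add: field_simps)
  then have "0 < ln (2 / (1 - t))" by (rule ln_gt_zero)
  then show ?thesis using C(2)[OF t] by simp
 qed
 then show ?thesis using C(1) by (intro that[of C]) (auto simp: tail_bound_def)
qed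

lemma tail_bound_0_finite: "tail_bound \<mu> 0 s C \<Longrightarrow> emeasure \<mu> {0..<1} < \<infinity>"
 unfolding tail_bound_def by (metis ennreal_less_top infinity_ennreal_def le_less_trans order_refl zero_less_one)

lemma tail_bound_weaken:
 assumes "tail_bound \<mu> a s e" "0 \<le> a" "s' \<le> s" "e \<le> e'" "0 \<le> e'"
 shows "tail_bound \<mu> a s' e'"
 unfolding tail_bound_def
proof (intro allI impI)
 fix t assume t: "a \<le> t \<and> t < 1"
 have "emeasure \<mu> {t..<1} \<le> ennreal (e * (1 - t) powr s)" using assms(1) t by (simp add: tail_bound_def)
 also have "\<dots> \<le> ennreal (e' * (1 - t) powr s')"
 proof (rule ennreal_leI)
  have "e * (1 - t) powr s \<le> e' * (1 - t) powr s" using assms by (intro mult_right_mono) auto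
  also have "\<dots> \<le> e' * (1 - t) powr s'" using assms t by (intro mult_left_mono powr_mono') auto
  finally show "e * (1 - t) powr s \<le> e' * (1 - t) powr s'" .
 qed
 finally show "emeasure \<mu> {t..<1} \<le> ennreal (e' * (1 - t) powr s')" .
qed

lemma vanishing_tail_weaken: "vanishing_tail \<mu> s \<Longrightarrow> s' \<le> s \<Longrightarrow> vanishing_tail \<mu> s'"
 unfolding vanishing_tail_def by (meson less_imp_le order_refl tail_bound_weaken)

lemma tail_bound_imp_vanishing:
 assumes "0 \<le> a0" "a0 < 1" "tail_bound \<mu> a0 s C" "0 \<le> C" "s' < s"
 shows "vanishing_tail \<mu> s'"
 unfolding vanishing_tail_def
proof (intro allI impI)
 fix e :: real assume e: "0 < e"
 define d where "d = (e / (C + 1)) powr (1 / (s - s'))"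
 have d: "0 < d" "C * d powr (s - s') \<le> e"
 proof -
  show "0 < d" using e assms by (simp add: d_def)
  have "d powr (s - s') = e / (C + 1)" using e assms by (simp add: d_def powr_powr)
  then have "C * d powr (s - s') = C * (e / (C + 1))" by simp
  also have "\<dots> \<le> (C + 1) * (e / (C + 1))" using e assms by (intro mult_right_mono) auto
  also have "\<dots> = e" using assms by simp
  finally show "C * d powr (s - s') \<le> e" .
 qed
 define a where "a = max a0 (1 - d)"
 have "tail_bound \<mu> a s' e"
  unfolding tail_bound_def
 proof (intro allI impI)
  fix t assume t: "a \<le> t \<and> t < 1"
  then have t': "a0 \<le> t" "1 - t \<le> d" "t < 1" by (auto simp: a_def)
  have "emeasure \<mu> {t..<1} \<le> ennreal (C * (1 - t) powr s)" using assms(3) t' by (simp add: tail_bound_def)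
  also have "\<dots> \<le> ennreal (e * (1 - t) powr s')"
  proof (rule ennreal_leI)
   have "(1 - t) powr s = (1 - t) powr (s - s') * (1 - t) powr s'" by (simp add: powr_add[symmetric])
   then have "C * (1 - t) powr s = C * (1 - t) powr (s - s') * (1 - t) powr s'" by simp
   also have "\<dots> \<le> C * d powr (s - s') * (1 - t) powr s'"
    using t' assms by (intro mult_right_mono mult_left_mono powr_mono2) auto
   also have "\<dots> \<le> e * (1 - t) powr s'" using d by (intro mult_right_mono) auto
   finally show "C * (1 - t) powr s \<le> e * (1 - t) powr s'" .
  qed
  finally show "emeasure \<mu> {t..<1} \<le> ennreal (e * (1 - t) powr s')" .
 qed
 then show "\<exists>a. 0 \<le> a \<and> a < 1 \<and> tail_bound \<mu> a s' e"
  using assms d by (intro exI[of _ a]) (auto simp: a_def)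
qed

definition moment :: "real measure \<Rightarrow> nat \<Rightarrow> real" where "moment \<mu> k = (LINT t|\<mu>. t ^ k)"

lemma finite_measure_01:
 assumes "borel_measure_01 \<mu>" "emeasure \<mu> {0..<1} < \<infinity>"
 shows "finite_measure \<mu>"
 by (rule finite_measureI) (use assms borel_measure_01D(2)[OF assms(1)] in auto)

lemma integrable_power_01:
 assumes "borel_measure_01 \<mu>" "emeasure \<mu> {0..<1} < \<infinity>"
 shows "integrable \<mu> (\<lambda>t. t ^ k :: real)"
proof -
 interpret finite_measure \<mu> by (rule finite_measure_01[OF assms])
 show ?thesis
  by (rule integrable_const_bound[of _ 1], rule AE_I2)
    (auto simp: borel_measure_01D(2)[OF assms(1)] power_le_one intro!: borel_measure_01D(4)[OF assms(1)])
qed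

lemma moment_nonneg: "borel_measure_01 \<mu> \<Longrightarrow> 0 \<le> moment \<mu> k"
 unfolding moment_def by (rule Bochner_Integration.integral_nonneg) (simp add: borel_measure_01D(2))

lemma moment_antimono:
 assumes "borel_measure_01 \<mu>" "emeasure \<mu> {0..<1} < \<infinity>" "k \<le> l"
 shows "moment \<mu> l \<le> moment \<mu> k"
 unfolding moment_def using assms(3)
 by (intro integral_mono integrable_power_01 assms) (auto simp: borel_measure_01D(2)[OF assms(1)] intro!: power_decreasing)

lemma ennreal_moment:
 assumes "borel_measure_01 \<mu>" "emeasure \<mu> {0..<1} < \<infinity>"
 shows "ennreal (moment \<mu> k) = (\<integral>\<^sup>+t. ennreal (t ^ k) \<partial>\<mu>)"
 unfolding moment_def
 by (rule nn_integral_eq_integral[symmetric, OF integrable_power_01[OF assms]], rule AE_I2) (simp add: borel_measure_01D(2)[OF assms(1)])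

lemma exp_minus_le_powr:
 fixes x y :: real
 assumes "0 \<le> x" "1 \<le> y"
 shows "exp (-x) \<le> y powr y * (1 + x) powr (-y)"
proof -
 have "(1 + x) / y \<le> 1 + x / y" using assms by (simp add: field_simps)
 also have "\<dots> \<le> exp (x / y)" by (rule exp_ge_add_one_self)
 finally have "((1 + x) / y) powr y \<le> exp (x / y) powr y" using assms by (intro powr_mono2) auto
 also have "exp (x / y) powr y = exp x" using assms by (simp add: powr_def)
 finally have le: "((1 + x) / y) powr y \<le> exp x" .
 have pos: "0 < ((1 + x) / y) powr y" using assms by simp
 have "exp (-x) = 1 / exp x" by (simp add: exp_minus divide_inverse)
 also have "\<dots> \<le> 1 / (((1 + x) / y) powr y)" using le pos by (intro divide_left_mono) auto
 also have "\<dots> = y powr y * (1 + x) powr (-y)" using assms by (simp add: powr_divide powr_minus_divide)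
 finally show ?thesis .
qed

text \<open>Replaces t^k, which is not of kernel type, by a kernel with r = 1 - 1/(k + 1), so that the
estimates for power kernels also govern moments.\<close>

lemma power_le_kernel:
 fixes t :: real
 assumes t: "0 \<le> t" "t < 1" and y: "1 \<le> y"
 shows "t ^ k \<le> exp 1 * y powr y * (1 / real (k + 1)) powr y * (1 - t * (1 - 1 / real (k + 1))) powr (-y)"
proof -
 define d where "d = 1 / real (k + 1)"
 have d: "0 < d" "d \<le> 1" by (auto simp: d_def)
 have "t \<le> exp (t - 1)" using exp_ge_add_one_self[of "t - 1"] by simp
 then have "t ^ k \<le> exp (t - 1) ^ k" using t by (intro power_mono) auto
 also have "\<dots> = exp (real k * (t - 1))" by (simp add: exp_of_nat_mult[symmetric])
 also have "\<dots> \<le> exp (1 + - (real (k + 1) * (1 - t)))" using t by (simp add: algebra_simps)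
 also have "\<dots> = exp 1 * exp (- (real (k + 1) * (1 - t)))" by (simp only: exp_add)
 also have "\<dots> \<le> exp 1 * (y powr y * (1 + real (k + 1) * (1 - t)) powr (-y))"
  using t y by (intro mult_left_mono exp_minus_le_powr) auto
 also have "\<dots> \<le> exp 1 * (y powr y * ((1 - t * (1 - d)) / d) powr (-y))"
 proof (intro mult_left_mono powr_mono2')
  have "t * (1 - d) \<le> 1 * (1 - d)" using t d by (intro mult_right_mono) auto
  then show "0 < (1 - t * (1 - d)) / d" using d by (intro divide_pos_pos) auto
  have "1 - t * (1 - d) \<le> d + (1 - t)" using mult_left_le[of d t] t d by (simp add: algebra_simps)
  then have "(1 - t * (1 - d)) / d \<le> (d + (1 - t)) / d" using d by (intro divide_right_mono) auto
  also have "\<dots> = 1 + real (k + 1) * (1 - t)" by (simp add: d_def field_simps)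
  finally show "(1 - t * (1 - d)) / d \<le> 1 + real (k + 1) * (1 - t)" .
 qed (use y in auto)
 also have "((1 - t * (1 - d)) / d) powr (-y) = d powr y * (1 - t * (1 - d)) powr (-y)"
 proof -
  have "t * (1 - d) \<le> 1" using t d mult_mono[of t 1 "1 - d" 1] by auto
  then show ?thesis using d by (simp add: powr_divide powr_minus field_simps)
 qed
 finally show ?thesis by (simp add: d_def mult_ac)
qed

text \<open>The kernel exponent y = s + 1 exceeds s, which makes the tail part a small multiple of k^(-s).\<close>

lemma moment_little_o:
 assumes \<mu>: "borel_measure_01 \<mu>" and fin: "emeasure \<mu> {0..<1} < \<infinity>" and s: "0 < s" and van: "vanishing_tail \<mu> s"
 shows "(\<lambda>k. real (k + 1) powr s * moment \<mu> k) \<longlonglongrightarrow> 0"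
proof -
 define h where "h = (\<lambda>k t. real (k + 1) powr s * (if 0 \<le> t \<and> t < 1 then t ^ k else 0))"
 have "(\<lambda>k. \<integral>\<^sup>+t. ennreal (h k t) \<partial>\<mu>) \<longlonglongrightarrow> 0"
 proof (rule nn_integral_to_zero_split[OF \<mu> fin])
  show "h n \<in> borel_measurable borel" for n unfolding h_def by measurable
  show "0 \<le> h n t" for n t by (simp add: h_def)
  fix e :: real assume e: "0 < e"
  define y where "y = s + 1"
  define K where "K = exp 1 * y powr y * (s * kernel_const (s - 0) y)"
  have K: "0 < K" using s kernel_const_pos[of s y] by (simp add: K_def y_def)
  obtain a where a: "0 \<le> a" "a < 1" "tail_bound \<mu> a s (e / K)"
   using van e K unfolding vanishing_tail_def by (meson divide_pos_pos)
  have "(\<integral>\<^sup>+t\<in>{a..<1}. ennreal (h k t) \<partial>\<mu>) \<le> ennreal e" for k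
  proof -
   define d where "d = 1 / real (k + 1)"
   have d: "0 < d" "d \<le> 1" by (auto simp: d_def)
   have ds: "real (k + 1) powr s = d powr (-s)" by (simp add: d_def powr_divide powr_minus_divide)
   define c where "c = d powr (-s) * (exp 1 * y powr y * d powr y)"
   have "(\<integral>\<^sup>+t\<in>{a..<1}. ennreal (h k t) \<partial>\<mu>) \<le>
     (\<integral>\<^sup>+t. ennreal c * (ennreal ((1 - t) powr (-0) * (1 - t * (1 - d)) powr (-y)) * indicator {a..<1} t) \<partial>\<mu>)"
   proof (rule nn_integral_mono)
    fix t
    show "ennreal (h k t) * indicator {a..<1} t \<le> ennreal c * (ennreal ((1 - t) powr (-0) * (1 - t * (1 - d)) powr (-y)) * indicator {a..<1} t)"
    proof (cases "t \<in> {a..<1}")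
     case True
     then have t: "0 \<le> t" "t < 1" using a by auto
     have "h k t \<le> d powr (-s) * (exp 1 * y powr y * d powr y * (1 - t * (1 - d)) powr (-y))"
      unfolding h_def ds using power_le_kernel[OF t, of y k] t s by (simp add: d_def y_def mult_left_mono)
     also have "\<dots> = c * ((1 - t) powr (-0) * (1 - t * (1 - d)) powr (-y))" using t by (simp add: c_def)
     finally show ?thesis using True by (simp add: ennreal_mult[symmetric] c_def ennreal_leI)
    qed simp
   qed
   also have "\<dots> = ennreal c * (\<integral>\<^sup>+t\<in>{a..<1}. ennreal ((1 - t) powr (-0) * (1 - t * (1 - d)) powr (-y)) \<partial>\<mu>)"
    by (rule nn_integral_cmult, rule borel_measure_01D(4)[OF \<mu>]) measurable
   also have "\<dots> \<le> ennreal c * ennreal (e / K * (s * kernel_const (s - 0) y) * (1 - (1 - d)) powr (s - 0 - y))"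
    using s e K d by (intro mult_left_mono nn_integral_tail_kernel[OF \<mu> a(1,2) _ a(3)]) (auto simp: y_def)
   also have "\<dots> = ennreal (c * (e / K * (s * kernel_const (s - 0) y) * (1 - (1 - d)) powr (s - 0 - y)))"
    using s e K kernel_const_pos[of s y] by (intro ennreal_mult[symmetric]) (auto simp: c_def y_def)
   also have "c * (e / K * (s * kernel_const (s - 0) y) * (1 - (1 - d)) powr (s - 0 - y)) = e"
   proof -
    have "d powr (-s) * d powr y * d powr (s - y) = 1" using d by (simp add: powr_add[symmetric])
    moreover have "c * (e / K * (s * kernel_const (s - 0) y) * (1 - (1 - d)) powr (s - 0 - y)) =
      (d powr (-s) * d powr y * d powr (s - y)) * (e / K * K)"
     unfolding c_def K_def by (simp add: mult_ac)
    ultimately show ?thesis using K by simp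
   qed
   finally show ?thesis .
  qed
  then show "\<exists>a. 0 \<le> a \<and> a < 1 \<and> (\<forall>n. (\<integral>\<^sup>+t\<in>{a..<1}. ennreal (h n t) \<partial>\<mu>) \<le> ennreal e)"
   using a by blast
 next
  fix a :: real assume a: "a < 1"
  show "uniform_limit {0..a} h (\<lambda>t. 0) sequentially"
  proof (cases "0 < a")
   case True
   have lim: "(\<lambda>k. real (k + 1) powr s * a ^ k) \<longlonglongrightarrow> 0"
    using True a by real_asymp
   show ?thesis unfolding uniform_limit_iff
   proof (intro allI impI)
    fix e :: real assume "0 < e"
    then have "\<forall>\<^sub>F k in sequentially. real (k + 1) powr s * a ^ k < e" using order_tendstoD(2)[OF lim] by blast
    then show "\<forall>\<^sub>F k in sequentially. \<forall>t\<in>{0..a}. dist (h k t) 0 < e"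
    proof (rule eventually_mono, intro ballI)
     fix k t assume *: "real (k + 1) powr s * a ^ k < e" and t: "t \<in> {0..a}"
     have "h k t \<le> real (k + 1) powr s * a ^ k" unfolding h_def using t by (auto intro!: mult_left_mono power_mono)
     moreover have "0 \<le> h k t" by (simp add: h_def)
     ultimately show "dist (h k t) 0 < e" using * unfolding dist_real_def by linarith
    qed
   qed
  next
   case False
   have "\<forall>\<^sub>F k in sequentially. \<forall>t\<in>{0..a}. h k t = 0"
    using eventually_gt_at_top[of 0] by eventually_elim (use False in \<open>auto simp: h_def\<close>)
   then show ?thesis unfolding uniform_limit_iff by (auto elim!: eventually_mono)
  qed
 qed
 moreover have "(\<integral>\<^sup>+t. ennreal (h k t) \<partial>\<mu>) = ennreal (real (k + 1) powr s * moment \<mu> k)" for k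
 proof -
  have "(\<integral>\<^sup>+t. ennreal (h k t) \<partial>\<mu>) = (\<integral>\<^sup>+t. ennreal (real (k + 1) powr s) * ennreal (t ^ k) \<partial>\<mu>)"
   by (intro nn_integral_cong) (auto simp: h_def borel_measure_01D(2)[OF \<mu>] ennreal_mult)
  also have "\<dots> = ennreal (real (k + 1) powr s) * (\<integral>\<^sup>+t. ennreal (t ^ k) \<partial>\<mu>)"
   by (rule nn_integral_cmult, rule borel_measure_01D(4)[OF \<mu>]) measurable
  also have "\<dots> = ennreal (real (k + 1) powr s * moment \<mu> k)"
   unfolding ennreal_moment[OF \<mu> fin, symmetric] by (simp add: ennreal_mult moment_nonneg[OF \<mu>])
  finally show ?thesis .
 qed
 ultimately have "(\<lambda>k. ennreal (real (k + 1) powr s * moment \<mu> k)) \<longlonglongrightarrow> 0" by simp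
 then show ?thesis by (subst (asm) ennreal_tendsto_0_iff) (auto simp: moment_nonneg[OF \<mu>])
qed

section \<open>The integral representation\<close>

text \<open>The Taylor coefficients of (1 - w)^(-\<alpha>).\<close>

definition binomial_weight :: "real \<Rightarrow> nat \<Rightarrow> real" where
 "binomial_weight \<alpha> n = Gamma (real n + \<alpha>) / (fact n * Gamma \<alpha>)"

lemma binomial_weight_pochhammer: "0 < \<alpha> \<Longrightarrow> binomial_weight \<alpha> n = pochhammer \<alpha> n / fact n"
 by (subst pochhammer_Gamma) (auto simp: binomial_weight_def add.commute elim: nonpos_Ints_cases)

lemma binomial_weight_nonneg: "0 < \<alpha> \<Longrightarrow> 0 \<le> binomial_weight \<alpha> n"
 by (simp add: binomial_weight_pochhammer pochhammer_nonneg)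

lemma binomial_weight_Suc: "0 < \<alpha> \<Longrightarrow> real (Suc n) * binomial_weight \<alpha> (Suc n) = \<alpha> * binomial_weight (\<alpha> + 1) n"
 by (simp add: binomial_weight_pochhammer pochhammer_rec)

lemma binomial_weight_sums:
 assumes "0 < \<alpha>" "norm (w::complex) < 1"
 shows "(\<lambda>n. of_real (binomial_weight \<alpha> n) * w ^ n) sums ((1 - w) powr (- of_real \<alpha>))"
proof -
 have "(\<lambda>n. ((- of_real \<alpha>) gchoose n) * (-w) ^ n) sums (1 + (-w)) powr (- of_real \<alpha>)"
  by (rule gen_binomial_complex) (use assms in simp)
 moreover have "((- of_real \<alpha>) gchoose n) * (-w) ^ n = of_real (binomial_weight \<alpha> n) * w ^ n" for n
 proof -
  have "((- of_real \<alpha>) gchoose n) = (-1) ^ n * pochhammer (of_real \<alpha> :: complex) n / fact n"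
   by (simp add: gbinomial_pochhammer)
  moreover have "(-w) ^ n = (-1) ^ n * w ^ n" by (rule power_minus)
  moreover have "(-1) ^ n * (-1) ^ n = (1::complex)" by (simp add: power_mult_distrib[symmetric])
  ultimately show ?thesis
   using assms(1) by (simp add: binomial_weight_pochhammer pochhammer_of_real)
 qed
 ultimately show ?thesis by simp
qed

lemma binomial_weight_summable:
 assumes "0 < \<alpha>" "0 \<le> r" "r < 1"
 shows "summable (\<lambda>n. binomial_weight \<alpha> n * r ^ n)"
proof -
 have "summable (\<lambda>n. complex_of_real (binomial_weight \<alpha> n * r ^ n))"
  using binomial_weight_sums[of \<alpha> "of_real r"] assms by (simp add: sums_iff)
 then show ?thesis by (simp only: summable_complex_of_real)
qed

lemma norm_kernel:
 assumes "norm w < 1"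
 shows "norm ((1 - w) powr (- complex_of_real \<alpha>)) = norm (1 - w) powr (-\<alpha>)"
proof -
 have "1 - w \<noteq> 0" using assms by auto
 then show ?thesis by (simp add: norm_powr_real_powr' powr_def)
qed

lemma norm_mult_01:
 fixes z :: complex
 assumes "0 \<le> t" "t < 1" "norm z < 1"
 shows "norm (of_real t * z) < 1"
 using mult_left_le_one_le[of "norm z" t] assms by (simp add: norm_mult)

lemma measurable_01I: "borel_measure_01 \<mu> \<Longrightarrow> f \<in> borel_measurable borel \<Longrightarrow> f \<in> borel_measurable \<mu>"
 by (rule borel_measure_01D(4))

lemma moment_kernel_sums:
 fixes \<phi> :: "real \<Rightarrow> complex"
 assumes \<mu>: "borel_measure_01 \<mu>" and \<alpha>: "0 < \<alpha>" and \<phi>: "integrable \<mu> \<phi>" and z: "norm z < 1"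
 shows "(\<lambda>n. of_real (binomial_weight \<alpha> n) * (LINT t|\<mu>. of_real (t ^ n) * \<phi> t) * z ^ n) sums
   (LINT t|\<mu>. \<phi> t * (1 - of_real t * z) powr (- of_real \<alpha>))"
  and "integrable \<mu> (\<lambda>t. \<phi> t * (1 - of_real t * z) powr (- of_real \<alpha>))"
  and "integrable \<mu> (\<lambda>t. of_real (t ^ n) * \<phi> t)"
  and "summable (\<lambda>n. binomial_weight \<alpha> n * norm (LINT t|\<mu>. of_real (t ^ n) * \<phi> t) * norm z ^ n)"
proof -
 note sp = borel_measure_01D(2)[OF \<mu>]
 have int: "integrable \<mu> (\<lambda>t. of_real (t ^ n) * \<phi> t)" for n
 proof (rule Bochner_Integration.integrable_bound[OF \<phi>])
  have "(\<lambda>t. complex_of_real (t ^ n)) \<in> borel_measurable \<mu>" by (rule measurable_01I[OF \<mu>]) measurable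
  then show "(\<lambda>t. of_real (t ^ n) * \<phi> t) \<in> borel_measurable \<mu>" using \<phi> by measurable
  show "AE t in \<mu>. norm (of_real (t ^ n) * \<phi> t) \<le> norm (\<phi> t)"
   by (rule AE_I2) (auto simp: sp norm_mult norm_power intro!: mult_left_le_one_le power_le_one)
 qed
 show "integrable \<mu> (\<lambda>t. of_real (t ^ n) * \<phi> t)" by (rule int)
 define N where "N = (LINT t|\<mu>. norm (\<phi> t))"
 have Nint: "(LINT t|\<mu>. norm (of_real (t ^ n) * \<phi> t)) \<le> N" for n
  unfolding N_def by (intro integral_mono integrable_norm int \<phi>)
   (auto simp: sp norm_mult norm_power intro!: mult_left_le_one_le power_le_one)
 have N0: "0 \<le> N" by (simp add: N_def)
 have sb: "summable (\<lambda>n. binomial_weight \<alpha> n * norm z ^ n * N)"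
  using z by (intro summable_mult2 binomial_weight_summable \<alpha>) auto
 define F where "F = (\<lambda>n t. of_real (binomial_weight \<alpha> n) * z ^ n * (of_real (t ^ n) * \<phi> t))"
 have Fs: "(\<lambda>n. F n t) sums (\<phi> t * (1 - of_real t * z) powr (- of_real \<alpha>))" if "t \<in> space \<mu>" for t
 proof -
  have "norm (of_real t * z) < 1" using that z by (intro norm_mult_01) (auto simp: sp)
  from sums_mult[OF binomial_weight_sums[OF \<alpha> this], of "\<phi> t"]
  show ?thesis by (simp add: F_def power_mult_distrib mult_ac)
 qed
 have normF: "norm (F n t) = binomial_weight \<alpha> n * norm z ^ n * norm (of_real (t ^ n) * \<phi> t)" for n t
  using binomial_weight_nonneg[OF \<alpha>, of n] by (simp add: F_def norm_mult norm_power)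
 have Fi: "integrable \<mu> (F n)" for n unfolding F_def by (intro integrable_mult_right int)
 have s1: "AE t in \<mu>. summable (\<lambda>n. norm (F n t))"
 proof (rule AE_I2)
  fix t assume t: "t \<in> space \<mu>"
  have "summable (\<lambda>n. binomial_weight \<alpha> n * norm z ^ n * norm (\<phi> t))"
   using z by (intro summable_mult2 binomial_weight_summable \<alpha>) auto
  then show "summable (\<lambda>n. norm (F n t))"
  proof (rule summable_comparison_test'[where N = 0])
   fix n
   have "norm (of_real (t ^ n) * \<phi> t) \<le> norm (\<phi> t)"
    using t by (auto simp: sp norm_mult norm_power intro!: mult_left_le_one_le power_le_one)
   then have "norm (F n t) \<le> binomial_weight \<alpha> n * norm z ^ n * norm (\<phi> t)"
    unfolding normF using binomial_weight_nonneg[OF \<alpha>, of n] by (intro mult_left_mono) auto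
   then show "norm (norm (F n t)) \<le> binomial_weight \<alpha> n * norm z ^ n * norm (\<phi> t)"
    by (simp only: real_norm_def abs_norm_cancel)
  qed
 qed
 have s2: "summable (\<lambda>n. LINT t|\<mu>. norm (F n t))"
 proof (rule summable_comparison_test'[OF sb, where N = 0])
  fix n
  have "(LINT t|\<mu>. norm (F n t)) = binomial_weight \<alpha> n * norm z ^ n * (LINT t|\<mu>. norm (of_real (t ^ n) * \<phi> t))"
   unfolding normF by (rule integral_mult_right_zero)
  also have "\<dots> \<le> binomial_weight \<alpha> n * norm z ^ n * N"
   using binomial_weight_nonneg[OF \<alpha>, of n] Nint by (intro mult_left_mono) auto
  finally show "norm (LINT t|\<mu>. norm (F n t)) \<le> binomial_weight \<alpha> n * norm z ^ n * N" by simp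
 qed
 have "(\<lambda>n. integral\<^sup>L \<mu> (F n)) sums (LINT t|\<mu>. (\<Sum>n. F n t))"
  by (rule sums_integral[OF Fi s1 s2])
 also have "(LINT t|\<mu>. (\<Sum>n. F n t)) = (LINT t|\<mu>. \<phi> t * (1 - of_real t * z) powr (- of_real \<alpha>))"
  by (intro Bochner_Integration.integral_cong refl) (use Fs in \<open>simp add: sums_iff\<close>)
 also have "(\<lambda>n. integral\<^sup>L \<mu> (F n)) = (\<lambda>n. of_real (binomial_weight \<alpha> n) * (LINT t|\<mu>. of_real (t ^ n) * \<phi> t) * z ^ n)"
  unfolding F_def by (intro ext) (subst integral_mult_right_zero, simp only: mult_ac)
 finally show "(\<lambda>n. of_real (binomial_weight \<alpha> n) * (LINT t|\<mu>. of_real (t ^ n) * \<phi> t) * z ^ n) sums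
   (LINT t|\<mu>. \<phi> t * (1 - of_real t * z) powr (- of_real \<alpha>))" .
 have "integrable \<mu> (\<lambda>t. \<Sum>n. F n t)" by (rule integrable_suminf[OF Fi s1 s2])
 also have "integrable \<mu> (\<lambda>t. \<Sum>n. F n t) \<longleftrightarrow> integrable \<mu> (\<lambda>t. \<phi> t * (1 - of_real t * z) powr (- of_real \<alpha>))"
  by (intro Bochner_Integration.integrable_cong refl) (use Fs in \<open>simp add: sums_iff\<close>)
 finally show "integrable \<mu> (\<lambda>t. \<phi> t * (1 - of_real t * z) powr (- of_real \<alpha>))" .
 show "summable (\<lambda>n. binomial_weight \<alpha> n * norm (LINT t|\<mu>. of_real (t ^ n) * \<phi> t) * norm z ^ n)"
 proof (rule summable_comparison_test'[OF sb, where N = 0])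
  fix n
  have "norm (LINT t|\<mu>. of_real (t ^ n) * \<phi> t) \<le> N" by (rule order_trans[OF integral_norm_bound Nint])
  then have "binomial_weight \<alpha> n * norm z ^ n * norm (LINT t|\<mu>. of_real (t ^ n) * \<phi> t) \<le> binomial_weight \<alpha> n * norm z ^ n * N"
   using binomial_weight_nonneg[OF \<alpha>, of n] by (intro mult_left_mono) auto
  then show "norm (binomial_weight \<alpha> n * norm (LINT t|\<mu>. of_real (t ^ n) * \<phi> t) * norm z ^ n) \<le> binomial_weight \<alpha> n * norm z ^ n * N"
   using binomial_weight_nonneg[OF \<alpha>, of n] by (simp add: abs_mult mult_ac)
 qed
qed

text \<open>Everything about the operator except the convergence of the inner series follows from this property.
It is obtained from Tauber's theorem for general functions and from absolute convergence for the
test functions.\<close>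

definition moment_represented :: "real measure \<Rightarrow> (complex \<Rightarrow> complex) \<Rightarrow> bool" where
 "moment_represented \<mu> f \<longleftrightarrow> f \<in> disc_holomorphic \<and> integrable \<mu> (\<lambda>t. f (of_real t)) \<and>
   (\<forall>n. (\<lambda>k. of_real (moment \<mu> (n + k)) * taylor_coeff f k) sums (LINT t|\<mu>. of_real (t ^ n) * f (of_real t)))"

text \<open>Inserting the moment representation into the double series and summing over n with the binomial
series under the integral. The formula for the derivative comes from differentiating the power
series termwise and using n c_n(\<alpha>) = \<alpha> c_(n-1)(\<alpha> + 1) for the binomial
weights.\<close>

lemma hilbert_op_representation:
 assumes \<mu>: "borel_measure_01 \<mu>" and fin: "emeasure \<mu> {0..<1} < \<infinity>" and \<alpha>: "0 < \<alpha>" and f: "moment_represented \<mu> f"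
 shows "hilbert_defined \<mu> \<alpha> f"
  and "norm z < 1 \<Longrightarrow> hilbert_op \<mu> \<alpha> f z = (LINT t|\<mu>. f (of_real t) * (1 - of_real t * z) powr (- of_real \<alpha>))"
  and "norm z < 1 \<Longrightarrow> deriv (hilbert_op \<mu> \<alpha> f) z = of_real \<alpha> * (LINT t|\<mu>. of_real t * f (of_real t) * (1 - of_real t * z) powr (- of_real (\<alpha> + 1)))"
  and "hilbert_op \<mu> \<alpha> f \<in> disc_holomorphic"
proof -
 let ?\<phi> = "\<lambda>t. f (of_real t)"
 have int: "integrable \<mu> ?\<phi>" using f by (simp add: moment_represented_def)
 have entry: "hilbert_entry \<mu> \<alpha> n k = binomial_weight \<alpha> n * moment \<mu> (n + k)" for n k
  unfolding hilbert_entry_def binomial_weight_def moment_def by (rule integral_mult_right_zero)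
 have hs: "(\<lambda>k. of_real (hilbert_entry \<mu> \<alpha> n k) * taylor_coeff f k) sums (of_real (binomial_weight \<alpha> n) * (LINT t|\<mu>. of_real (t ^ n) * ?\<phi> t))" for n
 proof -
  have "(\<lambda>k. of_real (moment \<mu> (n + k)) * taylor_coeff f k) sums (LINT t|\<mu>. of_real (t ^ n) * ?\<phi> t)"
   using f by (simp add: moment_represented_def)
  from sums_mult[OF this, of "of_real (binomial_weight \<alpha> n)"] show ?thesis by (simp add: entry mult.assoc)
 qed
 have coeff: "hilbert_coeff \<mu> \<alpha> f n = of_real (binomial_weight \<alpha> n) * (LINT t|\<mu>. of_real (t ^ n) * ?\<phi> t)" for n
  unfolding hilbert_coeff_def using hs[of n] by (simp add: sums_iff)
 have cs: "(\<lambda>n. hilbert_coeff \<mu> \<alpha> f n * z ^ n) sums (LINT t|\<mu>. ?\<phi> t * (1 - of_real t * z) powr (- of_real \<alpha>))" if "norm z < 1" for z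
  unfolding coeff by (rule moment_kernel_sums(1)[OF \<mu> \<alpha> int that])
 have op: "hilbert_op \<mu> \<alpha> f z = (\<Sum>n. hilbert_coeff \<mu> \<alpha> f n * z ^ n)" if "norm z < 1" for z
  using that by (simp add: hilbert_op_def)
 show rep: "hilbert_op \<mu> \<alpha> f z = (LINT t|\<mu>. ?\<phi> t * (1 - of_real t * z) powr (- of_real \<alpha>))" if "norm z < 1" for z
  using cs[OF that] op[OF that] by (simp add: sums_iff)
 have hol: "hilbert_op \<mu> \<alpha> f holomorphic_on ball 0 1"
 proof (rule power_series_holomorphic)
  show "(\<lambda>n. hilbert_coeff \<mu> \<alpha> f n * (w - 0) ^ n) sums hilbert_op \<mu> \<alpha> f w" if "w \<in> ball 0 1" for w
   using cs[of w] rep[of w] that by simp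
 qed
 show "hilbert_op \<mu> \<alpha> f \<in> disc_holomorphic"
  using hol by (simp add: disc_holomorphic_def hilbert_op_def)
 have "integrable \<mu> (\<lambda>t. Gamma (real n + \<alpha>) / (fact n * Gamma \<alpha>) * t ^ (n + k))" for n k
  by (intro integrable_mult_right integrable_power_01[OF \<mu> fin])
 then show "hilbert_defined \<mu> \<alpha> f"
  unfolding hilbert_defined_def using hs cs hol by (auto simp: sums_iff)
 show "deriv (hilbert_op \<mu> \<alpha> f) z = of_real \<alpha> * (LINT t|\<mu>. of_real t * ?\<phi> t * (1 - of_real t * z) powr (- of_real (\<alpha> + 1)))" if z: "norm z < 1"
 proof -
  have int1: "integrable \<mu> (\<lambda>t. of_real (t ^ 1) * ?\<phi> t)" by (rule moment_kernel_sums(3)[OF \<mu> \<alpha> int z])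
  then have int1: "integrable \<mu> (\<lambda>t. of_real t * ?\<phi> t)" by simp
  obtain r where r: "norm z < r" "r < 1" using dense z by blast
  have "summable (\<lambda>n. hilbert_coeff \<mu> \<alpha> f n * of_real r ^ n)"
   using cs[of "of_real r"] r norm_ge_zero[of z] by (auto simp: sums_iff simp del: norm_ge_zero)
  then have "DERIV (\<lambda>w. \<Sum>n. hilbert_coeff \<mu> \<alpha> f n * w ^ n) z :> (\<Sum>n. diffs (hilbert_coeff \<mu> \<alpha> f) n * z ^ n)"
   by (rule termdiffs_strong) (use r norm_ge_zero[of z] in \<open>auto simp del: norm_ge_zero\<close>)
  moreover have "\<forall>\<^sub>F w in nhds z. (\<Sum>n. hilbert_coeff \<mu> \<alpha> f n * w ^ n) = hilbert_op \<mu> \<alpha> f w"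
   using eventually_nhds_in_open[of "ball 0 1" z] z by (auto simp: op elim!: eventually_mono)
  ultimately have "DERIV (hilbert_op \<mu> \<alpha> f) z :> (\<Sum>n. diffs (hilbert_coeff \<mu> \<alpha> f) n * z ^ n)"
   by (subst (asm) DERIV_cong_ev[OF refl _ refl]) auto
  then have "deriv (hilbert_op \<mu> \<alpha> f) z = (\<Sum>n. diffs (hilbert_coeff \<mu> \<alpha> f) n * z ^ n)" by (rule DERIV_imp_deriv)
  also have "\<dots> = (\<Sum>n. of_real \<alpha> * (of_real (binomial_weight (\<alpha> + 1) n) * (LINT t|\<mu>. of_real (t ^ n) * (of_real t * ?\<phi> t)) * z ^ n))"
  proof (rule suminf_cong)
   fix n
   have "of_nat (Suc n) * complex_of_real (binomial_weight \<alpha> (Suc n)) = of_real (real (Suc n) * binomial_weight \<alpha> (Suc n))"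
    by (simp only: of_real_mult of_real_of_nat_eq)
   also have "\<dots> = of_real \<alpha> * of_real (binomial_weight (\<alpha> + 1) n)" by (simp only: binomial_weight_Suc[OF \<alpha>] of_real_mult)
   finally have "of_nat (Suc n) * complex_of_real (binomial_weight \<alpha> (Suc n)) = of_real \<alpha> * of_real (binomial_weight (\<alpha> + 1) n)" .
   moreover have "(LINT t|\<mu>. of_real (t ^ Suc n) * ?\<phi> t) = (LINT t|\<mu>. of_real (t ^ n) * (of_real t * ?\<phi> t))"
    by (intro Bochner_Integration.integral_cong refl) (simp add: mult_ac)
   ultimately show "diffs (hilbert_coeff \<mu> \<alpha> f) n * z ^ n = of_real \<alpha> * (of_real (binomial_weight (\<alpha> + 1) n) * (LINT t|\<mu>. of_real (t ^ n) * (of_real t * ?\<phi> t)) * z ^ n)"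
    unfolding diffs_def coeff by (simp only: mult.assoc[symmetric])
  qed
  also have "\<dots> = of_real \<alpha> * (LINT t|\<mu>. of_real t * ?\<phi> t * (1 - of_real t * z) powr (- of_real (\<alpha> + 1)))"
  proof (rule sums_unique[symmetric], rule sums_mult)
   show "(\<lambda>n. of_real (binomial_weight (\<alpha> + 1) n) * (LINT t|\<mu>. of_real (t ^ n) * (of_real t * ?\<phi> t)) * z ^ n) sums
     (LINT t|\<mu>. of_real t * ?\<phi> t * (1 - of_real t * z) powr (- of_real (\<alpha> + 1)))"
    by (rule moment_kernel_sums(1)[OF \<mu> _ int1 z]) (use \<alpha> in simp)
  qed
  finally show ?thesis .
 qed
qed

lemma moment_series_exchange:
 assumes \<mu>: "borel_measure_01 \<mu>" and fin: "emeasure \<mu> {0..<1} < \<infinity>" and s: "summable (\<lambda>k. norm (c k :: complex))"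
 shows "(\<lambda>k. of_real (moment \<mu> (n + k)) * c k) sums (LINT t|\<mu>. of_real (t ^ n) * (\<Sum>k. c k * of_real t ^ k))"
proof -
 note sp = borel_measure_01D(2)[OF \<mu>]
 define F where "F = (\<lambda>k t. c k * of_real (t ^ (n + k)))"
 have Fi: "integrable \<mu> (F k)" for k
  unfolding F_def by (intro integrable_mult_right integrable_of_real integrable_power_01[OF \<mu> fin])
 have nF: "norm (F k t) \<le> norm (c k)" "norm (F k t) = norm (c k) * t ^ (n + k)" if "t \<in> space \<mu>" for k t
  using that by (auto simp: F_def sp norm_mult norm_power intro!: mult_right_le_one_le power_le_one)
 have s1: "AE t in \<mu>. summable (\<lambda>k. norm (F k t))"
  by (rule AE_I2, rule summable_comparison_test'[OF s, where N = 0]) (simp add: nF(1))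
 have s2: "summable (\<lambda>k. LINT t|\<mu>. norm (F k t))"
 proof (rule summable_comparison_test'[OF summable_mult2[OF s, of "moment \<mu> 0"], where N = 0])
  fix k
  have "(LINT t|\<mu>. norm (F k t)) = (LINT t|\<mu>. norm (c k) * t ^ (n + k))"
   by (intro Bochner_Integration.integral_cong refl) (simp add: nF(2))
  also have "\<dots> = norm (c k) * moment \<mu> (n + k)" unfolding moment_def by (rule integral_mult_right_zero)
  finally have "(LINT t|\<mu>. norm (F k t)) = norm (c k) * moment \<mu> (n + k)" .
  moreover have "norm (c k) * moment \<mu> (n + k) \<le> norm (c k) * moment \<mu> 0"
   by (intro mult_left_mono moment_antimono[OF \<mu> fin]) auto
  moreover have "0 \<le> norm (c k) * moment \<mu> (n + k)" using moment_nonneg[OF \<mu>] by simp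
  ultimately show "norm (LINT t|\<mu>. norm (F k t)) \<le> norm (c k) * moment \<mu> 0" by simp
 qed
 have "(\<lambda>k. integral\<^sup>L \<mu> (F k)) sums (LINT t|\<mu>. (\<Sum>k. F k t))" by (rule sums_integral[OF Fi s1 s2])
 also have "(\<lambda>k. integral\<^sup>L \<mu> (F k)) = (\<lambda>k. of_real (moment \<mu> (n + k)) * c k)"
  unfolding F_def moment_def
  by (intro ext) (simp only: integral_mult_right_zero integral_complex_of_real mult.commute)
 also have "(LINT t|\<mu>. (\<Sum>k. F k t)) = (LINT t|\<mu>. of_real (t ^ n) * (\<Sum>k. c k * of_real t ^ k))"
 proof (intro Bochner_Integration.integral_cong refl)
  fix t assume t: "t \<in> space \<mu>"
  have "summable (\<lambda>k. norm (c k * of_real t ^ k))"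
   by (rule summable_comparison_test'[OF s, where N = 0])
     (use t in \<open>auto simp: sp norm_mult norm_power intro!: mult_right_le_one_le power_le_one\<close>)
  then have "summable (\<lambda>k. c k * of_real t ^ k)" by (rule summable_norm_cancel)
  from suminf_mult[OF this, of "of_real (t ^ n)"]
  show "(\<Sum>k. F k t) = of_real (t ^ n) * (\<Sum>k. c k * of_real t ^ k)"
   by (simp add: F_def power_add mult_ac)
 qed
 finally show ?thesis .
qed

lemma hardy_ball_dilate:
 assumes f: "f \<in> hardy_ball p B" and r: "0 < r" "r < 1"
 shows "(\<lambda>z. if norm z < 1 then f (of_real r * z) else 0) \<in> hardy_ball p B"
proof -
 let ?g = "\<lambda>z. if norm z < 1 then f (of_real r * z) else 0"
 have in1: "norm (of_real r * z) < 1" if "norm z < 1" for z :: complex using that r by (intro norm_mult_01) auto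
 have "(\<lambda>z. f (of_real r * z)) holomorphic_on ball 0 1"
  using in1 by (intro holomorphic_on_compose_gen[OF _ hardy_ballD(2)[OF f], unfolded o_def] holomorphic_intros) auto
 then have "?g holomorphic_on ball 0 1" by (rule holomorphic_transform) auto
 moreover have "circle_mean p \<rho> ?g \<le> B" if \<rho>: "0 < \<rho>" "\<rho> < 1" for \<rho>
 proof -
  have "circle_mean p \<rho> ?g = circle_mean p (r * \<rho>) f"
   using \<rho> by (simp add: circle_mean_def norm_mult mult.assoc)
  also have "\<dots> \<le> B" using r \<rho> mult_strict_mono[of r 1 \<rho> 1] by (intro hardy_ballD(3)[OF f]) auto
  finally show ?thesis .
 qed
 ultimately show ?thesis by (simp add: hardy_ball_def disc_holomorphic_def)
qed

lemma integrable_hardy: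
 assumes \<mu>: "borel_measure_01 \<mu>" and p: "0 < p" "p \<le> 1" and f: "f \<in> hardy_ball p B"
  and C: "0 \<le> C" "tail_bound \<mu> 0 (1 / p) C"
 shows "integrable \<mu> (\<lambda>t. f (of_real t))"
proof (rule integrableI_bounded)
 have [measurable]: "f \<in> borel_measurable borel" using disc_holomorphic_measurable[OF hardy_ballD(1)[OF f]] .
 show "(\<lambda>t. f (of_real t)) \<in> borel_measurable \<mu>" by (rule measurable_01I[OF \<mu>]) measurable
 have "(\<integral>\<^sup>+t. ennreal (norm (f (of_real t))) \<partial>\<mu>) = (\<integral>\<^sup>+t\<in>{0..<1}. ennreal (norm (f (of_real t)) powr 1) \<partial>\<mu>)"
  by (intro nn_integral_cong) (auto simp: borel_measure_01D(2)[OF \<mu>])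
 also have "\<dots> \<le> ennreal (4 * (1 / p) * C * B powr (1 / p))"
  by (rule carleson_embedding[OF p f \<mu> _ _ C]) auto
 also have "\<dots> < \<infinity>" by simp
 finally show "(\<integral>\<^sup>+t. ennreal (norm (f (of_real t))) \<partial>\<mu>) < \<infinity>" .
qed

text \<open>The series of moments times coefficients converges only conditionally in general. Tauber's
theorem applies since the moments are o(k^(-1/p)) and the coefficients O(k^(1/p - 1)). Its Abel
means are the integrals of t^n f(r t), and they converge because f(r z) - f(z) is bounded in H^p,
tends to 0 locally uniformly, and the vanishing Carleson embedding applies with exponent 1 \<ge>
p.\<close>

lemma moment_represented_hardy:
 assumes \<mu>: "borel_measure_01 \<mu>" and p: "0 < p" "p \<le> 1" and f: "f \<in> hardy_ball p B"
  and C: "0 \<le> C" "tail_bound \<mu> 0 (1 / p) C" and van: "vanishing_tail \<mu> (1 / p)"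
 shows "moment_represented \<mu> f"
proof -
 note fin = tail_bound_0_finite[OF C(2)]
 note fd = hardy_ballD(1)[OF f] and fh = hardy_ballD(2)[OF f]
 have fint: "integrable \<mu> (\<lambda>t. f (of_real t))" by (rule integrable_hardy[OF \<mu> p f C])
 note sp = borel_measure_01D(2)[OF \<mu>]
 have "(\<lambda>k. of_real (moment \<mu> (n + k)) * taylor_coeff f k) sums (LINT t|\<mu>. of_real (t ^ n) * f (of_real t))" for n
 proof (rule tauber)
  define A where "A = 2 * B * (2 * B) powr (1/p - 1)"
  have A: "0 \<le> A" using hardy_ball_nonneg[OF f p(1)] by (simp add: A_def)
  show "(\<lambda>k. real k * norm (of_real (moment \<mu> (n + k)) * taylor_coeff f k)) \<longlonglongrightarrow> 0"
  proof (rule Lim_null_comparison)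
   show "\<forall>\<^sub>F k in sequentially. norm (real k * norm (of_real (moment \<mu> (n + k)) * taylor_coeff f k)) \<le> A * (real (k + 1) powr (1/p) * moment \<mu> k)"
   proof (rule always_eventually, rule allI)
    fix k
    have "norm (taylor_coeff f k) \<le> A * real (k + 1) powr (1/p - 1)"
     using hardy_coefficient_bound[OF p f] by (simp add: A_def)
    moreover have "moment \<mu> (n + k) \<le> moment \<mu> k" by (rule moment_antimono[OF \<mu> fin]) simp
    ultimately have le: "moment \<mu> (n + k) * norm (taylor_coeff f k) \<le> moment \<mu> k * (A * real (k + 1) powr (1/p - 1))"
     using moment_nonneg[OF \<mu>] A by (intro mult_mono) auto
    have "real k * (moment \<mu> (n + k) * norm (taylor_coeff f k)) \<le> real (k + 1) * (moment \<mu> k * (A * real (k + 1) powr (1/p - 1)))"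
     by (rule mult_mono[OF _ le]) (use moment_nonneg[OF \<mu>] A in auto)
    also have "\<dots> = A * ((real (k + 1) * real (k + 1) powr (1/p - 1)) * moment \<mu> k)" by (simp only: mult_ac)
    also have "real (k + 1) * real (k + 1) powr (1/p - 1) = real (k + 1) powr (1/p)" by (simp add: powr_diff)
    finally show "norm (real k * norm (of_real (moment \<mu> (n + k)) * taylor_coeff f k)) \<le> A * (real (k + 1) powr (1/p) * moment \<mu> k)"
     using moment_nonneg[OF \<mu>, of "n + k"] by (simp add: norm_mult abs_mult)
   qed
   have "(\<lambda>k. A * (real (k + 1) powr (1/p) * moment \<mu> k)) \<longlonglongrightarrow> A * 0"
    using p by (intro tendsto_mult_left moment_little_o[OF \<mu> fin _ van]) simp
   then show "(\<lambda>k. A * (real (k + 1) powr (1/p) * moment \<mu> k)) \<longlonglongrightarrow> 0" by simp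
  qed
  have rep: "(\<Sum>k. of_real (moment \<mu> (n + k)) * taylor_coeff f k * of_real (r ^ k)) = (LINT t|\<mu>. of_real (t ^ n) * f (of_real r * of_real t))"
   if r: "0 < r" "r < 1" for r
  proof -
   have "summable (\<lambda>k. norm (taylor_coeff f k * of_real r ^ k))" using r by (intro taylor_series fd) simp
   from moment_series_exchange[OF \<mu> fin this, of n]
   have "(\<Sum>k. of_real (moment \<mu> (n + k)) * taylor_coeff f k * of_real (r ^ k)) = (LINT t|\<mu>. of_real (t ^ n) * (\<Sum>k. taylor_coeff f k * of_real r ^ k * of_real t ^ k))"
    by (simp add: sums_iff mult_ac)
   also have "\<dots> = (LINT t|\<mu>. of_real (t ^ n) * f (of_real r * of_real t))"
   proof (intro Bochner_Integration.integral_cong refl arg_cong2[where f = "(*)"])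
    fix t assume "t \<in> space \<mu>"
    then have "norm (of_real r * of_real t :: complex) < 1" using r by (intro norm_mult_01) (auto simp: sp)
    from taylor_series(1)[OF fd this]
    show "(\<Sum>k. taylor_coeff f k * of_real r ^ k * of_real t ^ k) = f (of_real r * of_real t)"
     by (simp add: sums_iff power_mult_distrib mult.assoc)
   qed
   finally show ?thesis .
  qed
  show "((\<lambda>r. \<Sum>k. of_real (moment \<mu> (n + k)) * taylor_coeff f k * of_real (r ^ k)) \<longlongrightarrow> (LINT t|\<mu>. of_real (t ^ n) * f (of_real t))) (at_left 1)"
  proof (rule tendsto_at_left_sequentially[of 0])
   fix R :: "nat \<Rightarrow> real" assume R: "\<And>n. R n < 1" "\<And>n. 0 < R n" "incseq R" "R \<longlonglongrightarrow> 1"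
   define G where "G = (\<lambda>j z. if norm z < 1 then f (of_real (R j) * z) else 0)"
   have G: "G j \<in> hardy_ball p B" for j unfolding G_def by (rule hardy_ball_dilate[OF f R(2,1)])
   define D where "D = (\<lambda>j z. G j z - f z)"
   have D: "D j \<in> hardy_ball p (2 powr p * (B + B))" for j unfolding D_def by (rule hardy_ball_diff[OF p(1) G f])
   have unif: "uniform_limit (cball 0 a) D (\<lambda>z. 0) sequentially" if a: "a < 1" for a
    unfolding uniform_limit_iff
   proof (intro allI impI)
    fix e :: real assume e: "0 < e"
    have "uniformly_continuous_on (cball 0 a) f"
     by (rule compact_uniformly_continuous[OF continuous_on_subset[OF holomorphic_on_imp_continuous_on[OF fh]]]) (use a in auto)
    then obtain d where d: "0 < d" "\<And>z w. z \<in> cball 0 a \<Longrightarrow> w \<in> cball 0 a \<Longrightarrow> dist w z < d \<Longrightarrow> dist (f w) (f z) < e"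
     unfolding uniformly_continuous_on_def using e by metis
    have "\<forall>\<^sub>F j in sequentially. 1 - d < R j" using order_tendstoD(1)[OF R(4)] d by simp
    then show "\<forall>\<^sub>F j in sequentially. \<forall>z\<in>cball 0 a. dist (D j z) 0 < e"
    proof (rule eventually_mono, intro ballI)
     fix j and z :: complex assume j: "1 - d < R j" and z: "z \<in> cball 0 a"
     have nz: "norm z \<le> a" "norm z < 1" using z a by auto
     have "norm (of_real (R j) * z) \<le> norm z" using R(1,2)[of j] by (simp add: norm_mult mult_left_le_one_le less_imp_le)
     then have in2: "of_real (R j) * z \<in> cball 0 a" using nz by simp
     have "of_real (R j) * z - z = of_real (R j - 1) * z" by (simp add: algebra_simps)
     then have "dist (of_real (R j) * z) z = (1 - R j) * norm z" using R(1)[of j] by (simp only: dist_norm norm_mult norm_of_real) simp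
     also have "\<dots> \<le> (1 - R j) * 1" using nz R(1)[of j] by (intro mult_left_mono) auto
     also have "\<dots> < d" using j by simp
     finally have "dist (f (of_real (R j) * z)) (f z) < e" by (rule d(2)[OF z in2])
     then show "dist (D j z) 0 < e" using nz by (simp add: D_def G_def dist_norm)
    qed
   qed
   have "(\<lambda>j. \<integral>\<^sup>+t. ennreal (norm (D j (of_real t)) powr 1) \<partial>\<mu>) \<longlonglongrightarrow> 0"
    by (rule carleson_embedding_vanishing[OF p D \<mu> fin van unif])
   then have Dlim: "(\<lambda>j. \<integral>\<^sup>+t. ennreal (norm (D j (of_real t))) \<partial>\<mu>) \<longlonglongrightarrow> 0" by simp
   have Gint: "integrable \<mu> (\<lambda>t. G j (of_real t))" for j by (rule integrable_hardy[OF \<mu> p G C])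
   have Dint: "integrable \<mu> (\<lambda>t. D j (of_real t))" for j by (rule integrable_hardy[OF \<mu> p D C])
   have tn: "integrable \<mu> (\<lambda>t. of_real (t ^ n) * \<phi> t)" if "integrable \<mu> \<phi>" for \<phi> :: "real \<Rightarrow> complex"
    by (rule moment_kernel_sums(3)[OF \<mu> zero_less_one that, of 0]) simp
   have "(\<lambda>j. LINT t|\<mu>. of_real (t ^ n) * G j (of_real t)) \<longlonglongrightarrow> (LINT t|\<mu>. of_real (t ^ n) * f (of_real t))"
   proof (rule LIM_zero_cancel, rule Lim_null_comparison)
    have "(\<integral>\<^sup>+t. ennreal (norm (D j (of_real t))) \<partial>\<mu>) = ennreal (LINT t|\<mu>. norm (D j (of_real t)))" for j
     by (rule nn_integral_eq_integral[OF integrable_norm[OF Dint]]) simp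
    then show "(\<lambda>j. LINT t|\<mu>. norm (D j (of_real t))) \<longlonglongrightarrow> 0"
     using Dlim by (simp add: ennreal_tendsto_0_iff)
    show "\<forall>\<^sub>F j in sequentially. norm ((LINT t|\<mu>. of_real (t ^ n) * G j (of_real t)) - (LINT t|\<mu>. of_real (t ^ n) * f (of_real t))) \<le> (LINT t|\<mu>. norm (D j (of_real t)))"
    proof (rule always_eventually, rule allI)
     fix j
     have "(LINT t|\<mu>. of_real (t ^ n) * G j (of_real t)) - (LINT t|\<mu>. of_real (t ^ n) * f (of_real t)) = (LINT t|\<mu>. of_real (t ^ n) * D j (of_real t))"
      unfolding D_def right_diff_distrib by (rule Bochner_Integration.integral_diff[symmetric]) (intro tn Gint fint)+
     also have "norm \<dots> \<le> (LINT t|\<mu>. norm (of_real (t ^ n) * D j (of_real t)))" by (rule integral_norm_bound)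
     also have "\<dots> \<le> (LINT t|\<mu>. norm (D j (of_real t)))"
      by (intro integral_mono integrable_norm tn Dint) (auto simp: sp norm_mult norm_power intro!: mult_left_le_one_le power_le_one)
     finally show "norm ((LINT t|\<mu>. of_real (t ^ n) * G j (of_real t)) - (LINT t|\<mu>. of_real (t ^ n) * f (of_real t))) \<le> (LINT t|\<mu>. norm (D j (of_real t)))" .
    qed
   qed
   moreover have "(LINT t|\<mu>. of_real (t ^ n) * G j (of_real t)) = (\<Sum>k. of_real (moment \<mu> (n + k)) * taylor_coeff f k * of_real (R j ^ k))" for j
    unfolding rep[OF R(2,1)] by (intro Bochner_Integration.integral_cong refl) (auto simp: G_def sp)
   ultimately show "(\<lambda>j. \<Sum>k. of_real (moment \<mu> (n + k)) * taylor_coeff f k * of_real (R j ^ k)) \<longlonglongrightarrow> (LINT t|\<mu>. of_real (t ^ n) * f (of_real t))"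
    by simp
  qed simp
 qed
 then show ?thesis using fd fint by (simp add: moment_represented_def)
qed

section \<open>Compactness tests\<close>

locale disc_norm =
 fixes Y :: "(complex \<Rightarrow> complex) set" and N :: "(complex \<Rightarrow> complex) \<Rightarrow> real"
 assumes holo: "Y \<subseteq> disc_holomorphic"
  and zero_mem: "(\<lambda>z. 0) \<in> Y" and zero_norm: "N (\<lambda>z. 0) = 0"
  and add_mem: "\<And>f g. f \<in> Y \<Longrightarrow> g \<in> Y \<Longrightarrow> (\<lambda>z. f z + g z) \<in> Y"
  and cmult_mem: "\<And>c f. f \<in> Y \<Longrightarrow> (\<lambda>z. c * f z) \<in> Y"
  and N_nonneg: "\<And>f. f \<in> Y \<Longrightarrow> 0 \<le> N f"
  and N_uminus: "\<And>f. f \<in> Y \<Longrightarrow> N (\<lambda>z. - f z) = N f"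
  and N_triangle: "\<And>f g. f \<in> Y \<Longrightarrow> g \<in> Y \<Longrightarrow> N (\<lambda>z. f z + g z) \<le> N f + N g"
  and evaluation: "\<And>z. norm z < 1 \<Longrightarrow> \<exists>C. \<forall>f\<in>Y. norm (f z) \<le> C * N f"
begin

definition dist_N :: "(complex \<Rightarrow> complex) \<Rightarrow> (complex \<Rightarrow> complex) \<Rightarrow> real" where
 "dist_N = (\<lambda>f g. if f \<in> Y \<and> g \<in> Y then N (\<lambda>z. f z - g z) else 0)"

lemma diff_mem: "f \<in> Y \<Longrightarrow> g \<in> Y \<Longrightarrow> (\<lambda>z. f z - g z) \<in> Y"
 using add_mem[OF _ cmult_mem, of f g "-1"] by simp

lemma norm_eq_0:
 assumes "f \<in> Y" "N f = 0"
 shows "f = (\<lambda>z. 0)"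
proof
 fix z
 show "f z = 0"
 proof (cases "norm z < 1")
  case True
  then obtain C where "\<forall>f\<in>Y. norm (f z) \<le> C * N f" using evaluation by blast
  then have "norm (f z) \<le> C * N f" using assms(1) by blast
  then show ?thesis using assms(2) by simp
 next
  case False
  then show ?thesis using holo assms(1) disc_holomorphicD(2)[of f z] by auto
 qed
qed

sublocale Metric_space Y dist_N
proof
 fix f g h
 show "0 \<le> dist_N f g" by (simp add: dist_N_def N_nonneg diff_mem)
 show "dist_N f g = dist_N g f"
  using N_uminus[OF diff_mem, of f g] by (simp add: dist_N_def)
 show "dist_N f g = 0 \<longleftrightarrow> f = g" if "f \<in> Y" "g \<in> Y"
 proof
  assume "dist_N f g = 0"
  then have "(\<lambda>z. f z - g z) = (\<lambda>z. 0)" using that by (intro norm_eq_0 diff_mem) (auto simp: dist_N_def)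
  then show "f = g" by (metis eq_iff_diff_eq_0 ext)
 next
  assume "f = g" then show "dist_N f g = 0" using that by (simp add: dist_N_def zero_norm)
 qed
 show "dist_N f h \<le> dist_N f g + dist_N g h" if "f \<in> Y" "g \<in> Y" "h \<in> Y"
  using N_triangle[OF diff_mem[OF that(1,2)] diff_mem[OF that(2,3)]] that by (simp add: dist_N_def)
qed

lemma norm_topology_eq: "norm_topology Y N = mtopology"
 unfolding norm_topology_def dist_N_def ..

text \<open>A bounded sequence has a locally uniformly convergent subsequence with limit in the same ball;
applying the hypothesis to the differences yields a cluster point of any infinite set of images,
which is the Bolzano-Weierstrass form of relative compactness.\<close>

lemma compact_operatorI:
 assumes p: "0 < p" and lin: "linear_operator_on (hardy_space p) Y T"
  and crit: "\<And>B F. (\<And>n. F n \<in> hardy_ball p B) \<Longrightarrow>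
   (\<And>a. a < 1 \<Longrightarrow> uniform_limit (cball 0 a) F (\<lambda>z. 0) sequentially) \<Longrightarrow> (\<lambda>n. N (T (F n))) \<longlonglongrightarrow> 0"
 shows "compact_operator (hardy_space p) (hardy_norm p) Y N T"
 unfolding compact_operator_def norm_topology_eq
proof (intro conjI allI impI lin)
 have TY: "T f \<in> Y" if "f \<in> hardy_space p" for f using lin that by (auto simp: linear_operator_on_def)
 have Tdiff: "T (\<lambda>z. f z - g z) = (\<lambda>z. T f z - T g z)" if "f \<in> hardy_ball p B" "g \<in> hardy_ball p B" for f g B
 proof -
  have m: "f \<in> hardy_space p" "g \<in> hardy_space p" "(\<lambda>z. (-1) * g z) \<in> hardy_space p"
   using hardy_ball_imp_norm_le(1)[OF p] that hardy_ball_cmult[OF p that(2), of "-1"] by blast+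
  have "T (\<lambda>z. f z + h z) = (\<lambda>z. T f z + T h z)" if "f \<in> hardy_space p" "h \<in> hardy_space p" for f h
   using lin that unfolding linear_operator_on_def by simp
  from this[OF m(1,3)] have "T (\<lambda>z. f z + (-1) * g z) = (\<lambda>z. T f z + T (\<lambda>z. (-1) * g z) z)" .
  moreover have "T (\<lambda>z. c * g z) = (\<lambda>z. c * T g z)" for c
   using lin m(2) unfolding linear_operator_on_def by simp
  from this[of "-1"] have "T (\<lambda>z. (-1) * g z) = (\<lambda>z. (-1) * T g z)" .
  ultimately show ?thesis by simp
 qed
 fix S assume S: "S \<subseteq> hardy_space p \<and> (\<exists>B. \<forall>f\<in>S. hardy_norm p f \<le> B)"
 then obtain B0 where B0: "\<And>f. f \<in> S \<Longrightarrow> hardy_norm p f \<le> B0" by blast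
 define B where "B = B0 powr p"
 have SB: "f \<in> hardy_ball p B" if "f \<in> S" for f
  unfolding B_def using S that B0 by (intro hardy_ball_of_norm_le[OF p]) auto
 show "compactin mtopology (mtopology closure_of T ` S)"
  unfolding compact_closure_of_eq_Bolzano_Weierstrass
 proof (intro allI impI)
  fix U assume U: "infinite U \<and> U \<subseteq> T ` S \<and> U \<subseteq> Y"
  then obtain u :: "nat \<Rightarrow> complex \<Rightarrow> complex" where u: "inj u" "range u \<subseteq> U" using infinite_countable_subset by blast
  have "\<exists>f. f \<in> S \<and> u n = T f" for n using u U by blast
  then obtain f where f: "\<And>n. f n \<in> S" "\<And>n. u n = T (f n)" by metis
  obtain g r where g: "g \<in> hardy_ball p B" "strict_mono (r :: nat \<Rightarrow> nat)"
   "\<And>\<rho>. \<rho> < 1 \<Longrightarrow> uniform_limit (cball 0 \<rho>) (f \<circ> r) g sequentially"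
   by (rule hardy_montel[OF p SB[OF f(1)]]) (rule that)
  have TgY: "T g \<in> Y" using TY hardy_ball_imp_norm_le(1)[OF p g(1)] by blast
  have "(\<lambda>n. N (T (\<lambda>z. f (r n) z - g z))) \<longlonglongrightarrow> 0"
  proof (rule crit)
   show "(\<lambda>z. f (r n) z - g z) \<in> hardy_ball p (2 powr p * (B + B))" for n
    by (rule hardy_ball_diff[OF p SB[OF f(1)] g(1)])
   show "uniform_limit (cball 0 a) (\<lambda>n z. f (r n) z - g z) (\<lambda>z. 0) sequentially" if "a < 1" for a
    using g(3)[OF that] by (simp add: uniform_limit_iff dist_norm)
  qed
  then have lim: "(\<lambda>n. N (\<lambda>z. u (r n) z - T g z)) \<longlonglongrightarrow> 0"
   unfolding Tdiff[OF SB[OF f(1)] g(1)] f(2) .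
  have "T g \<in> mtopology derived_set_of U"
   unfolding metric_derived_set_of
  proof (intro CollectI conjI TgY allI impI)
   fix \<epsilon> :: real assume "0 < \<epsilon>"
   then obtain n0 where n0: "\<And>n. n \<ge> n0 \<Longrightarrow> \<bar>N (\<lambda>z. u (r n) z - T g z)\<bar> < \<epsilon>"
    using LIMSEQ_D[OF lim] by auto
   have "u (r n0) \<noteq> u (r (Suc n0))" using u(1) g(2) by (metis injD n_not_Suc_n strict_mono_eq)
   then obtain n where n: "n \<ge> n0" "u (r n) \<noteq> T g" by (metis le_SucI order_refl)
   have uY: "u (r n) \<in> Y" using u(2) U by blast
   have "dist_N (T g) (u (r n)) = N (\<lambda>z. u (r n) z - T g z)"
    using uY TgY commute[of "T g" "u (r n)"] by (simp add: dist_N_def)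
   then have "u (r n) \<in> mball (T g) \<epsilon>" using n0[OF n(1)] uY TgY by (simp add: in_mball)
   then show "\<exists>y\<in>U. y \<noteq> T g \<and> y \<in> mball (T g) \<epsilon>" using n(2) u(2) by blast
  qed
  then show "mtopology derived_set_of U \<noteq> {}" by blast
 qed
qed

text \<open>The second part: a subsequence staying away from 0 in norm would have a further subsequence
converging in norm, and by the point evaluations its limit is the pointwise limit 0.\<close>

lemma compact_operatorD:
 assumes p: "0 < p" and comp: "compact_operator (hardy_space p) (hardy_norm p) Y N T"
 shows "\<exists>C. \<forall>f\<in>hardy_ball p B. N (T f) \<le> C"
  and "(\<And>n. F n \<in> hardy_ball p B) \<Longrightarrow> (\<And>z. norm z < 1 \<Longrightarrow> (\<lambda>n. T (F n) z) \<longlonglongrightarrow> 0) \<Longrightarrow> (\<lambda>n. N (T (F n))) \<longlonglongrightarrow> 0"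
proof -
 have lin: "linear_operator_on (hardy_space p) Y T" using comp by (simp add: compact_operator_def)
 have BX: "f \<in> hardy_space p" "hardy_norm p f \<le> B powr (1/p)" if "f \<in> hardy_ball p B" for f
  using hardy_ball_imp_norm_le[OF p that] by auto
 have TYB: "T f \<in> Y" if "f \<in> hardy_ball p B" for f using lin BX[OF that] by (auto simp: linear_operator_on_def)
 define K where "K = mtopology closure_of (T ` hardy_ball p B)"
 have K: "compactin mtopology K"
 proof -
  have a1: "\<forall>S. S \<subseteq> hardy_space p \<and> (\<exists>B. \<forall>f\<in>S. hardy_norm p f \<le> B) \<longrightarrow> compactin mtopology (mtopology closure_of (T ` S))"
   using comp[unfolded compact_operator_def norm_topology_eq] by (rule conjunct2)
  have a2: "hardy_ball p B \<subseteq> hardy_space p \<and> (\<exists>C. \<forall>f\<in>hardy_ball p B. hardy_norm p f \<le> C)"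
   using BX by (auto intro!: exI[of _ "B powr (1/p)"])
  show ?thesis unfolding K_def by (rule mp[OF spec[where x = "hardy_ball p B", OF a1] a2])
 qed
 have TKB: "T f \<in> K" if "f \<in> hardy_ball p B" for f
  unfolding K_def by (rule subsetD[OF closure_of_subset]) (use TYB that in auto)
 obtain c b where cb: "K \<subseteq> mcball c b" using compactin_imp_mbounded[OF K] unfolding mbounded_def by blast
 have "N (T f) \<le> N c + b" if f: "f \<in> hardy_ball p B" for f
 proof -
  have m: "c \<in> Y" "T f \<in> Y" "dist_N c (T f) \<le> b" using cb TKB[OF f] by (auto simp: in_mcball)
  have "N (T f) = N (\<lambda>z. c z + - (c z - T f z))" by simp
  also have "\<dots> \<le> N c + N (\<lambda>z. - (c z - T f z))"
   using N_triangle[OF m(1) cmult_mem[OF diff_mem[OF m(1,2)], of "-1"]] by simp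
  also have "N (\<lambda>z. - (c z - T f z)) = dist_N c (T f)"
   using N_uminus[OF diff_mem[OF m(1,2)]] m by (simp add: dist_N_def)
  finally show ?thesis using m by simp
 qed
 then show "\<exists>C. \<forall>f\<in>hardy_ball p B. N (T f) \<le> C" by blast
 assume F: "\<And>n. F n \<in> hardy_ball p B"
 note TY = TYB[OF F] and TK = TKB[OF F]
 assume ptw: "\<And>z. norm z < 1 \<Longrightarrow> (\<lambda>n. T (F n) z) \<longlonglongrightarrow> 0"
 show "(\<lambda>n. N (T (F n))) \<longlonglongrightarrow> 0"
 proof (rule ccontr)
  assume "\<not> (\<lambda>n. N (T (F n))) \<longlonglongrightarrow> 0"
  then obtain e where e: "0 < e" "\<exists>\<^sub>F n in sequentially. \<not> dist (N (T (F n))) 0 < e"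
   unfolding tendsto_iff by (auto simp: frequently_def)
  then have "infinite {n. e \<le> N (T (F n))}"
   using N_nonneg[OF TY] by (simp add: frequently_cofinite[symmetric] cofinite_eq_sequentially not_less)
  then obtain s where s: "strict_mono (s :: nat \<Rightarrow> nat)" "\<And>n. e \<le> N (T (F (s n)))"
   using infinite_enumerate by blast
  have "range (\<lambda>n. T (F (s n))) \<subseteq> K" using TK by blast
  then obtain l r where lr: "l \<in> K" "strict_mono (r :: nat \<Rightarrow> nat)" "limitin mtopology ((\<lambda>n. T (F (s n))) \<circ> r) l sequentially"
   using K unfolding compactin_sequentially by blast
  have lY: "l \<in> Y" and dl: "(\<lambda>n. dist_N (T (F (s (r n)))) l) \<longlonglongrightarrow> 0"
   using lr(3) unfolding limitin_metric_dist_null by (auto simp: o_def)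
  \<comment> \<open>Norm convergence implies pointwise convergence, so l is the pointwise limit.\<close>
  have l0: "l = (\<lambda>z. 0)"
  proof
   fix z
   show "l z = 0"
   proof (cases "norm z < 1")
    case True
    then obtain C where C: "\<And>f. f \<in> Y \<Longrightarrow> norm (f z) \<le> C * N f" using evaluation by blast
    have "(\<lambda>n. T (F (s (r n))) z - l z) \<longlonglongrightarrow> 0"
    proof (rule Lim_null_comparison)
     show "\<forall>\<^sub>F n in sequentially. norm (T (F (s (r n))) z - l z) \<le> C * dist_N (T (F (s (r n)))) l"
      using C[OF diff_mem[OF TY lY]] lY TY by (intro always_eventually) (simp add: dist_N_def)
     show "(\<lambda>n. C * dist_N (T (F (s (r n)))) l) \<longlonglongrightarrow> 0" using tendsto_mult_left[OF dl, of C] by simp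
    qed
    moreover have "(\<lambda>n. T (F (s (r n))) z) \<longlonglongrightarrow> 0"
     using LIMSEQ_subseq_LIMSEQ[OF ptw[OF True] strict_mono_o[OF s(1) lr(2)]] by (simp add: o_def)
    ultimately have "(\<lambda>n. T (F (s (r n))) z - (T (F (s (r n))) z - l z)) \<longlonglongrightarrow> 0 - 0" by (intro tendsto_diff)
    then show ?thesis using LIMSEQ_unique[OF _ tendsto_const] by fastforce
   next
    case False
    then show ?thesis using holo lY disc_holomorphicD(2)[of l z] by auto
   qed
  qed
  have "dist_N (T (F (s (r n)))) l = N (T (F (s (r n))))" for n
   using TY lY by (simp add: dist_N_def l0)
  then have "e \<le> dist_N (T (F (s (r n)))) l" for n using s(2) by simp
  then have "e \<le> 0" using LIMSEQ_le_const[OF dl] by blast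
  then show False using e by simp
 qed
qed

end

section \<open>The Bergman norm\<close>

lemma powr_convex_combination:
 fixes q r u v :: real
 assumes q: "1 \<le> q" and l: "0 < r" "r < 1" and uv: "0 \<le> u" "0 \<le> v"
 shows "(r * u + (1 - r) * v) powr q \<le> r * u powr q + (1 - r) * v powr q"
proof (cases "q = 1")
 case False
 with q have q: "1 < q" by simp
 define c where "c = r * u + (1 - r) * v"
 have c0: "0 \<le> c" using l uv by (simp add: c_def)
 show ?thesis
 proof (cases "c = 0")
  case True
  then show ?thesis using q l by (simp add: c_def[symmetric])
 next
  case False
  with c0 have c: "0 < c" by simp
  have "r * (q * c powr (q - 1) * u) + (1 - r) * (q * c powr (q - 1) * v) \<le>
    r * (u powr q + (q - 1) * c powr q) + (1 - r) * (v powr q + (q - 1) * c powr q)"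
   using powr_tangent_le[OF q c uv(1)] powr_tangent_le[OF q c uv(2)] l by (intro add_mono mult_left_mono) auto
  also have "r * (q * c powr (q - 1) * u) + (1 - r) * (q * c powr (q - 1) * v) = q * (c powr (q - 1) * c)"
   by (simp add: c_def algebra_simps)
  also have "c powr (q - 1) * c = c powr q" using c by (simp add: powr_diff)
  finally have fin: "q * c powr q \<le> r * (u powr q + (q - 1) * c powr q) + (1 - r) * (v powr q + (q - 1) * c powr q)" .
  show ?thesis unfolding c_def[symmetric] using fin by (simp add: algebra_simps)
 qed
qed (use uv l in simp)

text \<open>Convexity of x^q applied to the convex combination of F/a and G/b with weights a/(a+b) and
b/(a+b). Stating it with upper bounds a, b covers vanishing integrals without division by 0.\<close>

lemma minkowski_nn_integral:
 fixes F G :: "'a \<Rightarrow> real"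
 assumes q: "1 \<le> q" and ab: "0 < a" "0 < b"
  and [measurable]: "F \<in> borel_measurable M" "G \<in> borel_measurable M"
  and nn: "\<And>x. 0 \<le> F x" "\<And>x. 0 \<le> G x"
  and F: "(\<integral>\<^sup>+x. ennreal (F x powr q) \<partial>M) \<le> ennreal (a powr q)"
  and G: "(\<integral>\<^sup>+x. ennreal (G x powr q) \<partial>M) \<le> ennreal (b powr q)"
 shows "(\<integral>\<^sup>+x. ennreal ((F x + G x) powr q) \<partial>M) \<le> ennreal ((a + b) powr q)"
proof -
 define l where "l = a / (a + b)"
 have l: "0 < l" "l < 1" and l1: "1 - l = b / (a + b)" using ab by (auto simp: l_def field_simps)
 define c d where "c = (a + b) powr q * l / a powr q" and "d = (a + b) powr q * (1 - l) / b powr q"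
 have cd: "0 \<le> c" "0 \<le> d" using l by (auto simp: c_def d_def)
 have "(\<integral>\<^sup>+x. ennreal ((F x + G x) powr q) \<partial>M) \<le> (\<integral>\<^sup>+x. ennreal c * ennreal (F x powr q) + ennreal d * ennreal (G x powr q) \<partial>M)"
 proof (rule nn_integral_mono)
  fix x
  have ll: "(a + b) * l = a" "(a + b) * (1 - l) = b" using ab by (auto simp: l1, simp add: l_def)
  have "(a + b) * (l * (F x / a) + (1 - l) * (G x / b)) = ((a + b) * l) * (F x / a) + ((a + b) * (1 - l)) * (G x / b)"
   by (simp only: distrib_left mult.assoc)
  also have "\<dots> = F x + G x" unfolding ll using ab by simp
  finally have "F x + G x = (a + b) * (l * (F x / a) + (1 - l) * (G x / b))" by (rule sym)
  then have "(F x + G x) powr q = (a + b) powr q * (l * (F x / a) + (1 - l) * (G x / b)) powr q"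
   using ab l nn by (simp add: powr_mult)
  also have "\<dots> \<le> (a + b) powr q * (l * (F x / a) powr q + (1 - l) * (G x / b) powr q)"
   using ab l nn by (intro mult_left_mono powr_convex_combination q) auto
  also have "\<dots> = c * F x powr q + d * G x powr q"
   using ab nn by (simp add: c_def d_def powr_divide algebra_simps)
  finally show "ennreal ((F x + G x) powr q) \<le> ennreal c * ennreal (F x powr q) + ennreal d * ennreal (G x powr q)"
   using cd by (simp add: ennreal_mult[symmetric] ennreal_plus[symmetric] ennreal_leI del: ennreal_plus)
 qed
 also have "\<dots> = ennreal c * (\<integral>\<^sup>+x. ennreal (F x powr q) \<partial>M) + ennreal d * (\<integral>\<^sup>+x. ennreal (G x powr q) \<partial>M)"
  by (subst nn_integral_add) (auto simp: nn_integral_cmult)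
 also have "\<dots> \<le> ennreal c * ennreal (a powr q) + ennreal d * ennreal (b powr q)"
  by (intro add_mono mult_left_mono F G) auto
 also have "\<dots> = ennreal (c * a powr q + d * b powr q)"
  using cd by (simp add: ennreal_mult[symmetric] ennreal_plus[symmetric] del: ennreal_plus)
 also have "c * a powr q = (a + b) powr q * l" using ab by (simp add: c_def)
 also have "d * b powr q = (a + b) powr q * (1 - l)" using ab by (simp add: d_def)
 also have "(a + b) powr q * l + (a + b) powr q * (1 - l) = (a + b) powr q" by (simp add: algebra_simps)
 finally show ?thesis .
qed

definition bergman_integral :: "real \<Rightarrow> real \<Rightarrow> (complex \<Rightarrow> complex) \<Rightarrow> ennreal" where
 "bergman_integral q \<beta> f = (\<integral>\<^sup>+z\<in>(ball 0 1). ennreal (norm (f z) powr q * (1 - (norm z)\<^sup>2) powr \<beta>) \<partial>lborel)"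

lemma
 assumes f: "f \<in> disc_holomorphic"
 shows bergman_space_iff: "f \<in> bergman_space q \<beta> \<longleftrightarrow> bergman_integral q \<beta> f < \<infinity>"
  and bergman_norm_eq: "f \<in> bergman_space q \<beta> \<Longrightarrow> bergman_norm q \<beta> f = ((\<beta> + 1) / pi * enn2real (bergman_integral q \<beta> f)) powr (1 / q)"
proof -
 have [measurable]: "f \<in> borel_measurable borel" by (rule disc_holomorphic_measurable[OF f])
 let ?g = "\<lambda>z. norm (f z) powr q * (1 - (norm z)\<^sup>2) powr \<beta>"
 have eq: "(\<integral>\<^sup>+z. ennreal (norm (indicator (ball 0 1) z *\<^sub>R ?g z)) \<partial>lborel) = bergman_integral q \<beta> f"
  unfolding bergman_integral_def by (intro nn_integral_cong) (auto simp: indicator_def)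
 show iff: "f \<in> bergman_space q \<beta> \<longleftrightarrow> bergman_integral q \<beta> f < \<infinity>"
 proof -
  have m: "(\<lambda>z. indicator (ball 0 1) z *\<^sub>R ?g z) \<in> borel_measurable lborel" by measurable
  have "set_integrable lborel (ball 0 1) ?g \<longleftrightarrow> bergman_integral q \<beta> f < \<infinity>"
   by (simp only: set_integrable_def integrable_iff_bounded eq m simp_thms)
  then show ?thesis using f by (simp add: bergman_space_def)
 qed
 have "(LINT z:ball 0 1|lborel. ?g z) = enn2real (bergman_integral q \<beta> f)"
  unfolding set_lebesgue_integral_def
  by (subst integral_eq_nn_integral) (auto simp: bergman_integral_def indicator_def intro!: arg_cong[where f = enn2real] nn_integral_cong)
 then show "bergman_norm q \<beta> f = ((\<beta> + 1) / pi * enn2real (bergman_integral q \<beta> f)) powr (1 / q)"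
  unfolding bergman_norm_def by simp
qed

lemma bergman_norm_le_iff:
 assumes f: "f \<in> bergman_space q \<beta>" and q: "0 < q" and \<beta>: "-1 < \<beta>" and a: "0 \<le> a"
 shows "bergman_norm q \<beta> f \<le> a \<longleftrightarrow> ennreal ((\<beta> + 1) / pi) * bergman_integral q \<beta> f \<le> ennreal (a powr q)"
proof -
 have fd: "f \<in> disc_holomorphic" using f by (simp add: bergman_space_def)
 have fin: "bergman_integral q \<beta> f < \<infinity>" using f bergman_space_iff[OF fd] by blast
 define x where "x = (\<beta> + 1) / pi * enn2real (bergman_integral q \<beta> f)"
 have x0: "0 \<le> x" using \<beta> by (simp add: x_def)
 have N: "bergman_norm q \<beta> f = x powr (1/q)" using bergman_norm_eq[OF fd f] by (simp add: x_def)
 have e: "ennreal ((\<beta> + 1) / pi) * bergman_integral q \<beta> f = ennreal x"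
  unfolding x_def using fin \<beta> by (subst ennreal_mult) (auto simp: ennreal_enn2real)
 have "x powr (1/q) \<le> a \<longleftrightarrow> x \<le> a powr q"
 proof
  assume "x powr (1/q) \<le> a"
  then have "(x powr (1/q)) powr q \<le> a powr q" using q by (intro powr_mono2) auto
  then show "x \<le> a powr q" using q x0 by (simp add: powr_powr)
 next
  assume "x \<le> a powr q"
  then have "x powr (1/q) \<le> (a powr q) powr (1/q)" using q x0 by (intro powr_mono2) auto
  then show "x powr (1/q) \<le> a" using q a by (simp add: powr_powr)
 qed
 then show ?thesis unfolding N e by (simp add: ennreal_le_iff)
qed

lemma nn_integral_disc_circle_mean:
 assumes f: "f \<in> disc_holomorphic" and q: "0 < q"
 shows "bergman_integral q \<beta> f = ennreal pi * (\<integral>\<^sup>+u\<in>{0..<1}. ennreal (circle_mean q (sqrt u) f * (1 - u) powr \<beta>) \<partial>lborel)"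
proof -
 have [measurable]: "f \<in> borel_measurable borel" by (rule disc_holomorphic_measurable[OF f])
 have m: "(\<lambda>u. (\<integral>\<^sup>+\<theta>\<in>{0..<2*pi}. ennreal (norm (f (of_real (sqrt u) * cis \<theta>)) powr q * (1 - (norm (of_real (sqrt u) * cis \<theta>))\<^sup>2) powr \<beta>) \<partial>lborel) * indicator {0..<1} u) \<in> borel_measurable borel"
  by measurable
 have inner: "(\<integral>\<^sup>+\<theta>\<in>{0..<2*pi}. ennreal (norm (f (of_real (sqrt u) * cis \<theta>)) powr q * (1 - (norm (of_real (sqrt u) * cis \<theta>))\<^sup>2) powr \<beta>) \<partial>lborel) * indicator {0..<1} u
   = ennreal (2 * pi) * (ennreal (circle_mean q (sqrt u) f * (1 - u) powr \<beta>) * indicator {0..<1} u)" for u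
 proof (cases "u \<in> {0..<1}")
  case True
  then have s: "0 \<le> sqrt u" "sqrt u < 1" by auto
  have n: "(norm (of_real (sqrt u) * cis \<theta>))\<^sup>2 = u" for \<theta> using True by (simp add: norm_mult)
  have "(\<integral>\<^sup>+\<theta>\<in>{0..<2*pi}. ennreal (norm (f (of_real (sqrt u) * cis \<theta>)) powr q * (1 - u) powr \<beta>) \<partial>lborel)
   = (\<integral>\<^sup>+\<theta>. ennreal ((1 - u) powr \<beta>) * (ennreal (norm (f (of_real (sqrt u) * cis \<theta>)) powr q) * indicator {0..<2*pi} \<theta>) \<partial>lborel)"
   by (intro nn_integral_cong) (simp add: ennreal_mult mult_ac)
  also have "\<dots> = ennreal ((1 - u) powr \<beta>) * (\<integral>\<^sup>+\<theta>\<in>{0..<2*pi}. ennreal (norm (f (of_real (sqrt u) * cis \<theta>)) powr q) \<partial>lborel)"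
   by (rule nn_integral_cmult) measurable
  also have "\<dots> = ennreal ((1 - u) powr \<beta>) * ennreal (2 * pi * circle_mean q (sqrt u) f)"
   by (simp only: nn_integral_circle_mean[OF disc_holomorphicD(1)[OF f] s q])
  also have "\<dots> = ennreal (2 * pi) * ennreal (circle_mean q (sqrt u) f * (1 - u) powr \<beta>)"
   using circle_mean_nonneg[OF disc_holomorphicD(1)[OF f] s q] by (simp add: ennreal_mult[symmetric] mult_ac)
  finally show ?thesis using True unfolding n by simp
 qed simp
 have c: "ennreal (1/2) * (ennreal (2 * pi) * X) = ennreal pi * X" for X
 proof -
  have "ennreal (1/2) * ennreal (2 * pi) = ennreal pi" by (subst ennreal_mult[symmetric]) simp_all
  then show ?thesis by (simp only: mult.assoc[symmetric])
 qed
 have mm: "(\<lambda>u. ennreal (circle_mean q (sqrt u) f * (1 - u) powr \<beta>) * indicator {0..<1} u) \<in> borel_measurable borel"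
 proof -
  have "(\<lambda>u. ennreal (1 / (2 * pi)) * (ennreal (2 * pi) * (ennreal (circle_mean q (sqrt u) f * (1 - u) powr \<beta>) * indicator {0..<1} u))) \<in> borel_measurable borel"
   using m unfolding inner by measurable
  moreover have "ennreal (1 / (2 * pi)) * (ennreal (2 * pi) * X) = X" for X
  proof -
   have "ennreal (1 / (2 * pi)) * ennreal (2 * pi) = 1" by (subst ennreal_mult[symmetric]) simp_all
   then show ?thesis by (simp add: mult.assoc[symmetric])
  qed
  ultimately show ?thesis by simp
 qed
 have "bergman_integral q \<beta> f = ennreal (1/2) * (\<integral>\<^sup>+u. ennreal (2 * pi) * (ennreal (circle_mean q (sqrt u) f * (1 - u) powr \<beta>) * indicator {0..<1} u) \<partial>lborel)"
  unfolding bergman_integral_def by (subst nn_integral_disc_polar) (simp_all only: inner, measurable)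
 also have "\<dots> = ennreal pi * (\<integral>\<^sup>+u\<in>{0..<1}. ennreal (circle_mean q (sqrt u) f * (1 - u) powr \<beta>) \<partial>lborel)"
  using mm by (subst nn_integral_cmult) (simp, simp only: c)
 finally show ?thesis .
qed

text \<open>Countably many exceptional radii form a null set in polar coordinates.\<close>

lemma AE_radial_majorant:
 assumes f: "f \<in> disc_holomorphic" and q: "0 < q"
 shows "AE u in lborel. 0 < u \<and> u < 1 \<longrightarrow> (\<exists>A. radial_majorant q (sqrt u) f A)"
proof -
 obtain E where E: "countable E" "\<And>R. 0 < R \<Longrightarrow> R < 1 \<Longrightarrow> R \<notin> E \<Longrightarrow> \<exists>A. radial_majorant q R f A"
  by (rule radial_majorant_exists[OF disc_holomorphicD(1)[OF f] q]) (rule that)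
 have "countable ((\<lambda>x. x\<^sup>2) ` E)" using E(1) by (rule countable_image)
 then have "AE u in lborel. u \<notin> (\<lambda>x. x\<^sup>2) ` E"
  by (intro AE_not_in countable_imp_null_set_lborel)
 then show ?thesis
 proof (rule AE_mp, intro AE_I2 impI)
  fix u :: real assume u: "u \<notin> (\<lambda>x. x\<^sup>2) ` E" "0 < u \<and> u < 1"
  have "sqrt u \<notin> E"
  proof
   assume "sqrt u \<in> E"
   then have "(sqrt u)\<^sup>2 \<in> (\<lambda>x. x\<^sup>2) ` E" by (rule imageI)
   then show False using u by simp
  qed
  then show "\<exists>A. radial_majorant q (sqrt u) f A" using u by (intro E(2)) auto
 qed
qed

text \<open>On each circle of radius larger than (1 + |z|)/2 the majorant bounds |f(z)|^q by a mean over the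
circle; these bounds are then integrated in polar coordinates.\<close>

lemma bergman_point_evaluation:
 assumes f: "f \<in> disc_holomorphic" and q: "0 < q" and \<beta>: "-1 < \<beta>" and z: "norm z < 1"
 shows "ennreal (norm (f z) powr q * ((1 - norm z) / 2) powr (\<beta> + 2)) \<le> ennreal ((\<beta> + 1) / pi) * bergman_integral q \<beta> f"
proof -
 define \<rho> where "\<rho> = (1 + norm z) / 2"
 have \<rho>: "0 < \<rho>" "\<rho> < 1" "norm z < \<rho>" using z by (auto simp: \<rho>_def add_pos_nonneg)
 define h where "h = (1 - norm z) / 2"
 have h: "0 < h" "1 - \<rho> = h" using z by (auto simp: h_def \<rho>_def field_simps)
 define K where "K = norm (f z) powr q * h"
 have K: "0 \<le> K" using h by (simp add: K_def)
 have \<rho>2: "\<rho>\<^sup>2 < 1" "\<rho>\<^sup>2 \<le> \<rho>" "0 < \<rho>\<^sup>2" using \<rho> by (auto simp: power2_eq_square mult_left_le power_less_one_iff abs_square_less_1[unfolded power2_eq_square])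
 have "ennreal (K * ((1 - \<rho>\<^sup>2) powr (\<beta> + 1) / (\<beta> + 1))) = ennreal K * (\<integral>\<^sup>+u\<in>{\<rho>\<^sup>2<..<1}. ennreal ((1 - u) powr (\<beta> + 1 - 1)) \<partial>lborel)"
 proof -
  have "(\<integral>\<^sup>+u\<in>{\<rho>\<^sup>2<..<1}. ennreal ((1 - u) powr (\<beta> + 1 - 1)) \<partial>lborel) = ennreal ((1 - \<rho>\<^sup>2) powr (\<beta> + 1) / (\<beta> + 1))"
   by (rule nn_integral_powr_tail) (use \<beta> \<rho>2 in auto)
  then show ?thesis using \<beta> K by (simp only:) (intro ennreal_mult, auto)
 qed
 also have "\<dots> = (\<integral>\<^sup>+u. ennreal K * (ennreal ((1 - u) powr (\<beta> + 1 - 1)) * indicator {\<rho>\<^sup>2<..<1} u) \<partial>lborel)"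
  by (rule nn_integral_cmult[symmetric]) measurable
 also have "\<dots> \<le> (\<integral>\<^sup>+u\<in>{0..<1}. ennreal (circle_mean q (sqrt u) f * (1 - u) powr \<beta>) \<partial>lborel)"
 proof (rule nn_integral_mono_AE, rule AE_mp[OF AE_radial_majorant[OF f q]], intro AE_I2 impI)
  fix u assume maj: "0 < u \<and> u < 1 \<longrightarrow> (\<exists>A. radial_majorant q (sqrt u) f A)"
  show "ennreal K * (ennreal ((1 - u) powr (\<beta> + 1 - 1)) * indicator {\<rho>\<^sup>2<..<1} u) \<le> ennreal (circle_mean q (sqrt u) f * (1 - u) powr \<beta>) * indicator {0..<1} u"
  proof (cases "u \<in> {\<rho>\<^sup>2<..<1}")
   case True
   then have u: "0 < u" "u < 1" "\<rho>\<^sup>2 < u" using less_trans[OF \<rho>2(3)] by auto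
   obtain A where A: "radial_majorant q (sqrt u) f A" using maj u by blast
   have "sqrt (\<rho>\<^sup>2) < sqrt u" using u(3) by (rule real_sqrt_less_mono)
   then have su: "\<rho> < sqrt u" "sqrt u < 1" using \<rho> u by auto
   define t where "t = norm z / sqrt u"
   have "0 < sqrt u" "norm z < sqrt u" using su \<rho> by linarith+
   then have t: "0 \<le> t" "t < 1" by (simp_all add: t_def)
   have ht: "h \<le> 1 - t"
   proof -
    have "h = \<rho> - norm z" by (simp add: h_def \<rho>_def field_simps)
    also have "\<dots> \<le> (sqrt u - norm z) / 1" using su by simp
    also have "\<dots> \<le> (sqrt u - norm z) / sqrt u"
     by (rule divide_left_mono) (use su \<open>norm z < sqrt u\<close> \<open>0 < sqrt u\<close> in linarith, use su \<open>norm z < sqrt u\<close> in linarith, use \<open>0 < sqrt u\<close> in linarith)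
    also have "\<dots> = 1 - t" using \<open>0 < sqrt u\<close> by (simp add: t_def diff_divide_distrib)
    finally show ?thesis .
   qed
   have "K \<le> norm (f z) powr q * (1 - t)" unfolding K_def using ht by (intro mult_left_mono) auto
   also have "\<dots> \<le> A t * (1 - t)"
    using A su \<rho> t unfolding radial_majorant_def t_def by (intro mult_right_mono) auto
   also have "\<dots> \<le> circle_mean q (sqrt u) f" using A t unfolding radial_majorant_def by blast
   finally have "K * (1 - u) powr \<beta> \<le> circle_mean q (sqrt u) f * (1 - u) powr \<beta>" by (rule mult_right_mono) simp
   then show ?thesis using True u K by (simp add: ennreal_mult[symmetric] ennreal_leI)
  qed simp
 qed
 finally have 1: "ennreal (K * ((1 - \<rho>\<^sup>2) powr (\<beta> + 1) / (\<beta> + 1))) \<le> (\<integral>\<^sup>+u\<in>{0..<1}. ennreal (circle_mean q (sqrt u) f * (1 - u) powr \<beta>) \<partial>lborel)" .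
 have "norm (f z) powr q * h powr (\<beta> + 2) = K * h powr (\<beta> + 1)"
 proof -
  have "h powr (\<beta> + 2) = h * h powr (\<beta> + 1)" using powr_mult_base[of h "\<beta> + 1"] h by (simp add: algebra_simps)
  then show ?thesis by (simp add: K_def)
 qed
 also have "\<dots> \<le> K * (1 - \<rho>\<^sup>2) powr (\<beta> + 1)"
  using h \<rho>2 \<beta> K by (intro mult_left_mono powr_mono2) auto
 finally have "ennreal (norm (f z) powr q * h powr (\<beta> + 2)) \<le> ennreal ((\<beta> + 1) * (K * ((1 - \<rho>\<^sup>2) powr (\<beta> + 1) / (\<beta> + 1))))"
  using \<beta> by (intro ennreal_leI) simp
 also have "\<dots> = ennreal (\<beta> + 1) * ennreal (K * ((1 - \<rho>\<^sup>2) powr (\<beta> + 1) / (\<beta> + 1)))"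
  using \<beta> K by (intro ennreal_mult) auto
 also have "\<dots> \<le> ennreal (\<beta> + 1) * (\<integral>\<^sup>+u\<in>{0..<1}. ennreal (circle_mean q (sqrt u) f * (1 - u) powr \<beta>) \<partial>lborel)"
  by (rule mult_left_mono[OF 1]) simp
 also have "ennreal (\<beta> + 1) = ennreal ((\<beta> + 1) / pi) * ennreal pi"
  using \<beta> by (subst ennreal_mult[symmetric]) auto
 finally show ?thesis unfolding nn_integral_disc_circle_mean[OF f q] h_def by (simp add: mult.assoc)
qed

lemma bergman_disc_norm:
 assumes q: "1 \<le> q" and \<beta>: "-1 < \<beta>"
 shows "disc_norm (bergman_space q \<beta>) (bergman_norm q \<beta>)"
proof
 let ?Y = "bergman_space q \<beta>" and ?N = "bergman_norm q \<beta>"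
 have q0: "0 < q" using q by simp
 have sub: "f \<in> disc_holomorphic" if "f \<in> ?Y" for f using that by (simp add: bergman_space_def)
 then show "?Y \<subseteq> disc_holomorphic" by blast
 have z: "bergman_integral q \<beta> (\<lambda>z. 0) = 0" using q0 by (simp add: bergman_integral_def)
 have zd: "(\<lambda>z. 0) \<in> disc_holomorphic" by (simp add: disc_holomorphic_def)
 show z_mem: "(\<lambda>z. 0) \<in> ?Y" by (simp add: bergman_space_iff[OF zd] z)
 show "?N (\<lambda>z. 0) = 0" using bergman_norm_eq[OF zd z_mem] by (simp add: z)
 show N0: "0 \<le> ?N f" for f by (simp add: bergman_norm_def)
 show "?N (\<lambda>z. - f z) = ?N f" for f by (simp add: bergman_norm_def)
 show cm: "(\<lambda>z. c * f z) \<in> ?Y" if f: "f \<in> ?Y" for c f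
 proof -
  have [measurable]: "f \<in> borel_measurable borel" by (rule disc_holomorphic_measurable[OF sub[OF f]])
  have cd: "(\<lambda>z. c * f z) \<in> disc_holomorphic" using sub[OF f] by (auto simp: disc_holomorphic_def intro!: holomorphic_intros)
  have "bergman_integral q \<beta> (\<lambda>z. c * f z) = (\<integral>\<^sup>+z. ennreal (norm c powr q) * (ennreal (norm (f z) powr q * (1 - (norm z)\<^sup>2) powr \<beta>) * indicator (ball 0 1) z) \<partial>lborel)"
   unfolding bergman_integral_def by (intro nn_integral_cong) (simp add: norm_mult powr_mult ennreal_mult mult.assoc)
  also have "\<dots> = ennreal (norm c powr q) * bergman_integral q \<beta> f"
   unfolding bergman_integral_def by (rule nn_integral_cmult) measurable
  also have "\<dots> < \<infinity>" using f bergman_space_iff[OF sub[OF f], of q \<beta>] by (simp add: ennreal_mult_less_top)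
  finally show ?thesis by (simp add: bergman_space_iff[OF cd])
 qed
 have add: "(\<lambda>z. f z + g z) \<in> ?Y \<and> ?N (\<lambda>z. f z + g z) \<le> a + b"
  if f: "f \<in> ?Y" and g: "g \<in> ?Y" and ab: "0 < a" "0 < b" "?N f \<le> a" "?N g \<le> b" for f g a b
 proof -
  have [measurable]: "f \<in> borel_measurable borel" "g \<in> borel_measurable borel"
   by (rule disc_holomorphic_measurable[OF sub[OF f]], rule disc_holomorphic_measurable[OF sub[OF g]])
  have d: "(\<lambda>z. f z + g z) \<in> disc_holomorphic"
   using sub[OF f] sub[OF g] by (auto simp: disc_holomorphic_def intro!: holomorphic_intros)
  define M where "M = density lborel (\<lambda>z::complex. ennreal ((\<beta> + 1) / pi) * (ennreal ((1 - (norm z)\<^sup>2) powr \<beta>) * indicator (ball 0 1) z))"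
  have M: "(\<integral>\<^sup>+z. ennreal (norm (k z) powr q) \<partial>M) = ennreal ((\<beta> + 1) / pi) * bergman_integral q \<beta> k"
   if [measurable]: "k \<in> borel_measurable borel" for k
  proof -
   have "(\<integral>\<^sup>+z. ennreal (norm (k z) powr q) \<partial>M) = (\<integral>\<^sup>+z. ennreal ((\<beta> + 1) / pi) * (ennreal (norm (k z) powr q * (1 - (norm z)\<^sup>2) powr \<beta>) * indicator (ball 0 1) z) \<partial>lborel)"
    unfolding M_def by (subst nn_integral_density) (auto intro!: nn_integral_cong simp: ennreal_mult mult_ac)
   also have "\<dots> = ennreal ((\<beta> + 1) / pi) * bergman_integral q \<beta> k"
    unfolding bergman_integral_def by (rule nn_integral_cmult) measurable
   finally show ?thesis .
  qed
  have "ennreal ((\<beta> + 1) / pi) * bergman_integral q \<beta> (\<lambda>z. f z + g z) = (\<integral>\<^sup>+z. ennreal (norm (f z + g z) powr q) \<partial>M)"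
   by (rule M[symmetric]) measurable
  also have "\<dots> \<le> (\<integral>\<^sup>+z. ennreal ((norm (f z) + norm (g z)) powr q) \<partial>M)"
   using q0 by (intro nn_integral_mono ennreal_leI powr_mono2 norm_triangle_ineq) auto
  also have "\<dots> \<le> ennreal ((a + b) powr q)"
  proof (rule minkowski_nn_integral[OF q ab(1,2)])
   show "(\<lambda>z. norm (f z)) \<in> borel_measurable M" "(\<lambda>z. norm (g z)) \<in> borel_measurable M" unfolding M_def by simp_all
   show "(\<integral>\<^sup>+z. ennreal (norm (f z) powr q) \<partial>M) \<le> ennreal (a powr q)"
    using ab bergman_norm_le_iff[OF f q0 \<beta>, of a] by (subst M) auto
   show "(\<integral>\<^sup>+z. ennreal (norm (g z) powr q) \<partial>M) \<le> ennreal (b powr q)"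
    using ab bergman_norm_le_iff[OF g q0 \<beta>, of b] by (subst M) auto
  qed auto
  finally have le: "ennreal ((\<beta> + 1) / pi) * bergman_integral q \<beta> (\<lambda>z. f z + g z) \<le> ennreal ((a + b) powr q)" .
  have "bergman_integral q \<beta> (\<lambda>z. f z + g z) < \<infinity>"
  proof (rule ccontr)
   assume "\<not> bergman_integral q \<beta> (\<lambda>z. f z + g z) < \<infinity>"
   then have "bergman_integral q \<beta> (\<lambda>z. f z + g z) = top" by (metis less_top infinity_ennreal_def)
   then show False using le \<beta> by (simp add: ennreal_mult_top top_unique)
  qed
  then have mem: "(\<lambda>z. f z + g z) \<in> ?Y" by (simp add: bergman_space_iff[OF d])
  then show ?thesis using bergman_norm_le_iff[OF mem q0 \<beta>, of "a + b"] le ab by auto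
 qed
 show "(\<lambda>z. f z + g z) \<in> ?Y" if "f \<in> ?Y" "g \<in> ?Y" for f g
  using add[OF that, of "?N f + 1" "?N g + 1"] N0[of f] N0[of g] by simp
 show "?N (\<lambda>z. f z + g z) \<le> ?N f + ?N g" if "f \<in> ?Y" "g \<in> ?Y" for f g
 proof (rule field_le_epsilon)
  fix e :: real assume e: "0 < e"
  show "?N (\<lambda>z. f z + g z) \<le> ?N f + ?N g + e"
   using add[OF that, of "?N f + e / 2" "?N g + e / 2"] N0[of f] N0[of g] e by simp
 qed
 fix z :: complex assume z: "norm z < 1"
 define c where "c = ((1 - norm z) / 2) powr (\<beta> + 2)"
 have c: "0 < c" using z by (simp add: c_def)
 show "\<exists>C. \<forall>f\<in>?Y. norm (f z) \<le> C * ?N f"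
 proof (intro exI ballI)
  fix f assume f: "f \<in> ?Y"
  have "ennreal (norm (f z) powr q * c) \<le> ennreal ((\<beta> + 1) / pi) * bergman_integral q \<beta> f"
   unfolding c_def by (rule bergman_point_evaluation[OF sub[OF f] q0 \<beta> z])
  also have "\<dots> \<le> ennreal (?N f powr q)" using bergman_norm_le_iff[OF f q0 \<beta> N0[of f]] by simp
  finally have "norm (f z) powr q * c \<le> ?N f powr q" by (subst (asm) ennreal_le_iff) auto
  then have "norm (f z) powr q \<le> (1 / c) * ?N f powr q" using c by (simp add: field_simps)
  then have "(norm (f z) powr q) powr (1/q) \<le> ((1 / c) * ?N f powr q) powr (1/q)" using q0 by (intro powr_mono2) auto
  also have "((1 / c) * ?N f powr q) powr (1/q) = (1 / c) powr (1/q) * (?N f powr q) powr (1/q)"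
   by (rule powr_mult)
  finally show "norm (f z) \<le> (1 / c) powr (1 / q) * ?N f" using q0 N0[of f] by (simp add: powr_powr)
 qed
qed

section \<open>The Bloch norm\<close>

lemma bloch_disc_norm: "disc_norm bloch_space bloch_norm"
proof
 let ?b = "\<lambda>f z. (1 - (norm z)\<^sup>2) * norm (deriv f z)"
 have sub: "f \<in> disc_holomorphic" if "f \<in> bloch_space" for f using that by (simp add: bloch_space_def)
 then show "bloch_space \<subseteq> disc_holomorphic" by blast
 have w0: "0 \<le> 1 - (norm z)\<^sup>2" if "z \<in> ball 0 1" for z :: complex
  using that power_le_one[of "norm z" 2] by simp
 have le: "?b f z \<le> bloch_norm f - norm (f 0)" if "f \<in> bloch_space" "z \<in> ball 0 1" for f z
  unfolding bloch_norm_def using that cSUP_upper[of z "ball 0 1" "?b f"] by (simp add: bloch_space_def)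
 have crit: "f \<in> bloch_space \<and> bloch_norm f \<le> norm (f 0) + C"
  if "f \<in> disc_holomorphic" "\<And>z. z \<in> ball 0 1 \<Longrightarrow> ?b f z \<le> C" for f C
  using that unfolding bloch_space_def bloch_norm_def by (auto intro!: bdd_aboveI2[where M = C] cSUP_least)
 have N0: "norm (f 0) \<le> bloch_norm f" if "f \<in> bloch_space" for f
 proof -
  have "norm (deriv f 0) \<le> bloch_norm f - norm (f 0)" using le[OF that, of 0] by simp
  then show ?thesis using norm_ge_zero[of "deriv f 0"] by linarith
 qed
 have diffble: "f field_differentiable at z" if "f \<in> disc_holomorphic" "z \<in> ball 0 1" for f z
  using disc_holomorphicD(1)[OF that(1)] that(2) by (meson holomorphic_on_imp_differentiable_at open_ball)
 have zd: "(\<lambda>z. 0) \<in> disc_holomorphic" by (simp add: disc_holomorphic_def)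
 show z: "(\<lambda>z. 0) \<in> bloch_space" using crit[OF zd, of 0] by simp
 show "bloch_norm (\<lambda>z. 0) = 0" using crit[OF zd, of 0] N0[OF z] by simp
 show "0 \<le> bloch_norm f" if "f \<in> bloch_space" for f using N0[OF that] norm_ge_zero order_trans by blast
 show "(\<lambda>z. c * f z) \<in> bloch_space" if f: "f \<in> bloch_space" for c f
 proof -
  have d: "(\<lambda>z. c * f z) \<in> disc_holomorphic" using sub[OF f] by (auto simp: disc_holomorphic_def intro!: holomorphic_intros)
  have "?b (\<lambda>z. c * f z) z \<le> norm c * (bloch_norm f - norm (f 0))" if z: "z \<in> ball 0 1" for z
   using mult_left_mono[OF le[OF f z], of "norm c"] deriv_cmult[OF diffble[OF sub[OF f] z], of c] by (simp add: norm_mult mult_ac)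
  then show ?thesis using crit[OF d] by blast
 qed
 have add: "(\<lambda>z. f z + g z) \<in> bloch_space \<and> bloch_norm (\<lambda>z. f z + g z) \<le> norm (f 0 + g 0) + (bloch_norm f - norm (f 0) + (bloch_norm g - norm (g 0)))"
  if f: "f \<in> bloch_space" and g: "g \<in> bloch_space" for f g
 proof (rule crit)
  show "(\<lambda>z. f z + g z) \<in> disc_holomorphic" using sub[OF f] sub[OF g] by (auto simp: disc_holomorphic_def intro!: holomorphic_intros)
  fix z :: complex assume z: "z \<in> ball 0 1"
  have "deriv (\<lambda>z. f z + g z) z = deriv f z + deriv g z"
   by (rule deriv_add[OF diffble[OF sub[OF f] z] diffble[OF sub[OF g] z]])
  then have "?b (\<lambda>z. f z + g z) z \<le> (1 - (norm z)\<^sup>2) * (norm (deriv f z) + norm (deriv g z))"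
   using w0[OF z] by (intro mult_left_mono) (auto intro: norm_triangle_ineq)
  also have "\<dots> \<le> bloch_norm f - norm (f 0) + (bloch_norm g - norm (g 0))"
   using le[OF f z] le[OF g z] by (simp add: distrib_left)
  finally show "?b (\<lambda>z. f z + g z) z \<le> bloch_norm f - norm (f 0) + (bloch_norm g - norm (g 0))" .
 qed
 show "(\<lambda>z. f z + g z) \<in> bloch_space" if "f \<in> bloch_space" "g \<in> bloch_space" for f g using add[OF that] by blast
 show "bloch_norm (\<lambda>z. f z + g z) \<le> bloch_norm f + bloch_norm g" if "f \<in> bloch_space" "g \<in> bloch_space" for f g
  using add[OF that] norm_triangle_ineq[of "f 0" "g 0"] by linarith
 show "bloch_norm (\<lambda>z. - f z) = bloch_norm f" if f: "f \<in> bloch_space" for f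
 proof -
  have "norm (deriv (\<lambda>z. - f z) z) = norm (deriv f z)" if "z \<in> ball 0 1" for z
   using deriv_minus[OF diffble[OF sub[OF f] that]] by simp
  then have "(SUP z\<in>ball 0 1. ?b (\<lambda>z. - f z) z) = (SUP z\<in>ball 0 1. ?b f z)" by (intro SUP_cong) auto
  then show ?thesis by (simp add: bloch_norm_def)
 qed
 fix z :: complex assume z: "norm z < 1"
 define C where "C = 1 + norm z / (1 - (norm z)\<^sup>2)"
 have d0: "0 < 1 - (norm z)\<^sup>2" using z by (simp add: power_less_one_iff abs_square_less_1)
 show "\<exists>C. \<forall>f\<in>bloch_space. norm (f z) \<le> C * bloch_norm f"
 proof (intro exI ballI)
  fix f assume f: "f \<in> bloch_space"
  have N: "0 \<le> bloch_norm f" using N0[OF f] norm_ge_zero order_trans by blast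
  have "norm (f z - f 0) \<le> bloch_norm f / (1 - (norm z)\<^sup>2) * norm (z - 0)"
  proof (rule field_differentiable_bound[of "cball 0 (norm z)" f "deriv f"])
   show "(f has_field_derivative deriv f w) (at w within cball 0 (norm z))" if "w \<in> cball 0 (norm z)" for w
    using diffble[OF sub[OF f], of w] that z by (auto simp: field_differentiable_derivI has_field_derivative_at_within)
   show "norm (deriv f w) \<le> bloch_norm f / (1 - (norm z)\<^sup>2)" if w: "w \<in> cball 0 (norm z)" for w
   proof -
    have "norm w \<le> norm z" using w by simp
    then have "(norm w)\<^sup>2 \<le> (norm z)\<^sup>2" by (intro power_mono) auto
    then have "(1 - (norm z)\<^sup>2) * norm (deriv f w) \<le> ?b f w" by (intro mult_right_mono) auto
    also have "\<dots> \<le> bloch_norm f"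
    proof -
     have "w \<in> ball 0 1" using w z by simp
     from le[OF f this] show ?thesis using norm_ge_zero[of "f 0"] by linarith
    qed
    finally show ?thesis using d0 by (simp add: pos_le_divide_eq mult.commute)
   qed
  qed auto
  moreover have "norm (f z) \<le> norm (f 0) + norm (f z - f 0)" by (metis add.commute diff_add_cancel norm_triangle_ineq)
  ultimately show "norm (f z) \<le> C * bloch_norm f" using N0[OF f] by (simp add: C_def algebra_simps)
 qed
qed

section \<open>Sufficiency\<close>

lemma tail_bound_extend:
 assumes fin: "emeasure \<mu> {0..<1} < \<infinity>" and \<mu>: "borel_measure_01 \<mu>" and a: "0 \<le> a" "a < 1" and s: "0 < s"
  and tail: "tail_bound \<mu> a s e" and e: "0 \<le> e"
 obtains C where "0 < C" "tail_bound \<mu> 0 s C"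
proof -
 obtain M where M: "emeasure \<mu> {0..<1} = ennreal M" "0 \<le> M" using fin by (cases "emeasure \<mu> {0..<1}") auto
 \<comment> \<open>The three terms serve t \<ge> a, t < a, and positivity.\<close>
 define C where "C = e + M * (1 - a) powr (-s) + 1"
 have C: "0 < C" "e \<le> C" "M * (1 - a) powr (-s) \<le> C" using e M by (auto simp: C_def add_nonneg_pos)
 have "emeasure \<mu> {t..<1} \<le> ennreal (C * (1 - t) powr s)" if t: "0 \<le> t" "t < 1" for t
 proof (cases "a \<le> t")
  case True
  then have "emeasure \<mu> {t..<1} \<le> ennreal (e * (1 - t) powr s)" using tail t by (simp add: tail_bound_def)
  also have "\<dots> \<le> ennreal (C * (1 - t) powr s)" using C by (intro ennreal_leI mult_right_mono) auto
  finally show ?thesis .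
 next
  case False
  have "{0..<1} \<inter> {0..<1} \<in> sets \<mu>" by (rule borel_measure_01D(3)[OF \<mu>]) simp
  then have "emeasure \<mu> {t..<1} \<le> emeasure \<mu> {0..<1}" using t by (intro emeasure_mono) auto
  also have "\<dots> = ennreal M" by (rule M)
  also have "\<dots> \<le> ennreal (C * (1 - t) powr s)"
  proof (rule ennreal_leI)
   have "M = M * (1 - a) powr (-s) * (1 - a) powr s" using a by (simp add: powr_minus)
   also have "\<dots> \<le> C * (1 - t) powr s" using C M False a s by (intro mult_mono powr_mono2) auto
   finally show "M \<le> C * (1 - t) powr s" .
  qed
  finally show ?thesis .
 qed
 then show ?thesis using C by (intro that[of C]) (auto simp: tail_bound_def)
qed

definition density_01 :: "real measure \<Rightarrow> (real \<Rightarrow> real) \<Rightarrow> real measure" where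
 "density_01 \<mu> \<phi> = density \<mu> (\<lambda>t. ennreal (\<phi> t))"

lemma density_01:
 assumes \<mu>: "borel_measure_01 \<mu>" and \<phi>[measurable]: "\<phi> \<in> borel_measurable borel"
 shows "borel_measure_01 (density_01 \<mu> \<phi>)"
  and "h \<in> borel_measurable borel \<Longrightarrow> (\<integral>\<^sup>+t. h t \<partial>density_01 \<mu> \<phi>) = (\<integral>\<^sup>+t. ennreal (\<phi> t) * h t \<partial>\<mu>)"
  and "A \<in> sets borel \<Longrightarrow> A \<subseteq> {0..<1} \<Longrightarrow> emeasure (density_01 \<mu> \<phi>) A = (\<integral>\<^sup>+t\<in>A. ennreal (\<phi> t) \<partial>\<mu>)"
proof -
 have m: "(\<lambda>t. ennreal (\<phi> t)) \<in> borel_measurable \<mu>" by (rule measurable_01I[OF \<mu>]) measurable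
 show "borel_measure_01 (density_01 \<mu> \<phi>)" using \<mu> by (simp add: borel_measure_01_def density_01_def)
 show "(\<integral>\<^sup>+t. h t \<partial>density_01 \<mu> \<phi>) = (\<integral>\<^sup>+t. ennreal (\<phi> t) * h t \<partial>\<mu>)" if h: "h \<in> borel_measurable borel"
  unfolding density_01_def by (rule nn_integral_density[OF m measurable_01I[OF \<mu> h]])
 show "emeasure (density_01 \<mu> \<phi>) A = (\<integral>\<^sup>+t\<in>A. ennreal (\<phi> t) \<partial>\<mu>)" if "A \<in> sets borel" "A \<subseteq> {0..<1}"
  unfolding density_01_def using borel_measure_01D(3)[OF \<mu> that(1)] that(2)
  by (intro emeasure_density[OF m]) (simp add: Int_absorb2)
qed

text \<open>On {t..<1} the weight is at most (1 - t)^w.\<close>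

lemma tail_bound_power_weight:
 assumes \<mu>: "borel_measure_01 \<mu>" and w: "0 \<le> w" and a: "0 \<le> a" and tail: "tail_bound \<mu> a s e" and e: "0 \<le> e"
 shows "tail_bound (density_01 \<mu> (\<lambda>t. (1 - t) powr w)) a (w + s) e"
 unfolding tail_bound_def
proof (intro allI impI)
 fix t assume t: "a \<le> t \<and> t < 1"
 have "emeasure (density_01 \<mu> (\<lambda>t. (1 - t) powr w)) {t..<1} = (\<integral>\<^sup>+u\<in>{t..<1}. ennreal ((1 - u) powr w) \<partial>\<mu>)"
  by (rule density_01(3)[OF \<mu>]) (use a t in auto)
 also have "\<dots> \<le> (\<integral>\<^sup>+u\<in>{t..<1}. ennreal ((1 - t) powr w) \<partial>\<mu>)"
  using w by (intro nn_integral_mono) (auto simp: indicator_def intro!: ennreal_leI powr_mono2)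
 also have "\<dots> = ennreal ((1 - t) powr w) * emeasure \<mu> {t..<1}"
 proof (rule nn_integral_cmult_indicator)
  have "{t..<1} \<inter> {0..<1} \<in> sets \<mu>" by (rule borel_measure_01D(3)[OF \<mu>]) simp
  then show "{t..<1} \<in> sets \<mu>" using a t by (simp add: Int_absorb2)
 qed
 also have "\<dots> \<le> ennreal ((1 - t) powr w) * ennreal (e * (1 - t) powr s)"
  using tail t by (intro mult_left_mono) (auto simp: tail_bound_def)
 also have "\<dots> = ennreal (e * (1 - t) powr (w + s))"
  using e by (simp add: ennreal_mult[symmetric] powr_add mult_ac)
 finally show "emeasure (density_01 \<mu> (\<lambda>t. (1 - t) powr w)) {t..<1} \<le> ennreal (e * (1 - t) powr (w + s))" .
qed

lemma ln_two_over_ge: "0 \<le> t \<Longrightarrow> t < 1 \<Longrightarrow> 1 / 2 \<le> ln (2 / (1 - t))" for t :: real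
proof -
 assume t: "0 \<le> t" "t < 1"
 have "1 / 2 \<le> ln (2::real)" using ln2_ge_two_thirds by simp
 also have "\<dots> \<le> ln (2 / (1 - t))" using t by (subst ln_le_cancel_iff) (auto simp: field_simps)
 finally show ?thesis .
qed

lemma ln_two_over_split: "t0 < 1 \<Longrightarrow> t < 1 \<Longrightarrow> ln (2 / (1 - t)) = ln (2 / (1 - t0)) + ln ((1 - t0) / (1 - t))" for t t0 :: real
 by (simp add: ln_div)

text \<open>A tail bound with a logarithm passes to the weighted measure: on {c..<1} the hypothesis gives
\<mu> a tail constant e / L with L = ln (2 / (1 - c)), and the weight exceeds L by ln ((1 - c) /
(1 - t)), whose contribution is of the order e / (s L).\<close>

lemma tail_bound_log_weight:
 assumes \<mu>: "borel_measure_01 \<mu>" and s: "0 < s" and a: "0 \<le> a" and e: "0 \<le> e"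
  and tail: "\<And>t. a \<le> t \<Longrightarrow> t < 1 \<Longrightarrow> ennreal (ln (2 / (1 - t))) * emeasure \<mu> {t..<1} \<le> ennreal (e * (1 - t) powr s)"
 shows "tail_bound (density_01 \<mu> (\<lambda>t. ln (2 / (1 - t)))) a s (e * (1 + 8 / s))"
 unfolding tail_bound_def
proof (intro allI impI)
 fix c assume c: "a \<le> c \<and> c < 1"
 define L where "L = ln (2 / (1 - c))"
 have L: "1 / 2 \<le> L" unfolding L_def using c a by (intro ln_two_over_ge) auto
 have tb: "tail_bound \<mu> c s (e / L)"
  unfolding tail_bound_def
 proof (intro allI impI)
  fix t assume t: "c \<le> t \<and> t < 1"
  have "L \<le> ln (2 / (1 - t))" unfolding L_def using t c by (subst ln_le_cancel_iff) (auto simp: field_simps)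
  then have "ennreal L * emeasure \<mu> {t..<1} \<le> ennreal (ln (2 / (1 - t))) * emeasure \<mu> {t..<1}"
   by (intro mult_right_mono ennreal_leI) auto
  also have "\<dots> \<le> ennreal (e * (1 - t) powr s)" using tail t c by auto
  finally have "ennreal (1 / L) * (ennreal L * emeasure \<mu> {t..<1}) \<le> ennreal (1 / L) * ennreal (e * (1 - t) powr s)"
   by (intro mult_left_mono) auto
  moreover have "ennreal (1 / L) * ennreal L = 1" using L by (subst ennreal_mult[symmetric]) auto
  ultimately show "emeasure \<mu> {t..<1} \<le> ennreal (e / L * (1 - t) powr s)"
   using L e by (simp add: mult.assoc[symmetric] ennreal_mult[symmetric])
 qed
 have "emeasure (density_01 \<mu> (\<lambda>t. ln (2 / (1 - t)))) {c..<1} = (\<integral>\<^sup>+t\<in>{c..<1}. ennreal (ln (2 / (1 - t))) \<partial>\<mu>)"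
  by (rule density_01(3)[OF \<mu>]) (use a c in auto)
 also have "\<dots> \<le> ennreal (e / L * s) * (\<integral>\<^sup>+t\<in>{c..<1}. ennreal (ln (2 / (1 - t)) * (1 - t) powr (s - 1)) \<partial>lborel)"
 proof (rule nn_integral_le_of_tail_bound[OF \<mu> _ _ s _ tb])
  fix t assume "c \<le> t" "t < 1"
  then show "0 \<le> ln (2 / (1 - t))" using ln_two_over_ge[of t] a c by auto
 next
  fix t t' assume "c \<le> t" "t \<le> t'" "t' < 1"
  then show "ln (2 / (1 - t)) \<le> ln (2 / (1 - t'))" by (subst ln_le_cancel_iff) (auto simp: field_simps)
 qed (use a c L e in auto)
 also have "(\<integral>\<^sup>+t\<in>{c..<1}. ennreal (ln (2 / (1 - t)) * (1 - t) powr (s - 1)) \<partial>lborel) \<le>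
   (\<integral>\<^sup>+t. ennreal L * (ennreal ((1 - t) powr (s - 1)) * indicator {c<..<1} t) + ennreal (2 / s * (1 - c) powr (s / 2)) * (ennreal ((1 - t) powr (s / 2 - 1)) * indicator {c<..<1} t) \<partial>lborel)"
 proof (rule nn_integral_mono_AE, rule AE_mp[OF AE_lborel_singleton[of c]], rule AE_I2, rule impI)
  fix t :: real assume tc: "t \<noteq> c"
  show "ennreal (ln (2 / (1 - t)) * (1 - t) powr (s - 1)) * indicator {c..<1} t \<le> ennreal L * (ennreal ((1 - t) powr (s - 1)) * indicator {c<..<1} t) + ennreal (2 / s * (1 - c) powr (s / 2)) * (ennreal ((1 - t) powr (s / 2 - 1)) * indicator {c<..<1} t)"
  proof (cases "t \<in> {c<..<1}")
   case True
   then have t: "c < t" "t < 1" by auto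
   define y where "y = (1 - c) / (1 - t)"
   have y: "0 < y" using t c by (simp add: y_def)
   \<comment> \<open>ln y \<le> (2 / s) y^(s/2): half of the available power absorbs the logarithm.\<close>
   have "ln (y powr (s / 2)) \<le> y powr (s / 2)" using y by (intro ln_bound) auto
   then have "ln y \<le> 2 / s * y powr (s / 2)" using y s by (simp add: ln_powr field_simps)
   also have "y powr (s / 2) = (1 - c) powr (s / 2) * (1 - t) powr (- (s / 2))"
    using t c by (simp add: y_def powr_divide powr_minus_divide)
   finally have "ln (2 / (1 - t)) \<le> L + 2 / s * ((1 - c) powr (s / 2) * (1 - t) powr (- (s / 2)))"
    using ln_two_over_split[of c t] t c by (simp add: L_def y_def)
   then have "ln (2 / (1 - t)) * (1 - t) powr (s - 1) \<le> (L + 2 / s * ((1 - c) powr (s / 2) * (1 - t) powr (- (s / 2)))) * (1 - t) powr (s - 1)"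
    by (rule mult_right_mono) simp
   also have "\<dots> = L * (1 - t) powr (s - 1) + 2 / s * (1 - c) powr (s / 2) * ((1 - t) powr (- (s / 2)) * (1 - t) powr (s - 1))"
    by (simp add: algebra_simps)
   also have "(1 - t) powr (- (s / 2)) * (1 - t) powr (s - 1) = (1 - t) powr (s / 2 - 1)"
    by (subst powr_add[symmetric]) (simp add: field_simps)
   finally have "ennreal (ln (2 / (1 - t)) * (1 - t) powr (s - 1)) \<le> ennreal (L * (1 - t) powr (s - 1) + 2 / s * (1 - c) powr (s / 2) * (1 - t) powr (s / 2 - 1))"
    by (rule ennreal_leI)
   also have "\<dots> = ennreal L * ennreal ((1 - t) powr (s - 1)) + ennreal (2 / s * (1 - c) powr (s / 2)) * ennreal ((1 - t) powr (s / 2 - 1))"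
   proof -
    have p: "0 \<le> L" "0 \<le> (1 - t) powr (s - 1)" "0 \<le> 2 / s * (1 - c) powr (s / 2)" "0 \<le> (1 - t) powr (s / 2 - 1)"
     using L s by auto
    show ?thesis
     by (simp only: ennreal_mult[OF p(1,2)] ennreal_mult[OF p(3,4)] ennreal_plus[OF mult_nonneg_nonneg[OF p(1,2)] mult_nonneg_nonneg[OF p(3,4)]])
   qed
   finally show ?thesis using True by simp
  qed (use tc in auto)
 qed
 also have "\<dots> = ennreal L * ennreal ((1 - c) powr s / s) + ennreal (2 / s * (1 - c) powr (s / 2)) * ennreal ((1 - c) powr (s / 2) / (s / 2))"
  using s c nn_integral_powr_tail[of s c] nn_integral_powr_tail[of "s/2" c]
  by (subst nn_integral_add) (auto simp: nn_integral_cmult)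
 also have "\<dots> = ennreal (L * ((1 - c) powr s / s) + 2 / s * (1 - c) powr (s / 2) * ((1 - c) powr (s / 2) / (s / 2)))"
 proof -
  have p: "0 \<le> L" "0 \<le> (1 - c) powr s / s" "0 \<le> 2 / s * (1 - c) powr (s / 2)" "0 \<le> (1 - c) powr (s / 2) / (s / 2)"
   using L s by auto
  show ?thesis
   by (simp only: ennreal_mult[OF p(1,2)] ennreal_mult[OF p(3,4)] ennreal_plus[OF mult_nonneg_nonneg[OF p(1,2)] mult_nonneg_nonneg[OF p(3,4)]])
 qed
 also have "L * ((1 - c) powr s / s) + 2 / s * (1 - c) powr (s / 2) * ((1 - c) powr (s / 2) / (s / 2)) = (L / s + 4 / s\<^sup>2) * (1 - c) powr s"
 proof -
  have "(1 - c) powr (s / 2) * (1 - c) powr (s / 2) = (1 - c) powr s" by (simp add: powr_add[symmetric])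
  then show ?thesis using s by (simp add: field_simps power2_eq_square)
 qed
 also have "ennreal (e / L * s) * ennreal ((L / s + 4 / s\<^sup>2) * (1 - c) powr s) = ennreal (e / L * s * ((L / s + 4 / s\<^sup>2) * (1 - c) powr s))"
  using e L s by (intro ennreal_mult[symmetric]) auto
 also have "\<dots> \<le> ennreal (e * (1 + 8 / s) * (1 - c) powr s)"
 proof (rule ennreal_leI)
  have "e / L * s * (L / s + 4 / s\<^sup>2) = e * (1 + 4 / (s * L))" using L s by (simp add: field_simps power2_eq_square)
  also have "\<dots> \<le> e * (1 + 8 / s)"
  proof -
   have "1 / L \<le> 2" using L by (simp add: pos_divide_le_eq)
   then have "4 / s * (1 / L) \<le> 4 / s * 2" using s by (intro mult_left_mono) auto
   then show ?thesis using e by (intro mult_left_mono) auto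
  qed
  finally have "e / L * s * (L / s + 4 / s\<^sup>2) * (1 - c) powr s \<le> e * (1 + 8 / s) * (1 - c) powr s" by (rule mult_right_mono) simp
  then show "e / L * s * ((L / s + 4 / s\<^sup>2) * (1 - c) powr s) \<le> e * (1 + 8 / s) * (1 - c) powr s" by (simp only: mult.assoc)
 qed
 finally show "emeasure (density_01 \<mu> (\<lambda>t. ln (2 / (1 - t)))) {c..<1} \<le> ennreal (e * (1 + 8 / s) * (1 - c) powr s)"
  by (simp add: mult_left_mono)
qed

text \<open>Polar coordinates: the angular integral raises the exponent by 1, the radial one is a kernel
integral on the unit interval.\<close>

lemma disc_kernel_integral:
 assumes A: "1 < A" and \<gamma>: "-1 < \<gamma>" "\<gamma> + 1 \<le> A - 1" and t: "0 \<le> t" "t < 1"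
 shows "(\<integral>\<^sup>+z. ennreal (norm (1 - of_real t * z) powr (-A) * (1 - (norm z)\<^sup>2) powr \<gamma>) * indicator (ball (0::complex) 1) z \<partial>lborel)
  \<le> ennreal (angular_const A * 2 powr (A - 1) *
    (if \<gamma> + 1 = A - 1 then 1 / (\<gamma> + 1) + ln (1 / (1 - t)) else kernel_const (\<gamma> + 1) (A - 1) * (1 - t) powr (\<gamma> + 2 - A)))"
proof -
 define D where "D = (if \<gamma> + 1 = A - 1 then 1 / (\<gamma> + 1) + ln (1 / (1 - t)) else kernel_const (\<gamma> + 1) (A - 1) * (1 - t) powr (\<gamma> + 2 - A))"
 define c where "c = angular_const A * 2 powr (A - 1)"
 have c: "0 \<le> c" using angular_const_pos[OF A] by (simp add: c_def)
 have half: "ennreal (1/2) \<le> 1" using ennreal_leI[of "1/2" 1] by (simp only: ennreal_1)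
 have "(\<integral>\<^sup>+z. ennreal (norm (1 - of_real t * z) powr (-A) * (1 - (norm z)\<^sup>2) powr \<gamma>) * indicator (ball (0::complex) 1) z \<partial>lborel)
  = ennreal (1/2) * (\<integral>\<^sup>+u\<in>{0..<1}. \<integral>\<^sup>+\<theta>\<in>{0..<2*pi}. ennreal (norm (1 - of_real t * (of_real (sqrt u) * cis \<theta>)) powr (-A) * (1 - (norm (of_real (sqrt u) * cis \<theta>))\<^sup>2) powr \<gamma>) \<partial>lborel \<partial>lborel)"
  by (rule nn_integral_disc_polar) measurable
 also have "\<dots> \<le> 1 * (\<integral>\<^sup>+u. ennreal c * (ennreal ((1 - u) powr (\<gamma> + 1 - 1) * (1 - u * t) powr (-(A - 1))) * indicator {0..1} u) \<partial>lborel)"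
 proof (rule mult_mono[OF half nn_integral_mono])
  fix u :: real
  show "(\<integral>\<^sup>+\<theta>\<in>{0..<2*pi}. ennreal (norm (1 - of_real t * (of_real (sqrt u) * cis \<theta>)) powr (-A) * (1 - (norm (of_real (sqrt u) * cis \<theta>))\<^sup>2) powr \<gamma>) \<partial>lborel) * indicator {0..<1} u
    \<le> ennreal c * (ennreal ((1 - u) powr (\<gamma> + 1 - 1) * (1 - u * t) powr (-(A - 1))) * indicator {0..1} u)"
  proof (cases "u \<in> {0..<1}")
   case True
   then have u: "0 \<le> u" "u < 1" by auto
   define \<rho> where "\<rho> = t * sqrt u"
   have \<rho>: "0 \<le> \<rho>" "\<rho> < 1"
    using t u mult_left_le_one_le[of t "sqrt u"] by (auto simp: \<rho>_def mult.commute)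
   have n: "(norm (of_real (sqrt u) * cis \<theta>))\<^sup>2 = u" for \<theta> using u by (simp add: norm_mult)
   have n2: "of_real t * (of_real (sqrt u) * cis \<theta>) = of_real \<rho> * cis \<theta>" for \<theta> by (simp add: \<rho>_def)
   have "(\<integral>\<^sup>+\<theta>\<in>{0..<2*pi}. ennreal (norm (1 - of_real \<rho> * cis \<theta>) powr (-A) * (1 - u) powr \<gamma>) \<partial>lborel)
     \<le> (\<integral>\<^sup>+\<theta>. ennreal ((1 - u) powr \<gamma>) * (ennreal (norm (1 - of_real \<rho> * cis \<theta>) powr (-A)) * indicator {0..2*pi} \<theta>) \<partial>lborel)"
    by (intro nn_integral_mono) (auto simp: indicator_def ennreal_mult[symmetric] mult.commute)
   also have "\<dots> = ennreal ((1 - u) powr \<gamma>) * (\<integral>\<^sup>+\<theta>\<in>{0..2*pi}. ennreal (norm (1 - of_real \<rho> * cis \<theta>) powr (-A)) \<partial>lborel)"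
    by (rule nn_integral_cmult) measurable
   also have "\<dots> \<le> ennreal ((1 - u) powr \<gamma>) * ennreal (angular_const A * (1 - \<rho>) powr (1 - A))"
    by (intro mult_left_mono nn_integral_angular_kernel[OF A \<rho>]) simp
   also have "\<dots> = ennreal ((1 - u) powr \<gamma> * (angular_const A * (1 - \<rho>) powr (1 - A)))"
    using angular_const_pos[OF A] by (intro ennreal_mult[symmetric]) auto
   also have "\<dots> \<le> ennreal (c * ((1 - u) powr (\<gamma> + 1 - 1) * (1 - u * t) powr (-(A - 1))))"
   proof (rule ennreal_leI)
    have ut: "u * t \<le> u" using t u by (simp add: mult_left_le)
    have "(1 - u * t) / 2 \<le> 1 - \<rho>"
    proof -
     have "\<rho>\<^sup>2 = t * (t * u)" using u by (simp add: \<rho>_def power2_eq_square)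
     also have "\<dots> \<le> 1 * (t * u)" using t u by (intro mult_right_mono) auto
     finally have "1 - u * t \<le> (1 - \<rho>) * (1 + \<rho>)" by (simp add: algebra_simps power2_eq_square)
     also have "\<dots> \<le> (1 - \<rho>) * 2" using \<rho> by (intro mult_left_mono) auto
     finally show ?thesis by simp
    qed
    then have "(1 - \<rho>) powr (1 - A) \<le> ((1 - u * t) / 2) powr (1 - A)"
     using A ut u by (intro powr_mono2') auto
    also have "\<dots> = 2 powr (A - 1) * (1 - u * t) powr (-(A - 1))"
    proof -
     have "((1 - u * t) / 2) powr (1 - A) = (1 - u * t) powr (1 - A) / 2 powr (1 - A)" by (rule powr_divide)
     also have "\<dots> = (1 - u * t) powr (1 - A) * 2 powr (A - 1)" by (simp add: powr_minus_divide[of 2 "A - 1", simplified])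
     finally show ?thesis by simp
    qed
    finally have "(1 - u) powr \<gamma> * (angular_const A * (1 - \<rho>) powr (1 - A)) \<le> (1 - u) powr \<gamma> * (angular_const A * (2 powr (A - 1) * (1 - u * t) powr (-(A - 1))))"
     using angular_const_pos[OF A] by (intro mult_left_mono) auto
    then show "(1 - u) powr \<gamma> * (angular_const A * (1 - \<rho>) powr (1 - A)) \<le> c * ((1 - u) powr (\<gamma> + 1 - 1) * (1 - u * t) powr (-(A - 1)))"
     by (simp add: c_def mult_ac)
   qed
   finally show ?thesis using True c unfolding n n2 by (simp add: ennreal_mult)
  qed simp
 qed simp_all
 also have "\<dots> = ennreal c * (\<integral>\<^sup>+u\<in>{0..1}. ennreal ((1 - u) powr (\<gamma> + 1 - 1) * (1 - u * t) powr (-(A - 1))) \<partial>lborel)"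
  by (simp only: mult_1, rule nn_integral_cmult) measurable
 also have "\<dots> \<le> ennreal c * ennreal D"
 proof (intro mult_left_mono)
  show "(\<integral>\<^sup>+u\<in>{0..1}. ennreal ((1 - u) powr (\<gamma> + 1 - 1) * (1 - u * t) powr (-(A - 1))) \<partial>lborel) \<le> ennreal D"
  proof -
   have e: "\<gamma> + 1 - (A - 1) = \<gamma> + 2 - A" and \<gamma>1: "0 < \<gamma> + 1" using \<gamma> by simp_all
   show ?thesis using nn_integral_disc_kernel[OF \<gamma>1 \<gamma>(2) t] unfolding D_def kernel_const_def e .
  qed
 qed simp
 also have "\<dots> = ennreal (c * D)"
 proof (rule ennreal_mult[symmetric, OF c])
  have "0 \<le> ln (1 / (1 - t))" using t by (intro ln_ge_zero) (simp add: field_simps)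
  then have "0 \<le> 1 / (\<gamma> + 1) + ln (1 / (1 - t))" using \<gamma> by (intro add_nonneg_nonneg) auto
  moreover have "0 \<le> kernel_const (\<gamma> + 1) (A - 1) * (1 - t) powr (\<gamma> + 2 - A)" if "\<gamma> + 1 \<noteq> A - 1"
   using kernel_const_pos[of "\<gamma> + 1" "A - 1"] \<gamma> that by (intro mult_nonneg_nonneg) auto
  ultimately show "0 \<le> D" unfolding D_def by (simp only: if_split) blast
 qed
 finally show ?thesis by (simp add: c_def D_def)
qed

lemma norm_hilbert_op_le:
 assumes \<mu>: "borel_measure_01 \<mu>" and fin: "emeasure \<mu> {0..<1} < \<infinity>" and \<alpha>: "0 < \<alpha>" and f: "moment_represented \<mu> f" and z: "norm z < 1"
 shows "ennreal (norm (hilbert_op \<mu> \<alpha> f z)) \<le> (\<integral>\<^sup>+t. ennreal (norm (f (of_real t)) * norm (1 - of_real t * z) powr (-\<alpha>)) \<partial>\<mu>)"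
  and "(\<integral>\<^sup>+t. ennreal (norm (f (of_real t)) * norm (1 - of_real t * z) powr (-\<alpha>)) \<partial>\<mu>) < \<infinity>"
  and "ennreal (norm (deriv (hilbert_op \<mu> \<alpha> f) z)) \<le> ennreal \<alpha> * (\<integral>\<^sup>+t. ennreal (norm (f (of_real t)) * norm (1 - of_real t * z) powr (-(\<alpha> + 1))) \<partial>\<mu>)"
proof -
 note sp = borel_measure_01D(2)[OF \<mu>]
 have int: "integrable \<mu> (\<lambda>t. f (of_real t))" using f by (simp add: moment_represented_def)
 have n: "norm (f (of_real t) * (1 - of_real t * z) powr (- of_real a)) = norm (f (of_real t)) * norm (1 - of_real t * z) powr (-a)"
  if "t \<in> space \<mu>" for t a
  using norm_kernel[OF norm_mult_01, of t z a] that z by (simp add: norm_mult sp)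
 have k: "integrable \<mu> (\<lambda>t. f (of_real t) * (1 - of_real t * z) powr (- of_real a))" if "0 < a" for a
  by (rule moment_kernel_sums(2)[OF \<mu> that int z])
 have eq: "(\<integral>\<^sup>+t. ennreal (norm (f (of_real t)) * norm (1 - of_real t * z) powr (-a)) \<partial>\<mu>) = ennreal (LINT t|\<mu>. norm (f (of_real t) * (1 - of_real t * z) powr (- of_real a)))"
  if "0 < a" for a
 proof -
  have "(\<integral>\<^sup>+t. ennreal (norm (f (of_real t)) * norm (1 - of_real t * z) powr (-a)) \<partial>\<mu>) = (\<integral>\<^sup>+t. ennreal (norm (f (of_real t) * (1 - of_real t * z) powr (- of_real a))) \<partial>\<mu>)"
   by (intro nn_integral_cong) (simp only: n)
  also have "\<dots> = ennreal (LINT t|\<mu>. norm (f (of_real t) * (1 - of_real t * z) powr (- of_real a)))"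
   by (rule nn_integral_eq_integral[OF integrable_norm[OF k[OF that]]]) simp
  finally show ?thesis .
 qed
 show "ennreal (norm (hilbert_op \<mu> \<alpha> f z)) \<le> (\<integral>\<^sup>+t. ennreal (norm (f (of_real t)) * norm (1 - of_real t * z) powr (-\<alpha>)) \<partial>\<mu>)"
  unfolding hilbert_op_representation(2)[OF \<mu> fin \<alpha> f z] eq[OF \<alpha>] by (intro ennreal_leI integral_norm_bound)
 show "(\<integral>\<^sup>+t. ennreal (norm (f (of_real t)) * norm (1 - of_real t * z) powr (-\<alpha>)) \<partial>\<mu>) < \<infinity>"
  unfolding eq[OF \<alpha>] by simp
 have \<alpha>1: "0 < \<alpha> + 1" using \<alpha> by simp
 have "norm (LINT t|\<mu>. of_real t * f (of_real t) * (1 - of_real t * z) powr (- of_real (\<alpha> + 1))) \<le> (LINT t|\<mu>. norm (f (of_real t) * (1 - of_real t * z) powr (- of_real (\<alpha> + 1))))"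
 proof -
  have int1: "integrable \<mu> (\<lambda>t. of_real (t ^ 1) * f (of_real t))" by (rule moment_kernel_sums(3)[OF \<mu> \<alpha> int z])
  then have "integrable \<mu> (\<lambda>t. of_real t * f (of_real t))" by simp
  from moment_kernel_sums(2)[OF \<mu> \<alpha>1 this z]
  have k1: "integrable \<mu> (\<lambda>t. of_real t * f (of_real t) * (1 - of_real t * z) powr (- of_real (\<alpha> + 1)))" .
  have "norm (LINT t|\<mu>. of_real t * f (of_real t) * (1 - of_real t * z) powr (- of_real (\<alpha> + 1))) \<le> (LINT t|\<mu>. norm (of_real t * f (of_real t) * (1 - of_real t * z) powr (- of_real (\<alpha> + 1))))"
   by (rule integral_norm_bound)
  also have "\<dots> \<le> (LINT t|\<mu>. norm (f (of_real t) * (1 - of_real t * z) powr (- of_real (\<alpha> + 1))))"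
  proof (rule integral_mono[OF integrable_norm[OF k1] integrable_norm[OF k[OF \<alpha>1]]])
   fix t assume "t \<in> space \<mu>"
   then have "0 \<le> t" "t \<le> 1" by (auto simp: sp)
   then show "norm (of_real t * f (of_real t) * (1 - of_real t * z) powr (- of_real (\<alpha> + 1))) \<le> norm (f (of_real t) * (1 - of_real t * z) powr (- of_real (\<alpha> + 1)))"
    unfolding mult.assoc norm_mult[of "of_real t"] by (simp only: norm_of_real abs_of_nonneg) (rule mult_left_le_one_le, auto)
  qed
  finally show ?thesis .
 qed
 then show "ennreal (norm (deriv (hilbert_op \<mu> \<alpha> f) z)) \<le> ennreal \<alpha> * (\<integral>\<^sup>+t. ennreal (norm (f (of_real t)) * norm (1 - of_real t * z) powr (-(\<alpha> + 1))) \<partial>\<mu>)"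
  unfolding hilbert_op_representation(3)[OF \<mu> fin \<alpha> f z] eq[OF \<alpha>1] using \<alpha>
  by (simp only: norm_mult norm_of_real) (simp add: ennreal_mult[symmetric] ennreal_leI mult_left_mono)
qed

text \<open>Linearity of the operator comes from linearity of the integral representation.\<close>

lemma hilbert_compactI:
 assumes Y: "disc_norm Y N" and p: "0 < p" and \<mu>: "borel_measure_01 \<mu>" and fin: "emeasure \<mu> {0..<1} < \<infinity>" and \<alpha>: "0 < \<alpha>"
  and rep: "\<And>f B. f \<in> hardy_ball p B \<Longrightarrow> moment_represented \<mu> f"
  and mem: "\<And>f B. f \<in> hardy_ball p B \<Longrightarrow> hilbert_op \<mu> \<alpha> f \<in> Y"
  and crit: "\<And>B F. (\<And>n. F n \<in> hardy_ball p B) \<Longrightarrow>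
   (\<And>a. a < 1 \<Longrightarrow> uniform_limit (cball 0 a) F (\<lambda>z. 0) sequentially) \<Longrightarrow> (\<lambda>n. N (hilbert_op \<mu> \<alpha> (F n))) \<longlonglongrightarrow> 0"
 shows "hilbert_compact \<mu> \<alpha> (hardy_space p) (hardy_norm p) Y N"
proof -
 interpret disc_norm Y N by fact
 have ball: "\<exists>B. f \<in> hardy_ball p B" if "f \<in> hardy_space p" for f
  using hardy_ball_of_norm_le[OF p that order_refl] by blast
 have op0: "hilbert_op \<mu> \<alpha> f z = 0" if "\<not> norm z < 1" for f z using that by (simp add: hilbert_op_def)
 have R: "hilbert_op \<mu> \<alpha> f z = (LINT t|\<mu>. f (of_real t) * (1 - of_real t * z) powr (- of_real \<alpha>))"
  "integrable \<mu> (\<lambda>t. f (of_real t) * (1 - of_real t * z) powr (- of_real \<alpha>))"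
  if "f \<in> hardy_ball p B" "norm z < 1" for f B z
  using hilbert_op_representation(2)[OF \<mu> fin \<alpha> rep[OF that(1)] that(2)] moment_kernel_sums(2)[OF \<mu> \<alpha> _ that(2)] rep[OF that(1)]
  by (auto simp: moment_represented_def)
 have lin: "linear_operator_on (hardy_space p) Y (hilbert_op \<mu> \<alpha>)"
  unfolding linear_operator_on_def
 proof (intro conjI ballI allI)
  show "hilbert_op \<mu> \<alpha> \<in> hardy_space p \<rightarrow> Y" using ball mem by blast
  fix f assume "f \<in> hardy_space p"
  then obtain B where f: "f \<in> hardy_ball p B" using ball by blast
  show "hilbert_op \<mu> \<alpha> (\<lambda>z. c * f z) = (\<lambda>z. c * hilbert_op \<mu> \<alpha> f z)" for c
  proof
   fix z
   show "hilbert_op \<mu> \<alpha> (\<lambda>z. c * f z) z = c * hilbert_op \<mu> \<alpha> f z"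
   proof (cases "norm z < 1")
    case True
    show ?thesis unfolding R(1)[OF f True] R(1)[OF hardy_ball_cmult[OF p f] True]
     by (simp only: mult.assoc integral_mult_right_zero)
   qed (simp add: op0)
  qed
  fix g assume "g \<in> hardy_space p"
  then obtain C where g: "g \<in> hardy_ball p C" using ball by blast
  show "hilbert_op \<mu> \<alpha> (\<lambda>z. f z + g z) = (\<lambda>z. hilbert_op \<mu> \<alpha> f z + hilbert_op \<mu> \<alpha> g z)"
  proof
   fix z
   show "hilbert_op \<mu> \<alpha> (\<lambda>z. f z + g z) z = hilbert_op \<mu> \<alpha> f z + hilbert_op \<mu> \<alpha> g z"
   proof (cases "norm z < 1")
    case True
    show ?thesis unfolding R(1)[OF f True] R(1)[OF g True] R(1)[OF hardy_ball_add[OF p f g] True] distrib_right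
     by (rule Bochner_Integration.integral_add[OF R(2)[OF f True] R(2)[OF g True]])
   qed (simp add: op0)
  qed
 qed
 have "compact_operator (hardy_space p) (hardy_norm p) Y N (hilbert_op \<mu> \<alpha>)"
 proof (rule compact_operatorI[OF p lin])
  fix B and F :: "nat \<Rightarrow> complex \<Rightarrow> complex"
  assume "\<And>n. F n \<in> hardy_ball p B" "\<And>a. a < 1 \<Longrightarrow> uniform_limit (cball 0 a) F (\<lambda>z. 0) sequentially"
  then show "(\<lambda>n. N (hilbert_op \<mu> \<alpha> (F n))) \<longlonglongrightarrow> 0" by (rule crit)
 qed
 moreover have "hilbert_defined \<mu> \<alpha> f" if "f \<in> hardy_space p" for f
  using ball[OF that] hilbert_op_representation(1)[OF \<mu> fin \<alpha> rep] by blast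
 ultimately show ?thesis
  unfolding hilbert_compact_def by blast
qed

text \<open>The estimate by an L^q(\<nu>) norm combined with the Carleson embedding for \<nu> gives
boundedness, and with its vanishing form the compactness criterion.\<close>

lemma bergman_compactI:
 assumes p: "0 < p" "p \<le> q" and q: "1 \<le> q" and \<alpha>: "1 < \<alpha>"
  and \<mu>: "borel_measure_01 \<mu>" and fin: "emeasure \<mu> {0..<1} < \<infinity>"
  and rep: "\<And>f B. f \<in> hardy_ball p B \<Longrightarrow> moment_represented \<mu> f"
  and \<nu>: "borel_measure_01 \<nu>" and tail: "0 \<le> C" "tail_bound \<nu> 0 (q / p) C" and van: "vanishing_tail \<nu> (q / p)" and K: "0 \<le> K"
  and est: "\<And>f B. f \<in> hardy_ball p B \<Longrightarrow> bergman_integral q (\<alpha> - 2) (hilbert_op \<mu> \<alpha> f) \<le> ennreal K * (\<integral>\<^sup>+t. ennreal (norm (f (of_real t)) powr q) \<partial>\<nu>)"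
 shows "hilbert_compact \<mu> \<alpha> (hardy_space p) (hardy_norm p) (bergman_space q (\<alpha> - 2)) (bergman_norm q (\<alpha> - 2))"
proof (rule hilbert_compactI[OF bergman_disc_norm p(1) \<mu> fin _ rep])
 have \<alpha>0: "0 < \<alpha>" and \<beta>: "-1 < \<alpha> - 2" and q0: "0 < q" using \<alpha> q by auto
 show mem: "hilbert_op \<mu> \<alpha> f \<in> bergman_space q (\<alpha> - 2)" if f: "f \<in> hardy_ball p B" for f B
 proof -
  have "(\<integral>\<^sup>+t. ennreal (norm (f (of_real t)) powr q) \<partial>\<nu>) = (\<integral>\<^sup>+t\<in>{0..<1}. ennreal (norm (f (of_real t)) powr q) \<partial>\<nu>)"
   by (intro nn_integral_cong) (auto simp: borel_measure_01D(2)[OF \<nu>])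
  also have "\<dots> \<le> ennreal (4 * (q / p) * C * B powr (q / p))"
   by (rule carleson_embedding[OF p f \<nu> _ _ tail]) auto
  finally have "(\<integral>\<^sup>+t. ennreal (norm (f (of_real t)) powr q) \<partial>\<nu>) < \<infinity>" by (rule le_less_trans) simp
  then have "ennreal K * (\<integral>\<^sup>+t. ennreal (norm (f (of_real t)) powr q) \<partial>\<nu>) < \<infinity>" by (simp add: ennreal_mult_less_top)
  then show ?thesis
   using est[OF f] by (subst bergman_space_iff[OF hilbert_op_representation(4)[OF \<mu> fin \<alpha>0 rep[OF f]]]) (rule le_less_trans)
 qed
 fix B and F :: "nat \<Rightarrow> complex \<Rightarrow> complex"
 assume F: "\<And>n. F n \<in> hardy_ball p B" and unif: "\<And>a. a < 1 \<Longrightarrow> uniform_limit (cball 0 a) F (\<lambda>z. 0) sequentially"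
 have lim: "(\<lambda>n. \<integral>\<^sup>+t. ennreal (norm (F n (of_real t)) powr q) \<partial>\<nu>) \<longlonglongrightarrow> 0"
  by (rule carleson_embedding_vanishing[OF p F \<nu> tail_bound_0_finite[OF tail(2)] van unif])
 let ?c = "ennreal ((\<alpha> - 2 + 1) / pi) * ennreal K"
 have "(\<lambda>n. ?c * (\<integral>\<^sup>+t. ennreal (norm (F n (of_real t)) powr q) \<partial>\<nu>)) \<longlonglongrightarrow> ?c * 0"
  by (rule tendsto_mult_ennreal[OF tendsto_const lim]) (auto simp: ennreal_mult_eq_top_iff)
 then have lim2: "(\<lambda>n. ?c * (\<integral>\<^sup>+t. ennreal (norm (F n (of_real t)) powr q) \<partial>\<nu>)) \<longlonglongrightarrow> 0" by simp
 show "(\<lambda>n. bergman_norm q (\<alpha> - 2) (hilbert_op \<mu> \<alpha> (F n))) \<longlonglongrightarrow> 0"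
 proof (rule tendstoI)
  fix e :: real assume e: "0 < e"
  have "\<forall>\<^sub>F n in sequentially. ?c * (\<integral>\<^sup>+t. ennreal (norm (F n (of_real t)) powr q) \<partial>\<nu>) < ennreal ((e / 2) powr q)"
   using order_tendstoD(2)[OF lim2, of "ennreal ((e / 2) powr q)"] e by simp
  then show "\<forall>\<^sub>F n in sequentially. dist (bergman_norm q (\<alpha> - 2) (hilbert_op \<mu> \<alpha> (F n))) 0 < e"
  proof eventually_elim
   case (elim n)
   have "ennreal ((\<alpha> - 2 + 1) / pi) * bergman_integral q (\<alpha> - 2) (hilbert_op \<mu> \<alpha> (F n)) \<le> ?c * (\<integral>\<^sup>+t. ennreal (norm (F n (of_real t)) powr q) \<partial>\<nu>)"
    unfolding mult.assoc by (intro mult_left_mono est[OF F]) simp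
   also have "\<dots> \<le> ennreal ((e / 2) powr q)" using elim by simp
   finally have "bergman_norm q (\<alpha> - 2) (hilbert_op \<mu> \<alpha> (F n)) \<le> e / 2"
    using bergman_norm_le_iff[OF mem[OF F] q0 \<beta>, of "e/2" n] e by simp
   moreover have "0 \<le> bergman_norm q (\<alpha> - 2) (hilbert_op \<mu> \<alpha> (F n))" by (simp add: bergman_norm_def)
   ultimately show ?case using e by simp
  qed
 qed
qed (use q \<alpha> in auto)

lemma fubini_disc_01:
 fixes H :: "complex \<times> real \<Rightarrow> ennreal"
 assumes \<mu>: "borel_measure_01 \<mu>" and fin: "emeasure \<mu> {0..<1} < \<infinity>" and H: "H \<in> borel_measurable (borel \<Otimes>\<^sub>M borel)"
 shows "(\<integral>\<^sup>+z. \<integral>\<^sup>+t. H (z, t) \<partial>\<mu> \<partial>lborel) = (\<integral>\<^sup>+t. \<integral>\<^sup>+z. H (z, t) \<partial>lborel \<partial>\<mu>)"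
proof -
 interpret finite_measure \<mu> by (rule finite_measure_01[OF \<mu> fin])
 interpret P: pair_sigma_finite \<mu> "lborel :: complex measure" ..
 have id: "(\<lambda>t. t) \<in> borel_measurable \<mu>" by (rule measurable_01I[OF \<mu>]) simp
 have fs: "(\<lambda>p. fst p) \<in> measurable (\<mu> \<Otimes>\<^sub>M lborel) borel"
  by (rule measurable_compose[OF measurable_fst id])
 have sn: "(\<lambda>p. snd p) \<in> measurable (\<mu> \<Otimes>\<^sub>M (lborel :: complex measure)) borel"
  using measurable_snd[of \<mu> "lborel :: complex measure"] by simp
 have "(\<lambda>p. H (snd p, fst p)) \<in> borel_measurable (\<mu> \<Otimes>\<^sub>M lborel)"
  by (rule measurable_compose[OF measurable_Pair[OF sn fs] H])
 then have "(\<lambda>(t, z). H (z, t)) \<in> borel_measurable (\<mu> \<Otimes>\<^sub>M lborel)" by (simp add: case_prod_beta')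
 from P.Fubini'[OF this] show ?thesis by simp
qed

lemma norm_kernel_ge:
 fixes z :: complex
 assumes "0 \<le> t" "t < 1" "norm z < 1"
 shows "1 - t * norm z \<le> norm (1 - of_real t * z)" "0 < 1 - t * norm z" "1 - norm z \<le> 1 - t * norm z" "1 - t \<le> 1 - t * norm z"
proof -
 show "1 - t * norm z \<le> norm (1 - of_real t * z)"
  using norm_triangle_ineq2[of 1 "of_real t * z"] assms by (simp add: norm_mult)
 have "t * norm z \<le> 1 * norm z" using assms by (intro mult_right_mono) auto
 then show "0 < 1 - t * norm z" "1 - norm z \<le> 1 - t * norm z" using assms by auto
 show "1 - t \<le> 1 - t * norm z" using mult_left_le[of "norm z" t] assms by simp
qed

lemma one_minus_norm_square_le: "norm z \<le> 1 \<Longrightarrow> 1 - (norm z)\<^sup>2 \<le> 2 * (1 - norm z)"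
proof -
 assume "norm z \<le> 1"
 have "1 - (norm z)\<^sup>2 = (1 - norm z) * (1 + norm z)" by (simp add: power2_eq_square algebra_simps)
 also have "\<dots> \<le> (1 - norm z) * 2" using \<open>norm z \<le> 1\<close> by (intro mult_left_mono) auto
 finally show ?thesis by simp
qed

text \<open>Jensen's inequality against the weight w(t) = (1 - t)^(-x) |1 - t z|^(-y). With x = s -
\<alpha>/2 its total mass is of order (1 - |z|)^(\<alpha>/2 - y); y is chosen such that the
resulting power of 1 - |z| is -(\<alpha> - 1)/2, which lies strictly between -(\<alpha> - 1) and
0. This leaves room for both the weight and the kernel in the area integral that follows.\<close>

lemma hilbert_op_pointwise_jensen:
 assumes \<mu>: "borel_measure_01 \<mu>" and fin: "emeasure \<mu> {0..<1} < \<infinity>" and \<alpha>: "1 < \<alpha>" and q: "1 < q" and s: "\<alpha> \<le> s"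
  and C: "0 < C" "tail_bound \<mu> 0 s C" and f: "moment_represented \<mu> f" and z: "norm z < 1"
 shows "ennreal (norm (hilbert_op \<mu> \<alpha> f z) powr q) \<le>
  ennreal ((C * (s * kernel_const (\<alpha> / 2) ((\<alpha> * q - 1) / (2 * (q - 1))))) powr (q - 1) * (1 - norm z) powr (-((\<alpha> - 1) / 2))) *
  (\<integral>\<^sup>+t. ennreal (norm (f (of_real t)) powr q * (1 - t) powr ((s - \<alpha> / 2) * (q - 1)) * norm (1 - of_real t * z) powr (-((\<alpha> * q + 1) / 2))) \<partial>\<mu>)"
proof -
 note sp = borel_measure_01D(2)[OF \<mu>]
 have [measurable]: "f \<in> borel_measurable borel" using f disc_holomorphic_measurable by (auto simp: moment_represented_def)
 have \<alpha>0: "0 < \<alpha>" using \<alpha> by simp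
 \<comment> \<open>f times the kernel is F w; x and y distribute it between the two factors.\<close>
 define x where "x = s - \<alpha> / 2"
 define y where "y = (\<alpha> * q - 1) / (2 * (q - 1))"
 have x: "0 \<le> x" "x < s" "s - x = \<alpha> / 2" using \<alpha> s by (auto simp: x_def)
 have y: "\<alpha> / 2 < y" using q \<alpha> by (simp add: y_def field_simps)
 have yq: "y * (q - 1) = (\<alpha> * q - 1) / 2"
 proof -
  have ne: "q - 1 \<noteq> 0" using q by simp
  have "y = (\<alpha> * q - 1) / 2 / (q - 1)" by (simp add: y_def)
  then show ?thesis by (simp only: nonzero_eq_divide_eq[OF ne])
 qed
 define J0 where "J0 = C * (s * kernel_const (\<alpha> / 2) y)"
 have J0: "0 < J0" using C \<alpha> s y kernel_const_pos[of "\<alpha>/2" y] by (simp add: J0_def)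
 define J where "J = J0 * (1 - norm z) powr (\<alpha> / 2 - y)"
 have J: "0 < J" using J0 z by (simp add: J_def)
 define F where "F = (\<lambda>t. norm (f (of_real t)) * \<bar>1 - t\<bar> powr x * norm (1 - of_real t * z) powr (y - \<alpha>))"
 define w where "w = (\<lambda>t. \<bar>1 - t\<bar> powr (-x) * norm (1 - of_real t * z) powr (-y))"
 have Fm: "F \<in> borel_measurable \<mu>" unfolding F_def by (rule measurable_01I[OF \<mu>]) measurable
 have wm: "w \<in> borel_measurable \<mu>" unfolding w_def by (rule measurable_01I[OF \<mu>]) measurable
 define I where "I = enn2real (\<integral>\<^sup>+t. ennreal (norm (f (of_real t)) * norm (1 - of_real t * z) powr (-\<alpha>)) \<partial>\<mu>)"
 have I: "(\<integral>\<^sup>+t. ennreal (norm (f (of_real t)) * norm (1 - of_real t * z) powr (-\<alpha>)) \<partial>\<mu>) = ennreal I"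
  using norm_hilbert_op_le(2)[OF \<mu> fin \<alpha>0 f z] by (simp add: I_def ennreal_enn2real)
 have I0: "0 \<le> I" by (simp add: I_def)
 have TI: "norm (hilbert_op \<mu> \<alpha> f z) \<le> I"
  using norm_hilbert_op_le(1)[OF \<mu> fin \<alpha>0 f z] I0 unfolding I by (simp add: ennreal_le_iff)
 have kp: "0 < norm (1 - of_real t * z)" if "t \<in> space \<mu>" for t
  using norm_kernel_ge(1,2)[of t z] that z by (auto simp: sp)
 have jen: "ennreal (I powr q) \<le> ennreal (J powr (q - 1)) * (\<integral>\<^sup>+t. ennreal (F t powr q * w t) \<partial>\<mu>)"
 proof (rule jensen_powr_nn_integral[OF q J I0 Fm wm])
  show "0 \<le> F t" "0 \<le> w t" for t by (auto simp: F_def w_def)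
  have "(\<integral>\<^sup>+t. ennreal (w t) \<partial>\<mu>) \<le> (\<integral>\<^sup>+t\<in>{0..<1}. ennreal ((1 - t) powr (-x) * (1 - t * norm z) powr (-y)) \<partial>\<mu>)"
  proof (rule nn_integral_mono)
   fix t assume "t \<in> space \<mu>"
   then have t: "0 \<le> t" "t < 1" by (auto simp: sp)
   have "norm (1 - of_real t * z) powr (-y) \<le> (1 - t * norm z) powr (-y)"
    using norm_kernel_ge[OF t z] y \<alpha> by (intro powr_mono2') auto
   then show "ennreal (w t) \<le> ennreal ((1 - t) powr (-x) * (1 - t * norm z) powr (-y)) * indicator {0..<1} t"
    using t by (simp add: w_def ennreal_leI mult_left_mono)
  qed
  also have "\<dots> \<le> ennreal (C * (s * kernel_const (s - x) y) * (1 - norm z) powr (s - x - y))"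
   by (rule nn_integral_tail_kernel[OF \<mu> _ _ _ C(2)]) (use C x y z in auto)
  also have "\<dots> = ennreal J" by (simp add: J_def J0_def x(3))
  finally show "(\<integral>\<^sup>+t. ennreal (w t) \<partial>\<mu>) \<le> ennreal J" .
  show "(\<integral>\<^sup>+t. ennreal (F t * w t) \<partial>\<mu>) = ennreal I"
   unfolding I[symmetric]
  proof (intro nn_integral_cong arg_cong[where f = ennreal])
   fix t assume t: "t \<in> space \<mu>"
   have "F t * w t = norm (f (of_real t)) * (\<bar>1 - t\<bar> powr x * \<bar>1 - t\<bar> powr (-x)) * (norm (1 - of_real t * z) powr (y - \<alpha>) * norm (1 - of_real t * z) powr (-y))"
    by (simp add: F_def w_def mult_ac)
   also have "\<bar>1 - t\<bar> powr x * \<bar>1 - t\<bar> powr (-x) = 1" using t by (simp add: powr_add[symmetric] sp)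
   also have "norm (1 - of_real t * z) powr (y - \<alpha>) * norm (1 - of_real t * z) powr (-y) = norm (1 - of_real t * z) powr (-\<alpha>)"
    by (simp add: powr_add[symmetric])
   finally show "F t * w t = norm (f (of_real t)) * norm (1 - of_real t * z) powr (-\<alpha>)" by simp
  qed
 qed
 have "ennreal (norm (hilbert_op \<mu> \<alpha> f z) powr q) \<le> ennreal (I powr q)"
  using TI q by (intro ennreal_leI powr_mono2) auto
 also note jen
 also have "J powr (q - 1) = J0 powr (q - 1) * (1 - norm z) powr (-((\<alpha> - 1) / 2))"
 proof -
  have "(\<alpha> / 2 - y) * (q - 1) = -((\<alpha> - 1) / 2)" using yq by (simp add: left_diff_distrib) (simp add: field_simps)
  then show ?thesis unfolding J_def powr_mult powr_powr by simp
 qed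
 also have "(\<integral>\<^sup>+t. ennreal (F t powr q * w t) \<partial>\<mu>) = (\<integral>\<^sup>+t. ennreal (norm (f (of_real t)) powr q * (1 - t) powr ((s - \<alpha> / 2) * (q - 1)) * norm (1 - of_real t * z) powr (-((\<alpha> * q + 1) / 2))) \<partial>\<mu>)"
 proof (intro nn_integral_cong arg_cong[where f = ennreal])
  fix t assume t: "t \<in> space \<mu>"
  let ?k = "norm (1 - of_real t * z)"
  have "F t powr q * w t = norm (f (of_real t)) powr q * (\<bar>1 - t\<bar> powr (x * q) * \<bar>1 - t\<bar> powr (-x)) * (?k powr ((y - \<alpha>) * q) * ?k powr (-y))"
   by (simp add: F_def w_def powr_mult powr_powr mult_ac)
  also have "\<bar>1 - t\<bar> powr (x * q) * \<bar>1 - t\<bar> powr (-x) = (1 - t) powr ((s - \<alpha> / 2) * (q - 1))"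
  proof -
   have "x * q + - x = (s - \<alpha> / 2) * (q - 1)" unfolding x_def[symmetric] by (simp add: algebra_simps)
   then show ?thesis using t by (subst powr_add[symmetric]) (simp add: sp)
  qed
  also have "?k powr ((y - \<alpha>) * q) * ?k powr (-y) = ?k powr (-((\<alpha> * q + 1) / 2))"
  proof -
   have "(y - \<alpha>) * q + - y = y * (q - 1) - \<alpha> * q" by (simp add: algebra_simps)
   also have "\<dots> = -((\<alpha> * q + 1) / 2)" unfolding yq by (simp add: field_simps)
   finally show ?thesis by (subst powr_add[symmetric]) simp
  qed
  finally show "F t powr q * w t = norm (f (of_real t)) powr q * (1 - t) powr ((s - \<alpha> / 2) * (q - 1)) * ?k powr (-((\<alpha> * q + 1) / 2))" .
 qed
 finally show ?thesis unfolding J0_def y_def .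
qed

text \<open>Integrating the pointwise inequality over the disc and exchanging integrals; all powers of 1 - t
add up to (q - 1)(s - \<alpha>).\<close>

lemma bergman_estimate:
 assumes \<mu>: "borel_measure_01 \<mu>" and fin: "emeasure \<mu> {0..<1} < \<infinity>" and \<alpha>: "1 < \<alpha>" and q: "1 < q" and s: "\<alpha> \<le> s"
  and C: "0 < C" "tail_bound \<mu> 0 s C"
 shows "\<exists>K\<ge>0. \<forall>f. moment_represented \<mu> f \<longrightarrow> bergman_integral q (\<alpha> - 2) (hilbert_op \<mu> \<alpha> f) \<le>
  ennreal K * (\<integral>\<^sup>+t. ennreal (norm (f (of_real t)) powr q) \<partial>density_01 \<mu> (\<lambda>t. (1 - t) powr ((q - 1) * (s - \<alpha>))))"
proof -
 note sp = borel_measure_01D(2)[OF \<mu>]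
 define A B \<gamma> where "A = (\<alpha> * q + 1) / 2" and "B = (\<alpha> - 1) / 2" and "\<gamma> = \<alpha> - 2 - B"
 have aq: "\<alpha> < \<alpha> * q" using \<alpha> q by simp
 have aq1: "1 < \<alpha> * q" using \<alpha> aq by linarith
 have A: "1 < A" and B: "0 < B" and \<gamma>: "-1 < \<gamma>" "\<gamma> + 1 < A - 1"
  using \<alpha> aq aq1 by (auto simp: A_def B_def \<gamma>_def field_simps)
 define J0 where "J0 = (C * (s * kernel_const (\<alpha> / 2) ((\<alpha> * q - 1) / (2 * (q - 1))))) powr (q - 1)"
 define D where "D = angular_const A * 2 powr (A - 1) * kernel_const (\<gamma> + 1) (A - 1)"
 have J0: "0 \<le> J0" by (simp add: J0_def)
 have D: "0 \<le> D" using angular_const_pos[OF A] kernel_const_pos[of "\<gamma> + 1" "A - 1"] \<gamma> by (simp add: D_def)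
 define K where "K = J0 * 2 powr B * D"
 have K: "0 \<le> K" using J0 D by (simp add: K_def)
 have "bergman_integral q (\<alpha> - 2) (hilbert_op \<mu> \<alpha> f) \<le>
  ennreal K * (\<integral>\<^sup>+t. ennreal (norm (f (of_real t)) powr q) \<partial>density_01 \<mu> (\<lambda>t. (1 - t) powr ((q - 1) * (s - \<alpha>))))"
  if f: "moment_represented \<mu> f" for f
 proof -
  have [measurable]: "f \<in> borel_measurable borel" using f disc_holomorphic_measurable by (auto simp: moment_represented_def)
  define g where "g = (\<lambda>t. norm (f (of_real t)) powr q * (1 - t) powr ((s - \<alpha> / 2) * (q - 1)))"
  have [measurable]: "g \<in> borel_measurable borel" unfolding g_def by measurable
  have g0: "0 \<le> g t" for t by (simp add: g_def)
  define c where "c = J0 * 2 powr B"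
  have c: "0 \<le> c" using J0 by (simp add: c_def)
  define H where "H = (\<lambda>p. ennreal (g (snd p)) * (ennreal (norm (1 - of_real (snd p) * fst p) powr (-A) * (1 - (norm (fst p))\<^sup>2) powr \<gamma>) * indicator (ball (0::complex) 1) (fst p)))"
  have H[measurable]: "H \<in> borel_measurable (borel \<Otimes>\<^sub>M borel)" unfolding H_def by measurable
  have Hz: "(\<lambda>t. H (z, t)) \<in> borel_measurable \<mu>" for z
   by (rule measurable_01I[OF \<mu>]) measurable
  have "bergman_integral q (\<alpha> - 2) (hilbert_op \<mu> \<alpha> f) \<le> (\<integral>\<^sup>+z. ennreal c * (\<integral>\<^sup>+t. H (z, t) \<partial>\<mu>) \<partial>lborel)"
   unfolding bergman_integral_def
  proof (rule nn_integral_mono)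
   fix z :: complex
   show "ennreal (norm (hilbert_op \<mu> \<alpha> f z) powr q * (1 - (norm z)\<^sup>2) powr (\<alpha> - 2)) * indicator (ball 0 1) z \<le> ennreal c * (\<integral>\<^sup>+t. H (z, t) \<partial>\<mu>)"
   proof (cases "z \<in> ball 0 1")
    case True
    then have z: "norm z < 1" by simp
    have z2: "0 < 1 - (norm z)\<^sup>2" using z by (simp add: power_less_one_iff abs_square_less_1)
    let ?k = "\<lambda>t. norm (1 - of_real t * z) powr (-A)"
    have wgt: "J0 * (1 - norm z) powr (-B) * (1 - (norm z)\<^sup>2) powr (\<alpha> - 2) \<le> c * (1 - (norm z)\<^sup>2) powr \<gamma>"
    proof -
     have "(1 - norm z) powr (-B) \<le> ((1 - (norm z)\<^sup>2) / 2) powr (-B)"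
      using one_minus_norm_square_le[of z] z z2 B by (intro powr_mono2') auto
     also have "\<dots> = 2 powr B * (1 - (norm z)\<^sup>2) powr (-B)"
      using z2 by (simp add: powr_divide powr_minus field_simps)
     finally have "J0 * (1 - norm z) powr (-B) * (1 - (norm z)\<^sup>2) powr (\<alpha> - 2) \<le> J0 * (2 powr B * (1 - (norm z)\<^sup>2) powr (-B)) * (1 - (norm z)\<^sup>2) powr (\<alpha> - 2)"
      using J0 by (intro mult_right_mono mult_left_mono) auto
     also have "\<dots> = c * ((1 - (norm z)\<^sup>2) powr (-B) * (1 - (norm z)\<^sup>2) powr (\<alpha> - 2))" by (simp add: c_def mult_ac)
     also have "(1 - (norm z)\<^sup>2) powr (-B) * (1 - (norm z)\<^sup>2) powr (\<alpha> - 2) = (1 - (norm z)\<^sup>2) powr \<gamma>"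
      by (subst powr_add[symmetric]) (simp add: \<gamma>_def)
     finally show ?thesis .
    qed
    have km: "(\<lambda>t. ennreal (g t * ?k t)) \<in> borel_measurable \<mu>" by (rule measurable_01I[OF \<mu>]) measurable
    have "ennreal (norm (hilbert_op \<mu> \<alpha> f z) powr q * (1 - (norm z)\<^sup>2) powr (\<alpha> - 2)) = ennreal (norm (hilbert_op \<mu> \<alpha> f z) powr q) * ennreal ((1 - (norm z)\<^sup>2) powr (\<alpha> - 2))"
     by (rule ennreal_mult) auto
    also have "\<dots> \<le> (ennreal (J0 * (1 - norm z) powr (-B)) * (\<integral>\<^sup>+t. ennreal (g t * ?k t) \<partial>\<mu>)) * ennreal ((1 - (norm z)\<^sup>2) powr (\<alpha> - 2))"
     using hilbert_op_pointwise_jensen[OF \<mu> fin \<alpha> q s C f z]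
     unfolding J0_def[symmetric] A_def[symmetric] B_def[symmetric] g_def[symmetric, THEN fun_cong]
     by (intro mult_right_mono) (auto simp: g_def)
    also have "\<dots> = ennreal (J0 * (1 - norm z) powr (-B) * (1 - (norm z)\<^sup>2) powr (\<alpha> - 2)) * (\<integral>\<^sup>+t. ennreal (g t * ?k t) \<partial>\<mu>)"
     using J0 by (simp add: ennreal_mult mult_ac)
    also have "\<dots> \<le> ennreal (c * (1 - (norm z)\<^sup>2) powr \<gamma>) * (\<integral>\<^sup>+t. ennreal (g t * ?k t) \<partial>\<mu>)"
     by (intro mult_right_mono ennreal_leI wgt) auto
    also have "\<dots> = ennreal c * (ennreal ((1 - (norm z)\<^sup>2) powr \<gamma>) * (\<integral>\<^sup>+t. ennreal (g t * ?k t) \<partial>\<mu>))"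
     using c by (simp add: ennreal_mult mult.assoc)
    also have "ennreal ((1 - (norm z)\<^sup>2) powr \<gamma>) * (\<integral>\<^sup>+t. ennreal (g t * ?k t) \<partial>\<mu>) = (\<integral>\<^sup>+t. ennreal ((1 - (norm z)\<^sup>2) powr \<gamma>) * ennreal (g t * ?k t) \<partial>\<mu>)"
     by (rule nn_integral_cmult[symmetric, OF km])
    also have "\<dots> = (\<integral>\<^sup>+t. H (z, t) \<partial>\<mu>)"
     using True g0 by (intro nn_integral_cong) (simp add: H_def ennreal_mult mult_ac)
    finally show ?thesis using True by simp
   qed simp
  qed
  also have "\<dots> = ennreal c * (\<integral>\<^sup>+z. \<integral>\<^sup>+t. H (z, t) \<partial>\<mu> \<partial>lborel)"
  proof (rule nn_integral_cmult)
   interpret finite_measure \<mu> by (rule finite_measure_01[OF \<mu> fin])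
   have id: "(\<lambda>t. t) \<in> borel_measurable \<mu>" by (rule measurable_01I[OF \<mu>]) simp
   have fs: "(\<lambda>p. fst p) \<in> measurable ((lborel :: complex measure) \<Otimes>\<^sub>M \<mu>) borel"
    using measurable_fst[of "lborel :: complex measure" \<mu>] by simp
   have "(\<lambda>p. H (fst p, snd p)) \<in> borel_measurable ((lborel :: complex measure) \<Otimes>\<^sub>M \<mu>)"
    by (rule measurable_compose[OF measurable_Pair[OF fs measurable_compose[OF measurable_snd id]] H])
   then show "(\<lambda>z. \<integral>\<^sup>+t. H (z, t) \<partial>\<mu>) \<in> borel_measurable lborel"
    by (intro borel_measurable_nn_integral) (simp add: case_prod_beta')
  qed
  also have "(\<integral>\<^sup>+z. \<integral>\<^sup>+t. H (z, t) \<partial>\<mu> \<partial>lborel) = (\<integral>\<^sup>+t. \<integral>\<^sup>+z. H (z, t) \<partial>lborel \<partial>\<mu>)"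
   by (rule fubini_disc_01[OF \<mu> fin H])
  also have "\<dots> \<le> (\<integral>\<^sup>+t. ennreal D * (ennreal ((1 - t) powr ((q - 1) * (s - \<alpha>))) * ennreal (norm (f (of_real t)) powr q)) \<partial>\<mu>)"
  proof (rule nn_integral_mono)
   fix t assume "t \<in> space \<mu>"
   then have t: "0 \<le> t" "t < 1" by (auto simp: sp)
   have "(\<integral>\<^sup>+z. H (z, t) \<partial>lborel) = ennreal (g t) * (\<integral>\<^sup>+z. ennreal (norm (1 - of_real t * z) powr (-A) * (1 - (norm z)\<^sup>2) powr \<gamma>) * indicator (ball (0::complex) 1) z \<partial>lborel)"
    unfolding H_def fst_conv snd_conv by (rule nn_integral_cmult) measurable
   also have "\<dots> \<le> ennreal (g t) * ennreal (D * (1 - t) powr (\<gamma> + 2 - A))"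
    using disc_kernel_integral[OF A \<gamma>(1) less_imp_le[OF \<gamma>(2)] t] \<gamma> by (intro mult_left_mono) (auto simp: D_def mult.assoc)
   also have "\<dots> = ennreal (g t * (D * (1 - t) powr (\<gamma> + 2 - A)))" using g0 D by (intro ennreal_mult[symmetric]) auto
   also have "g t * (D * (1 - t) powr (\<gamma> + 2 - A)) = D * (((1 - t) powr ((s - \<alpha> / 2) * (q - 1)) * (1 - t) powr (\<gamma> + 2 - A)) * norm (f (of_real t)) powr q)"
    by (simp add: g_def mult_ac)
   also have "(1 - t) powr ((s - \<alpha> / 2) * (q - 1)) * (1 - t) powr (\<gamma> + 2 - A) = (1 - t) powr ((q - 1) * (s - \<alpha>))"
   proof -
    have "(s - \<alpha> / 2) * (q - 1) + (\<gamma> + 2 - A) = (q - 1) * (s - \<alpha>)"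
    proof -
     have "\<gamma> + 2 - A = - (\<alpha> / 2) * (q - 1)" by (simp add: \<gamma>_def A_def B_def field_simps)
     moreover have "(s - h) * (q - 1) + - h * (q - 1) = (q - 1) * (s - 2 * h)" for h by (simp add: algebra_simps)
     from this[of "\<alpha> / 2"] have "(s - \<alpha> / 2) * (q - 1) + - (\<alpha> / 2) * (q - 1) = (q - 1) * (s - \<alpha>)" by simp
     ultimately show ?thesis by (simp only:)
    qed
    then show ?thesis by (subst powr_add[symmetric]) simp
   qed
   finally show "(\<integral>\<^sup>+z. H (z, t) \<partial>lborel) \<le> ennreal D * (ennreal ((1 - t) powr ((q - 1) * (s - \<alpha>))) * ennreal (norm (f (of_real t)) powr q))"
    using D by (simp add: ennreal_mult)
  qed
  also have "\<dots> = ennreal D * (\<integral>\<^sup>+t. ennreal ((1 - t) powr ((q - 1) * (s - \<alpha>))) * ennreal (norm (f (of_real t)) powr q) \<partial>\<mu>)"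
   by (rule nn_integral_cmult, rule measurable_01I[OF \<mu>]) measurable
  also have "(\<integral>\<^sup>+t. ennreal ((1 - t) powr ((q - 1) * (s - \<alpha>))) * ennreal (norm (f (of_real t)) powr q) \<partial>\<mu>) =
    (\<integral>\<^sup>+t. ennreal (norm (f (of_real t)) powr q) \<partial>density_01 \<mu> (\<lambda>t. (1 - t) powr ((q - 1) * (s - \<alpha>))))"
   by (rule density_01(2)[OF \<mu>, symmetric]) measurable
  finally have fin': "bergman_integral q (\<alpha> - 2) (hilbert_op \<mu> \<alpha> f) \<le> ennreal c * (ennreal D * (\<integral>\<^sup>+t. ennreal (norm (f (of_real t)) powr q) \<partial>density_01 \<mu> (\<lambda>t. (1 - t) powr ((q - 1) * (s - \<alpha>)))))"
   by (simp add: mult_left_mono)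
  have eK: "ennreal K = ennreal c * ennreal D" unfolding K_def c_def[symmetric] by (rule ennreal_mult[OF c D])
  show ?thesis unfolding eK mult.assoc by (rule fin')
 qed
 then show ?thesis using K by blast
qed

text \<open>The kernel integral is critical: it is of order ln (2 / (1 - t)).\<close>

lemma bergman_estimate_1:
 assumes \<mu>: "borel_measure_01 \<mu>" and fin: "emeasure \<mu> {0..<1} < \<infinity>" and \<alpha>: "1 < \<alpha>"
 shows "\<exists>K\<ge>0. \<forall>f. moment_represented \<mu> f \<longrightarrow> bergman_integral 1 (\<alpha> - 2) (hilbert_op \<mu> \<alpha> f) \<le>
  ennreal K * (\<integral>\<^sup>+t. ennreal (norm (f (of_real t)) powr 1) \<partial>density_01 \<mu> (\<lambda>t. ln (2 / (1 - t))))"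
proof -
 note sp = borel_measure_01D(2)[OF \<mu>]
 have \<alpha>0: "0 < \<alpha>" using \<alpha> by simp
 define c where "c = angular_const \<alpha> * 2 powr (\<alpha> - 1)"
 have c: "0 \<le> c" using angular_const_pos[OF \<alpha>] by (simp add: c_def)
 define K where "K = c * (2 / (\<alpha> - 1) + 1)"
 have K: "0 \<le> K" using c \<alpha> by (simp add: K_def)
 have "bergman_integral 1 (\<alpha> - 2) (hilbert_op \<mu> \<alpha> f) \<le>
  ennreal K * (\<integral>\<^sup>+t. ennreal (norm (f (of_real t)) powr 1) \<partial>density_01 \<mu> (\<lambda>t. ln (2 / (1 - t))))"
  if f: "moment_represented \<mu> f" for f
 proof -
  have [measurable]: "f \<in> borel_measurable borel" using f disc_holomorphic_measurable by (auto simp: moment_represented_def)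
  define H where "H = (\<lambda>p. ennreal (norm (f (of_real (snd p)))) * (ennreal (norm (1 - of_real (snd p) * fst p) powr (-\<alpha>) * (1 - (norm (fst p))\<^sup>2) powr (\<alpha> - 2)) * indicator (ball (0::complex) 1) (fst p)))"
  have H[measurable]: "H \<in> borel_measurable (borel \<Otimes>\<^sub>M borel)" unfolding H_def by measurable
  have "bergman_integral 1 (\<alpha> - 2) (hilbert_op \<mu> \<alpha> f) \<le> (\<integral>\<^sup>+z. \<integral>\<^sup>+t. H (z, t) \<partial>\<mu> \<partial>lborel)"
   unfolding bergman_integral_def
  proof (rule nn_integral_mono)
   fix z :: complex
   show "ennreal (norm (hilbert_op \<mu> \<alpha> f z) powr 1 * (1 - (norm z)\<^sup>2) powr (\<alpha> - 2)) * indicator (ball 0 1) z \<le> (\<integral>\<^sup>+t. H (z, t) \<partial>\<mu>)"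
   proof (cases "z \<in> ball 0 1")
    case True
    then have z: "norm z < 1" by simp
    let ?k = "\<lambda>t. norm (f (of_real t)) * norm (1 - of_real t * z) powr (-\<alpha>)"
    have km: "(\<lambda>t. ennreal (?k t)) \<in> borel_measurable \<mu>" by (rule measurable_01I[OF \<mu>]) measurable
    have "ennreal (norm (hilbert_op \<mu> \<alpha> f z) powr 1 * (1 - (norm z)\<^sup>2) powr (\<alpha> - 2)) = ennreal ((1 - (norm z)\<^sup>2) powr (\<alpha> - 2)) * ennreal (norm (hilbert_op \<mu> \<alpha> f z))"
     by (simp add: ennreal_mult mult.commute)
    also have "\<dots> \<le> ennreal ((1 - (norm z)\<^sup>2) powr (\<alpha> - 2)) * (\<integral>\<^sup>+t. ennreal (?k t) \<partial>\<mu>)"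
     by (intro mult_left_mono norm_hilbert_op_le(1)[OF \<mu> fin \<alpha>0 f z]) simp
    also have "\<dots> = (\<integral>\<^sup>+t. ennreal ((1 - (norm z)\<^sup>2) powr (\<alpha> - 2)) * ennreal (?k t) \<partial>\<mu>)"
     by (rule nn_integral_cmult[symmetric, OF km])
    also have "\<dots> = (\<integral>\<^sup>+t. H (z, t) \<partial>\<mu>)"
     using True by (intro nn_integral_cong) (simp add: H_def ennreal_mult mult_ac)
    finally show ?thesis using True by simp
   qed simp
  qed
  also have "\<dots> = (\<integral>\<^sup>+t. \<integral>\<^sup>+z. H (z, t) \<partial>lborel \<partial>\<mu>)"
   by (rule fubini_disc_01[OF \<mu> fin H])
  also have "\<dots> \<le> (\<integral>\<^sup>+t. ennreal K * (ennreal (ln (2 / (1 - t))) * ennreal (norm (f (of_real t)) powr 1)) \<partial>\<mu>)"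
  proof (rule nn_integral_mono)
   fix t assume "t \<in> space \<mu>"
   then have t: "0 \<le> t" "t < 1" by (auto simp: sp)
   note ln = ln_two_over_ge[OF t]
   have "(\<integral>\<^sup>+z. H (z, t) \<partial>lborel) = ennreal (norm (f (of_real t))) * (\<integral>\<^sup>+z. ennreal (norm (1 - of_real t * z) powr (-\<alpha>) * (1 - (norm z)\<^sup>2) powr (\<alpha> - 2)) * indicator (ball (0::complex) 1) z \<partial>lborel)"
    unfolding H_def fst_conv snd_conv by (rule nn_integral_cmult) measurable
   also have "\<dots> \<le> ennreal (norm (f (of_real t))) * ennreal (K * ln (2 / (1 - t)))"
   proof (rule mult_left_mono)
    have e: "\<alpha> - 2 + 1 = \<alpha> - 1" by simp
    have "(\<integral>\<^sup>+z. ennreal (norm (1 - of_real t * z) powr (-\<alpha>) * (1 - (norm z)\<^sup>2) powr (\<alpha> - 2)) * indicator (ball (0::complex) 1) z \<partial>lborel)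
     \<le> ennreal (c * (1 / (\<alpha> - 1) + ln (1 / (1 - t))))"
     using disc_kernel_integral[OF \<alpha> _ _ t, of "\<alpha> - 2"] \<alpha> by (simp add: c_def e)
    also have "\<dots> \<le> ennreal (K * ln (2 / (1 - t)))"
    proof (rule ennreal_leI)
     have "ln (1 / (1 - t)) \<le> ln (2 / (1 - t))" using t by (subst ln_le_cancel_iff) (auto simp: field_simps)
     moreover have "1 / (\<alpha> - 1) * 1 \<le> 1 / (\<alpha> - 1) * (2 * ln (2 / (1 - t)))" using ln \<alpha> by (intro mult_left_mono) auto
     ultimately have "1 / (\<alpha> - 1) + ln (1 / (1 - t)) \<le> (2 / (\<alpha> - 1) + 1) * ln (2 / (1 - t))" by (simp add: algebra_simps)
     then have "c * (1 / (\<alpha> - 1) + ln (1 / (1 - t))) \<le> c * ((2 / (\<alpha> - 1) + 1) * ln (2 / (1 - t)))" using c by (rule mult_left_mono)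
     then show "c * (1 / (\<alpha> - 1) + ln (1 / (1 - t))) \<le> K * ln (2 / (1 - t))" by (simp add: K_def mult.assoc)
    qed
    finally show "(\<integral>\<^sup>+z. ennreal (norm (1 - of_real t * z) powr (-\<alpha>) * (1 - (norm z)\<^sup>2) powr (\<alpha> - 2)) * indicator (ball (0::complex) 1) z \<partial>lborel) \<le> ennreal (K * ln (2 / (1 - t)))" .
   qed simp
   also have "\<dots> = ennreal K * (ennreal (ln (2 / (1 - t))) * ennreal (norm (f (of_real t)) powr 1))"
    using K ln by (simp add: ennreal_mult mult_ac)
   finally show "(\<integral>\<^sup>+z. H (z, t) \<partial>lborel) \<le> ennreal K * (ennreal (ln (2 / (1 - t))) * ennreal (norm (f (of_real t)) powr 1))" .
  qed
  also have "\<dots> = ennreal K * (\<integral>\<^sup>+t. ennreal (ln (2 / (1 - t))) * ennreal (norm (f (of_real t)) powr 1) \<partial>\<mu>)"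
   by (rule nn_integral_cmult, rule measurable_01I[OF \<mu>]) measurable
  also have "(\<integral>\<^sup>+t. ennreal (ln (2 / (1 - t))) * ennreal (norm (f (of_real t)) powr 1) \<partial>\<mu>) =
    (\<integral>\<^sup>+t. ennreal (norm (f (of_real t)) powr 1) \<partial>density_01 \<mu> (\<lambda>t. ln (2 / (1 - t))))"
   by (rule density_01(2)[OF \<mu>, symmetric]) measurable
  finally show ?thesis .
 qed
 then show ?thesis using K by blast
qed

text \<open>The part t \<ge> a uses the growth estimate and the tail bound, the part t \<le> a the local size
d of f. The constants are tracked because both must become small in the compactness criterion.\<close>

lemma bloch_estimate:
 assumes p: "0 < p" and \<mu>: "borel_measure_01 \<mu>" and fin: "emeasure \<mu> {0..<1} < \<infinity>" and \<alpha>: "0 < \<alpha>"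
  and a: "0 \<le> a" "a < 1" and e: "0 \<le> e" and tail: "tail_bound \<mu> a (1 / p + \<alpha>) e"
  and f: "f \<in> hardy_ball p B" "moment_represented \<mu> f"
  and d: "0 \<le> d" "\<And>t. 0 \<le> t \<Longrightarrow> t \<le> a \<Longrightarrow> norm (f (of_real t)) \<le> d"
  and z: "norm z < 1"
 shows "(1 - (norm z)\<^sup>2) * norm (deriv (hilbert_op \<mu> \<alpha> f) z) \<le>
  2 * \<alpha> * (e * ((1 / p + \<alpha>) * kernel_const \<alpha> (\<alpha> + 1)) * B powr (1 / p) + d * (1 - a) powr (-(\<alpha> + 1)) * measure \<mu> {0..<1})"
proof -
 note sp = borel_measure_01D(2)[OF \<mu>]
 have [measurable]: "f \<in> borel_measurable borel" using disc_holomorphic_measurable[OF hardy_ballD(1)[OF f(1)]] .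
 have B: "0 \<le> B" by (rule hardy_ball_nonneg[OF f(1) p])
 have M: "emeasure \<mu> {0..<1} = ennreal (measure \<mu> {0..<1})" using fin by (simp add: measure_def ennreal_enn2real)
 define k where "k = (1 / p + \<alpha>) * kernel_const \<alpha> (\<alpha> + 1)"
 have k: "0 \<le> k" using p \<alpha> kernel_const_pos[of \<alpha> "\<alpha> + 1"] by (simp add: k_def)
 let ?r = "1 - norm z"
 define X where "X = e * k * B powr (1 / p) * ?r powr (-1)"
 define Z where "Z = d * (1 - a) powr (-(\<alpha> + 1)) * measure \<mu> {0..<1}"
 have X: "0 \<le> X" using e k by (simp add: X_def)
 have Z: "0 \<le> Z" using d by (simp add: Z_def)
 have "(\<integral>\<^sup>+t. ennreal (norm (f (of_real t)) * norm (1 - of_real t * z) powr (-(\<alpha> + 1))) \<partial>\<mu>) \<le>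
  (\<integral>\<^sup>+t. ennreal (B powr (1 / p)) * (ennreal ((1 - t) powr (-(1 / p)) * (1 - t * norm z) powr (-(\<alpha> + 1))) * indicator {a..<1} t) + ennreal (d * (1 - a) powr (-(\<alpha> + 1))) \<partial>\<mu>)"
 proof (rule nn_integral_mono)
  fix t assume "t \<in> space \<mu>"
  then have t: "0 \<le> t" "t < 1" by (auto simp: sp)
  have ker: "norm (1 - of_real t * z) powr (-(\<alpha> + 1)) \<le> (1 - t * norm z) powr (-(\<alpha> + 1))"
   using norm_kernel_ge[OF t z] \<alpha> by (intro powr_mono2') auto
  show "ennreal (norm (f (of_real t)) * norm (1 - of_real t * z) powr (-(\<alpha> + 1))) \<le>
   ennreal (B powr (1 / p)) * (ennreal ((1 - t) powr (-(1 / p)) * (1 - t * norm z) powr (-(\<alpha> + 1))) * indicator {a..<1} t) + ennreal (d * (1 - a) powr (-(\<alpha> + 1)))"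
  proof (cases "a \<le> t")
   case True
   have "norm (f (of_real t)) \<le> (B / (1 - t)) powr (1 / p)" using hardy_growth(2)[OF p f(1), of "of_real t"] t by simp
   also have "\<dots> = B powr (1 / p) * (1 - t) powr (-(1 / p))" by (simp add: powr_divide powr_minus_divide)
   finally have "norm (f (of_real t)) * norm (1 - of_real t * z) powr (-(\<alpha> + 1)) \<le> B powr (1 / p) * (1 - t) powr (-(1 / p)) * (1 - t * norm z) powr (-(\<alpha> + 1))"
    using ker by (intro mult_mono) auto
   then have "ennreal (norm (f (of_real t)) * norm (1 - of_real t * z) powr (-(\<alpha> + 1))) \<le> ennreal (B powr (1 / p)) * ennreal ((1 - t) powr (-(1 / p)) * (1 - t * norm z) powr (-(\<alpha> + 1)))"
    by (subst ennreal_mult[symmetric]) (auto intro!: ennreal_leI simp: mult.assoc)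
   then show ?thesis using True t by (simp add: add_increasing2)
  next
   case False
   have "(1 - t * norm z) powr (-(\<alpha> + 1)) \<le> (1 - a) powr (-(\<alpha> + 1))"
    using norm_kernel_ge(4)[OF t z] False a \<alpha> by (intro powr_mono2') auto
   then have "norm (f (of_real t)) * norm (1 - of_real t * z) powr (-(\<alpha> + 1)) \<le> d * (1 - a) powr (-(\<alpha> + 1))"
    using ker d t False by (intro mult_mono) auto
   then show ?thesis using False by (simp add: ennreal_leI)
  qed
 qed
 also have "\<dots> = (\<integral>\<^sup>+t. ennreal (B powr (1 / p)) * (ennreal ((1 - t) powr (-(1 / p)) * (1 - t * norm z) powr (-(\<alpha> + 1))) * indicator {a..<1} t) \<partial>\<mu>) + (\<integral>\<^sup>+t. ennreal (d * (1 - a) powr (-(\<alpha> + 1))) \<partial>\<mu>)"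
  by (rule nn_integral_add; rule measurable_01I[OF \<mu>]) measurable
 also have "(\<integral>\<^sup>+t. ennreal (B powr (1 / p)) * (ennreal ((1 - t) powr (-(1 / p)) * (1 - t * norm z) powr (-(\<alpha> + 1))) * indicator {a..<1} t) \<partial>\<mu>)
   = ennreal (B powr (1 / p)) * (\<integral>\<^sup>+t\<in>{a..<1}. ennreal ((1 - t) powr (-(1 / p)) * (1 - t * norm z) powr (-(\<alpha> + 1))) \<partial>\<mu>)"
  by (rule nn_integral_cmult, rule measurable_01I[OF \<mu>]) measurable
 also have "(\<integral>\<^sup>+t. ennreal (d * (1 - a) powr (-(\<alpha> + 1))) \<partial>\<mu>) = ennreal Z"
  using d by (simp add: sp M Z_def ennreal_mult)
 also have "ennreal (B powr (1 / p)) * (\<integral>\<^sup>+t\<in>{a..<1}. ennreal ((1 - t) powr (-(1 / p)) * (1 - t * norm z) powr (-(\<alpha> + 1))) \<partial>\<mu>) + ennreal Z \<le> ennreal X + ennreal Z"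
 proof (intro add_mono order_refl)
  have "(\<integral>\<^sup>+t\<in>{a..<1}. ennreal ((1 - t) powr (-(1 / p)) * (1 - t * norm z) powr (-(\<alpha> + 1))) \<partial>\<mu>)
   \<le> ennreal (e * ((1 / p + \<alpha>) * kernel_const (1 / p + \<alpha> - 1 / p) (\<alpha> + 1)) * (1 - norm z) powr (1 / p + \<alpha> - 1 / p - (\<alpha> + 1)))"
   by (rule nn_integral_tail_kernel[OF \<mu> a e tail]) (use p \<alpha> z in auto)
  also have "\<dots> = ennreal (e * k * ?r powr (-1))" by (simp add: k_def)
  finally have "ennreal (B powr (1 / p)) * (\<integral>\<^sup>+t\<in>{a..<1}. ennreal ((1 - t) powr (-(1 / p)) * (1 - t * norm z) powr (-(\<alpha> + 1))) \<partial>\<mu>)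
   \<le> ennreal (B powr (1 / p)) * ennreal (e * k * ?r powr (-1))" by (rule mult_left_mono) simp
  also have "\<dots> = ennreal X" using e k by (subst ennreal_mult[symmetric]) (auto simp: X_def mult_ac)
  finally show "ennreal (B powr (1 / p)) * (\<integral>\<^sup>+t\<in>{a..<1}. ennreal ((1 - t) powr (-(1 / p)) * (1 - t * norm z) powr (-(\<alpha> + 1))) \<partial>\<mu>) \<le> ennreal X" .
 qed
 also have "\<dots> = ennreal (X + Z)" using X Z by (rule ennreal_plus[symmetric])
 finally have I: "(\<integral>\<^sup>+t. ennreal (norm (f (of_real t)) * norm (1 - of_real t * z) powr (-(\<alpha> + 1))) \<partial>\<mu>) \<le> ennreal (X + Z)" .
 have "ennreal (norm (deriv (hilbert_op \<mu> \<alpha> f) z)) \<le> ennreal \<alpha> * ennreal (X + Z)"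
  by (rule order_trans[OF norm_hilbert_op_le(3)[OF \<mu> fin \<alpha> f(2) z] mult_left_mono[OF I]]) simp
 also have "\<dots> = ennreal (\<alpha> * (X + Z))" using \<alpha> X Z by (intro ennreal_mult[symmetric]) auto
 finally have "norm (deriv (hilbert_op \<mu> \<alpha> f) z) \<le> \<alpha> * (X + Z)" using \<alpha> X Z by (subst (asm) ennreal_le_iff) auto
 then have "(1 - (norm z)\<^sup>2) * norm (deriv (hilbert_op \<mu> \<alpha> f) z) \<le> (2 * ?r) * (\<alpha> * (X + Z))"
  using one_minus_norm_square_le[of z] z by (intro mult_mono) auto
 also have "\<dots> = 2 * \<alpha> * (?r * X + ?r * Z)" by (simp add: algebra_simps)
 also have "\<dots> \<le> 2 * \<alpha> * (e * k * B powr (1 / p) + Z)"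
 proof -
  have "?r * X = e * k * B powr (1 / p)" using z by (simp add: X_def powr_minus_divide)
  moreover have "?r * Z \<le> Z" using Z by (simp add: mult_left_le_one_le z less_imp_le)
  ultimately show ?thesis using \<alpha> by (intro mult_left_mono) auto
 qed
 finally show ?thesis by (simp add: k_def Z_def)
qed

lemma bloch_compactI:
 assumes p: "0 < p" and \<alpha>: "0 < \<alpha>" and \<mu>: "borel_measure_01 \<mu>" and fin: "emeasure \<mu> {0..<1} < \<infinity>"
  and rep: "\<And>f B. f \<in> hardy_ball p B \<Longrightarrow> moment_represented \<mu> f"
  and van: "vanishing_tail \<mu> (1 / p + \<alpha>)"
  and van0: "\<And>B F. (\<And>n. F n \<in> hardy_ball p B) \<Longrightarrow>
   (\<And>a. a < 1 \<Longrightarrow> uniform_limit (cball 0 a) F (\<lambda>z. 0) sequentially) \<Longrightarrow> (\<lambda>n. \<integral>\<^sup>+t. ennreal (norm (F n (of_real t))) \<partial>\<mu>) \<longlonglongrightarrow> 0"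
 shows "hilbert_compact \<mu> \<alpha> (hardy_space p) (hardy_norm p) bloch_space bloch_norm"
proof (rule hilbert_compactI[OF bloch_disc_norm p \<mu> fin \<alpha> rep])
 define k where "k = (1 / p + \<alpha>) * kernel_const \<alpha> (\<alpha> + 1)"
 have k: "0 \<le> k" using p \<alpha> kernel_const_pos[of \<alpha> "\<alpha> + 1"] by (simp add: k_def)
 let ?b = "\<lambda>f z. (1 - (norm z)\<^sup>2) * norm (deriv f z)"
 have d0: "hilbert_op \<mu> \<alpha> f \<in> disc_holomorphic" if "f \<in> hardy_ball p B" for f B
  by (rule hilbert_op_representation(4)[OF \<mu> fin \<alpha> rep[OF that]])
 obtain a1 where a1: "0 \<le> a1" "a1 < 1" "tail_bound \<mu> a1 (1 / p + \<alpha>) 1" using van unfolding vanishing_tail_def by (meson zero_less_one)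
 obtain C where C: "0 < C" "tail_bound \<mu> 0 (1 / p + \<alpha>) C"
  by (rule tail_bound_extend[OF fin \<mu> a1(1,2) _ a1(3)]) (use p \<alpha> that in \<open>auto simp: add_pos_pos\<close>)
 show "hilbert_op \<mu> \<alpha> f \<in> bloch_space" if f: "f \<in> hardy_ball p B" for f B
 proof -
  have "?b (hilbert_op \<mu> \<alpha> f) z \<le> 2 * \<alpha> * (C * ((1 / p + \<alpha>) * kernel_const \<alpha> (\<alpha> + 1)) * B powr (1 / p) + norm (f 0) * (1 - 0) powr (-(\<alpha> + 1)) * measure \<mu> {0..<1})"
   if "z \<in> ball 0 1" for z
   by (rule bloch_estimate[OF p \<mu> fin \<alpha> _ _ _ C(2) f rep[OF f]]) (use C that in auto)
  then show ?thesis using d0[OF f] by (auto simp: bloch_space_def intro!: bdd_aboveI2)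
 qed
 fix B and F :: "nat \<Rightarrow> complex \<Rightarrow> complex"
 assume F: "\<And>n. F n \<in> hardy_ball p B" and unif: "\<And>a. a < 1 \<Longrightarrow> uniform_limit (cball 0 a) F (\<lambda>z. 0) sequentially"
 have lim0: "(\<lambda>n. \<integral>\<^sup>+t. ennreal (norm (F n (of_real t))) \<partial>\<mu>) \<longlonglongrightarrow> 0" by (rule van0[OF F unif])
 show "(\<lambda>n. bloch_norm (hilbert_op \<mu> \<alpha> (F n))) \<longlonglongrightarrow> 0"
 proof (rule tendstoI)
  fix \<epsilon> :: real assume \<epsilon>: "0 < \<epsilon>"
  define e where "e = \<epsilon> / (12 * \<alpha> * (k * B powr (1 / p) + 1))"
  have e: "0 < e" using \<epsilon> \<alpha> k by (simp add: e_def add_nonneg_pos)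
  obtain a where a: "0 \<le> a" "a < 1" "tail_bound \<mu> a (1 / p + \<alpha>) e" using van e unfolding vanishing_tail_def by blast
  define m where "m = (1 - a) powr (-(\<alpha> + 1)) * measure \<mu> {0..<1}"
  have m: "0 \<le> m" by (simp add: m_def)
  define d where "d = \<epsilon> / (12 * \<alpha> * (m + 1))"
  have d: "0 < d" using \<epsilon> \<alpha> m by (simp add: d_def)
  have scale: "2 * \<alpha> * (\<epsilon> / (12 * \<alpha> * (x + 1)) * x) \<le> \<epsilon> / 6" if "0 \<le> x" for x
  proof -
   have "2 * \<alpha> * (\<epsilon> / (12 * \<alpha> * (x + 1)) * x) \<le> 2 * \<alpha> * (\<epsilon> / (12 * \<alpha> * (x + 1)) * (x + 1))"
    using that \<alpha> \<epsilon> by (intro mult_left_mono) auto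
   also have "\<epsilon> / (12 * \<alpha> * (x + 1)) * (x + 1) = \<epsilon> / (12 * \<alpha>)" using that by simp
   also have "2 * \<alpha> * (\<epsilon> / (12 * \<alpha>)) = \<epsilon> / 6" using \<alpha> by simp
   finally show ?thesis .
  qed
  have e1: "2 * \<alpha> * (e * k * B powr (1 / p)) \<le> \<epsilon> / 6"
   using scale[of "k * B powr (1 / p)"] k by (simp add: e_def mult.assoc)
  have e2: "2 * \<alpha> * (d * m) \<le> \<epsilon> / 6" unfolding d_def by (rule scale[OF m])
  have "\<forall>\<^sub>F n in sequentially. \<forall>z\<in>cball 0 a. dist (F n z) 0 < d" using unif[OF a(2)] d by (simp add: uniform_limit_iff)
  moreover have "\<forall>\<^sub>F n in sequentially. (\<integral>\<^sup>+t. ennreal (norm (F n (of_real t))) \<partial>\<mu>) < ennreal (\<epsilon> / 3)"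
   using order_tendstoD(2)[OF lim0, of "ennreal (\<epsilon> / 3)"] \<epsilon> by simp
  ultimately show "\<forall>\<^sub>F n in sequentially. dist (bloch_norm (hilbert_op \<mu> \<alpha> (F n))) 0 < \<epsilon>"
  proof eventually_elim
   case (elim n)
   have b: "?b (hilbert_op \<mu> \<alpha> (F n)) z \<le> \<epsilon> / 3" if z: "z \<in> ball 0 1" for z
   proof -
    have "?b (hilbert_op \<mu> \<alpha> (F n)) z \<le> 2 * \<alpha> * (e * ((1 / p + \<alpha>) * kernel_const \<alpha> (\<alpha> + 1)) * B powr (1 / p) + d * (1 - a) powr (-(\<alpha> + 1)) * measure \<mu> {0..<1})"
    proof (rule bloch_estimate[OF p \<mu> fin \<alpha> a(1,2) less_imp_le[OF e] a(3) F rep[OF F] less_imp_le[OF d]])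
     fix t assume "0 \<le> t" "t \<le> a"
     then have "of_real t \<in> cball (0::complex) a" by simp
     then have "dist (F n (of_real t)) 0 < d" using elim by blast
     then show "norm (F n (of_real t)) \<le> d" by simp
    qed (use z in simp)
    also have "\<dots> = 2 * \<alpha> * (e * k * B powr (1 / p)) + 2 * \<alpha> * (d * m)" by (simp add: k_def m_def algebra_simps)
    also have "\<dots> \<le> \<epsilon> / 3" using e1 e2 by simp
    finally show ?thesis .
   qed
   have sup: "(SUP z\<in>ball 0 1. ?b (hilbert_op \<mu> \<alpha> (F n)) z) \<le> \<epsilon> / 3" by (rule cSUP_least) (use b in auto)
   have "ennreal (norm (hilbert_op \<mu> \<alpha> (F n) 0)) \<le> (\<integral>\<^sup>+t. ennreal (norm (F n (of_real t))) \<partial>\<mu>)"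
    using norm_hilbert_op_le(1)[OF \<mu> fin \<alpha> rep[OF F], of 0 n] by simp
   also have "\<dots> < ennreal (\<epsilon> / 3)" using elim by blast
   finally have z0: "norm (hilbert_op \<mu> \<alpha> (F n) 0) < \<epsilon> / 3" using \<epsilon> by (subst (asm) ennreal_less_iff) auto
   have bdd: "bdd_above (?b (hilbert_op \<mu> \<alpha> (F n)) ` ball 0 1)" using b by (intro bdd_aboveI2[where M = "\<epsilon> / 3"]) auto
   have "0 \<le> (SUP z\<in>ball 0 1. ?b (hilbert_op \<mu> \<alpha> (F n)) z)"
    by (rule order_trans[OF _ cSUP_upper[OF _ bdd, of 0]]) auto
   then show ?case using sup z0 \<epsilon> by (simp add: bloch_norm_def)
  qed
 qed
qed

section \<open>Necessity\<close>

text \<open>The power of a normalised reproducing kernel: its p-th power has modulus (1 - b) |1 - b z|^(-2).\<close>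

definition test_fn :: "real \<Rightarrow> real \<Rightarrow> complex \<Rightarrow> complex" where
 "test_fn p b z = (if z \<in> ball 0 1 then of_real ((1 - b) powr (1 / p)) * (1 - of_real b * z) powr (- of_real (2 / p)) else 0)"

lemma test_fn_holomorphic_aux:
 assumes b: "0 < b" "b < 1"
 shows "(\<lambda>z. of_real ((1 - b) powr (1 / p)) * (1 - of_real b * z) powr (- of_real (2 / p))) holomorphic_on ball (0::complex) (1 / b)"
proof -
 have "1 - of_real b * z \<notin> \<real>\<^sub>\<le>\<^sub>0" if "z \<in> ball (0::complex) (1 / b)" for z
 proof -
  have "norm (of_real b * z) < 1" using that b by (simp add: norm_mult field_simps)
  then have "Re (of_real b * z) < 1" using complex_Re_le_cmod[of "of_real b * z"] by linarith
  then show ?thesis by (auto simp: complex_nonpos_Reals_iff)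
 qed
 then show ?thesis by (intro holomorphic_intros) auto
qed

lemma test_fn_disc_holomorphic:
 assumes b: "0 < b" "b < 1"
 shows "test_fn p b \<in> disc_holomorphic"
proof -
 have "1 \<le> 1 / b" using b by simp
 then have "ball (0::complex) 1 \<subseteq> ball 0 (1 / b)" by (rule subset_ball)
 from holomorphic_on_subset[OF test_fn_holomorphic_aux[OF b] this]
 have "test_fn p b holomorphic_on ball 0 1" by (rule holomorphic_transform) (simp add: test_fn_def)
 then show ?thesis by (simp add: disc_holomorphic_def test_fn_def)
qed

lemma norm_test_fn:
 assumes b: "0 < b" "b < 1" and z: "norm z < 1"
 shows "norm (test_fn p b z) = (1 - b) powr (1 / p) * norm (1 - of_real b * z) powr (- (2 / p))"
 using norm_kernel[of "of_real b * z" "2 / p"] norm_mult_01[of b z] b z by (simp add: test_fn_def norm_mult)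

text \<open>The kernel integral over the circle with exponent 2, and 1 - b \<le> 1 - b r.\<close>

lemma test_fn_hardy_ball:
 assumes p: "0 < p" and b: "0 < b" "b < 1"
 shows "test_fn p b \<in> hardy_ball p (angular_const 2 / (2 * pi))"
proof -
 have "circle_mean p r (test_fn p b) \<le> angular_const 2 / (2 * pi)" if r: "0 < r" "r < 1" for r
 proof -
  have br: "0 \<le> b * r" "b * r < 1" using b r mult_strict_mono[of b 1 r 1] by auto
  have eq: "norm (test_fn p b (of_real r * cis \<theta>)) powr p = (1 - b) * norm (1 - of_real (b * r) * cis \<theta>) powr (-2)" for \<theta>
  proof -
   have "norm (of_real r * cis \<theta>) < 1" using r by (simp add: norm_mult)
   then have "norm (test_fn p b (of_real r * cis \<theta>)) = (1 - b) powr (1 / p) * norm (1 - of_real b * (of_real r * cis \<theta>)) powr (- (2 / p))"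
    by (rule norm_test_fn[OF b])
   then show ?thesis using p b by (simp add: powr_mult powr_powr mult.assoc)
  qed
  have "ennreal (2 * pi * circle_mean p r (test_fn p b)) = (\<integral>\<^sup>+\<theta>\<in>{0..<2*pi}. ennreal (norm (test_fn p b (of_real r * cis \<theta>)) powr p) \<partial>lborel)"
   using r by (intro nn_integral_circle_mean[symmetric] disc_holomorphicD(1) test_fn_disc_holomorphic b p) auto
  also have "\<dots> \<le> (\<integral>\<^sup>+\<theta>. ennreal (1 - b) * (ennreal (norm (1 - of_real (b * r) * cis \<theta>) powr (-2)) * indicator {0..2*pi} \<theta>) \<partial>lborel)"
   unfolding eq using b by (intro nn_integral_mono) (auto simp: indicator_def ennreal_mult)
  also have "\<dots> = ennreal (1 - b) * (\<integral>\<^sup>+\<theta>\<in>{0..2*pi}. ennreal (norm (1 - of_real (b * r) * cis \<theta>) powr (-2)) \<partial>lborel)"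
   by (rule nn_integral_cmult) measurable
  also have "\<dots> \<le> ennreal (1 - b) * ennreal (angular_const 2 * (1 - b * r) powr (1 - 2))"
   by (intro mult_left_mono nn_integral_angular_kernel br) auto
  also have "\<dots> = ennreal ((1 - b) * (angular_const 2 * (1 - b * r) powr (1 - 2)))"
   using b angular_const_pos[of 2] by (intro ennreal_mult[symmetric]) auto
  also have "\<dots> \<le> ennreal (angular_const 2)"
  proof (rule ennreal_leI)
   have "1 - b \<le> 1 - b * r" using b r by (simp add: mult_left_le)
   then have "(1 - b) / (1 - b * r) \<le> 1" using br by simp
   then have "angular_const 2 * ((1 - b) / (1 - b * r)) \<le> angular_const 2 * 1" using angular_const_pos[of 2] by (intro mult_left_mono) auto
   moreover have "(1 - b) * (angular_const 2 * (1 - b * r) powr (1 - 2)) = angular_const 2 * ((1 - b) / (1 - b * r))"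
    using br by (simp add: powr_minus_divide)
   ultimately show "(1 - b) * (angular_const 2 * (1 - b * r) powr (1 - 2)) \<le> angular_const 2" by simp
  qed
  finally have "2 * pi * circle_mean p r (test_fn p b) \<le> angular_const 2"
   using angular_const_pos[of 2] by (subst (asm) ennreal_le_iff) auto
  then show ?thesis by (simp add: field_simps)
 qed
 then show ?thesis using test_fn_disc_holomorphic[OF b] by (simp add: hardy_ball_def)
qed

text \<open>The test functions extend holomorphically beyond the closed disc, so the series converge
absolutely for every finite \<mu>. This keeps the necessity part independent of the vanishing
condition.\<close>

lemma test_fn_moment_represented:
 assumes \<mu>: "borel_measure_01 \<mu>" and fin: "emeasure \<mu> {0..<1} < \<infinity>" and b: "0 < b" "b < 1"
 shows "moment_represented \<mu> (test_fn p b)"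
proof -
 note sp = borel_measure_01D(2)[OF \<mu>]
 let ?f = "test_fn p b"
 let ?g = "\<lambda>z. of_real ((1 - b) powr (1 / p)) * (1 - of_real b * z) powr (- of_real (2 / p)) :: complex"
 note fd = test_fn_disc_holomorphic[OF b, of p]
 have b1: "1 < 1 / b" using b by simp
 have tc: "taylor_coeff ?f k = (deriv ^^ k) ?g 0 / fact k" for k
 proof -
  have "(deriv ^^ k) ?f 0 = (deriv ^^ k) ?g 0"
  proof (rule higher_deriv_transform_within_open)
   show "?f holomorphic_on ball 0 1" by (rule disc_holomorphicD(1)[OF fd])
   show "?g holomorphic_on ball 0 1" by (rule holomorphic_on_subset[OF test_fn_holomorphic_aux[OF b]]) (use b1 in \<open>auto intro: less_trans\<close>)
  qed (auto simp: test_fn_def)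
  then show ?thesis by (simp add: taylor_coeff_def)
 qed
 obtain R where R: "1 < R" "R < 1 / b" using dense b1 by blast
 have "summable (\<lambda>k. taylor_coeff ?f k * of_real R ^ k)"
  using holomorphic_power_series[OF test_fn_holomorphic_aux[OF b, of p], of "of_real R"] R by (simp add: tc sums_iff)
 then have "summable (\<lambda>k. norm (taylor_coeff ?f k * 1 ^ k))" by (rule powser_insidea) (use R in simp)
 then have s: "summable (\<lambda>k. norm (taylor_coeff ?f k))" by simp
 have ser: "?f (of_real t) = (\<Sum>k. taylor_coeff ?f k * of_real t ^ k)" if "t \<in> space \<mu>" for t
  using taylor_series(1)[OF fd, of "of_real t"] that by (simp add: sums_iff sp)
 have "integrable \<mu> (\<lambda>t. ?f (of_real t))"
 proof -
  interpret finite_measure \<mu> by (rule finite_measure_01[OF \<mu> fin])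
  have [measurable]: "?f \<in> borel_measurable borel" by (rule disc_holomorphic_measurable[OF fd])
  show ?thesis
  proof (rule integrable_const_bound[where B = "\<Sum>k. norm (taylor_coeff ?f k)"])
   show "(\<lambda>t. ?f (of_real t)) \<in> borel_measurable \<mu>" by (rule measurable_01I[OF \<mu>]) measurable
   show "AE t in \<mu>. norm (?f (of_real t)) \<le> (\<Sum>k. norm (taylor_coeff ?f k))"
   proof (rule AE_I2)
    fix t assume t: "t \<in> space \<mu>"
    have "norm (\<Sum>k. taylor_coeff ?f k * of_real t ^ k) \<le> (\<Sum>k. norm (taylor_coeff ?f k))"
     by (rule norm_suminf_le[OF _ s]) (use t in \<open>auto simp: sp norm_mult norm_power intro!: mult_right_le_one_le power_le_one\<close>)
    then show "norm (?f (of_real t)) \<le> (\<Sum>k. norm (taylor_coeff ?f k))" by (simp only: ser[OF t])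
   qed
  qed
 qed
 moreover have "(\<lambda>k. of_real (moment \<mu> (n + k)) * taylor_coeff ?f k) sums (LINT t|\<mu>. of_real (t ^ n) * ?f (of_real t))" for n
 proof -
  have "(LINT t|\<mu>. of_real (t ^ n) * ?f (of_real t)) = (LINT t|\<mu>. of_real (t ^ n) * (\<Sum>k. taylor_coeff ?f k * of_real t ^ k))"
   by (intro Bochner_Integration.integral_cong refl) (simp only: ser)
  then show ?thesis using moment_series_exchange[OF \<mu> fin s, of n] by (simp only:)
 qed
 ultimately show ?thesis using fd by (simp add: moment_represented_def)
qed

lemma ennreal_norm_integral_of_real:
 fixes h :: "'a \<Rightarrow> complex"
 assumes "integrable M h" "\<And>t. t \<in> space M \<Longrightarrow> h t = of_real (k t)" "\<And>t. t \<in> space M \<Longrightarrow> 0 \<le> k t"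
 shows "ennreal (norm (integral\<^sup>L M h)) = (\<integral>\<^sup>+t. ennreal (k t) \<partial>M)"
proof -
 have "integral\<^sup>L M h = (LINT t|M. complex_of_real (norm (h t)))"
  using assms(2,3) by (intro Bochner_Integration.integral_cong refl) simp
 also have "\<dots> = of_real (LINT t|M. norm (h t))" by (rule integral_complex_of_real)
 finally have "norm (integral\<^sup>L M h) = (LINT t|M. norm (h t))" by simp
 then have "ennreal (norm (integral\<^sup>L M h)) = (\<integral>\<^sup>+t. ennreal (norm (h t)) \<partial>M)"
  using nn_integral_eq_integral[OF integrable_norm[OF assms(1)]] by simp
 also have "\<dots> = (\<integral>\<^sup>+t. ennreal (k t) \<partial>M)"
  using assms(2,3) by (intro nn_integral_cong) simp
 finally show ?thesis .
qed

text \<open>On [0, 1) all integrands are positive, so taking the modulus loses nothing.\<close>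

lemma hilbert_op_test_fn:
 assumes \<mu>: "borel_measure_01 \<mu>" and fin: "emeasure \<mu> {0..<1} < \<infinity>" and \<alpha>: "0 < \<alpha>" and b: "0 < b" "b < 1" and r: "0 \<le> r" "r < 1"
 shows "ennreal (norm (hilbert_op \<mu> \<alpha> (test_fn p b) (of_real r))) =
   (\<integral>\<^sup>+t. ennreal ((1 - b) powr (1 / p) * (1 - t * b) powr (- (2 / p)) * (1 - t * r) powr (-\<alpha>)) \<partial>\<mu>)"
  and "ennreal (norm (deriv (hilbert_op \<mu> \<alpha> (test_fn p b)) (of_real r))) =
   ennreal \<alpha> * (\<integral>\<^sup>+t. ennreal (t * ((1 - b) powr (1 / p) * (1 - t * b) powr (- (2 / p)) * (1 - t * r) powr (-(\<alpha> + 1)))) \<partial>\<mu>)"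
proof -
 note sp = borel_measure_01D(2)[OF \<mu>]
 let ?f = "test_fn p b"
 have f: "moment_represented \<mu> ?f" by (rule test_fn_moment_represented[OF \<mu> fin b])
 then have int: "integrable \<mu> (\<lambda>t. ?f (of_real t))" by (simp add: moment_represented_def)
 have z: "norm (of_real r :: complex) < 1" using r by simp
 have pw: "(1 - of_real t * of_real c :: complex) powr (- of_real a) = of_real ((1 - t * c) powr (-a))" if "t \<in> space \<mu>" "0 \<le> c" "c < 1" for t c a
 proof -
  have "t * c \<le> 1 * 1" using that by (intro mult_mono) (auto simp: sp)
  then have "0 \<le> 1 - t * c" by simp
  then have "complex_of_real (1 - t * c) powr of_real (-a) = of_real ((1 - t * c) powr (-a))" by (rule powr_of_real)
  then show ?thesis by simp
 qed
 have ft: "?f (of_real t) = of_real ((1 - b) powr (1 / p) * (1 - t * b) powr (- (2 / p)))" if "t \<in> space \<mu>" for t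
  using pw[OF that, of b "2 / p"] b that by (simp add: test_fn_def sp mult.commute)
 show "ennreal (norm (hilbert_op \<mu> \<alpha> ?f (of_real r))) = (\<integral>\<^sup>+t. ennreal ((1 - b) powr (1 / p) * (1 - t * b) powr (- (2 / p)) * (1 - t * r) powr (-\<alpha>)) \<partial>\<mu>)"
  unfolding hilbert_op_representation(2)[OF \<mu> fin \<alpha> f z]
 proof (rule ennreal_norm_integral_of_real)
  show "integrable \<mu> (\<lambda>t. ?f (of_real t) * (1 - of_real t * of_real r) powr (- of_real \<alpha>))"
   by (rule moment_kernel_sums(2)[OF \<mu> \<alpha> int z])
  show "?f (of_real t) * (1 - of_real t * of_real r) powr (- of_real \<alpha>) = of_real ((1 - b) powr (1 / p) * (1 - t * b) powr (- (2 / p)) * (1 - t * r) powr (-\<alpha>))"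
   if "t \<in> space \<mu>" for t unfolding ft[OF that] pw[OF that r] by simp
 qed simp
 have "integrable \<mu> (\<lambda>t. of_real (t ^ 1) * ?f (of_real t))" by (rule moment_kernel_sums(3)[OF \<mu> \<alpha> int z])
 then have int1: "integrable \<mu> (\<lambda>t. of_real t * ?f (of_real t))" by simp
 have \<alpha>1: "0 < \<alpha> + 1" using \<alpha> by simp
 have "ennreal (norm (LINT t|\<mu>. of_real t * ?f (of_real t) * (1 - of_real t * of_real r) powr (- of_real (\<alpha> + 1)))) =
   (\<integral>\<^sup>+t. ennreal (t * ((1 - b) powr (1 / p) * (1 - t * b) powr (- (2 / p)) * (1 - t * r) powr (-(\<alpha> + 1)))) \<partial>\<mu>)"
 proof (rule ennreal_norm_integral_of_real)
  show "integrable \<mu> (\<lambda>t. of_real t * ?f (of_real t) * (1 - of_real t * of_real r) powr (- of_real (\<alpha> + 1)))"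
   by (rule moment_kernel_sums(2)[OF \<mu> \<alpha>1 int1 z])
  show "of_real t * ?f (of_real t) * (1 - of_real t * of_real r) powr (- of_real (\<alpha> + 1)) = of_real (t * ((1 - b) powr (1 / p) * (1 - t * b) powr (- (2 / p)) * (1 - t * r) powr (-(\<alpha> + 1))))"
   if "t \<in> space \<mu>" for t unfolding ft[OF that] pw[OF that r] by (simp only: of_real_mult mult.assoc)
 qed (auto simp: sp)
 then show "ennreal (norm (deriv (hilbert_op \<mu> \<alpha> ?f) (of_real r))) =
   ennreal \<alpha> * (\<integral>\<^sup>+t. ennreal (t * ((1 - b) powr (1 / p) * (1 - t * b) powr (- (2 / p)) * (1 - t * r) powr (-(\<alpha> + 1)))) \<partial>\<mu>)"
  unfolding hilbert_op_representation(3)[OF \<mu> fin \<alpha> f z] norm_mult norm_of_real using \<alpha> by (simp add: ennreal_mult)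
qed

lemma const_times_tail_le:
 assumes \<mu>: "borel_measure_01 \<mu>" and b: "0 \<le> b" "b < 1" and le: "\<And>t. b \<le> t \<Longrightarrow> t < 1 \<Longrightarrow> X \<le> k t"
 shows "ennreal X * emeasure \<mu> {b..<1} \<le> (\<integral>\<^sup>+t. ennreal (k t) \<partial>\<mu>)"
proof -
 have "{b..<1} \<inter> {0..<1} \<in> sets \<mu>" by (rule borel_measure_01D(3)[OF \<mu>]) simp
 then have "{b..<1} \<in> sets \<mu>" using b by (simp add: Int_absorb2)
 then have "ennreal X * emeasure \<mu> {b..<1} = (\<integral>\<^sup>+t\<in>{b..<1}. ennreal X \<partial>\<mu>)"
  by (rule nn_integral_cmult_indicator[symmetric])
 also have "\<dots> \<le> (\<integral>\<^sup>+t. ennreal (k t) \<partial>\<mu>)"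
  by (intro nn_integral_mono) (auto simp: indicator_def intro!: ennreal_leI le)
 finally show ?thesis .
qed

lemma one_minus_mult_le:
 fixes t x :: real
 assumes "0 \<le> x" "x \<le> t" "t < 1"
 shows "1 - t * x \<le> 2 * (1 - x)" "0 < 1 - t * x"
proof -
 have "x * x \<le> t * x" using assms by (intro mult_right_mono) auto
 then have "1 - t * x \<le> (1 - x) * (1 + x)" by (simp add: algebra_simps)
 also have "\<dots> \<le> (1 - x) * 2" using assms by (intro mult_left_mono) auto
 finally show "1 - t * x \<le> 2 * (1 - x)" by simp
 have "t * x \<le> t * 1" using assms by (intro mult_left_mono) auto
 then show "0 < 1 - t * x" using assms by simp
qed

text \<open>For t \<ge> b the quantities 1 - t b and 1 - t x are at most twice 1 - b and 1 - x.\<close>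

lemma test_kernel_lower:
 fixes t b x :: real
 assumes p: "0 < p" and b: "0 < b" "b \<le> t" "t < 1" and x: "0 \<le> x" "x \<le> b" and a: "0 < a"
 shows "2 powr (-(2 / p + a)) * (1 - b) powr (-(1 / p)) * (1 - x) powr (-a)
  \<le> (1 - b) powr (1 / p) * (1 - t * b) powr (- (2 / p)) * (1 - t * x) powr (-a)"
proof -
 have "(2 * (1 - b)) powr (-(2 / p)) \<le> (1 - t * b) powr (-(2 / p))"
  using one_minus_mult_le[of b t] b p by (intro powr_mono2') auto
 moreover have "(2 * (1 - x)) powr (-a) \<le> (1 - t * x) powr (-a)"
  using one_minus_mult_le[of x t] b x a by (intro powr_mono2') auto
 ultimately have "(1 - b) powr (1 / p) * (2 * (1 - b)) powr (-(2 / p)) * (2 * (1 - x)) powr (-a) \<le> (1 - b) powr (1 / p) * (1 - t * b) powr (-(2 / p)) * (1 - t * x) powr (-a)"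
  by (intro mult_mono) auto
 moreover have "(1 - b) powr (1 / p) * (2 * (1 - b)) powr (-(2 / p)) * (2 * (1 - x)) powr (-a) =
   (2 powr (-(2 / p)) * 2 powr (-a)) * ((1 - b) powr (1 / p) * (1 - b) powr (-(2 / p))) * (1 - x) powr (-a)"
  by (simp only: powr_mult mult_ac)
 moreover have "2 powr (-(2 / p)) * 2 powr (-a) = (2::real) powr (-(2 / p + a))" by (simp add: powr_add[symmetric])
 moreover have "(1 - b) powr (1 / p) * (1 - b) powr (-(2 / p)) = (1 - b) powr (-(1 / p))"
  by (subst powr_add[symmetric]) (simp add: field_simps)
 ultimately show ?thesis by (simp only:)
qed

lemma test_fn_integral_tendsto:
 assumes p: "0 < p" and \<mu>: "borel_measure_01 \<mu>" and fin: "emeasure \<mu> {0..<1} < \<infinity>" and van: "vanishing_tail \<mu> (1 / p)"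
  and b: "\<And>n. 0 < b n" "\<And>n. b n < 1" "b \<longlonglongrightarrow> 1"
 shows "(\<lambda>n. \<integral>\<^sup>+t. ennreal (norm (test_fn p (b n) (of_real t))) \<partial>\<mu>) \<longlonglongrightarrow> 0"
proof -
 note sp = borel_measure_01D(2)[OF \<mu>]
 define h where "h = (\<lambda>n t. (1 - b n) powr (1 / p) * (1 - t * b n) powr (- (2 / p)))"
 have lim: "(\<lambda>n. \<integral>\<^sup>+t. ennreal (h n t) \<partial>\<mu>) \<longlonglongrightarrow> 0"
 proof (rule nn_integral_to_zero_split[OF \<mu> fin])
  show "h n \<in> borel_measurable borel" for n unfolding h_def by measurable
  show "0 \<le> h n t" for n t by (simp add: h_def)
  fix e :: real assume e: "0 < e"
  define k where "k = 1 / p * kernel_const (1 / p - 0) (2 / p)"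
  have kc: "0 < kernel_const (1 / p) (2 / p)" by (rule kernel_const_pos) (use p in \<open>auto simp: divide_strict_right_mono\<close>)
  then have k: "0 < k" using p by (simp add: k_def)
  obtain a where a: "0 \<le> a" "a < 1" "tail_bound \<mu> a (1 / p) (e / k)" using van e k unfolding vanishing_tail_def by (meson divide_pos_pos)
  have "(\<integral>\<^sup>+t\<in>{a..<1}. ennreal (h n t) \<partial>\<mu>) \<le> ennreal e" for n
  proof -
   let ?d = "1 - b n"
   have "(\<integral>\<^sup>+t\<in>{a..<1}. ennreal (h n t) \<partial>\<mu>) = (\<integral>\<^sup>+t. ennreal (?d powr (1 / p)) * (ennreal ((1 - t) powr (-0) * (1 - t * b n) powr (-(2 / p))) * indicator {a..<1} t) \<partial>\<mu>)"
    by (intro nn_integral_cong) (auto simp: h_def indicator_def ennreal_mult)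
   also have "\<dots> = ennreal (?d powr (1 / p)) * (\<integral>\<^sup>+t\<in>{a..<1}. ennreal ((1 - t) powr (-0) * (1 - t * b n) powr (-(2 / p))) \<partial>\<mu>)"
    by (rule nn_integral_cmult, rule measurable_01I[OF \<mu>]) measurable
   also have "\<dots> \<le> ennreal (?d powr (1 / p)) * ennreal (e / k * (1 / p * kernel_const (1 / p - 0) (2 / p)) * ?d powr (1 / p - 0 - 2 / p))"
    using e k b p by (intro mult_left_mono nn_integral_tail_kernel[OF \<mu> a(1,2) _ a(3)]) (auto simp: less_imp_le divide_strict_right_mono)
   also have "\<dots> = ennreal (?d powr (1 / p) * (e / k * (1 / p * kernel_const (1 / p - 0) (2 / p)) * ?d powr (1 / p - 0 - 2 / p)))"
    using e k kc p by (intro ennreal_mult[symmetric]) auto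
   also have "?d powr (1 / p) * (e / k * (1 / p * kernel_const (1 / p - 0) (2 / p)) * ?d powr (1 / p - 0 - 2 / p)) = e"
   proof -
    have "?d powr (1 / p) * ?d powr (1 / p - 0 - 2 / p) = 1" using b(2)[of n] by (subst powr_add[symmetric]) (simp add: field_simps)
    moreover have "?d powr (1 / p) * (e / k * k * ?d powr (1 / p - 0 - 2 / p)) = (?d powr (1 / p) * ?d powr (1 / p - 0 - 2 / p)) * (e / k * k)" by (simp only: mult_ac)
    ultimately show ?thesis using k unfolding k_def[symmetric] by simp
   qed
   finally show ?thesis .
  qed
  then show "\<exists>a. 0 \<le> a \<and> a < 1 \<and> (\<forall>n. (\<integral>\<^sup>+t\<in>{a..<1}. ennreal (h n t) \<partial>\<mu>) \<le> ennreal e)" using a by blast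
 next
  fix a :: real assume a: "a < 1"
  have "(\<lambda>n. (1 - b n) powr (1 / p) * (1 - a) powr (-(2 / p))) \<longlonglongrightarrow> (1 - 1) powr (1 / p) * (1 - a) powr (-(2 / p))"
   using p b(2) by (intro tendsto_mult tendsto_powr' tendsto_diff tendsto_const b(3)) (auto simp: less_imp_le)
  then have l0: "(\<lambda>n. (1 - b n) powr (1 / p) * (1 - a) powr (-(2 / p))) \<longlonglongrightarrow> 0" by simp
  show "uniform_limit {0..a} h (\<lambda>t. 0) sequentially"
   unfolding uniform_limit_iff
  proof (intro allI impI)
   fix e :: real assume "0 < e"
   then have "\<forall>\<^sub>F n in sequentially. (1 - b n) powr (1 / p) * (1 - a) powr (-(2 / p)) < e" using order_tendstoD(2)[OF l0] by blast
   then show "\<forall>\<^sub>F n in sequentially. \<forall>t\<in>{0..a}. dist (h n t) 0 < e"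
   proof (rule eventually_mono, intro ballI)
    fix n t assume *: "(1 - b n) powr (1 / p) * (1 - a) powr (-(2 / p)) < e" and t: "t \<in> {0..a}"
    have "t * b n \<le> t * 1" using t b(2)[of n] by (intro mult_left_mono) auto
    then have "(1 - t * b n) powr (-(2 / p)) \<le> (1 - a) powr (-(2 / p))" using t a p by (intro powr_mono2') auto
    then have "h n t \<le> (1 - b n) powr (1 / p) * (1 - a) powr (-(2 / p))" unfolding h_def by (intro mult_left_mono) auto
    moreover have "0 \<le> h n t" by (simp add: h_def)
    ultimately show "dist (h n t) 0 < e" using * unfolding dist_real_def by linarith
   qed
  qed
 qed
 have "(\<integral>\<^sup>+t. ennreal (norm (test_fn p (b n) (of_real t))) \<partial>\<mu>) = (\<integral>\<^sup>+t. ennreal (h n t) \<partial>\<mu>)" for n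
 proof (intro nn_integral_cong arg_cong[where f = ennreal])
  fix t assume "t \<in> space \<mu>"
  then have t: "0 \<le> t" "t < 1" by (auto simp: sp)
  have "1 - of_real (b n) * complex_of_real t = of_real (1 - t * b n)" by (simp add: mult.commute)
  then have "norm (1 - of_real (b n) * complex_of_real t) = \<bar>1 - t * b n\<bar>" by (simp only: norm_of_real)
  also have "\<dots> = 1 - t * b n"
  proof -
   have "t * b n \<le> 1 * 1" using t b(1,2)[of n] by (intro mult_mono) (auto simp: less_imp_le)
   then show ?thesis by simp
  qed
  finally show "norm (test_fn p (b n) (of_real t)) = h n t"
   using norm_test_fn[OF b(1)[of n] b(2)[of n], of "of_real t" p] t by (simp add: h_def)
 qed
 then show ?thesis using lim by simp
qed

text \<open>The common part of the three necessity proofs. Here L is the extra weight (1 or the logarithm)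
and s the exponent in the condition on \<mu>. Boundedness of the operator first yields the
estimate with a constant, which must imply the vanishing condition of exponent 1/p; then the test
functions tend to 0 in L^1(\<mu>), hence their images tend to 0 pointwise and, by compactness, in
norm.\<close>

lemma vanishing_of_compact:
 assumes Y: "disc_norm Y N" and p: "0 < p" and \<alpha>: "0 < \<alpha>" and \<mu>: "borel_measure_01 \<mu>" and fin: "emeasure \<mu> {0..<1} < \<infinity>"
  and comp: "hilbert_compact \<mu> \<alpha> (hardy_space p) (hardy_norm p) Y N" and c: "0 \<le> c"
  and lower: "\<And>b. 1 / 2 \<le> b \<Longrightarrow> b < 1 \<Longrightarrow> hilbert_op \<mu> \<alpha> (test_fn p b) \<in> Y \<Longrightarrow>
   ennreal (L b) * emeasure \<mu> {b..<1} \<le> ennreal (c * (1 - b) powr s * N (hilbert_op \<mu> \<alpha> (test_fn p b)))"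
  and van: "\<And>C. 0 \<le> C \<Longrightarrow> (\<And>b. 1 / 2 \<le> b \<Longrightarrow> b < 1 \<Longrightarrow> ennreal (L b) * emeasure \<mu> {b..<1} \<le> ennreal (C * (1 - b) powr s)) \<Longrightarrow> vanishing_tail \<mu> (1 / p)"
 shows "\<forall>e>0. \<exists>a. 0 \<le> a \<and> a < 1 \<and> (\<forall>t. a \<le> t \<and> t < 1 \<longrightarrow> ennreal (L t) * emeasure \<mu> {t..<1} \<le> ennreal (e * (1 - t) powr s))"
proof -
 interpret disc_norm Y N by fact
 let ?T = "hilbert_op \<mu> \<alpha>" and ?B = "angular_const 2 / (2 * pi)"
 have co: "compact_operator (hardy_space p) (hardy_norm p) Y N ?T" using comp by (simp add: hilbert_compact_def)
 have fb: "test_fn p b \<in> hardy_ball p ?B" if "0 < b" "b < 1" for b by (rule test_fn_hardy_ball[OF p that])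
 have mem: "?T (test_fn p b) \<in> Y" if "0 < b" "b < 1" for b
 proof -
  have "?T \<in> hardy_space p \<rightarrow> Y" using co by (simp add: compact_operator_def linear_operator_on_def)
  then show ?thesis using hardy_ball_imp_norm_le(1)[OF p fb[OF that]] by blast
 qed
 obtain C0 where C0: "\<And>f. f \<in> hardy_ball p ?B \<Longrightarrow> N (?T f) \<le> C0" using compact_operatorD(1)[OF p co] by blast
 have "vanishing_tail \<mu> (1 / p)"
 proof (rule van)
  show "0 \<le> c * \<bar>C0\<bar>" using c by simp
  fix b :: real assume b: "1 / 2 \<le> b" "b < 1"
  then have b0: "0 < b" by simp
  have "ennreal (L b) * emeasure \<mu> {b..<1} \<le> ennreal (c * (1 - b) powr s * N (?T (test_fn p b)))" by (rule lower[OF b mem[OF b0 b(2)]])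
  also have "\<dots> \<le> ennreal (c * (1 - b) powr s * \<bar>C0\<bar>)"
   using C0[OF fb[OF b0 b(2)]] c by (intro ennreal_leI mult_left_mono) auto
  finally show "ennreal (L b) * emeasure \<mu> {b..<1} \<le> ennreal (c * \<bar>C0\<bar> * (1 - b) powr s)" by (simp add: mult_ac)
 qed
 note vt = this
 have lim: "((\<lambda>b. N (?T (test_fn p b))) \<longlongrightarrow> 0) (at_left 1)"
 proof (rule tendsto_at_left_sequentially[of 0])
  fix b :: "nat \<Rightarrow> real" assume b: "\<And>n. b n < 1" "\<And>n. 0 < b n" "incseq b" "b \<longlonglongrightarrow> 1"
  have int0: "(\<lambda>n. \<integral>\<^sup>+t. ennreal (norm (test_fn p (b n) (of_real t))) \<partial>\<mu>) \<longlonglongrightarrow> 0"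
   by (rule test_fn_integral_tendsto[OF p \<mu> fin vt b(2,1,4)])
  show "(\<lambda>n. N (?T (test_fn p (b n)))) \<longlonglongrightarrow> 0"
  proof (rule compact_operatorD(2)[OF p co fb[OF b(2,1)]])
   fix z :: complex assume z: "norm z < 1"
   let ?k = "ennreal ((1 - norm z) powr (-\<alpha>))"
   have le: "ennreal (norm (?T (test_fn p (b n)) z)) \<le> ?k * (\<integral>\<^sup>+t. ennreal (norm (test_fn p (b n) (of_real t))) \<partial>\<mu>)" for n
   proof -
    have [measurable]: "test_fn p (b n) \<in> borel_measurable borel" by (rule disc_holomorphic_measurable[OF test_fn_disc_holomorphic[OF b(2,1)]])
    have "ennreal (norm (?T (test_fn p (b n)) z)) \<le> (\<integral>\<^sup>+t. ennreal (norm (test_fn p (b n) (of_real t)) * norm (1 - of_real t * z) powr (-\<alpha>)) \<partial>\<mu>)"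
     by (rule norm_hilbert_op_le(1)[OF \<mu> fin \<alpha> test_fn_moment_represented[OF \<mu> fin b(2,1)] z])
    also have "\<dots> \<le> (\<integral>\<^sup>+t. ?k * ennreal (norm (test_fn p (b n) (of_real t))) \<partial>\<mu>)"
    proof (rule nn_integral_mono)
     fix t assume "t \<in> space \<mu>"
     then have t: "0 \<le> t" "t < 1" by (auto simp: borel_measure_01D(2)[OF \<mu>])
     have "norm (1 - of_real t * z) powr (-\<alpha>) \<le> (1 - norm z) powr (-\<alpha>)"
      using norm_kernel_ge[OF t z] z \<alpha> by (intro powr_mono2') auto
     then have "norm (test_fn p (b n) (of_real t)) * norm (1 - of_real t * z) powr (-\<alpha>) \<le> (1 - norm z) powr (-\<alpha>) * norm (test_fn p (b n) (of_real t))"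
      by (subst mult.commute) (rule mult_right_mono, auto)
     then show "ennreal (norm (test_fn p (b n) (of_real t)) * norm (1 - of_real t * z) powr (-\<alpha>)) \<le> ?k * ennreal (norm (test_fn p (b n) (of_real t)))"
      by (subst ennreal_mult[symmetric]) (auto intro: ennreal_leI)
    qed
    also have "\<dots> = ?k * (\<integral>\<^sup>+t. ennreal (norm (test_fn p (b n) (of_real t))) \<partial>\<mu>)"
     by (rule nn_integral_cmult, rule measurable_01I[OF \<mu>]) measurable
    finally show ?thesis .
   qed
   have "(\<lambda>n. ?k * (\<integral>\<^sup>+t. ennreal (norm (test_fn p (b n) (of_real t))) \<partial>\<mu>)) \<longlonglongrightarrow> ?k * 0"
    by (rule tendsto_mult_ennreal[OF tendsto_const int0]) auto
   then have "(\<lambda>n. ?k * (\<integral>\<^sup>+t. ennreal (norm (test_fn p (b n) (of_real t))) \<partial>\<mu>)) \<longlonglongrightarrow> 0" by simp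
   then have "(\<lambda>n. ennreal (norm (?T (test_fn p (b n)) z))) \<longlonglongrightarrow> 0"
    by (rule tendsto_sandwich[OF _ _ tendsto_const, rotated 2]) (auto intro: always_eventually le)
   then have "(\<lambda>n. norm (?T (test_fn p (b n)) z)) \<longlonglongrightarrow> 0" by (subst (asm) ennreal_tendsto_0_iff) auto
   then show "(\<lambda>n. ?T (test_fn p (b n)) z) \<longlonglongrightarrow> 0" by (rule tendsto_norm_zero_cancel)
  qed
 qed simp
 show ?thesis
 proof (intro allI impI)
  fix e :: real assume e: "0 < e"
  have "\<forall>\<^sub>F b in at_left 1. N (?T (test_fn p b)) < e / (c + 1)" using order_tendstoD(2)[OF lim, of "e / (c + 1)"] e c by simp
  then obtain b0 where b0: "b0 < 1" "\<And>b. b0 < b \<Longrightarrow> b < 1 \<Longrightarrow> N (?T (test_fn p b)) < e / (c + 1)"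
   unfolding eventually_at_left_field by blast
  define a where "a = max (1 / 2) ((1 + b0) / 2)"
  have a: "1 / 2 \<le> a" "a < 1" "b0 < a" using b0(1) by (auto simp: a_def less_max_iff_disj)
  have "ennreal (L t) * emeasure \<mu> {t..<1} \<le> ennreal (e * (1 - t) powr s)" if t: "a \<le> t" "t < 1" for t
  proof -
   have t0: "0 < t" "1 / 2 \<le> t" "b0 < t" using a t by auto
   have "ennreal (L t) * emeasure \<mu> {t..<1} \<le> ennreal (c * (1 - t) powr s * N (?T (test_fn p t)))" by (rule lower[OF t0(2) t(2) mem[OF t0(1) t(2)]])
   also have "\<dots> \<le> ennreal (e * (1 - t) powr s)"
   proof (rule ennreal_leI)
    have "c * N (?T (test_fn p t)) \<le> c * (e / (c + 1))" using b0(2)[OF t0(3) t(2)] c by (intro mult_left_mono) auto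
    also have "\<dots> \<le> (c + 1) * (e / (c + 1))" using c e by (intro mult_right_mono) auto
    also have "\<dots> = e" using c by simp
    finally have "c * N (?T (test_fn p t)) * (1 - t) powr s \<le> e * (1 - t) powr s" by (rule mult_right_mono) simp
    then show "c * (1 - t) powr s * N (?T (test_fn p t)) \<le> e * (1 - t) powr s" by (simp add: mult_ac)
   qed
   finally show ?thesis .
  qed
  then show "\<exists>a. 0 \<le> a \<and> a < 1 \<and> (\<forall>t. a \<le> t \<and> t < 1 \<longrightarrow> ennreal (L t) * emeasure \<mu> {t..<1} \<le> ennreal (e * (1 - t) powr s))"
   using a by (intro exI[of _ a]) auto
 qed
qed

lemma ennreal_divide_out:
 assumes "0 < X" "0 \<le> Y" "ennreal X * m \<le> ennreal Y"
 shows "m \<le> ennreal (Y / X)"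
proof -
 have "ennreal (1 / X) * (ennreal X * m) \<le> ennreal (1 / X) * ennreal Y" by (intro mult_left_mono assms) simp
 moreover have "ennreal (1 / X) * ennreal X = 1" using assms by (subst ennreal_mult[symmetric]) auto
 ultimately show ?thesis using assms by (simp add: mult.assoc[symmetric] ennreal_mult[symmetric])
qed

text \<open>Point evaluation at b, of norm (1 - b)^(-\<alpha>/q) up to a constant.\<close>

lemma bergman_lower_bound:
 assumes p: "0 < p" and \<alpha>: "1 < \<alpha>" and q: "0 < q" and \<mu>: "borel_measure_01 \<mu>" and fin: "emeasure \<mu> {0..<1} < \<infinity>" and b: "0 < b" "b < 1"
  and mem: "hilbert_op \<mu> \<alpha> (test_fn p b) \<in> bergman_space q (\<alpha> - 2)"
 shows "emeasure \<mu> {b..<1} \<le> ennreal (2 powr (2 / p + \<alpha> + \<alpha> / q) * (1 - b) powr (1 / p + \<alpha> - \<alpha> / q) * bergman_norm q (\<alpha> - 2) (hilbert_op \<mu> \<alpha> (test_fn p b)))"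
proof -
 let ?g = "hilbert_op \<mu> \<alpha> (test_fn p b)"
 define N where "N = bergman_norm q (\<alpha> - 2) ?g"
 have N0: "0 \<le> N" by (simp add: N_def bergman_norm_def)
 have \<alpha>0: "0 < \<alpha>" and \<beta>: "-1 < \<alpha> - 2" using \<alpha> by auto
 have gd: "?g \<in> disc_holomorphic" using mem by (simp add: bergman_space_def)
 have nb: "norm (of_real b :: complex) = b" using b by simp
 have "ennreal (norm (?g (of_real b)) powr q * ((1 - norm (of_real b :: complex)) / 2) powr (\<alpha> - 2 + 2)) \<le> ennreal ((\<alpha> - 2 + 1) / pi) * bergman_integral q (\<alpha> - 2) ?g"
  by (rule bergman_point_evaluation[OF gd q \<beta>]) (use b in simp)
 also have "\<dots> \<le> ennreal (N powr q)" using bergman_norm_le_iff[OF mem q \<beta> N0] by (simp add: N_def)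
 finally have "norm (?g (of_real b)) powr q * ((1 - b) / 2) powr \<alpha> \<le> N powr q"
  unfolding nb by (subst (asm) ennreal_le_iff) auto
 then have "(norm (?g (of_real b)) powr q * ((1 - b) / 2) powr \<alpha>) powr (1 / q) \<le> (N powr q) powr (1 / q)"
  using q by (intro powr_mono2) auto
 then have "norm (?g (of_real b)) * ((1 - b) / 2) powr (\<alpha> / q) \<le> N" using q N0 by (simp add: powr_mult powr_powr)
 then have gb: "norm (?g (of_real b)) \<le> N / ((1 - b) / 2) powr (\<alpha> / q)" using b by (simp add: pos_le_divide_eq)
 define X where "X = 2 powr (-(2 / p + \<alpha>)) * (1 - b) powr (-(1 / p)) * (1 - b) powr (-\<alpha>)"
 have X: "0 < X" using b by (simp add: X_def)
 have "ennreal X * emeasure \<mu> {b..<1} \<le> (\<integral>\<^sup>+t. ennreal ((1 - b) powr (1 / p) * (1 - t * b) powr (- (2 / p)) * (1 - t * b) powr (-\<alpha>)) \<partial>\<mu>)"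
  unfolding X_def by (rule const_times_tail_le[OF \<mu> _ _ test_kernel_lower[OF p b(1) _ _ _ _ \<alpha>0]]) (use b in auto)
 also have "\<dots> = ennreal (norm (?g (of_real b)))"
  by (rule hilbert_op_test_fn(1)[OF \<mu> fin \<alpha>0 b, symmetric]) (use b in auto)
 also have "\<dots> \<le> ennreal (N / ((1 - b) / 2) powr (\<alpha> / q))" by (rule ennreal_leI[OF gb])
 finally have "ennreal X * emeasure \<mu> {b..<1} \<le> ennreal (N / ((1 - b) / 2) powr (\<alpha> / q))" .
 then have "emeasure \<mu> {b..<1} \<le> ennreal (N / ((1 - b) / 2) powr (\<alpha> / q) / X)"
  by (rule ennreal_divide_out[OF X, rotated]) (use N0 in simp)
 also have "N / ((1 - b) / 2) powr (\<alpha> / q) / X = 2 powr (2 / p + \<alpha> + \<alpha> / q) * (1 - b) powr (1 / p + \<alpha> - \<alpha> / q) * N"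
  using b by (simp add: X_def powr_add powr_diff powr_minus powr_divide field_simps)
 finally show ?thesis by (simp add: N_def)
qed

text \<open>The seminorm at the point b.\<close>

lemma bloch_lower_bound:
 assumes p: "0 < p" and \<alpha>: "0 < \<alpha>" and \<mu>: "borel_measure_01 \<mu>" and fin: "emeasure \<mu> {0..<1} < \<infinity>" and b: "1 / 2 \<le> b" "b < 1"
  and mem: "hilbert_op \<mu> \<alpha> (test_fn p b) \<in> bloch_space"
 shows "emeasure \<mu> {b..<1} \<le> ennreal (2 powr (2 / p + \<alpha> + 2) / \<alpha> * (1 - b) powr (1 / p + \<alpha>) * bloch_norm (hilbert_op \<mu> \<alpha> (test_fn p b)))"
proof -
 let ?g = "hilbert_op \<mu> \<alpha> (test_fn p b)"
 have b0: "0 < b" using b by simp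
 define N where "N = bloch_norm ?g"
 have nb: "norm (of_real b :: complex) = b" using b by simp
 have "(1 - (norm (of_real b :: complex))\<^sup>2) * norm (deriv ?g (of_real b)) \<le> (SUP z\<in>ball 0 1. (1 - (norm z)\<^sup>2) * norm (deriv ?g z))"
  by (rule cSUP_upper) (use mem b in \<open>auto simp: bloch_space_def\<close>)
 then have "(1 - b\<^sup>2) * norm (deriv ?g (of_real b)) \<le> N" unfolding nb using norm_ge_zero[of "?g 0"] unfolding N_def bloch_norm_def by linarith
 moreover have "(1 - b) * norm (deriv ?g (of_real b)) \<le> (1 - b\<^sup>2) * norm (deriv ?g (of_real b))"
  using b by (intro mult_right_mono) (auto simp: power2_eq_square mult_left_le)
 ultimately have "(1 - b) * norm (deriv ?g (of_real b)) \<le> N" by linarith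
 then have gb: "norm (deriv ?g (of_real b)) \<le> N / (1 - b)" using b by (simp add: field_simps)
 have N0: "0 \<le> N" using order_trans[OF norm_ge_zero gb] b by (simp add: zero_le_divide_iff)
 define X where "X = 1 / 2 * (2 powr (-(2 / p + (\<alpha> + 1))) * (1 - b) powr (-(1 / p)) * (1 - b) powr (-(\<alpha> + 1)))"
 have X: "0 < X" using b by (simp add: X_def)
 have "ennreal X * emeasure \<mu> {b..<1} \<le> (\<integral>\<^sup>+t. ennreal (t * ((1 - b) powr (1 / p) * (1 - t * b) powr (- (2 / p)) * (1 - t * b) powr (-(\<alpha> + 1)))) \<partial>\<mu>)"
 proof (rule const_times_tail_le[OF \<mu>])
  fix t assume t: "b \<le> t" "t < 1"
  show "X \<le> t * ((1 - b) powr (1 / p) * (1 - t * b) powr (- (2 / p)) * (1 - t * b) powr (-(\<alpha> + 1)))"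
   unfolding X_def by (rule mult_mono[OF _ test_kernel_lower[OF p b0 t]]) (use b0 b t \<alpha> in auto)
 qed (use b in auto)
 then have "ennreal \<alpha> * (ennreal X * emeasure \<mu> {b..<1}) \<le> ennreal (norm (deriv ?g (of_real b)))"
  unfolding hilbert_op_test_fn(2)[OF \<mu> fin \<alpha> b0 b(2) less_imp_le[OF b0] b(2)] by (rule mult_left_mono) simp
 also have "\<dots> \<le> ennreal (N / (1 - b))" by (rule ennreal_leI[OF gb])
 finally have "ennreal (\<alpha> * X) * emeasure \<mu> {b..<1} \<le> ennreal (N / (1 - b))"
  using \<alpha> X by (simp add: ennreal_mult mult.assoc)
 then have "emeasure \<mu> {b..<1} \<le> ennreal (N / (1 - b) / (\<alpha> * X))"
  by (rule ennreal_divide_out[rotated 2]) (use X \<alpha> N0 b in auto)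
 also have "N / (1 - b) / (\<alpha> * X) = N / \<alpha> / (X * (1 - b))" by (simp add: mult_ac)
 also have "X * (1 - b) = (2 powr (-1) * 2 powr (-(2 / p + (\<alpha> + 1)))) * ((1 - b) powr (-(1 / p)) * (1 - b) powr (-(\<alpha> + 1)) * (1 - b) powr 1)"
  using b by (simp add: X_def powr_minus_divide)
 also have "\<dots> = 2 powr (-(2 / p + \<alpha> + 2)) * (1 - b) powr (-(1 / p + \<alpha>))"
 proof -
  have "-1 + -(2 / p + (\<alpha> + 1)) = -(2 / p + \<alpha> + 2)" "-(1 / p) + -(\<alpha> + 1) + 1 = -(1 / p + \<alpha>)" by simp_all
  then show ?thesis by (simp only: powr_add[symmetric])
 qed
 also have "N / \<alpha> / (2 powr (-(2 / p + \<alpha> + 2)) * (1 - b) powr (-(1 / p + \<alpha>))) = 2 powr (2 / p + \<alpha> + 2) / \<alpha> * (1 - b) powr (1 / p + \<alpha>) * N"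
  by (simp only: powr_minus) (simp add: field_simps)
 finally show ?thesis by (simp add: N_def)
qed

text \<open>Integrated along a radius, |g| is controlled by its circle means (the Fejer-Riesz inequality up
to a constant, from the radial majorant with p = 1); integrating over the radii of the circles
gives one more power of 1 - x.\<close>

lemma bergman_1_ge_radial:
 assumes g: "g \<in> disc_holomorphic" and \<beta>: "-1 < \<beta>"
 shows "ennreal (pi / (4 * (\<beta> + 1))) * (\<integral>\<^sup>+x\<in>{0..<1}. ennreal (norm (g (of_real x)) * (1 - x) powr (\<beta> + 1)) \<partial>lborel) \<le> bergman_integral 1 \<beta> g"
proof -
 have [measurable]: "g \<in> borel_measurable borel" by (rule disc_holomorphic_measurable[OF g])
 let ?n = "\<lambda>x. ennreal (norm (g (of_real x)))"
 have circ: "AE u in lborel. ennreal (1/4) * (\<integral>\<^sup>+x\<in>{0..<u}. ?n x \<partial>lborel) * (ennreal ((1 - u) powr \<beta>) * indicator {0<..<1} u)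
   \<le> ennreal (circle_mean 1 (sqrt u) g * (1 - u) powr \<beta>) * indicator {0..<1} u"
 proof (rule AE_mp[OF AE_radial_majorant[OF g zero_less_one]], intro AE_I2 impI)
  fix u assume maj: "0 < u \<and> u < 1 \<longrightarrow> (\<exists>A. radial_majorant 1 (sqrt u) g A)"
  show "ennreal (1/4) * (\<integral>\<^sup>+x\<in>{0..<u}. ?n x \<partial>lborel) * (ennreal ((1 - u) powr \<beta>) * indicator {0<..<1} u)
   \<le> ennreal (circle_mean 1 (sqrt u) g * (1 - u) powr \<beta>) * indicator {0..<1} u"
  proof (cases "u \<in> {0<..<1}")
   case True
   then have u: "0 < u" "u < 1" by auto
   obtain A where A: "radial_majorant 1 (sqrt u) g A" using maj u by blast
   note A = A[unfolded radial_majorant_def]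
   define R where "R = sqrt u"
   have R: "0 < R" "R < 1" "u \<le> R"
   proof -
    show "0 < R" "R < 1" using u by (auto simp: R_def)
    have "u = R * R" using u by (simp add: R_def)
    also have "\<dots> \<le> R * 1" using \<open>0 < R\<close> \<open>R < 1\<close> by (intro mult_left_mono) auto
    finally show "u \<le> R" by simp
   qed
   have cm0: "0 \<le> circle_mean 1 R g" using circle_mean_nonneg[OF disc_holomorphicD(1)[OF g] _ R(2), of 1] R by simp
   have "(\<integral>\<^sup>+x\<in>{0..<u}. ?n x \<partial>lborel) \<le> (\<integral>\<^sup>+x\<in>{0..<R}. ?n x \<partial>lborel)"
    using R by (intro nn_integral_mono) (auto simp: indicator_def)
   also have "\<dots> = ennreal R * (\<integral>\<^sup>+t\<in>{0..<1}. ?n (R * t) \<partial>lborel)"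
    using R by (subst nn_integral_real_affine[where c = R and t = 0]) (auto intro!: nn_integral_cong arg_cong2[where f = "(*)"] simp: indicator_def zero_le_mult_iff)
   also have "\<dots> \<le> 1 * (\<integral>\<^sup>+t\<in>{0..<1}. ennreal (A t) \<partial>lborel)"
   proof (rule mult_mono[OF _ nn_integral_mono])
    show "ennreal R \<le> 1" using ennreal_leI[of R 1] R by simp
    fix t
    show "?n (R * t) * indicator {0..<1} t \<le> ennreal (A t) * indicator {0..<1} t"
    proof (cases "t \<in> {0..<1}")
     case True
     then have t: "0 \<le> t" "t < 1" by auto
     have n: "norm (of_real (R * t) :: complex) = R * t" using t R by (simp add: norm_mult)
     have lt: "R * t < R" using t R by simp
     have "\<forall>z. norm z < R \<longrightarrow> norm (g z) powr 1 \<le> A (norm z / R)" using A by (simp add: R_def)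
     then have "norm (g (of_real (R * t))) powr 1 \<le> A (norm (of_real (R * t) :: complex) / R)" using n lt by metis
     then have "norm (g (of_real (R * t))) \<le> A t" unfolding n using R by simp
     then show ?thesis using True by (simp add: ennreal_leI)
    qed simp
   qed simp_all
   also have "\<dots> \<le> ennreal (4 * circle_mean 1 R g)" using A by (simp add: R_def)
   finally have I: "(\<integral>\<^sup>+x\<in>{0..<u}. ?n x \<partial>lborel) \<le> ennreal (4 * circle_mean 1 R g)" .
   have "ennreal (1/4) * (\<integral>\<^sup>+x\<in>{0..<u}. ?n x \<partial>lborel) \<le> ennreal (1/4) * ennreal (4 * circle_mean 1 R g)"
    by (rule mult_left_mono[OF I]) simp
   also have "\<dots> = ennreal (circle_mean 1 R g)" using cm0 by (subst ennreal_mult[symmetric]) auto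
   finally have "ennreal (1/4) * (\<integral>\<^sup>+x\<in>{0..<u}. ?n x \<partial>lborel) * ennreal ((1 - u) powr \<beta>) \<le> ennreal (circle_mean 1 R g) * ennreal ((1 - u) powr \<beta>)"
    by (rule mult_right_mono) simp
   then show ?thesis using True cm0 by (simp add: R_def ennreal_mult)
  qed simp
 qed
 define H where "H = (\<lambda>(x, u). ennreal (1/4) * (?n x * (if 0 \<le> x \<and> x < u then 1 else 0)) * (ennreal ((1 - u) powr \<beta>) * indicator {0<..<1} u))"
 have Hm: "H \<in> borel_measurable (lborel \<Otimes>\<^sub>M lborel)" unfolding H_def by measurable
 have "(\<integral>\<^sup>+x. ennreal (1 / (4 * (\<beta> + 1))) * (ennreal (norm (g (of_real x)) * (1 - x) powr (\<beta> + 1)) * indicator {0..<1} x) \<partial>lborel) = (\<integral>\<^sup>+x. \<integral>\<^sup>+u. H (x, u) \<partial>lborel \<partial>lborel)"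
 proof (rule nn_integral_cong)
  fix x :: real
  show "ennreal (1 / (4 * (\<beta> + 1))) * (ennreal (norm (g (of_real x)) * (1 - x) powr (\<beta> + 1)) * indicator {0..<1} x) = (\<integral>\<^sup>+u. H (x, u) \<partial>lborel)"
  proof (cases "x \<in> {0..<1}")
   case True
   have "(\<integral>\<^sup>+u. H (x, u) \<partial>lborel) = (\<integral>\<^sup>+u. (ennreal (1/4) * ?n x) * (ennreal ((1 - u) powr (\<beta> + 1 - 1)) * indicator {x<..<1} u) \<partial>lborel)"
    using True by (intro nn_integral_cong) (auto simp: H_def indicator_def)
   also have "\<dots> = (ennreal (1/4) * ?n x) * (\<integral>\<^sup>+u\<in>{x<..<1}. ennreal ((1 - u) powr (\<beta> + 1 - 1)) \<partial>lborel)"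
    by (rule nn_integral_cmult) measurable
   also have "(\<integral>\<^sup>+u\<in>{x<..<1}. ennreal ((1 - u) powr (\<beta> + 1 - 1)) \<partial>lborel) = ennreal ((1 - x) powr (\<beta> + 1) / (\<beta> + 1))"
    by (rule nn_integral_powr_tail) (use \<beta> True in auto)
   also have "(ennreal (1/4) * ?n x) * ennreal ((1 - x) powr (\<beta> + 1) / (\<beta> + 1)) = ennreal (1/4 * norm (g (of_real x)) * ((1 - x) powr (\<beta> + 1) / (\<beta> + 1)))"
    using \<beta> by (subst ennreal_mult[symmetric], simp, simp, intro ennreal_mult[symmetric]) auto
   also have "1/4 * norm (g (of_real x)) * ((1 - x) powr (\<beta> + 1) / (\<beta> + 1)) = 1 / (4 * (\<beta> + 1)) * (norm (g (of_real x)) * (1 - x) powr (\<beta> + 1))" by simp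
   also have "ennreal \<dots> = ennreal (1 / (4 * (\<beta> + 1))) * ennreal (norm (g (of_real x)) * (1 - x) powr (\<beta> + 1))"
    using \<beta> by (intro ennreal_mult) auto
   finally show ?thesis using True by simp
  next
   case False
   then have "H (x, u) = 0" for u by (auto simp: H_def indicator_def)
   then show ?thesis using False by simp
  qed
 qed
 also have "\<dots> = (\<integral>\<^sup>+u. \<integral>\<^sup>+x. H (x, u) \<partial>lborel \<partial>lborel)"
  using lborel_pair.Fubini'[of "\<lambda>x u. H (x, u)"] Hm by (simp add: case_prod_beta')
 also have "\<dots> = (\<integral>\<^sup>+u. ennreal (1/4) * (\<integral>\<^sup>+x\<in>{0..<u}. ?n x \<partial>lborel) * (ennreal ((1 - u) powr \<beta>) * indicator {0<..<1} u) \<partial>lborel)"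
 proof (rule nn_integral_cong)
  fix u :: real
  have "(\<integral>\<^sup>+x. H (x, u) \<partial>lborel) = (\<integral>\<^sup>+x. ennreal (1/4) * (?n x * indicator {0..<u} x) \<partial>lborel) * (ennreal ((1 - u) powr \<beta>) * indicator {0<..<1} u)"
   unfolding H_def case_prod_conv by (subst nn_integral_multc[symmetric]) (auto intro!: nn_integral_cong simp: indicator_def)
  also have "(\<integral>\<^sup>+x. ennreal (1/4) * (?n x * indicator {0..<u} x) \<partial>lborel) = ennreal (1/4) * (\<integral>\<^sup>+x\<in>{0..<u}. ?n x \<partial>lborel)"
   by (rule nn_integral_cmult) measurable
  finally show "(\<integral>\<^sup>+x. H (x, u) \<partial>lborel) = ennreal (1/4) * (\<integral>\<^sup>+x\<in>{0..<u}. ?n x \<partial>lborel) * (ennreal ((1 - u) powr \<beta>) * indicator {0<..<1} u)" .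
 qed
 also have "\<dots> \<le> (\<integral>\<^sup>+u\<in>{0..<1}. ennreal (circle_mean 1 (sqrt u) g * (1 - u) powr \<beta>) \<partial>lborel)"
  by (rule nn_integral_mono_AE[OF circ])
 finally have 1: "ennreal (1 / (4 * (\<beta> + 1))) * (\<integral>\<^sup>+x\<in>{0..<1}. ennreal (norm (g (of_real x)) * (1 - x) powr (\<beta> + 1)) \<partial>lborel)
   \<le> (\<integral>\<^sup>+u\<in>{0..<1}. ennreal (circle_mean 1 (sqrt u) g * (1 - u) powr \<beta>) \<partial>lborel)"
  by (subst nn_integral_cmult[symmetric]) auto
 have pc: "ennreal (pi / (4 * (\<beta> + 1))) = ennreal pi * ennreal (1 / (4 * (\<beta> + 1)))"
  using \<beta> by (subst ennreal_mult[symmetric]) auto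
 show ?thesis
  unfolding nn_integral_disc_circle_mean[OF g zero_less_one] pc mult.assoc by (rule mult_left_mono[OF 1]) simp
qed

text \<open>Point evaluation would lose the logarithm. On the whole segment [0, b] the image is at least (1 -
b)^(-1/p) \<mu>([b, 1)) (1 - x)^(-\<alpha>) up to a constant, and integrating against (1 -
x)^(\<alpha> - 1) gives ln (1 / (1 - b)).\<close>

lemma bergman_1_lower_bound:
 assumes p: "0 < p" and \<alpha>: "1 < \<alpha>" and \<mu>: "borel_measure_01 \<mu>" and fin: "emeasure \<mu> {0..<1} < \<infinity>" and b: "1 / 2 \<le> b" "b < 1"
  and mem: "hilbert_op \<mu> \<alpha> (test_fn p b) \<in> bergman_space 1 (\<alpha> - 2)"
 shows "ennreal (ln (2 / (1 - b))) * emeasure \<mu> {b..<1} \<le> ennreal (8 * 2 powr (2 / p + \<alpha>) * (1 - b) powr (1 / p) * bergman_norm 1 (\<alpha> - 2) (hilbert_op \<mu> \<alpha> (test_fn p b)))"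
proof -
 let ?g = "hilbert_op \<mu> \<alpha> (test_fn p b)" and ?m = "emeasure \<mu> {b..<1}"
 have b0: "0 < b" using b by simp
 have \<alpha>0: "0 < \<alpha>" and \<beta>: "-1 < \<alpha> - 2" using \<alpha> by auto
 define N where "N = bergman_norm 1 (\<alpha> - 2) ?g"
 have N0: "0 \<le> N" by (simp add: N_def bergman_norm_def)
 have gd: "?g \<in> disc_holomorphic" using mem by (simp add: bergman_space_def)
 have [measurable]: "?g \<in> borel_measurable borel" by (rule disc_holomorphic_measurable[OF gd])
 define X where "X = 2 powr (-(2 / p + \<alpha>)) * (1 - b) powr (-(1 / p))"
 have X: "0 < X" using b by (simp add: X_def)
 have pt: "ennreal (X * (1 - x) powr (-\<alpha>)) * ?m \<le> ennreal (norm (?g (of_real x)))" if x: "0 \<le> x" "x \<le> b" for x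
 proof -
  have "ennreal (X * (1 - x) powr (-\<alpha>)) * ?m \<le> (\<integral>\<^sup>+t. ennreal ((1 - b) powr (1 / p) * (1 - t * b) powr (- (2 / p)) * (1 - t * x) powr (-\<alpha>)) \<partial>\<mu>)"
   unfolding X_def by (rule const_times_tail_le[OF \<mu>]) (use test_kernel_lower[OF p b0 _ _ x] b0 b \<alpha> x in auto)
  also have "\<dots> = ennreal (norm (?g (of_real x)))"
   by (rule hilbert_op_test_fn(1)[OF \<mu> fin \<alpha>0 b0 b(2), symmetric]) (use x b in auto)
  finally show ?thesis .
 qed
 have "ennreal X * ?m * ennreal (ln (1 / (1 - b))) = ennreal X * ?m * (\<integral>\<^sup>+u\<in>{1-b..1}. ennreal (1 / u) \<partial>lborel)"
  using b b0 by (subst nn_integral_inverse_to_1) auto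
 also have "(\<integral>\<^sup>+u\<in>{1-b..1}. ennreal (1 / u) \<partial>lborel) = (\<integral>\<^sup>+x\<in>{0..b}. ennreal (1 / (1 - x)) \<partial>lborel)"
  by (subst nn_integral_real_affine[where c = "-1" and t = 1]) (auto intro!: nn_integral_cong simp: indicator_def)
 also have "ennreal X * ?m * (\<integral>\<^sup>+x\<in>{0..b}. ennreal (1 / (1 - x)) \<partial>lborel) = (\<integral>\<^sup>+x. ennreal X * ?m * (ennreal (1 / (1 - x)) * indicator {0..b} x) \<partial>lborel)"
  by (rule nn_integral_cmult[symmetric]) measurable
 also have "\<dots> \<le> (\<integral>\<^sup>+x\<in>{0..<1}. ennreal (norm (?g (of_real x)) * (1 - x) powr (\<alpha> - 2 + 1)) \<partial>lborel)"
 proof (rule nn_integral_mono)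
  fix x
  show "ennreal X * ?m * (ennreal (1 / (1 - x)) * indicator {0..b} x) \<le> ennreal (norm (?g (of_real x)) * (1 - x) powr (\<alpha> - 2 + 1)) * indicator {0..<1} x"
  proof (cases "x \<in> {0..b}")
   case True
   then have x: "0 \<le> x" "x \<le> b" "x < 1" using b by auto
   have "1 / (1 - x) = (1 - x) powr (-\<alpha>) * (1 - x) powr (\<alpha> - 2 + 1)"
    using x by (subst powr_add[symmetric]) (simp add: powr_minus_divide)
   then have "ennreal X * ?m * ennreal (1 / (1 - x)) = (ennreal (X * (1 - x) powr (-\<alpha>)) * ?m) * ennreal ((1 - x) powr (\<alpha> - 2 + 1))"
    using X by (simp add: ennreal_mult mult_ac)
   also have "\<dots> \<le> ennreal (norm (?g (of_real x))) * ennreal ((1 - x) powr (\<alpha> - 2 + 1))"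
    by (rule mult_right_mono[OF pt]) (use x in auto)
   also have "\<dots> = ennreal (norm (?g (of_real x)) * (1 - x) powr (\<alpha> - 2 + 1))" by (rule ennreal_mult[symmetric]) auto
   finally show ?thesis using True x by simp
  qed simp
 qed
 finally have 1: "ennreal X * ?m * ennreal (ln (1 / (1 - b))) \<le> (\<integral>\<^sup>+x\<in>{0..<1}. ennreal (norm (?g (of_real x)) * (1 - x) powr (\<alpha> - 2 + 1)) \<partial>lborel)" .
 have q: "ennreal (1 / 4) = ennreal ((\<alpha> - 2 + 1) / pi) * ennreal (pi / (4 * (\<alpha> - 2 + 1)))"
  using \<alpha> by (subst ennreal_mult[symmetric]) auto
 have "ennreal (1 / 4) * (ennreal X * ?m * ennreal (ln (1 / (1 - b)))) \<le> ennreal ((\<alpha> - 2 + 1) / pi) * bergman_integral 1 (\<alpha> - 2) ?g"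
  unfolding q mult.assoc[of "ennreal ((\<alpha> - 2 + 1) / pi)"]
  by (rule mult_left_mono[OF order_trans[OF mult_left_mono[OF 1] bergman_1_ge_radial[OF gd \<beta>]]]) auto
 also have "\<dots> \<le> ennreal (N powr 1)" using bergman_norm_le_iff[OF mem zero_less_one \<beta> N0] by (simp add: N_def)
 also have "ennreal (N powr 1) = ennreal N" using N0 by simp
 finally have 2: "ennreal (1 / 4) * (ennreal X * ?m * ennreal (ln (1 / (1 - b)))) \<le> ennreal N" .
 have ln0: "0 \<le> ln (1 / (1 - b))" using b by (intro ln_ge_zero) (simp add: field_simps)
 have "ln 2 \<le> ln (1 / (1 - b))" using b by (subst ln_le_cancel_iff) (auto simp: field_simps)
 then have lnle: "1 / 8 * ln (2 / (1 - b)) \<le> 1 / 4 * ln (1 / (1 - b))" using b ln_two_over_split[of 0 b] by simp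
 have ln2: "0 \<le> ln (2 / (1 - b))" using ln_two_over_ge[of b] b by simp
 have "ennreal (X / 8) * (ennreal (ln (2 / (1 - b))) * ?m) = ennreal (1 / 8 * ln (2 / (1 - b))) * (ennreal X * ?m)"
 proof -
  have "ennreal (X / 8) * ennreal (ln (2 / (1 - b))) = ennreal (1 / 8 * ln (2 / (1 - b))) * ennreal X"
   using X ln2 by (simp add: ennreal_mult[symmetric] mult_ac)
  then show ?thesis by (simp only: mult.assoc[symmetric])
 qed
 also have "\<dots> \<le> ennreal (1 / 4 * ln (1 / (1 - b))) * (ennreal X * ?m)"
  by (intro mult_right_mono ennreal_leI lnle) simp
 also have "\<dots> = ennreal (1 / 4) * (ennreal X * ?m * ennreal (ln (1 / (1 - b))))"
  using ln0 by (subst ennreal_mult) (auto simp: mult_ac)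
 also note 2
 finally have "ennreal (X / 8) * (ennreal (ln (2 / (1 - b))) * ?m) \<le> ennreal N" .
 then have "ennreal (ln (2 / (1 - b))) * ?m \<le> ennreal (N / (X / 8))"
  by (rule ennreal_divide_out[rotated 2]) (use X N0 in auto)
 also have "N / (X / 8) = 8 * 2 powr (2 / p + \<alpha>) * (1 - b) powr (1 / p) * N"
  unfolding X_def by (simp only: powr_minus) (simp add: field_simps)
 finally show ?thesis by (simp add: N_def)
qed

section \<open>The three equivalences\<close>

text \<open>For p > 1 the space H^p is treated as a subspace of H^1.\<close>

lemma moment_represented_of_carleson:
 assumes p: "0 < p" and p1: "p1 = min p 1" and \<mu>: "borel_measure_01 \<mu>"
  and C: "0 \<le> C" "tail_bound \<mu> 0 (1 / p1) C" and van: "vanishing_tail \<mu> (1 / p1)" and f: "f \<in> hardy_ball p B"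
 shows "moment_represented \<mu> f"
proof (rule moment_represented_hardy[OF \<mu> _ _ _ C van])
 show "0 < p1" "p1 \<le> 1" using p by (auto simp: p1)
 show "f \<in> hardy_ball p1 (1 + B)" by (rule hardy_ball_lower_exponent[OF _ _ f]) (use p in \<open>auto simp: p1\<close>)
qed

lemma tail_bound_half_imp_vanishing:
 assumes "0 \<le> C" "\<And>b. 1 / 2 \<le> b \<Longrightarrow> b < 1 \<Longrightarrow> ennreal 1 * emeasure \<mu> {b..<1} \<le> ennreal (C * (1 - b) powr s)" "s' < s"
 shows "vanishing_tail \<mu> s'"
 by (rule tail_bound_imp_vanishing[of "1 / 2" \<mu> s C]) (use assms in \<open>auto simp: tail_bound_def\<close>)

lemma vanishing_tail_of_unit_weight:
 assumes "\<forall>e>0. \<exists>a. 0 \<le> a \<and> a < 1 \<and> (\<forall>t. a \<le> t \<and> t < 1 \<longrightarrow> ennreal 1 * emeasure \<mu> {t..<1} \<le> ennreal (e * (1 - t) powr s))"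
 shows "vanishing_tail \<mu> s"
 using assms by (simp add: vanishing_tail_def tail_bound_def)

lemma ln_two_over_powr_1: "0 \<le> t \<Longrightarrow> t < 1 \<Longrightarrow> ln (2 / (1 - t)) powr 1 = ln (2 / (1 - t))" for t :: real
 using ln_two_over_ge[of t] by simp

lemma vanishing_log_carleson_1_iff:
 "vanishing_log_carleson 1 s \<mu> \<longleftrightarrow> (\<forall>e>0. \<exists>a. 0 \<le> a \<and> a < 1 \<and>
   (\<forall>t. a \<le> t \<and> t < 1 \<longrightarrow> ennreal (ln (2 / (1 - t))) * emeasure \<mu> {t..<1} \<le> ennreal (e * (1 - t) powr s)))"
proof -
 have "(\<forall>t. a \<le> t \<and> t < 1 \<longrightarrow> ennreal (ln (2 / (1 - t)) powr 1) * emeasure \<mu> {t..<1} \<le> ennreal (e * (1 - t) powr s)) \<longleftrightarrow>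
   (\<forall>t. a \<le> t \<and> t < 1 \<longrightarrow> ennreal (ln (2 / (1 - t))) * emeasure \<mu> {t..<1} \<le> ennreal (e * (1 - t) powr s))" if "0 \<le> a" for a e
  using that by (simp add: ln_two_over_powr_1 cong: imp_cong)
 then show ?thesis unfolding vanishing_log_carleson_iff by (simp cong: conj_cong)
qed

lemma emeasure_tail_le_of_ln_weight:
 assumes t: "0 \<le> t" "t < 1" and e: "0 \<le> e" and l: "0 < l" "l \<le> ln (2 / (1 - t))"
  and le: "ennreal (ln (2 / (1 - t))) * emeasure \<mu> {t..<1} \<le> ennreal e"
 shows "emeasure \<mu> {t..<1} \<le> ennreal (e / l)"
proof (rule ennreal_divide_out[OF l(1) e])
 have "ennreal l * emeasure \<mu> {t..<1} \<le> ennreal (ln (2 / (1 - t))) * emeasure \<mu> {t..<1}"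
  by (rule mult_right_mono[OF ennreal_leI[OF l(2)]]) simp
 also note le
 finally show "ennreal l * emeasure \<mu> {t..<1} \<le> ennreal e" .
qed

lemma vanishing_log_imp_vanishing_tail:
 assumes "vanishing_log_carleson 1 s \<mu>"
 shows "vanishing_tail \<mu> s"
 unfolding vanishing_tail_def
proof (intro allI impI)
 fix e :: real assume e: "0 < e"
 then obtain a where a: "0 \<le> a" "a < 1"
  "\<And>t. a \<le> t \<Longrightarrow> t < 1 \<Longrightarrow> ennreal (ln (2 / (1 - t))) * emeasure \<mu> {t..<1} \<le> ennreal (e / 2 * (1 - t) powr s)"
  using assms unfolding vanishing_log_carleson_1_iff by (meson half_gt_zero)
 have "tail_bound \<mu> a s e"
  unfolding tail_bound_def
 proof (intro allI impI)
  fix t assume t: "a \<le> t \<and> t < 1"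
  have "emeasure \<mu> {t..<1} \<le> ennreal (e / 2 * (1 - t) powr s / (1 / 2))"
   by (rule emeasure_tail_le_of_ln_weight) (use t a e ln_two_over_ge[of t] in auto)
  then show "emeasure \<mu> {t..<1} \<le> ennreal (e * (1 - t) powr s)" by simp
 qed
 then show "\<exists>a. 0 \<le> a \<and> a < 1 \<and> tail_bound \<mu> a s e" using a by blast
qed

text \<open>The logarithm tends to infinity, so a bound with it is a vanishing bound without it.\<close>

lemma log_bound_imp_vanishing_tail:
 assumes C: "0 \<le> C"
  and le: "\<And>b. 1 / 2 \<le> b \<Longrightarrow> b < 1 \<Longrightarrow> ennreal (ln (2 / (1 - b))) * emeasure \<mu> {b..<1} \<le> ennreal (C * (1 - b) powr s)"
 shows "vanishing_tail \<mu> s"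
 unfolding vanishing_tail_def
proof (intro allI impI)
 fix e :: real assume e: "0 < e"
 \<comment> \<open>C / l \<le> e, and the logarithm exceeds l from a onwards.\<close>
 define l where "l = C / e + 1"
 have l: "0 < l" "C / l \<le> e" using C e by (auto simp: l_def field_simps add_pos_nonneg)
 define a where "a = max (1 / 2) (1 - 2 * exp (-l))"
 have a: "1 / 2 \<le> a" "a < 1" by (auto simp: a_def)
 have "tail_bound \<mu> a s e"
  unfolding tail_bound_def
 proof (intro allI impI)
  fix t assume t: "a \<le> t \<and> t < 1"
  then have t': "1 / 2 \<le> t" "t < 1" "1 - t \<le> 2 * exp (-l)" by (auto simp: a_def)
  have "exp l \<le> 2 / (1 - t)" using t' by (simp add: exp_minus field_simps)
  then have ll: "l \<le> ln (2 / (1 - t))" using t' by (subst ln_ge_iff) auto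
  have "emeasure \<mu> {t..<1} \<le> ennreal (C * (1 - t) powr s / l)"
   by (rule emeasure_tail_le_of_ln_weight[OF _ t'(2) _ l(1) ll le[OF t'(1,2)]]) (use t' C in auto)
  also have "C * (1 - t) powr s / l = C / l * (1 - t) powr s" by simp
  also have "ennreal (C / l * (1 - t) powr s) \<le> ennreal (e * (1 - t) powr s)"
   by (intro ennreal_leI mult_right_mono l) simp
  finally show "emeasure \<mu> {t..<1} \<le> ennreal (e * (1 - t) powr s)" .
 qed
 then show "\<exists>a. 0 \<le> a \<and> a < 1 \<and> tail_bound \<mu> a s e" using a by (intro exI[of _ a]) auto
qed

lemma density_ln_finite:
 assumes \<mu>: "borel_measure_01 \<mu>" and fin: "emeasure \<mu> {0..<1} < \<infinity>" and a: "0 \<le> a" "a < 1"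
  and tail: "tail_bound (density_01 \<mu> (\<lambda>t. ln (2 / (1 - t)))) a s e"
 shows "emeasure (density_01 \<mu> (\<lambda>t. ln (2 / (1 - t)))) {0..<1} < \<infinity>"
proof -
 let ?\<nu> = "density_01 \<mu> (\<lambda>t. ln (2 / (1 - t)))"
 have \<nu>: "borel_measure_01 ?\<nu>" by (rule density_01(1)[OF \<mu>]) measurable
 have sets: "A \<in> sets ?\<nu>" if "A \<in> sets borel" "A \<subseteq> {0..<1}" for A
  using borel_measure_01D(3)[OF \<nu> that(1)] that(2) by (simp add: Int_absorb2)
 have sets\<mu>: "A \<in> sets \<mu>" if "A \<in> sets borel" "A \<subseteq> {0..<1}" for A
  using borel_measure_01D(3)[OF \<mu> that(1)] that(2) by (simp add: Int_absorb2)
 have "emeasure ?\<nu> {0..<a} = (\<integral>\<^sup>+t\<in>{0..<a}. ennreal (ln (2 / (1 - t))) \<partial>\<mu>)"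
  by (rule density_01(3)[OF \<mu>]) (use a in auto)
 also have "\<dots> \<le> (\<integral>\<^sup>+t\<in>{0..<1}. ennreal (ln (2 / (1 - a))) \<partial>\<mu>)"
  using a by (intro nn_integral_mono) (auto simp: indicator_def frac_le intro!: ennreal_leI)
 also have "\<dots> = ennreal (ln (2 / (1 - a))) * emeasure \<mu> {0..<1}"
  by (rule nn_integral_cmult_indicator[OF sets\<mu>]) auto
 finally have "emeasure ?\<nu> {0..<a} \<le> ennreal (ln (2 / (1 - a))) * emeasure \<mu> {0..<1}" .
 then have 1: "emeasure ?\<nu> {0..<a} < \<infinity>" by (rule le_less_trans) (use fin in \<open>simp add: ennreal_mult_less_top\<close>)
 have "emeasure ?\<nu> {a..<1} \<le> ennreal (e * (1 - a) powr s)" using tail a by (simp add: tail_bound_def)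
 then have 2: "emeasure ?\<nu> {a..<1} < \<infinity>" by (rule le_less_trans) simp
 have "emeasure ?\<nu> ({0..<a} \<union> {a..<1}) \<le> emeasure ?\<nu> {0..<a} + emeasure ?\<nu> {a..<1}"
  by (rule emeasure_subadditive; rule sets) (use a in auto)
 also have "{0..<a} \<union> {a..<1} = {0..<1}" using a by auto
 finally show ?thesis by (rule le_less_trans) (use 1 2 in simp)
qed

text \<open>Here s - \<alpha> = 1/p - \<alpha>/q \<ge> 0, and (q - 1)(s - \<alpha>) + s = q/p is the Carleson
exponent for embedding H^p into L^q.\<close>

lemma compact_bergman_iff:
 assumes p: "0 < p" and \<alpha>: "1 < \<alpha>" and \<mu>: "borel_measure_01 \<mu>" and p1: "p1 = min p 1"
  and C1: "0 < C1" "tail_bound \<mu> 0 (1 / p1) C1" and q: "1 < q" "\<alpha> * p \<le> q" and s: "s = 1 / p + \<alpha> - \<alpha> / q"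
 shows "hilbert_compact \<mu> \<alpha> (hardy_space p) (hardy_norm p) (bergman_space q (\<alpha> - 2)) (bergman_norm q (\<alpha> - 2)) \<longleftrightarrow> vanishing_tail \<mu> s"
  (is "?L \<longleftrightarrow> ?R")
proof -
 note fin = tail_bound_0_finite[OF C1(2)]
 have \<alpha>0: "0 < \<alpha>" and q1: "1 \<le> q" and q0: "0 < q" using \<alpha> q by auto
 have "p * 1 \<le> p * \<alpha>" using p \<alpha> by (intro mult_left_mono) auto
 then have pq: "p \<le> q" using q by (simp add: mult.commute)
 have aq: "\<alpha> / q \<le> 1 / p" using p q q0 by (simp add: field_simps)
 have aq': "\<alpha> / q < \<alpha>" using \<alpha> q by (simp add: field_simps)
 have s\<alpha>: "\<alpha> \<le> s" and sp: "1 / p < s" using aq aq' by (auto simp: s)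
 have sp1: "1 / p1 \<le> s" using sp s\<alpha> \<alpha> by (auto simp: p1 min_def)
 have s0: "0 < s" using s\<alpha> \<alpha>0 by simp
 show ?thesis
 proof
  assume van: ?R
  have rep: "moment_represented \<mu> f" if "f \<in> hardy_ball p B" for f B
   by (rule moment_represented_of_carleson[OF p p1 \<mu> less_imp_le[OF C1(1)] C1(2) vanishing_tail_weaken[OF van sp1] that])
  obtain a where a: "0 \<le> a" "a < 1" "tail_bound \<mu> a s 1" using van unfolding vanishing_tail_def by (meson zero_less_one)
  obtain C where C: "0 < C" "tail_bound \<mu> 0 s C" by (rule tail_bound_extend[OF fin \<mu> a(1,2) s0 a(3)]) auto
  define w where "w = (q - 1) * (s - \<alpha>)"
  let ?\<nu> = "density_01 \<mu> (\<lambda>t. (1 - t) powr w)"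
  have w: "0 \<le> w" using q s\<alpha> by (simp add: w_def)
  have ws: "w + s = q / p"
  proof -
   have "w + s = q * (s - \<alpha>) + \<alpha>" by (simp add: w_def algebra_simps)
   also have "s - \<alpha> = 1 / p - \<alpha> / q" by (simp add: s)
   also have "q * (1 / p - \<alpha> / q) + \<alpha> = q / p" using q0 by (simp add: field_simps)
   finally show ?thesis .
  qed
  obtain K where K: "0 \<le> K" "\<And>f. moment_represented \<mu> f \<Longrightarrow> bergman_integral q (\<alpha> - 2) (hilbert_op \<mu> \<alpha> f) \<le>
    ennreal K * (\<integral>\<^sup>+t. ennreal (norm (f (of_real t)) powr q) \<partial>?\<nu>)"
   using bergman_estimate[OF \<mu> fin \<alpha> q(1) s\<alpha> C] unfolding w_def by blast
  show ?L
  proof (rule bergman_compactI[OF p pq q1 \<alpha> \<mu> fin rep _ _ _ _ K(1) K(2)[OF rep]])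
   show "borel_measure_01 ?\<nu>" by (rule density_01(1)[OF \<mu>]) measurable
   show "0 \<le> C" using C by simp
   show "tail_bound ?\<nu> 0 (q / p) C"
    using tail_bound_power_weight[OF \<mu> w order_refl C(2) less_imp_le[OF C(1)]] unfolding ws .
   show "vanishing_tail ?\<nu> (q / p)"
    unfolding vanishing_tail_def
   proof (intro allI impI)
    fix e :: real assume e: "0 < e"
    then obtain a where a: "0 \<le> a" "a < 1" "tail_bound \<mu> a s e" using van unfolding vanishing_tail_def by blast
    have "tail_bound ?\<nu> a (q / p) e"
     using tail_bound_power_weight[OF \<mu> w a(1,3) less_imp_le[OF e]] unfolding ws .
    then show "\<exists>a. 0 \<le> a \<and> a < 1 \<and> tail_bound ?\<nu> a (q / p) e" using a by blast
   qed
  qed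
 next
  assume comp: ?L
  show ?R
  proof (rule vanishing_tail_of_unit_weight, rule vanishing_of_compact[OF bergman_disc_norm p \<alpha>0 \<mu> fin comp])
   show "1 \<le> q" "-1 < \<alpha> - 2" using q \<alpha> by auto
   show "0 \<le> 2 powr (2 / p + \<alpha> + \<alpha> / q)" by simp
   fix b :: real assume b: "1 / 2 \<le> b" "b < 1" and mem: "hilbert_op \<mu> \<alpha> (test_fn p b) \<in> bergman_space q (\<alpha> - 2)"
   have b0: "0 < b" using b by simp
   show "ennreal 1 * emeasure \<mu> {b..<1} \<le> ennreal (2 powr (2 / p + \<alpha> + \<alpha> / q) * (1 - b) powr s * bergman_norm q (\<alpha> - 2) (hilbert_op \<mu> \<alpha> (test_fn p b)))"
    using bergman_lower_bound[OF p \<alpha> q0 \<mu> fin b0 b(2) mem] by (simp only: s ennreal_1 mult_1)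
  next
   fix C :: real assume "0 \<le> C" "\<And>b. 1 / 2 \<le> b \<Longrightarrow> b < 1 \<Longrightarrow> ennreal 1 * emeasure \<mu> {b..<1} \<le> ennreal (C * (1 - b) powr s)"
   then show "vanishing_tail \<mu> (1 / p)" by (rule tail_bound_half_imp_vanishing[OF _ _ sp])
  qed
 qed
qed

lemma compact_bergman_1_iff:
 assumes p: "0 < p" "p \<le> 1" and \<alpha>: "1 < \<alpha>" and \<mu>: "borel_measure_01 \<mu>" and C1: "0 < C1" "tail_bound \<mu> 0 (1 / p) C1"
 shows "hilbert_compact \<mu> \<alpha> (hardy_space p) (hardy_norm p) (bergman_space 1 (\<alpha> - 2)) (bergman_norm 1 (\<alpha> - 2)) \<longleftrightarrow> vanishing_log_carleson 1 (1 / p) \<mu>"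
  (is "?L \<longleftrightarrow> ?R")
proof -
 note fin = tail_bound_0_finite[OF C1(2)]
 have \<alpha>0: "0 < \<alpha>" and p0: "0 < 1 / p" using \<alpha> p by auto
 have p1: "p = min p 1" using p by simp
 show ?thesis
 proof
  assume van: ?R
  have rep: "moment_represented \<mu> f" if "f \<in> hardy_ball p B" for f B
   by (rule moment_represented_of_carleson[OF p(1) p1 \<mu> less_imp_le[OF C1(1)] C1(2) vanishing_log_imp_vanishing_tail[OF van] that])
  let ?\<nu> = "density_01 \<mu> (\<lambda>t. ln (2 / (1 - t)))"
  have \<nu>: "borel_measure_01 ?\<nu>" by (rule density_01(1)[OF \<mu>]) measurable
  have van\<nu>: "vanishing_tail ?\<nu> (1 / p)"
   unfolding vanishing_tail_def
  proof (intro allI impI)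
   fix e :: real assume e: "0 < e"
   define k where "k = 1 + 8 / (1 / p)"
   have k: "0 < k" using p by (simp add: k_def)
   then have ek: "0 < e / k" using e by simp
   obtain a where a: "0 \<le> a" "a < 1"
    "\<And>t. a \<le> t \<Longrightarrow> t < 1 \<Longrightarrow> ennreal (ln (2 / (1 - t))) * emeasure \<mu> {t..<1} \<le> ennreal (e / k * (1 - t) powr (1 / p))"
    using van ek unfolding vanishing_log_carleson_1_iff by meson
   have "tail_bound ?\<nu> a (1 / p) (e / k * (1 + 8 / (1 / p)))"
    by (rule tail_bound_log_weight[OF \<mu> p0 a(1) less_imp_le[OF ek] a(3)])
   also have "e / k * (1 + 8 / (1 / p)) = e" using k unfolding k_def[symmetric] by simp
   finally show "\<exists>a. 0 \<le> a \<and> a < 1 \<and> tail_bound ?\<nu> a (1 / p) e" using a by blast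
  qed
  obtain a where a: "0 \<le> a" "a < 1" "tail_bound ?\<nu> a (1 / p) 1" using van\<nu> unfolding vanishing_tail_def by (meson zero_less_one)
  obtain C where C: "0 < C" "tail_bound ?\<nu> 0 (1 / p) C"
   by (rule tail_bound_extend[OF density_ln_finite[OF \<mu> fin a] \<nu> a(1,2) p0 a(3)]) auto
  obtain K where K: "0 \<le> K" "\<And>f. moment_represented \<mu> f \<Longrightarrow> bergman_integral 1 (\<alpha> - 2) (hilbert_op \<mu> \<alpha> f) \<le>
    ennreal K * (\<integral>\<^sup>+t. ennreal (norm (f (of_real t)) powr 1) \<partial>?\<nu>)"
   using bergman_estimate_1[OF \<mu> fin \<alpha>] by blast
  show ?L
   by (rule bergman_compactI[OF p order_refl \<alpha> \<mu> fin rep \<nu> less_imp_le[OF C(1)] C(2) van\<nu> K(1) K(2)[OF rep]])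
 next
  assume comp: ?L
  show ?R
   unfolding vanishing_log_carleson_1_iff
  proof (rule vanishing_of_compact[OF bergman_disc_norm p(1) \<alpha>0 \<mu> fin comp])
   show "1 \<le> (1::real)" "-1 < \<alpha> - 2" using \<alpha> by auto
   show "0 \<le> 8 * 2 powr (2 / p + \<alpha>)" by simp
  qed (rule bergman_1_lower_bound[OF p(1) \<alpha> \<mu> fin] log_bound_imp_vanishing_tail; assumption)+
 qed
qed

lemma compact_bloch_iff:
 assumes p: "0 < p" and \<alpha>: "1 < \<alpha>" and \<mu>: "borel_measure_01 \<mu>" and p1: "p1 = min p 1"
  and C1: "0 < C1" "tail_bound \<mu> 0 (1 / p1) C1"
 shows "hilbert_compact \<mu> \<alpha> (hardy_space p) (hardy_norm p) bloch_space bloch_norm \<longleftrightarrow> vanishing_tail \<mu> (1 / p + \<alpha>)"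
  (is "?L \<longleftrightarrow> ?R")
proof -
 note fin = tail_bound_0_finite[OF C1(2)]
 have \<alpha>0: "0 < \<alpha>" and p10: "0 < p1" "p1 \<le> 1" "p1 \<le> p" using \<alpha> p by (auto simp: p1)
 have sp1: "1 / p1 \<le> 1 / p + \<alpha>" using \<alpha> p by (auto simp: p1 min_def add_increasing)
 show ?thesis
 proof
  assume van: ?R
  have van1: "vanishing_tail \<mu> (1 / p1)" by (rule vanishing_tail_weaken[OF van sp1])
  show ?L
  proof (rule bloch_compactI[OF p \<alpha>0 \<mu> fin _ van])
   show "moment_represented \<mu> f" if "f \<in> hardy_ball p B" for f B
    by (rule moment_represented_of_carleson[OF p p1 \<mu> less_imp_le[OF C1(1)] C1(2) van1 that])
   fix B and F :: "nat \<Rightarrow> complex \<Rightarrow> complex"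
   assume F: "\<And>n. F n \<in> hardy_ball p B" and lim: "\<And>a. a < 1 \<Longrightarrow> uniform_limit (cball 0 a) F (\<lambda>z. 0) sequentially"
   show "(\<lambda>n. \<integral>\<^sup>+t. ennreal (norm (F n (of_real t))) \<partial>\<mu>) \<longlonglongrightarrow> 0"
    using carleson_embedding_vanishing[OF p10(1,2) hardy_ball_lower_exponent[OF p10(1,3) F] \<mu> fin van1 lim] by simp
  qed
 next
  assume comp: ?L
  have sp: "1 / p < 1 / p + \<alpha>" using \<alpha> by simp
  show ?R
  proof (rule vanishing_tail_of_unit_weight, rule vanishing_of_compact[OF bloch_disc_norm p \<alpha>0 \<mu> fin comp])
   show "0 \<le> 2 powr (2 / p + \<alpha> + 2) / \<alpha>" using \<alpha> by simp
   fix b :: real assume b: "1 / 2 \<le> b" "b < 1" and mem: "hilbert_op \<mu> \<alpha> (test_fn p b) \<in> bloch_space"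
   show "ennreal 1 * emeasure \<mu> {b..<1} \<le> ennreal (2 powr (2 / p + \<alpha> + 2) / \<alpha> * (1 - b) powr (1 / p + \<alpha>) * bloch_norm (hilbert_op \<mu> \<alpha> (test_fn p b)))"
    using bloch_lower_bound[OF p \<alpha>0 \<mu> fin b mem] by (simp only: ennreal_1 mult_1)
  next
   fix C :: real assume "0 \<le> C" "\<And>b. 1 / 2 \<le> b \<Longrightarrow> b < 1 \<Longrightarrow> ennreal 1 * emeasure \<mu> {b..<1} \<le> ennreal (C * (1 - b) powr (1 / p + \<alpha>))"
   then show "vanishing_tail \<mu> (1 / p)" by (rule tail_bound_half_imp_vanishing[OF _ _ sp])
  qed
 qed
qed

theorem theorem4p1:
  fixes p \<alpha> :: real and \<mu> :: "real measure"
  assumes "0 < p" and "1 < \<alpha>"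
    and "borel_measure_01 \<mu>"
    and "p \<le> 1 \<Longrightarrow> carleson (1 / p) \<mu>"
    and "1 < p \<Longrightarrow> carleson 1 \<mu>"
  shows "(\<forall>q q'. 1 < q \<and> \<alpha> * p \<le> q \<and> 1 / q + 1 / q' = 1 \<longrightarrow>
            (hilbert_compact \<mu> \<alpha> (hardy_space p) (hardy_norm p)
                (bergman_space q (\<alpha> - 2)) (bergman_norm q (\<alpha> - 2))
              \<longleftrightarrow> vanishing_carleson (1 / p + \<alpha> / q') \<mu>)) \<and>
         (\<forall>q. q = 1 \<and> p \<le> q \<longrightarrow>
            (hilbert_compact \<mu> \<alpha> (hardy_space p) (hardy_norm p)
                (bergman_space 1 (\<alpha> - 2)) (bergman_norm 1 (\<alpha> - 2))
              \<longleftrightarrow> vanishing_log_carleson 1 (1 / p) \<mu>)) \<and>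
         (hilbert_compact \<mu> \<alpha> (hardy_space p) (hardy_norm p) bloch_space bloch_norm
              \<longleftrightarrow> vanishing_carleson (1 / p + \<alpha>) \<mu>)"
proof -
 define p1 where "p1 = min p 1"
 have "carleson (1 / p1) \<mu>" using assms(4,5) by (cases "p \<le> 1") (auto simp: p1_def)
 then obtain C where C: "0 < C" "tail_bound \<mu> 0 (1 / p1) C" by (rule carleson_tail_bound)
 have 1: "hilbert_compact \<mu> \<alpha> (hardy_space p) (hardy_norm p) (bergman_space q (\<alpha> - 2)) (bergman_norm q (\<alpha> - 2))
   \<longleftrightarrow> vanishing_carleson (1 / p + \<alpha> / q') \<mu>" if q: "1 < q" "\<alpha> * p \<le> q" "1 / q + 1 / q' = 1" for q q'
 proof -
  have "\<alpha> / q' = \<alpha> * (1 / q')" by simp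
  also have "1 / q' = 1 - 1 / q" using q(3) by linarith
  finally have "1 / p + \<alpha> / q' = 1 / p + \<alpha> - \<alpha> / q" by (simp add: algebra_simps)
  then show ?thesis unfolding vanishing_carleson_iff by (rule compact_bergman_iff[OF assms(1-3) p1_def C q(1,2)])
 qed
 have 2: "hilbert_compact \<mu> \<alpha> (hardy_space p) (hardy_norm p) (bergman_space 1 (\<alpha> - 2)) (bergman_norm 1 (\<alpha> - 2))
   \<longleftrightarrow> vanishing_log_carleson 1 (1 / p) \<mu>" if "p \<le> 1"
 proof -
  have "p1 = p" using that by (simp add: p1_def)
  then show ?thesis using compact_bergman_1_iff[OF assms(1) that assms(2,3) C(1)] C(2) by simp
 qed
 have 3: "hilbert_compact \<mu> \<alpha> (hardy_space p) (hardy_norm p) bloch_space bloch_norm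
   \<longleftrightarrow> vanishing_carleson (1 / p + \<alpha>) \<mu>"
  unfolding vanishing_carleson_iff by (rule compact_bloch_iff[OF assms(1-3) p1_def C])
 show ?thesis using 1 2 3 by blast
qed

end
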